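(* There exists $\gamma>0$ such that, for all $R\ge 1$, all $\lambda\ge 1$, all $l\in\mathbb{N}$, all $f_1\in L^2(\mathbb{R}^2)$ and every $f_2\in L^2(\mathbb{R}^2)$ with $\operatorname{supp}\widehat{f_2}\subset B(0,2\lambda)\setminus B(0,\lambda)$, $$\|T_l^R(f_1,f_2)\|_{L^1([0,1]^2)}\le C_l\,\lambda^{-\gamma}\|f_1\|_{L^2(\mathbb{R}^2)}\|f_2\|_{L^2(\mathbb{R}^2)},$$ where $C_l\le 2^{Cl}$ for some $C>0$ independent of $R$ and $\lambda$.
   Context: For $t=(t_1,t_2)\in\mathbb{R}^2$: $P(t)=(t_1^2+t_2^2,\;t_1^3+t_2^3)$ and $B_Rt=\big(\tfrac{t_1}{R},\tfrac{t_2}{R^2}\big)$. For $l\in\mathbb{N}$, $r_l(x)=2^{2l}\chi_{[0,2^{-l}]^2}(x)$ for $x\in\mathbb{R}^2$, where $\chi_E$ is the characteristic function of $E$, and $$T_l^R(f_1,f_2)(x)=\int_{\mathbb{R}^2}f_1(x+B_Rt)\,f_2(x+P(t))\,r_l(t)\,dt .$$ $B(a,r)$ is the ball with center $a$ and radius $r$; $\widehat{f}$ is the Fourier transform of $f$. *)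

theory Defs
  imports "HOL-Analysis.Analysis"
begin

definition L2 :: "(real \<times> real \<Rightarrow> complex) set" where
  "L2 = {f \<in> borel_measurable lebesgue. integrable lebesgue (\<lambda>x. (norm (f x))\<^sup>2)}"

definition L2_norm :: "(real \<times> real \<Rightarrow> complex) \<Rightarrow> real" where
  "L2_norm f = sqrt (LINT x|lebesgue. (norm (f x))\<^sup>2)"

definition fourier_L1 :: "(real \<times> real \<Rightarrow> complex) \<Rightarrow> real \<times> real \<Rightarrow> complex" where
  "fourier_L1 f \<xi> = (LINT x|lebesgue. f x * cis (- 2 * pi * (x \<bullet> \<xi>)))"

(* The Plancherel extension to L2: g is the L2-limit of the Fourier integrals of the
   truncations of f to balls (which lie in L1). It determines g up to null sets.
   The squared L2-distance is taken in ennreal, so that a difference that is not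
   square-integrable counts as infinitely far away. *)
definition has_fourier_transform ::
    "(real \<times> real \<Rightarrow> complex) \<Rightarrow> (real \<times> real \<Rightarrow> complex) \<Rightarrow> bool" where
  "has_fourier_transform f g \<longleftrightarrow> f \<in> L2 \<and> g \<in> L2 \<and>
     (\<lambda>n. \<integral>\<^sup>+ \<xi>. ennreal ((norm (fourier_L1 (\<lambda>x. indicator (ball 0 (real n)) x * f x) \<xi> - g \<xi>))\<^sup>2)
        \<partial>lebesgue) \<longlonglongrightarrow> 0"

(* Support of a function given up to null sets, i.e. its support as a distribution. *)
definition ess_support :: "(real \<times> real \<Rightarrow> complex) \<Rightarrow> (real \<times> real) set" where
  "ess_support g = - \<Union>{U. open U \<and> (AE \<xi> in lebesgue. \<xi> \<in> U \<longrightarrow> g \<xi> = 0)}"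

definition power_sum_map :: "real \<times> real \<Rightarrow> real \<times> real" where
  "power_sum_map t = ((fst t)\<^sup>2 + (snd t)\<^sup>2, fst t ^ 3 + snd t ^ 3)"

definition aniso_dilation :: "real \<Rightarrow> real \<times> real \<Rightarrow> real \<times> real" where
  "aniso_dilation R t = (fst t / R, snd t / R\<^sup>2)"

definition square_bump :: "nat \<Rightarrow> real \<times> real \<Rightarrow> real" where
  "square_bump l x = 2 ^ (2 * l) * indicator ({0..1 / 2 ^ l} \<times> {0..1 / 2 ^ l}) x"

(* For f1, f2 in L2 the integral converges absolutely for almost every x (by Tonelli and
   Cauchy-Schwarz), so the value 0 of a divergent Bochner integral only occurs on a null set. *)
definition bilinear_avg :: "real \<Rightarrow> nat \<Rightarrow> (real \<times> real \<Rightarrow> complex) \<Rightarrow>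
    (real \<times> real \<Rightarrow> complex) \<Rightarrow> real \<times> real \<Rightarrow> complex" where
  "bilinear_avg R l f1 f2 x =
     (LINT t|lebesgue. f1 (x + aniso_dilation R t) * f2 (x + power_sum_map t)
        * complex_of_real (square_bump l t))"

abbreviation unit_square :: "(real \<times> real) set" where
  "unit_square \<equiv> {0..1} \<times> {0..1}"

end

(* Put u = 1/R, so that all constants have to be uniform in u in [0,1], and let Y be a small power of lam. Since the frequencies of f2 have size lam, f2 is L2-close (up to 1/Y) to
   avg r f2 - avg q f2, where avg r is the mean over a square of side r, r << 1/lam << q.
   Truncating f2 in size splits this further. The unbounded part has a small L1 norm and is handled by
   the L1 x L1 -> L1 bound that holds because t |-> P(t) - B_R t is a local diffeomorphism off a small
   set. For the bounded part F, replacing the indicator by a Lipschitz cutoff and applying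
   Cauchy-Schwarz twice bounds the fourth power of the form by an average of F(p1) F(p2) F(p3) F(p4)
   over configurations of four points depending on a point z of R^8. Off a small set of z (a
   sublevel set of a determinant that is polynomial in z and does not vanish identically, uniformly in
   u), one can move p1 while the other three points stay fixed to first order; hence F(p1) may be replaced
   by its average at an intermediate scale, which is tiny because avg r - avg q nearly cancels there.

   This yields a bound C lam^(-c) with some large C. At l = 0 the constant K 0 is at most 1, so for
   small lam one also needs that the form is a strict contraction: a translate of the unit square
   can not meet both P([0,1/5]^2) and P([4/5,1]^2). *)

theory Submission
  imports Defs "HOL-Probability.Probability"
begin

text \<open>Uniformity in u needs no compactness: a polynomial of bounded degree has small sublevel
  sets once its modulus is at least 1 at one point, and \<open>quad_base\<close> and (-1, 1) are
  points where the two determinants have this property for every u in [0,1]. That they lie outside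
  the unit square is harmless, the determinants being polynomials on the whole space. Means over
  squares replace smooth frequency projections because they can be handled in space: they contract
  sup norm and L^2 norm, are Lipschitz and commute. The Fourier transform serves only to find their
  L^2 size on f2. No nonlinear change of variables is made. The variable z is translated by a vector
  that solves the linearised system at a nearby point, so only translation invariance enters and the
  error is of second order. This dictates the scales r < q << s << \<rho>: F is Lipschitz with
  constant of order 1/r, its cancellation shows at scale s, and the product of the shift size s /
  \<epsilon> and the localisation \<rho> must stay well below r. Hence the small exponent 1/4000,
  from \<open>lam\<close> = Y^4000, r = 1 / (Y \<open>lam\<close>) and q = Y /
  \<open>lam\<close>.\<close>

type_synonym plane = "real \<times> real"

abbreviation nnL1 :: "(plane \<Rightarrow> 'a::real_normed_vector) \<Rightarrow> ennreal" where
  "nnL1 f \<equiv> \<integral>\<^sup>+x. ennreal (norm (f x)) \<partial>lborel"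

abbreviation nnL2 :: "(plane \<Rightarrow> 'a::real_normed_vector) \<Rightarrow> ennreal" where
  "nnL2 f \<equiv> \<integral>\<^sup>+x. ennreal ((norm (f x))\<^sup>2) \<partial>lborel"

abbreviation nnL1_square :: "(plane \<Rightarrow> complex) \<Rightarrow> ennreal" where
  "nnL1_square f \<equiv> \<integral>\<^sup>+x. indicator unit_square x * ennreal (norm (f x)) \<partial>lborel"

section \<open>Sublevel sets of polynomials\<close>

text \<open>A Remez-type inequality. Dividing p - p(x0) by y - x0 lowers the degree, and deleting
  the interval of length m/2 around a point x0 of E leaves at least half of the measure, where the
  quotient is at most 8 \<epsilon> / m. Each degree thus costs one factor m.\<close>

lemma poly_bound_from_large_set:
  "\<exists>C>0. \<forall>p E m x \<epsilon>. degree (p::real poly) \<le> d \<and> E \<in> sets lborel \<and> E \<subseteq> {0..1} \<and>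
      0 < m \<and> m \<le> measure lborel E \<and> (\<forall>y\<in>E. \<bar>poly p y\<bar> \<le> \<epsilon>) \<and> x \<in> {0..1} \<longrightarrow>
      \<bar>poly p x\<bar> * m ^ d \<le> C * \<epsilon>"
proof (induction d)
  case 0
  have "\<bar>poly p x\<bar> * m ^ 0 \<le> 1 * \<epsilon>" if "degree p \<le> 0" "0 < m" "m \<le> measure lborel E" "\<forall>y\<in>E. \<bar>poly p y\<bar> \<le> \<epsilon>"
    for p :: "real poly" and E m x \<epsilon>
  proof -
    have "E \<noteq> {}" using that by auto
    then obtain y where "y \<in> E" by auto
    moreover have "poly p x = poly p y" using that(1) by (auto elim: degree_eq_zeroE)
    ultimately show ?thesis using that by auto
  qed
  then show ?case by (intro exI[of _ 1]) auto
next
  case (Suc d)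
  then obtain C where C: "C > 0" and IH: "\<And>p E m x \<epsilon>. degree (p::real poly) \<le> d \<Longrightarrow> E \<in> sets lborel \<Longrightarrow> E \<subseteq> {0..1} \<Longrightarrow>
      0 < m \<Longrightarrow> m \<le> measure lborel E \<Longrightarrow> (\<forall>y\<in>E. \<bar>poly p y\<bar> \<le> \<epsilon>) \<Longrightarrow> x \<in> {0..1} \<Longrightarrow>
      \<bar>poly p x\<bar> * m ^ d \<le> C * \<epsilon>"
    by blast
  have "\<bar>poly p x\<bar> * m ^ Suc d \<le> (C * 8 * 2 ^ d + 1) * \<epsilon>"
    if p: "degree p \<le> Suc d" and E: "E \<in> sets lborel" "E \<subseteq> {0..1}" and m: "0 < m" "m \<le> measure lborel E"
      and \<epsilon>: "\<forall>y\<in>E. \<bar>poly p y\<bar> \<le> \<epsilon>" and x: "x \<in> {0..1}"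
    for p :: "real poly" and E m x \<epsilon>
  proof -
    have "E \<noteq> {}" using m by auto
    then obtain x0 where x0: "x0 \<in> E" by auto
    have \<epsilon>0: "\<epsilon> \<ge> 0" using \<epsilon> x0 by fastforce
    have Efin: "emeasure lborel E < \<infinity>"
      using emeasure_mono[of E "{0..1::real}" lborel] E by (auto simp: top.not_eq_extremum intro: le_less_trans)
    have "measure lborel E \<le> measure lborel {0..1::real}"
      by (rule measure_mono_fmeasurable) (use E in \<open>auto simp: fmeasurable_def\<close>)
    then have m1: "m \<le> 1" using m by simp
    define q where "q = synthetic_div p x0"
    have pq: "poly p y = (y - x0) * poly q y + poly p x0" for y
    proof -
      have "poly p y = poly ([:- x0, 1:] * q + [:poly p x0:]) y" by (simp only: q_def synthetic_div_correct')
      then show ?thesis by (simp add: algebra_simps)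
    qed
    have dq: "degree q \<le> d" using p by (simp add: q_def degree_synthetic_div)
    define E' where "E' = E - {x0 - m/4 .. x0 + m/4}"
    have E': "E' \<in> sets lborel" "E' \<subseteq> {0..1}" using E by (auto simp: E'_def)
    have fm: "E \<in> fmeasurable lborel" using E(1) Efin by (simp add: fmeasurable_def)
    have "measure lborel E' \<ge> measure lborel E - measure lborel {x0 - m/4 .. x0 + m/4}"
      unfolding E'_def by (rule measure_diff_le_measure_setdiff) (use fm in \<open>simp_all add: fmeasurable_def emeasure_lborel_Icc_eq\<close>)
    then have mE': "m / 2 \<le> measure lborel E'" using m by simp
    have "\<bar>poly q y\<bar> \<le> 8 * \<epsilon> / m" if "y \<in> E'" for y
    proof -
      have "\<bar>y - x0\<bar> \<ge> m / 4" using that by (auto simp: E'_def abs_if)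
      then have "m / 4 * \<bar>poly q y\<bar> \<le> \<bar>(y - x0) * poly q y\<bar>"
        unfolding abs_mult by (intro mult_right_mono) auto
      also have "\<dots> = \<bar>poly p y - poly p x0\<bar>" using pq[of y] by simp
      also have "\<dots> \<le> 2 * \<epsilon>"
      proof -
        have "\<bar>poly p y\<bar> \<le> \<epsilon>" "\<bar>poly p x0\<bar> \<le> \<epsilon>" using \<epsilon> x0 that by (auto simp: E'_def)
        then show ?thesis by linarith
      qed
      finally show ?thesis using m by (simp add: field_simps)
    qed
    then have "\<bar>poly q x\<bar> * (m/2) ^ d \<le> C * (8 * \<epsilon> / m)"
      using m mE' x by (intro IH[OF dq E', of "m/2"]) auto
    then have 1: "\<bar>poly q x\<bar> * m ^ Suc d \<le> C * 8 * 2 ^ d * \<epsilon>"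
      using m by (simp add: field_simps power_divide)
    have "\<bar>x - x0\<bar> \<le> 1" using x x0 E by (auto simp: abs_le_iff subset_iff)
    then have "\<bar>(x - x0) * poly q x\<bar> \<le> \<bar>poly q x\<bar>" unfolding abs_mult
      using mult_right_mono[of "\<bar>x-x0\<bar>" 1 "\<bar>poly q x\<bar>"] by simp
    then have "\<bar>poly p x\<bar> \<le> \<bar>poly q x\<bar> + \<epsilon>"
      using pq[of x] \<epsilon>[rule_format, OF x0] by linarith
    then have "\<bar>poly p x\<bar> * m ^ Suc d \<le> \<bar>poly q x\<bar> * m ^ Suc d + \<epsilon> * m ^ Suc d"
      using m by (metis distrib_right less_imp_le mult_right_mono zero_le_power)
    also have "\<epsilon> * m ^ Suc d \<le> \<epsilon>" using \<epsilon>0 m m1 by (simp add: mult_left_le power_le_one mult_le_one del: power_Suc)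
    finally show ?thesis using 1 by (simp add: algebra_simps)
  qed
  then show ?case using C by (intro exI[of _ "C * 8 * 2 ^ d + 1"]) (auto simp del: power_Suc intro: add_pos_pos)
qed

section \<open>Polynomial functions along lines and their sublevel sets\<close>

text \<open>Degrees are needed only along lines, where the one-variable bound applies. A predicate
  on functions of one real variable spares the use of multivariate polynomials.\<close>

definition polyfun :: "nat \<Rightarrow> (real \<Rightarrow> real) \<Rightarrow> bool" where
  "polyfun d f \<longleftrightarrow> (\<exists>p. degree p \<le> d \<and> (\<forall>x. f x = poly p x))"

lemma polyfun_const: "polyfun 0 (\<lambda>_. c)"
  unfolding polyfun_def by (intro exI[of _ "[:c:]"]) auto

lemma polyfun_ident: "polyfun 1 (\<lambda>x. x)"
  unfolding polyfun_def by (intro exI[of _ "[:0,1:]"]) auto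

lemma polyfun_add: "polyfun a f \<Longrightarrow> polyfun b g \<Longrightarrow> polyfun (max a b) (\<lambda>x. f x + g x)"
  unfolding polyfun_def by (metis degree_add_le max.coboundedI1 max.coboundedI2 poly_add)

lemma polyfun_diff: "polyfun a f \<Longrightarrow> polyfun b g \<Longrightarrow> polyfun (max a b) (\<lambda>x. f x - g x)"
  unfolding polyfun_def by (metis degree_diff_le max.coboundedI1 max.coboundedI2 poly_diff)

lemma polyfun_mult: "polyfun a f \<Longrightarrow> polyfun b g \<Longrightarrow> polyfun (a + b) (\<lambda>x. f x * g x)"
  unfolding polyfun_def by (metis add_mono degree_mult_le order_trans poly_mult)

lemma polyfun_power: "polyfun a f \<Longrightarrow> polyfun (n * a) (\<lambda>x. f x ^ n)"
proof (induction n)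
  case 0 then show ?case using polyfun_const[of 1] by simp
next
  case (Suc n) then show ?case using polyfun_mult[of a f "n*a" "\<lambda>x. f x ^ n"] by simp
qed

lemma polyfun_mono: "polyfun a f \<Longrightarrow> a \<le> b \<Longrightarrow> polyfun b f"
  unfolding polyfun_def by force

lemma nn_integral_lborel_affine:
  fixes f :: "'a::euclidean_space \<Rightarrow> ennreal"
  assumes [measurable]: "f \<in> borel_measurable borel" and c: "c \<noteq> 0"
  shows "(\<integral>\<^sup>+x. f x \<partial>lborel) = ennreal (\<bar>c\<bar> ^ DIM('a)) * (\<integral>\<^sup>+x. f (t + c *\<^sub>R x) \<partial>lborel)"
  by (subst lborel_affine[OF c, of t])
     (simp add: nn_integral_density nn_integral_distr nn_integral_cmult)

lemma nn_integral_lborel_shift: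
  fixes f :: "'a::euclidean_space \<Rightarrow> ennreal"
  assumes "f \<in> borel_measurable borel"
  shows "(\<integral>\<^sup>+x. f (t + x) \<partial>lborel) = (\<integral>\<^sup>+x. f x \<partial>lborel)"
  using nn_integral_lborel_affine[OF assms, of 1 t] by simp

text \<open>Averaging over dilations about \<theta> replaces polar coordinates. On each ray the
  parameters r in [1/2,1] that lead into the sublevel set form a set of measure at most \<delta>;
  otherwise the one-variable bound, evaluated at r = 0, would force the modulus of f \<theta> below
  1. The constant depends on the degree only.\<close>

lemma sublevel_measure:
  assumes "d \<ge> 1"
  shows "\<exists>C>0. \<forall>(f::'a::euclidean_space \<Rightarrow> real) \<theta> \<rho> \<epsilon> \<delta>.
    f \<in> borel_measurable borel \<and> (\<forall>v. polyfun d (\<lambda>r. f (\<theta> + r *\<^sub>R v))) \<and> \<bar>f \<theta>\<bar> \<ge> 1 \<and>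
    0 < \<rho> \<and> 0 < \<delta> \<and> C * \<epsilon> \<le> \<delta> ^ d \<longrightarrow>
    emeasure lborel {z \<in> cball \<theta> \<rho>. \<bar>f z\<bar> \<le> \<epsilon>} \<le> ennreal (2 * \<delta>) * emeasure lborel (cball \<theta> (2 * \<rho>))"
proof -
  obtain C where C: "C > 0" and IH: "\<And>p E m x \<epsilon>. degree (p::real poly) \<le> d \<Longrightarrow> E \<in> sets lborel \<Longrightarrow> E \<subseteq> {0..1} \<Longrightarrow>
      0 < m \<Longrightarrow> m \<le> measure lborel E \<Longrightarrow> (\<forall>y\<in>E. \<bar>poly p y\<bar> \<le> \<epsilon>) \<Longrightarrow> x \<in> {0..1} \<Longrightarrow>
      \<bar>poly p x\<bar> * m ^ d \<le> C * \<epsilon>"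
    using poly_bound_from_large_set[of d] by blast
  show ?thesis
  proof (intro exI[of _ C] conjI C allI impI)
    fix f :: "'a \<Rightarrow> real" and \<theta> :: 'a and \<rho> \<epsilon> \<delta> :: real
    assume *: "f \<in> borel_measurable borel \<and> (\<forall>v. polyfun d (\<lambda>r. f (\<theta> + r *\<^sub>R v))) \<and> \<bar>f \<theta>\<bar> \<ge> 1 \<and>
      0 < \<rho> \<and> 0 < \<delta> \<and> C * \<epsilon> \<le> \<delta> ^ d"
    then have [measurable]: "f \<in> borel_measurable borel" and pf: "\<And>v. polyfun d (\<lambda>r. f (\<theta> + r *\<^sub>R v))"
      and f1: "\<bar>f \<theta>\<bar> \<ge> 1" and \<rho>: "0 < \<rho>" and \<delta>: "0 < \<delta>" "C * \<epsilon> \<le> \<delta> ^ d" by auto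
    define E where "E = {z \<in> cball \<theta> \<rho>. \<bar>f z\<bar> \<le> \<epsilon>}"
    have [measurable]: "E \<in> sets borel" unfolding E_def by measurable
    define G where "G r z = indicator {1/2..1} r * (indicator E (\<theta> + r *\<^sub>R (z - \<theta>)) :: ennreal)" for r :: real and z
    have [measurable]: "(\<lambda>(r,z). G r z) \<in> borel_measurable (borel \<Otimes>\<^sub>M borel)"
      unfolding G_def by measurable
    have [measurable]: "(\<lambda>x. G (snd x) (fst x)) \<in> borel_measurable (borel \<Otimes>\<^sub>M borel)"
      "cball \<theta> (2*\<rho>) \<in> sets borel"
      unfolding G_def by measurable
    have S: "(\<integral>\<^sup>+r. G r z \<partial>lborel) \<le> ennreal \<delta>" for z
    proof -
      define S where "S = {r \<in> {1/2..1}. \<theta> + r *\<^sub>R (z - \<theta>) \<in> E}"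
      have [measurable]: "S \<in> sets borel" unfolding S_def by measurable
      have "(\<integral>\<^sup>+r. G r z \<partial>lborel) = (\<integral>\<^sup>+r. indicator S r \<partial>lborel)"
        by (intro nn_integral_cong) (auto simp: G_def S_def split: split_indicator)
      also have "\<dots> = emeasure lborel S" by simp
      also have "\<dots> \<le> ennreal \<delta>"
      proof -
        have fin: "emeasure lborel S \<le> emeasure lborel {0..1::real}" by (intro emeasure_mono) (auto simp: S_def)
        then have Sm: "emeasure lborel S = ennreal (measure lborel S)"
          by (intro emeasure_eq_ennreal_measure) (auto simp: top_unique)
        have "measure lborel S \<le> \<delta>"
        proof (rule ccontr)
          assume "\<not> measure lborel S \<le> \<delta>"
          then have m: "measure lborel S > \<delta>" by simp
          obtain p where p: "degree p \<le> d" "\<And>r. f (\<theta> + r *\<^sub>R (z - \<theta>)) = poly p r"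
            using pf[of "z - \<theta>"] unfolding polyfun_def by blast
          have "\<bar>poly p 0\<bar> * measure lborel S ^ d \<le> C * \<epsilon>"
          proof (rule IH[OF p(1)])
            show "S \<in> sets lborel" by simp
            show "S \<subseteq> {0..1}" by (auto simp: S_def)
            show "0 < measure lborel S" using m \<delta> by linarith
            show "\<forall>y\<in>S. \<bar>poly p y\<bar> \<le> \<epsilon>" unfolding S_def E_def p(2)[symmetric] by simp
          qed auto
          moreover have "poly p 0 = f \<theta>" using p(2)[of 0] by simp
          ultimately have "measure lborel S ^ d \<le> \<delta> ^ d"
            using f1 \<delta> mult_right_mono[of 1 "\<bar>f \<theta>\<bar>" "measure lborel S ^ d"] by auto
          then show False using m \<delta> assms power_strict_mono[of \<delta> "measure lborel S" d] by auto
        qed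
        then show ?thesis using Sm by (simp add: ennreal_leI)
      qed
      finally show ?thesis .
    qed
    \<comment> \<open>A dilation with r \<le> 1 does not increase volume, so E is no larger than its
      preimage; r \<ge> 1/2 keeps that preimage in the doubled ball.\<close>
    have T: "emeasure lborel E \<le> (\<integral>\<^sup>+z. indicator (cball \<theta> (2*\<rho>)) z * indicator E (\<theta> + r *\<^sub>R (z - \<theta>)) \<partial>lborel)"
      if r: "r \<in> {1/2..1}" for r
    proof -
      have "emeasure lborel E = (\<integral>\<^sup>+z. indicator E z \<partial>lborel)" by simp
      also have "\<dots> = ennreal (\<bar>r\<bar> ^ DIM('a)) * (\<integral>\<^sup>+z. indicator E ((\<theta> - r *\<^sub>R \<theta>) + r *\<^sub>R z) \<partial>lborel)"
        using r by (intro nn_integral_lborel_affine) auto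
      also have "\<dots> \<le> 1 * (\<integral>\<^sup>+z. indicator E ((\<theta> - r *\<^sub>R \<theta>) + r *\<^sub>R z) \<partial>lborel)"
        using r by (intro mult_right_mono) (auto intro!: power_le_one)
      also have "\<dots> = (\<integral>\<^sup>+z. indicator E (\<theta> + r *\<^sub>R (z - \<theta>)) \<partial>lborel)"
        by (simp add: algebra_simps)
      also have "\<dots> = (\<integral>\<^sup>+z. indicator (cball \<theta> (2*\<rho>)) z * indicator E (\<theta> + r *\<^sub>R (z - \<theta>)) \<partial>lborel)"
      proof (intro nn_integral_cong)
        fix z :: 'a
        have "dist \<theta> z \<le> 2 * \<rho>" if "\<theta> + r *\<^sub>R (z - \<theta>) \<in> E"
        proof -
          have "r * norm (z - \<theta>) \<le> \<rho>" using that r by (auto simp: E_def dist_norm)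
          moreover have "1/2 * norm (z - \<theta>) \<le> r * norm (z - \<theta>)" using r by (intro mult_right_mono) auto
          ultimately show ?thesis by (simp add: dist_norm norm_minus_commute)
        qed
        then show "indicator E (\<theta> + r *\<^sub>R (z - \<theta>)) = indicator (cball \<theta> (2*\<rho>)) z * (indicator E (\<theta> + r *\<^sub>R (z - \<theta>)) :: ennreal)"
          by (auto split: split_indicator)
      qed
      finally show ?thesis .
    qed
    have "ennreal (1/2) * emeasure lborel E = (\<integral>\<^sup>+r. indicator {1/2..1::real} r * emeasure lborel E \<partial>lborel)"
      by (simp add: nn_integral_multc)
    also have "\<dots> \<le> (\<integral>\<^sup>+r. (\<integral>\<^sup>+z. indicator (cball \<theta> (2*\<rho>)) z * G r z \<partial>lborel) \<partial>lborel)"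
    proof (intro nn_integral_mono)
      fix r :: real
      show "indicator {1/2..1} r * emeasure lborel E \<le> (\<integral>\<^sup>+z. indicator (cball \<theta> (2*\<rho>)) z * G r z \<partial>lborel)"
        using T[of r] by (cases "r \<in> {1/2..1}") (auto simp: G_def)
    qed
    also have "\<dots> = (\<integral>\<^sup>+z. (\<integral>\<^sup>+r. indicator (cball \<theta> (2*\<rho>)) z * G r z \<partial>lborel) \<partial>lborel)"
      by (intro lborel_pair.Fubini') measurable
    also have "\<dots> \<le> (\<integral>\<^sup>+z. ennreal \<delta> * indicator (cball \<theta> (2*\<rho>)) z \<partial>lborel)"
      using S by (intro nn_integral_mono) (auto simp: nn_integral_cmult mult.commute split: split_indicator)
    also have "\<dots> = ennreal \<delta> * emeasure lborel (cball \<theta> (2*\<rho>))" by (simp add: nn_integral_cmult)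
    finally have "2 * (ennreal (1/2) * emeasure lborel E) \<le> 2 * (ennreal \<delta> * emeasure lborel (cball \<theta> (2*\<rho>)))"
      by (rule mult_left_mono) simp
    moreover have "2 * (ennreal (1/2) * emeasure lborel E) = emeasure lborel E"
    proof -
      have "2 * ennreal (1/2) = 1"
        using ennreal_divide_self[of 2] by (simp add: divide_ennreal_def)
      then show ?thesis by (simp only: mult.assoc[symmetric] mult_1)
    qed
    ultimately show "emeasure lborel {z \<in> cball \<theta> \<rho>. \<bar>f z\<bar> \<le> \<epsilon>} \<le> ennreal (2 * \<delta>) * emeasure lborel (cball \<theta> (2 * \<rho>))"
      using \<delta> by (simp add: E_def ennreal_mult mult.assoc)
  qed
qed

section \<open>Fourier analysis on the plane\<close>

lemma integrable_lborel_shift: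
  fixes f :: "'a::euclidean_space \<Rightarrow> 'b::{banach, second_countable_topology}"
  assumes "integrable lborel f"
  shows "integrable lborel (\<lambda>x. f (x + t))"
  using assms integrable_distr[of "(+) t" lborel borel f]
  by (simp add: lborel_distr_plus add.commute)

lemma integral_lborel_shift:
  fixes f :: "'a::euclidean_space \<Rightarrow> 'b::{banach, second_countable_topology}"
  assumes [measurable]: "f \<in> borel_measurable borel"
  shows "(LINT x|lborel. f (x + t)) = (LINT x|lborel. f x)"
  using integral_distr[of "(+) t" lborel borel f]
  by (simp add: lborel_distr_plus add.commute)

text \<open>For x in the open set U the point x + v n is eventually in U, so the loss
  \<open>indicator U x - indicator U (x + v n)\<close> tends to 0 in mean by domination. The gain
  has no such majorant, but by translation invariance its integral equals that of the loss, whence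
  the factor 2.\<close>

lemma open_indicator_shift:
  fixes U :: "'a::euclidean_space set"
  assumes U: "open U" "emeasure lborel U < \<infinity>" and v: "v \<longlonglongrightarrow> 0"
  shows "(\<lambda>n. LINT x|lborel. \<bar>indicator U (x + v n) - indicator U x :: real\<bar>) \<longlonglongrightarrow> 0"
proof -
  have [measurable]: "U \<in> sets borel" using U by simp
  have int: "integrable lborel (indicator U :: 'a \<Rightarrow> real)"
    using U by (simp add: integrable_indicator_iff)
  have int': "integrable lborel (\<lambda>x. indicator U (x + v n) :: real)" for n
    by (rule integrable_lborel_shift[OF int])
  define p where "p n x = max 0 (indicator U x - indicator U (x + v n) :: real)" for n x
  have [measurable]: "p n \<in> borel_measurable borel" for n unfolding p_def by measurable
  have p0: "(\<lambda>n. LINT x|lborel. p n x) \<longlonglongrightarrow> integral\<^sup>L (lborel::'a measure) (\<lambda>_. 0::real)" 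
  proof (rule integral_dominated_convergence[where w="indicator U" and s=p and f="\<lambda>_. 0"])
    show "AE x in lborel. (\<lambda>n. p n x) \<longlonglongrightarrow> 0"
    proof (intro AE_I2)
      fix x :: 'a
      have "eventually (\<lambda>n. p n x = 0) sequentially"
      proof (cases "x \<in> U")
        case True
        have "(\<lambda>n. x + v n) \<longlonglongrightarrow> x + 0" by (intro tendsto_intros v)
        then have "eventually (\<lambda>n. x + v n \<in> U) sequentially"
          using U True by (auto intro: topological_tendstoD)
        then show ?thesis by eventually_elim (simp add: p_def)
      qed (simp add: p_def)
      then show "(\<lambda>n. p n x) \<longlonglongrightarrow> 0" by (simp add: tendsto_eventually)
    qed
    show "AE x in lborel. norm (p n x) \<le> indicator U x" for n
      by (auto simp: p_def split: split_indicator)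
  qed (use int in auto)
  have ip: "integrable lborel (p n)" for n
    unfolding p_def by (intro integrable_max Bochner_Integration.integrable_diff int int' integrable_zero)
  have "(LINT x|lborel. \<bar>indicator U (x + v n) - indicator U x :: real\<bar>) = 2 * (LINT x|lborel. p n x)" for n
  proof -
    have "(LINT x|lborel. \<bar>indicator U (x + v n) - indicator U x :: real\<bar>)
      = (LINT x|lborel. 2 * p n x + indicator U (x + v n) - indicator U x)"
      by (intro Bochner_Integration.integral_cong) (auto simp: p_def split: split_indicator)
    also have "\<dots> = 2 * (LINT x|lborel. p n x) + (LINT x|lborel. indicator U (x + v n)) - (LINT x|lborel. indicator U x)"
      using ip int' int by (simp add: Bochner_Integration.integral_diff Bochner_Integration.integral_add)
    also have "(LINT x|lborel. indicator U (x + v n) :: real) = (LINT x|lborel. indicator U x)"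
      by (rule integral_lborel_shift) simp
    finally show ?thesis by simp
  qed
  then show ?thesis using tendsto_mult[OF tendsto_const[of 2] p0] by simp
qed

text \<open>The quantity D is stable under approximation in L^1 (\<open>Dadd\<close>), so open sets
  suffice: outer regularity leads from them to measurable sets of finite measure, and the induction
  on integrable functions does the rest.\<close>

lemma L1_shift_continuous:
  fixes h :: "'a::euclidean_space \<Rightarrow> real"
  assumes "integrable lborel h" and v: "v \<longlonglongrightarrow> 0"
  shows "(\<lambda>n. LINT x|lborel. \<bar>h (x + v n) - h x\<bar>) \<longlonglongrightarrow> 0"
proof -
  define D where "D h n = (LINT x|lborel. \<bar>h (x + v n) - h x\<bar>)" for h :: "'a \<Rightarrow> real" and n
  have Dadd: "D h n \<le> D g n + 2 * (LINT x|lborel. \<bar>h x - g x\<bar>)" if h: "integrable lborel h" and g: "integrable lborel g" for h g n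
  proof -
    note sh = integrable_lborel_shift[of _ "v n"]
    have [measurable]: "h \<in> borel_measurable borel" "g \<in> borel_measurable borel" using h g by auto
    have "D h n \<le> (LINT x|lborel. \<bar>g (x + v n) - g x\<bar> + \<bar>h (x + v n) - g (x + v n)\<bar> + \<bar>h x - g x\<bar>)"
      unfolding D_def using h g sh[OF h] sh[OF g]
      by (intro integral_mono integrable_add integrable_abs Bochner_Integration.integrable_diff) auto
    also have "\<dots> = D g n + (LINT x|lborel. \<bar>h (x + v n) - g (x + v n)\<bar>) + (LINT x|lborel. \<bar>h x - g x\<bar>)"
      unfolding D_def using h g sh[OF h] sh[OF g]
      by (simp add: Bochner_Integration.integral_add)
    also have "(LINT x|lborel. \<bar>h (x + v n) - g (x + v n)\<bar>) = (LINT x|lborel. \<bar>h x - g x\<bar>)"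
      by (rule integral_lborel_shift) measurable
    finally show ?thesis by simp
  qed
  have Dpos: "D h n \<ge> 0" for h n unfolding D_def by simp
  have approx: "D h \<longlonglongrightarrow> 0" if h: "integrable lborel h" and
    ap: "\<And>e. e > 0 \<Longrightarrow> \<exists>g. integrable lborel g \<and> D g \<longlonglongrightarrow> 0 \<and> (LINT x|lborel. \<bar>h x - g x\<bar>) < e" for h
  proof (rule LIMSEQ_I)
    fix e :: real assume e: "e > 0"
    then obtain g where g: "integrable lborel g" "D g \<longlonglongrightarrow> 0" "(LINT x|lborel. \<bar>h x - g x\<bar>) < e/4"
      using ap[of "e/4"] by auto
    then obtain N where N: "\<And>n. n \<ge> N \<Longrightarrow> norm (D g n - 0) < e/2" using LIMSEQ_D[OF g(2), of "e/2"] e by auto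
    have "norm (D h n - 0) < e" if "n \<ge> N" for n
      using N[OF that] Dadd[OF h g(1), of n] g(3) Dpos[of h n] Dpos[of g n] by simp
    then show "\<exists>N. \<forall>n\<ge>N. norm (D h n - 0) < e" by blast
  qed
  have "D h \<longlonglongrightarrow> 0"
    using assms(1)
  proof (induction h rule: integrable_induct)
    case (base A c)
    then have A: "A \<in> sets borel" "emeasure lborel A < \<infinity>" by auto
    have iA: "integrable lborel (indicator A :: 'a \<Rightarrow> real)" using A by (simp add: integrable_indicator_iff)
    have DA: "D (indicator A) \<longlonglongrightarrow> 0"
    proof (rule approx[OF iA])
      fix e :: real assume e: "e > 0"
      obtain U where U: "open U" "A \<subseteq> U" "emeasure lborel (U - A) < ennreal e"
        using outer_regular_lborel[OF A(1) e] by blast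
      have [measurable]: "U \<in> sets borel" "A \<in> sets borel" using U A by auto
      have "emeasure lborel U \<le> emeasure lborel (U - A) + emeasure lborel A"
        using emeasure_subadditive[of "U - A" lborel A] U(2) by (simp add: Un_absorb2)
      also have "\<dots> < \<infinity>" using less_trans[OF U(3) ennreal_less_top] A(2) by simp
      finally have Uf: "emeasure lborel U < \<infinity>" .
      have iU: "integrable lborel (indicator U :: 'a \<Rightarrow> real)" using Uf by (simp add: integrable_indicator_iff)
      have "(LINT x|lborel. \<bar>indicator A x - indicator U x :: real\<bar>) = (LINT x|lborel. indicator (U - A) x)"
        using U(2) by (intro Bochner_Integration.integral_cong) (auto split: split_indicator)
      also have "\<dots> = measure lborel (U - A)" by simp
      also have "\<dots> < e" using less_trans[OF U(3) ennreal_less_top] U(3) by (simp add: measure_def)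
      finally show "\<exists>g. integrable lborel g \<and> D g \<longlonglongrightarrow> 0 \<and> (LINT x|lborel. \<bar>indicator A x - g x\<bar>) < e"
        using iU open_indicator_shift[OF U(1) Uf v] unfolding D_def by blast
    qed
    have "D (\<lambda>x. indicat_real A x *\<^sub>R c) = (\<lambda>n. \<bar>c\<bar> * D (indicator A) n)"
    proof
      fix n
      have "D (\<lambda>x. indicat_real A x *\<^sub>R c) n = (LINT x|lborel. \<bar>c\<bar> * \<bar>indicat_real A (x + v n) - indicat_real A x\<bar>)"
        unfolding D_def by (intro Bochner_Integration.integral_cong) (auto split: split_indicator)
      then show "D (\<lambda>x. indicat_real A x *\<^sub>R c) n = \<bar>c\<bar> * D (indicator A) n" by (simp add: D_def)
    qed
    then show ?case using tendsto_mult_right_zero[OF DA, of "\<bar>c\<bar>"] by simp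
  next
    case (add f g)
    have "D (\<lambda>x. f x + g x) n \<le> D f n + D g n" for n
    proof -
      note sh = integrable_lborel_shift[of _ "v n"]
      have "D (\<lambda>x. f x + g x) n \<le> (LINT x|lborel. \<bar>f (x + v n) - f x\<bar> + \<bar>g (x + v n) - g x\<bar>)"
        unfolding D_def using add.hyps sh[OF add.hyps(1)] sh[OF add.hyps(2)]
        by (intro integral_mono integrable_add integrable_abs Bochner_Integration.integrable_diff) auto
      also have "\<dots> = D f n + D g n"
        unfolding D_def using add.hyps sh[OF add.hyps(1)] sh[OF add.hyps(2)]
        by (intro Bochner_Integration.integral_add integrable_abs Bochner_Integration.integrable_diff)
      finally show ?thesis .
    qed
    then show ?case using tendsto_add_zero[OF add.IH] Dpos
      by (intro tendsto_sandwich[of "\<lambda>_. 0" "D (\<lambda>x. f x + g x)" sequentially "\<lambda>n. D f n + D g n"]) auto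
  next
    case (lim f s)
    have "(\<lambda>i. LINT x|lborel. \<bar>f x - s i x\<bar>) \<longlonglongrightarrow> integral\<^sup>L (lborel::'a measure) (\<lambda>_. 0::real)"
    proof (rule integral_dominated_convergence[where w="\<lambda>x. 3 * norm (f x)"])
      show "AE x in lborel. (\<lambda>i. \<bar>f x - s i x\<bar>) \<longlonglongrightarrow> 0"
        proof (intro AE_I2)
        fix x :: 'a
        show "(\<lambda>i. \<bar>f x - s i x\<bar>) \<longlonglongrightarrow> 0"
          using tendsto_rabs[OF tendsto_diff[OF tendsto_const[of "f x"] lim.hyps(2)[of x]]] by simp
      qed
      show "AE x in lborel. norm \<bar>f x - s i x\<bar> \<le> 3 * norm (f x)" for i
        proof (intro AE_I2)
        fix x :: 'a
        have "norm (s i x) \<le> 2 * norm (f x)" by (rule lim.hyps(3)) simp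
        then show "norm \<bar>f x - s i x\<bar> \<le> 3 * norm (f x)" by simp
      qed
    qed (use lim.hyps(1,4) in auto)
    then have "(\<lambda>i. LINT x|lborel. \<bar>f x - s i x\<bar>) \<longlonglongrightarrow> 0" by simp
    then show ?case
    proof (intro approx[OF lim.hyps(4)])
      fix e :: real assume "e > 0" 
      then obtain i where "(LINT x|lborel. \<bar>f x - s i x\<bar>) < e"
        using order_tendstoD(2)[OF \<open>(\<lambda>i. LINT x|lborel. \<bar>f x - s i x\<bar>) \<longlonglongrightarrow> 0\<close>, of e]
        by (auto simp: eventually_sequentially)
      then show "\<exists>g. integrable lborel g \<and> D g \<longlonglongrightarrow> 0 \<and> (LINT x|lborel. \<bar>f x - g x\<bar>) < e"
        using lim.hyps(1) lim.IH by blast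
    qed
  qed
  then show ?thesis unfolding D_def .
qed

lemma square_diff_le: "(a - b)\<^sup>2 \<le> \<bar>a\<^sup>2 - b\<^sup>2\<bar>" if "a \<ge> 0" "b \<ge> 0" for a b :: real
proof -
  have "(a - b)\<^sup>2 = \<bar>a - b\<bar> * \<bar>a - b\<bar>" by (simp add: power2_eq_square)
  also have "\<dots> \<le> \<bar>a - b\<bar> * \<bar>a + b\<bar>" using that by (intro mult_left_mono) auto
  also have "\<dots> = \<bar>a\<^sup>2 - b\<^sup>2\<bar>" by (simp add: abs_mult[symmetric] power2_eq_square algebra_simps)
  finally show ?thesis .
qed

text \<open>Reduced to L^1. The squares of the positive and negative parts of real and imaginary
  part are integrable, and (a - b)^2 is at most |a^2 - b^2| for nonnegative a and b. The splitting
  by sign is there because this inequality fails for opposite signs.\<close>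

lemma L2_shift_continuous:
  fixes f :: "'a::euclidean_space \<Rightarrow> complex"
  assumes [measurable]: "f \<in> borel_measurable borel" and f: "integrable lborel (\<lambda>x. (norm (f x))\<^sup>2)" and v: "v \<longlonglongrightarrow> 0"
  shows "(\<lambda>n. LINT x|lborel. (norm (f (x + v n) - f x))\<^sup>2) \<longlonglongrightarrow> 0"
proof -
  define G where "G = [\<lambda>x. (max 0 (Re (f x)))\<^sup>2, \<lambda>x. (max 0 (- Re (f x)))\<^sup>2, \<lambda>x. (max 0 (Im (f x)))\<^sup>2, \<lambda>x. (max 0 (- Im (f x)))\<^sup>2]"
  have le1: "(max 0 a)\<^sup>2 \<le> (norm z)\<^sup>2" if "\<bar>a\<bar> \<le> norm z" for a :: real and z :: complex
    using that by (intro power_mono) auto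
  have int: "integrable lborel g" if "g \<in> set G" for g
    using that unfolding G_def
    by (auto intro!: Bochner_Integration.integrable_bound[OF f] le1 AE_I2 simp: abs_Re_le_cmod abs_Im_le_cmod abs_le_D1[OF abs_Re_le_cmod] abs_le_D2[OF abs_Re_le_cmod] abs_le_D1[OF abs_Im_le_cmod] abs_le_D2[OF abs_Im_le_cmod])
  define D where "D g n = (LINT x|lborel. \<bar>g (x + v n) - g x\<bar>)" for g :: "'a \<Rightarrow> real" and n
  have D0: "D g \<longlonglongrightarrow> 0" if "g \<in> set G" for g
    unfolding D_def by (rule L1_shift_continuous[OF int[OF that] v])
  have c: "(a - b)\<^sup>2 \<le> 2 * (\<bar>(max 0 a)\<^sup>2 - (max 0 b)\<^sup>2\<bar> + \<bar>(max 0 (-a))\<^sup>2 - (max 0 (-b))\<^sup>2\<bar>)" for a b :: real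
  proof -
    have "(a - b)\<^sup>2 = ((max 0 a - max 0 b) - (max 0 (-a) - max 0 (-b)))\<^sup>2" by (auto simp: max_def)
    also have "\<dots> \<le> 2 * (max 0 a - max 0 b)\<^sup>2 + 2 * (max 0 (-a) - max 0 (-b))\<^sup>2"
      using sum_squares_bound[of "max 0 a - max 0 b" "- (max 0 (-a) - max 0 (-b))"] 
      by (simp add: power2_eq_square algebra_simps)
    also have "\<dots> \<le> 2 * (\<bar>(max 0 a)\<^sup>2 - (max 0 b)\<^sup>2\<bar> + \<bar>(max 0 (-a))\<^sup>2 - (max 0 (-b))\<^sup>2\<bar>)"
      unfolding distrib_left by (intro add_mono mult_left_mono square_diff_le) simp_all
    finally show ?thesis .
  qed
  have le: "(LINT x|lborel. (norm (f (x + v n) - f x))\<^sup>2) \<le> 2 * (\<Sum>g\<leftarrow>G. D g n)" for n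
  proof -
    note i = int integrable_lborel_shift[OF int, of _ "v n"]
    have ii: "integrable lborel (\<lambda>x. \<bar>g (x + v n) - g x\<bar>)" if "g \<in> set G" for g
      using i[OF that] by auto
    have L: "integrable lborel (\<lambda>x. \<Sum>g\<leftarrow>L. \<bar>g (x + v n) - g x\<bar>) \<and>
        (LINT x|lborel. (\<Sum>g\<leftarrow>L. \<bar>g (x + v n) - g x\<bar>)) = (\<Sum>g\<leftarrow>L. D g n)" if "set L \<subseteq> set G" for L
      using that ii by (induction L) (auto simp: D_def)
    have "(LINT x|lborel. (norm (f (x + v n) - f x))\<^sup>2) \<le> (LINT x|lborel. 2 * (\<Sum>g\<leftarrow>G. \<bar>g (x + v n) - g x\<bar>))"
    proof (rule integral_mono')
      show "integrable lborel (\<lambda>x. 2 * (\<Sum>g\<leftarrow>G. \<bar>g (x + v n) - g x\<bar>))"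
        using L[of G] by simp
      show "(norm (f (x + v n) - f x))\<^sup>2 \<le> 2 * (\<Sum>g\<leftarrow>G. \<bar>g (x + v n) - g x\<bar>)" for x
        using add_mono[OF c[of "Re (f (x + v n))" "Re (f x)"] c[of "Im (f (x + v n))" "Im (f x)"]]
        unfolding G_def cmod_power2 minus_complex.simps list.map sum_list.Cons sum_list.Nil
        by (simp only: distrib_left add.assoc add_0_right)
    qed (simp add: sum_list_nonneg G_def)
    also have "\<dots> = 2 * (\<Sum>g\<leftarrow>G. D g n)"
      using L[of G] by simp
    finally show ?thesis .
  qed
  have lim: "(\<lambda>n. 2 * (\<Sum>g\<leftarrow>G. D g n)) \<longlonglongrightarrow> 0"
  proof -
    have "(\<lambda>n. 2 * (\<Sum>g\<leftarrow>G. D g n)) \<longlonglongrightarrow> 2 * (0 + (0 + (0 + (0 + 0))))"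
      using D0 unfolding G_def by (simp only: list.map sum_list.Cons sum_list.Nil) (intro tendsto_intros; simp)
    then show ?thesis by simp
  qed
  show ?thesis
  proof (rule tendsto_sandwich[OF _ _ tendsto_const lim])
    show "\<forall>\<^sub>F n in sequentially. 0 \<le> (LINT x|lborel. (norm (f (x + v n) - f x))\<^sup>2)"
      by (intro always_eventually allI Bochner_Integration.integral_nonneg) (rule zero_le_power2)
    show "\<forall>\<^sub>F n in sequentially. (LINT x|lborel. (norm (f (x + v n) - f x))\<^sup>2) \<le> 2 * (\<Sum>g\<leftarrow>G. D g n)"
      by (intro always_eventually allI le)
  qed
qed

section \<open>The Gaussian and Plancherel's theorem\<close>

lemma cis_measurable [measurable]: "cis \<in> borel_measurable borel"
  by (intro borel_measurable_continuous_onI continuous_intros)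

lemma cnj_measurable [measurable]: "cnj \<in> borel_measurable borel"
  by (intro borel_measurable_continuous_onI continuous_intros)

text \<open>Read off from the characteristic function of the standard normal distribution.\<close>

lemma std_normal_fourier:
  "has_bochner_integral lborel (\<lambda>x. complex_of_real (std_normal_density x) * cis (t * x)) (complex_of_real (exp (- t\<^sup>2 / 2)))"
proof -
  have i: "integrable lborel (\<lambda>x. std_normal_density x *\<^sub>R cis (t * x))"
    by (rule Bochner_Integration.integrable_bound[of _ "std_normal_density"])
       (auto simp: normal_density_nonneg)
  have "char std_normal_distribution t = complex_of_real (exp (- t\<^sup>2 / 2))"
    by (simp add: char_std_normal_distribution)
  then have "(LINT x|lborel. std_normal_density x *\<^sub>R cis (t * x)) = complex_of_real (exp (- t\<^sup>2 / 2))"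
    unfolding char_def by (subst (asm) integral_density) (auto simp: normal_density_nonneg cis_conv_exp)
  then show ?thesis using i by (simp add: has_bochner_integral_iff scaleR_conv_of_real)
qed

lemma has_bochner_integral_pair_mult:
  fixes f g :: "real \<Rightarrow> 'b::{real_normed_field, banach, second_countable_topology}"
  assumes f: "has_bochner_integral lborel f a" and g: "has_bochner_integral lborel g b"
  shows "has_bochner_integral (lborel :: plane measure) (\<lambda>z. f (fst z) * g (snd z)) (a * b)"
proof -
  have [measurable]: "f \<in> borel_measurable borel" "g \<in> borel_measurable borel"
    using f g by (auto simp: has_bochner_integral_iff)
  have fi: "integrable lborel f" "integrable lborel g" "integral\<^sup>L lborel f = a" "integral\<^sup>L lborel g = b"
    using f g by (auto simp: has_bochner_integral_iff)
  have i: "integrable (lborel \<Otimes>\<^sub>M lborel) (\<lambda>z. f (fst z) * g (snd z))"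
  proof (rule lborel_pair.Fubini_integrable)
    show "integrable lborel (\<lambda>x. LINT y|lborel. norm (f (fst (x, y)) * g (snd (x, y))))"
      using fi by (simp add: norm_mult)
    show "AE x in lborel. integrable lborel (\<lambda>y. f (fst (x, y)) * g (snd (x, y)))"
      using fi by simp
  qed measurable
  moreover have "integral\<^sup>L (lborel \<Otimes>\<^sub>M lborel) (\<lambda>z. f (fst z) * g (snd z)) = a * b"
    by (subst lborel_pair.integral_fst'[OF i, symmetric]) (use fi in simp)
  ultimately show ?thesis by (simp add: has_bochner_integral_iff lborel_prod)
qed

definition gauss2 :: "plane \<Rightarrow> real" where
  "gauss2 w = std_normal_density (fst w) * std_normal_density (snd w)"

lemma gauss2_eq: "gauss2 w = exp (- (norm w)\<^sup>2 / 2) / (2 * pi)"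
  by (simp add: gauss2_def std_normal_density_def norm_prod_def real_sqrt_mult[symmetric] add_divide_distrib exp_add[symmetric] flip: exp_add)

lemma gauss2_pos: "gauss2 w > 0" by (simp add: gauss2_eq)

lemma gauss2_measurable [measurable]: "gauss2 \<in> borel_measurable borel"
  unfolding gauss2_def borel_prod[symmetric] by measurable

lemma gauss2_fourier:
  "has_bochner_integral lborel (\<lambda>w. complex_of_real (gauss2 w) * cis (\<eta> \<bullet> w)) (complex_of_real (2 * pi * gauss2 \<eta>))"
proof -
  have "has_bochner_integral lborel (\<lambda>w. complex_of_real (std_normal_density (fst w)) * cis (fst \<eta> * fst w) * 
      (complex_of_real (std_normal_density (snd w)) * cis (snd \<eta> * snd w)))
     (complex_of_real (exp (- (fst \<eta>)\<^sup>2 / 2)) * complex_of_real (exp (- (snd \<eta>)\<^sup>2 / 2)))"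
    by (rule has_bochner_integral_pair_mult; rule std_normal_fourier)
  also have "(\<lambda>w. complex_of_real (std_normal_density (fst w)) * cis (fst \<eta> * fst w) * 
      (complex_of_real (std_normal_density (snd w)) * cis (snd \<eta> * snd w))) = (\<lambda>w. complex_of_real (gauss2 w) * cis (\<eta> \<bullet> w))"
    by (auto simp: fun_eq_iff gauss2_def inner_prod_def cis_mult[symmetric])
  also have "complex_of_real (exp (- (fst \<eta>)\<^sup>2 / 2)) * complex_of_real (exp (- (snd \<eta>)\<^sup>2 / 2)) = complex_of_real (2 * pi * gauss2 \<eta>)"
    by (simp add: gauss2_eq norm_prod_def add_divide_distrib exp_add[symmetric] flip: of_real_mult)
  finally show ?thesis .
qed

lemma gauss2_integral: "has_bochner_integral lborel gauss2 1"
proof -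
  have "has_bochner_integral lborel (\<lambda>w. complex_of_real (gauss2 w)) 1"
    using gauss2_fourier[of 0] by (simp add: gauss2_eq)
  then have "has_bochner_integral lborel (\<lambda>w. Re (complex_of_real (gauss2 w))) (Re 1)"
    by (rule has_bochner_integral_Re)
  then show ?thesis by simp
qed

text \<open>The same integral as \<open>fourier_L1\<close>, but over \<open>lborel\<close>, since
  the Fubini arguments live on Borel product measures; \<open>annulus_frequency_bounds\<close>
  passes between the two.\<close>

definition ft :: "(plane \<Rightarrow> complex) \<Rightarrow> plane \<Rightarrow> complex" where
  "ft f \<xi> = (LINT x|lborel. f x * cis (- 2 * pi * (x \<bullet> \<xi>)))"

lemma ft_measurable [measurable]:
  assumes [measurable]: "f \<in> borel_measurable borel"
  shows "ft f \<in> borel_measurable borel"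
  unfolding ft_def by measurable

lemma lborel_integral_affine:
  fixes f :: "'a::euclidean_space \<Rightarrow> 'b::{banach, second_countable_topology}"
  assumes [measurable]: "f \<in> borel_measurable borel" and c: "c \<noteq> 0"
  shows "(LINT x|lborel. f x) = (\<bar>c\<bar> ^ DIM('a)) *\<^sub>R (LINT x|lborel. f (t + c *\<^sub>R x))"
  by (subst lborel_affine[OF c, of t])
     (simp add: integral_density integral_distr)

lemma integrable_lborel_affine:
  fixes f :: "'a::euclidean_space \<Rightarrow> 'b::{banach, second_countable_topology}"
  assumes f: "integrable lborel f" and c: "c \<noteq> 0"
  shows "integrable lborel (\<lambda>x. f (t + c *\<^sub>R x))"
proof -
  have [measurable]: "f \<in> borel_measurable borel" using f by auto
  have "integrable (density (distr lborel borel (\<lambda>x. t + c *\<^sub>R x)) (\<lambda>_. ennreal (\<bar>c\<bar> ^ DIM('a)))) f"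
    using f by (subst (asm) lborel_affine[OF c, of t]) simp
  then have "integrable lborel (\<lambda>x. (\<bar>c\<bar> ^ DIM('a)) *\<^sub>R f (t + c *\<^sub>R x))" by (simp add: integrable_density integrable_distr_eq)
  then have "integrable lborel (\<lambda>x. (1 / \<bar>c\<bar> ^ DIM('a)) *\<^sub>R (\<bar>c\<bar> ^ DIM('a)) *\<^sub>R f (t + c *\<^sub>R x))"
    by (rule integrable_scaleR_right)
  then show ?thesis using c by simp
qed

text \<open>A majorant of product form reduces an interchange of integrals to a pointwise estimate,
  the shape in which most interchanges below arise.\<close>

lemma Fubini_dominated:
  fixes F :: "'a::euclidean_space \<Rightarrow> 'b::euclidean_space \<Rightarrow> 'c::{banach, second_countable_topology}"
  assumes [measurable]: "(\<lambda>(x,y). F x y) \<in> borel_measurable (borel \<Otimes>\<^sub>M borel)"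
    and a: "integrable lborel a" and b: "integrable lborel b"
    and F: "\<And>x y. norm (F x y) \<le> a x * b y"
  shows "(LINT x|lborel. LINT y|lborel. F x y) = (LINT y|lborel. LINT x|lborel. F x y)"
proof -
  have [measurable]: "a \<in> borel_measurable borel" "b \<in> borel_measurable borel" using a b by auto
  have ia: "integrable lborel (\<lambda>y. a x * b y)" for x using b by simp
  have iF: "integrable lborel (F x)" for x
    by (rule Bochner_Integration.integrable_bound[OF ia[of x]])
       (use F in \<open>auto intro!: AE_I2 intro: order_trans[OF _ abs_ge_self]\<close>)
  have "integrable (lborel \<Otimes>\<^sub>M lborel) (\<lambda>z. F (fst z) (snd z))"
  proof (rule lborel_pair.Fubini_integrable)
    show "integrable lborel (\<lambda>x. LINT y|lborel. norm (F (fst (x, y)) (snd (x, y))))"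
    proof (rule Bochner_Integration.integrable_bound)
      show "integrable lborel (\<lambda>x. a x * integral\<^sup>L lborel b)" using a by simp
      show "AE x in lborel. norm (LINT y|lborel. norm (F (fst (x, y)) (snd (x, y)))) \<le> norm (a x * integral\<^sup>L lborel b)"
      proof (intro AE_I2)
        fix x
        have "(LINT y|lborel. norm (F x y)) \<le> (LINT y|lborel. a x * b y)"
          by (rule integral_mono) (use iF ia F in auto)
        then have "(LINT y|lborel. norm (F x y)) \<le> a x * integral\<^sup>L lborel b" by simp
        moreover have "0 \<le> (LINT y|lborel. norm (F x y))" by (rule Bochner_Integration.integral_nonneg) simp
        ultimately show "norm (LINT y|lborel. norm (F (fst (x, y)) (snd (x, y)))) \<le> norm (a x * integral\<^sup>L lborel b)"
          by simp
      qed
    qed measurable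
    show "AE x in lborel. integrable lborel (\<lambda>y. F (fst (x, y)) (snd (x, y)))" using iF by simp
  qed measurable
  then show ?thesis by (intro lborel_pair.Fubini_integral[of F, symmetric]) (simp add: case_prod_beta')
qed

lemma integrable_L2_product:
  fixes f g :: "'a \<Rightarrow> complex"
  assumes [measurable]: "f \<in> borel_measurable M" "g \<in> borel_measurable M"
    and "integrable M (\<lambda>x. (norm (f x))\<^sup>2)" "integrable M (\<lambda>x. (norm (g x))\<^sup>2)"
  shows "integrable M (\<lambda>x. f x * g x)"
proof (rule Bochner_Integration.integrable_bound)
  show "integrable M (\<lambda>x. (norm (f x))\<^sup>2 + (norm (g x))\<^sup>2)" using assms by simp
  show "AE x in M. norm (f x * g x) \<le> norm ((norm (f x))\<^sup>2 + (norm (g x))\<^sup>2)"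
  proof (intro AE_I2)
    fix x
    have "2 * (norm (f x) * norm (g x)) \<le> (norm (f x))\<^sup>2 + (norm (g x))\<^sup>2"
      using sum_squares_bound[of "norm (f x)" "norm (g x)"] by simp
    moreover have "0 \<le> norm (f x) * norm (g x)" by simp
    ultimately show "norm (f x * g x) \<le> norm ((norm (f x))\<^sup>2 + (norm (g x))\<^sup>2)"
      unfolding norm_mult real_norm_def by linarith
  qed
qed measurable

text \<open>The transform of an integrable function is a priori only bounded, so a Gaussian factor
  in \<xi> is inserted to make all integrals converge absolutely. Expanding the two factors of the
  squared modulus one after the other, and using that the Gaussian is its own transform, turns
  damping at frequencies of size 1/\<delta> into a Gaussian mean of the autocorrelation over the
  shifts \<delta> w.\<close>

lemma gaussian_mean_of_ft:
  fixes f :: "plane \<Rightarrow> complex"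
  assumes [measurable]: "f \<in> borel_measurable borel" and f1: "integrable lborel f"
    and f2: "integrable lborel (\<lambda>x. (norm (f x))\<^sup>2)" and \<delta>: "\<delta> > 0"
  shows "integrable lborel (\<lambda>\<xi>. 2 * pi * gauss2 ((2 * pi * \<delta>) *\<^sub>R \<xi>) * (norm (ft f \<xi>))\<^sup>2)"
    and "(LINT \<xi>|lborel. 2 * pi * gauss2 ((2 * pi * \<delta>) *\<^sub>R \<xi>) * (norm (ft f \<xi>))\<^sup>2)
      = (LINT w|lborel. gauss2 w * Re (LINT x|lborel. f x * cnj (f (x + \<delta> *\<^sub>R w))))"
proof -
  define k where "k \<xi> = 2 * pi * gauss2 ((2 * pi * \<delta>) *\<^sub>R \<xi>)" for \<xi>
  have k0: "k \<xi> \<ge> 0" for \<xi> using gauss2_pos[of "(2 * pi * \<delta>) *\<^sub>R \<xi>"] by (simp add: k_def)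
  have [measurable]: "k \<in> borel_measurable borel" unfolding k_def by measurable
  have gi: "integrable lborel gauss2" using gauss2_integral by (simp add: has_bochner_integral_iff)
  have ki: "integrable lborel k"
    unfolding k_def using integrable_lborel_affine[OF gi, of "2 * pi * \<delta>" 0] \<delta> by simp
  define A where "A = (LINT x|lborel. norm (f x))"
  have ftA: "norm (ft f \<xi>) \<le> A" for \<xi>
    unfolding ft_def A_def
    by (rule order_trans[OF Bochner_Integration.integral_norm_bound]) (simp add: norm_mult)
  have A0: "A \<ge> 0" unfolding A_def by (rule Bochner_Integration.integral_nonneg) simp
  have nf: "integrable lborel (\<lambda>x. norm (f x))" using f1 by simp
  have kf: "integrable lborel (\<lambda>\<xi>. k \<xi> * (norm (ft f \<xi>))\<^sup>2)"
  proof (rule Bochner_Integration.integrable_bound)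
    show "integrable lborel (\<lambda>\<xi>. k \<xi> * A\<^sup>2)" using ki by simp
    show "AE \<xi> in lborel. norm (k \<xi> * (norm (ft f \<xi>))\<^sup>2) \<le> norm (k \<xi> * A\<^sup>2)"
      using ftA k0 by (intro AE_I2) (auto simp: abs_mult intro!: mult_left_mono power_mono)
  qed measurable
  then show "integrable lborel (\<lambda>\<xi>. 2 * pi * gauss2 ((2 * pi * \<delta>) *\<^sub>R \<xi>) * (norm (ft f \<xi>))\<^sup>2)"
    by (simp add: k_def)
  \<comment> \<open>The transform of the damping factor. Since \<open>gauss2_fourier\<close> has no
    2 pi in its phase, the rescaling by 2 pi \<delta> restores it and produces the normalised
    Gaussian of width \<delta>.\<close>
  have kappa: "(LINT \<xi>|lborel. complex_of_real (k \<xi>) * cis (2 * pi * (v \<bullet> \<xi>))) = complex_of_real (gauss2 ((1/\<delta>) *\<^sub>R v) / \<delta>\<^sup>2)" for v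
  proof -
    have "complex_of_real (2 * pi * gauss2 ((1/\<delta>) *\<^sub>R v)) = (LINT w|lborel. complex_of_real (gauss2 w) * cis (((1/\<delta>) *\<^sub>R v) \<bullet> w))"
      using gauss2_fourier[of "(1/\<delta>) *\<^sub>R v"] by (simp add: has_bochner_integral_iff)
    also have "\<dots> = (\<bar>2 * pi * \<delta>\<bar> ^ DIM(plane)) *\<^sub>R (LINT \<xi>|lborel. complex_of_real (gauss2 (0 + (2 * pi * \<delta>) *\<^sub>R \<xi>)) * cis (((1/\<delta>) *\<^sub>R v) \<bullet> (0 + (2 * pi * \<delta>) *\<^sub>R \<xi>)))"
      by (rule lborel_integral_affine) (use \<delta> in auto)
    also have "(LINT \<xi>|lborel. complex_of_real (gauss2 (0 + (2 * pi * \<delta>) *\<^sub>R \<xi>)) * cis (((1/\<delta>) *\<^sub>R v) \<bullet> (0 + (2 * pi * \<delta>) *\<^sub>R \<xi>)))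
       = (LINT \<xi>|lborel. (1 / (2 * pi)) *\<^sub>R (complex_of_real (k \<xi>) * cis (2 * pi * (v \<bullet> \<xi>))))"
      using \<delta> by (intro Bochner_Integration.integral_cong) (auto simp: k_def scaleR_conv_of_real mult.assoc)
    also have "\<dots> = (1 / (2 * pi)) *\<^sub>R (LINT \<xi>|lborel. complex_of_real (k \<xi>) * cis (2 * pi * (v \<bullet> \<xi>)))"
      by (rule integral_scaleR_right)
    finally show ?thesis using \<delta> by (simp add: scaleR_conv_of_real field_simps power2_eq_square)
  qed
  have s1: "(LINT \<xi>|lborel. complex_of_real (k \<xi>) * cnj (ft f \<xi>) * ft f \<xi>)
      = (LINT x|lborel. LINT \<xi>|lborel. f x * (complex_of_real (k \<xi>) * cnj (ft f \<xi>) * cis (- 2 * pi * (x \<bullet> \<xi>))))"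
  proof -
    have "(LINT \<xi>|lborel. complex_of_real (k \<xi>) * cnj (ft f \<xi>) * ft f \<xi>)
      = (LINT \<xi>|lborel. LINT x|lborel. complex_of_real (k \<xi>) * cnj (ft f \<xi>) * (f x * cis (- 2 * pi * (x \<bullet> \<xi>))))"
      unfolding ft_def[of f] by simp
    also have "\<dots> = (LINT x|lborel. LINT \<xi>|lborel. complex_of_real (k \<xi>) * cnj (ft f \<xi>) * (f x * cis (- 2 * pi * (x \<bullet> \<xi>))))"
    proof (rule Fubini_dominated)
      show "integrable lborel (\<lambda>\<xi>. k \<xi> * A)" using ki by simp
      show "integrable lborel (\<lambda>x. norm (f x))" by (rule nf)
      show "norm (complex_of_real (k \<xi>) * cnj (ft f \<xi>) * (f x * cis (- 2 * pi * (x \<bullet> \<xi>)))) \<le> k \<xi> * A * norm (f x)" for x \<xi>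
        using ftA[of \<xi>] k0[of \<xi>] by (auto simp: norm_mult intro!: mult_right_mono mult_left_mono)
    qed measurable
    finally show ?thesis by (simp add: mult_ac)
  qed
  have s2: "(LINT \<xi>|lborel. complex_of_real (k \<xi>) * cnj (ft f \<xi>) * cis (- 2 * pi * (x \<bullet> \<xi>)))
      = (LINT w|lborel. complex_of_real (gauss2 w) * cnj (f (x + \<delta> *\<^sub>R w)))" for x
  proof -
    have "(LINT \<xi>|lborel. complex_of_real (k \<xi>) * cnj (ft f \<xi>) * cis (- 2 * pi * (x \<bullet> \<xi>)))
      = (LINT \<xi>|lborel. (LINT y|lborel. cnj (f y) * (complex_of_real (k \<xi>) * cis (2 * pi * ((y - x) \<bullet> \<xi>)))))"
    proof (intro Bochner_Integration.integral_cong refl)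
      fix \<xi> :: "plane"
      have "complex_of_real (k \<xi>) * cnj (ft f \<xi>) * cis (- 2 * pi * (x \<bullet> \<xi>))
         = (LINT y|lborel. complex_of_real (k \<xi>) * cis (- 2 * pi * (x \<bullet> \<xi>)) * cnj (f y * cis (- 2 * pi * (y \<bullet> \<xi>))))"
        by (subst integral_mult_right_zero, subst Bochner_Integration.integral_cnj) (simp add: ft_def mult_ac)
      also have "\<dots> = (LINT y|lborel. cnj (f y) * (complex_of_real (k \<xi>) * cis (2 * pi * ((y - x) \<bullet> \<xi>))))"
      proof (intro Bochner_Integration.integral_cong refl)
        fix y :: "plane"
        have "cis (2 * pi * ((y - x) \<bullet> \<xi>)) = cis (- 2 * pi * (x \<bullet> \<xi>)) * cis (2 * pi * (y \<bullet> \<xi>))"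
          by (simp add: cis_mult inner_diff_left algebra_simps)
        then show "complex_of_real (k \<xi>) * cis (- 2 * pi * (x \<bullet> \<xi>)) * cnj (f y * cis (- 2 * pi * (y \<bullet> \<xi>)))
          = cnj (f y) * (complex_of_real (k \<xi>) * cis (2 * pi * ((y - x) \<bullet> \<xi>)))"
          by (simp add: cis_cnj mult_ac)
      qed
      finally show "complex_of_real (k \<xi>) * cnj (ft f \<xi>) * cis (- 2 * pi * (x \<bullet> \<xi>))
         = (LINT y|lborel. cnj (f y) * (complex_of_real (k \<xi>) * cis (2 * pi * ((y - x) \<bullet> \<xi>))))" .
    qed
    also have "\<dots> = (LINT y|lborel. LINT \<xi>|lborel. cnj (f y) * (complex_of_real (k \<xi>) * cis (2 * pi * ((y - x) \<bullet> \<xi>))))"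
    proof (rule Fubini_dominated)
      show "norm (cnj (f y) * (complex_of_real (k \<xi>) * cis (2 * pi * ((y - x) \<bullet> \<xi>)))) \<le> k \<xi> * norm (f y)" for y \<xi>
        using k0[of \<xi>] by (simp add: norm_mult)
    qed (use ki nf in measurable)
    also have "\<dots> = (LINT y|lborel. cnj (f y) * complex_of_real (gauss2 ((1/\<delta>) *\<^sub>R (y - x)) / \<delta>\<^sup>2))"
      by (simp only: integral_mult_right_zero kappa)
    also have "\<dots> = (\<bar>\<delta>\<bar> ^ DIM(real\<times>real)) *\<^sub>R (LINT w|lborel. cnj (f (x + \<delta> *\<^sub>R w)) * complex_of_real (gauss2 ((1/\<delta>) *\<^sub>R ((x + \<delta> *\<^sub>R w) - x)) / \<delta>\<^sup>2))"
      by (rule lborel_integral_affine) (use \<delta> in auto)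
    also have "\<dots> = (LINT w|lborel. (\<bar>\<delta>\<bar> ^ DIM(real\<times>real)) *\<^sub>R (cnj (f (x + \<delta> *\<^sub>R w)) * complex_of_real (gauss2 ((1/\<delta>) *\<^sub>R ((x + \<delta> *\<^sub>R w) - x)) / \<delta>\<^sup>2)))"
      by (rule integral_scaleR_right[symmetric])
    also have "\<dots> = (LINT w|lborel. complex_of_real (gauss2 w) * cnj (f (x + \<delta> *\<^sub>R w)))"
      using \<delta> by (intro Bochner_Integration.integral_cong) (auto simp: scaleR_conv_of_real power2_eq_square)
    finally show ?thesis .
  qed
  have fs2: "integrable lborel (\<lambda>x. (norm (f (x + t)))\<^sup>2)" "(LINT x|lborel. (norm (f (x + t)))\<^sup>2) = (LINT x|lborel. (norm (f x))\<^sup>2)" for t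
    using integrable_lborel_shift[OF f2] integral_lborel_shift[of "\<lambda>x. (norm (f x))\<^sup>2" t] by auto
  have fprod: "integrable lborel (\<lambda>x. f x * cnj (f (x + t)))" for t
    using f2 fs2[of t] by (intro integrable_L2_product) auto
  have fprod_le: "(LINT x|lborel. norm (f x * cnj (f (x + t)))) \<le> (LINT x|lborel. (norm (f x))\<^sup>2)" for t
  proof -
    have "(LINT x|lborel. norm (f x * cnj (f (x + t)))) \<le> (LINT x|lborel. ((norm (f x))\<^sup>2 + (norm (f (x + t)))\<^sup>2) / 2)"
    proof (rule integral_mono)
      show "norm (f x * cnj (f (x + t))) \<le> ((norm (f x))\<^sup>2 + (norm (f (x + t)))\<^sup>2) / 2" for x
        using sum_squares_bound[of "norm (f x)" "norm (f (x + t))"] by (simp add: norm_mult)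
    qed (use fprod f2 fs2 in auto)
    also have "\<dots> = (LINT x|lborel. (norm (f x))\<^sup>2)" using f2 fs2[of t] by simp
    finally show ?thesis .
  qed
  have s3: "(LINT x|lborel. LINT w|lborel. f x * (complex_of_real (gauss2 w) * cnj (f (x + \<delta> *\<^sub>R w))))
     = (LINT w|lborel. LINT x|lborel. complex_of_real (gauss2 w) * (f x * cnj (f (x + \<delta> *\<^sub>R w))))"
  proof -
    have "integrable (lborel \<Otimes>\<^sub>M lborel) (\<lambda>z. complex_of_real (gauss2 (fst z)) * (f (snd z) * cnj (f (snd z + \<delta> *\<^sub>R fst z))))"
    proof (rule lborel_pair.Fubini_integrable)
      show "integrable lborel (\<lambda>w. LINT x|lborel. norm (complex_of_real (gauss2 (fst (w,x))) * (f (snd (w,x)) * cnj (f (snd (w,x) + \<delta> *\<^sub>R fst (w,x))))))"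
      proof (rule Bochner_Integration.integrable_bound)
        show "integrable lborel (\<lambda>w. gauss2 w * (LINT x|lborel. (norm (f x))\<^sup>2))" using gi by simp
        show "AE w in lborel. norm (LINT x|lborel. norm (complex_of_real (gauss2 (fst (w,x))) * (f (snd (w,x)) * cnj (f (snd (w,x) + \<delta> *\<^sub>R fst (w,x))))))
           \<le> norm (gauss2 w * (LINT x|lborel. (norm (f x))\<^sup>2))"
        proof (intro AE_I2)
          fix w :: "plane"
          have "norm (LINT x|lborel. norm (complex_of_real (gauss2 w) * (f x * cnj (f (x + \<delta> *\<^sub>R w)))))
              = gauss2 w * (LINT x|lborel. norm (f x * cnj (f (x + \<delta> *\<^sub>R w))))"
            using gauss2_pos[of w] unfolding norm_mult[of "complex_of_real (gauss2 w)"]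
            by (simp add: abs_mult abs_of_nonneg[OF Bochner_Integration.integral_nonneg])
          also have "\<dots> \<le> gauss2 w * (LINT x|lborel. (norm (f x))\<^sup>2)"
            using gauss2_pos[of w] fprod_le by (intro mult_left_mono) auto
          also have "\<dots> \<le> norm (gauss2 w * (LINT x|lborel. (norm (f x))\<^sup>2))" by simp
          finally show "norm (LINT x|lborel. norm (complex_of_real (gauss2 (fst (w,x))) * (f (snd (w,x)) * cnj (f (snd (w,x) + \<delta> *\<^sub>R fst (w,x))))))
           \<le> norm (gauss2 w * (LINT x|lborel. (norm (f x))\<^sup>2))" by simp
        qed
      qed measurable
      show "AE w in lborel. integrable lborel (\<lambda>x. complex_of_real (gauss2 (fst (w,x))) * (f (snd (w,x)) * cnj (f (snd (w,x) + \<delta> *\<^sub>R fst (w,x)))))"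
        using fprod by simp
    qed measurable
    then have "(LINT x|lborel. LINT w|lborel. complex_of_real (gauss2 w) * (f x * cnj (f (x + \<delta> *\<^sub>R w))))
      = (LINT w|lborel. LINT x|lborel. complex_of_real (gauss2 w) * (f x * cnj (f (x + \<delta> *\<^sub>R w))))"
      using lborel_pair.Fubini_integral[of "\<lambda>w x. complex_of_real (gauss2 w) * (f x * cnj (f (x + \<delta> *\<^sub>R w)))"]
      by (simp add: case_prod_beta')
    then show ?thesis by (simp add: mult_ac)
  qed
  have "complex_of_real (LINT \<xi>|lborel. k \<xi> * (norm (ft f \<xi>))\<^sup>2) = (LINT \<xi>|lborel. complex_of_real (k \<xi> * (norm (ft f \<xi>))\<^sup>2))"
    by (rule integral_complex_of_real[symmetric])
  also have "\<dots> = (LINT \<xi>|lborel. complex_of_real (k \<xi>) * cnj (ft f \<xi>) * ft f \<xi>)"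
    by (intro Bochner_Integration.integral_cong refl) (simp only: of_real_mult complex_norm_square mult_ac)
  also have "\<dots> = (LINT x|lborel. f x * (LINT w|lborel. complex_of_real (gauss2 w) * cnj (f (x + \<delta> *\<^sub>R w))))"
    unfolding s1 integral_mult_right_zero s2 ..
  also have "\<dots> = (LINT w|lborel. complex_of_real (gauss2 w) * (LINT x|lborel. f x * cnj (f (x + \<delta> *\<^sub>R w))))"
    using s3 unfolding integral_mult_right_zero .
  finally have e: "complex_of_real (LINT \<xi>|lborel. k \<xi> * (norm (ft f \<xi>))\<^sup>2)
     = (LINT w|lborel. complex_of_real (gauss2 w) * (LINT x|lborel. f x * cnj (f (x + \<delta> *\<^sub>R w))))" .
  have ie: "integrable lborel (\<lambda>w. complex_of_real (gauss2 w) * (LINT x|lborel. f x * cnj (f (x + \<delta> *\<^sub>R w))))"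
  proof (rule Bochner_Integration.integrable_bound)
    show "integrable lborel (\<lambda>w. gauss2 w * (LINT x|lborel. (norm (f x))\<^sup>2))" using gi by simp
    show "AE w in lborel. norm (complex_of_real (gauss2 w) * (LINT x|lborel. f x * cnj (f (x + \<delta> *\<^sub>R w)))) \<le> norm (gauss2 w * (LINT x|lborel. (norm (f x))\<^sup>2))"
      using gauss2_pos fprod_le
      by (intro AE_I2) (auto simp: norm_mult abs_mult intro!: mult_left_mono intro: order_trans[OF Bochner_Integration.integral_norm_bound] order_trans[OF _ abs_ge_self])
  qed measurable
  have "(LINT \<xi>|lborel. k \<xi> * (norm (ft f \<xi>))\<^sup>2) = Re (LINT w|lborel. complex_of_real (gauss2 w) * (LINT x|lborel. f x * cnj (f (x + \<delta> *\<^sub>R w))))"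
    unfolding e[symmetric] by simp
  also have "\<dots> = (LINT w|lborel. gauss2 w * Re (LINT x|lborel. f x * cnj (f (x + \<delta> *\<^sub>R w))))"
    using integral_Re[OF ie] by simp
  finally show "(LINT \<xi>|lborel. 2 * pi * gauss2 ((2 * pi * \<delta>) *\<^sub>R \<xi>) * (norm (ft f \<xi>))\<^sup>2)
      = (LINT w|lborel. gauss2 w * Re (LINT x|lborel. f x * cnj (f (x + \<delta> *\<^sub>R w))))"
    by (simp add: k_def)
qed

text \<open>Polarisation: the autocorrelation falls short of its value at t = 0 by half the squared
  L^2 distance between f and its translate, which continuity of translations controls.\<close>

lemma Re_autocorrelation:
  fixes f :: "'a::euclidean_space \<Rightarrow> complex"
  assumes [measurable]: "f \<in> borel_measurable borel" and f2: "integrable lborel (\<lambda>x. (norm (f x))\<^sup>2)"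
  shows "Re (LINT x|lborel. f x * cnj (f (x + t))) = (LINT x|lborel. (norm (f x))\<^sup>2) - (LINT x|lborel. (norm (f (x + t) - f x))\<^sup>2) / 2"
    and "\<bar>Re (LINT x|lborel. f x * cnj (f (x + t)))\<bar> \<le> (LINT x|lborel. (norm (f x))\<^sup>2)"
proof -
  have fs2: "integrable lborel (\<lambda>x. (norm (f (x + t)))\<^sup>2)" "(LINT x|lborel. (norm (f (x + t)))\<^sup>2) = (LINT x|lborel. (norm (f x))\<^sup>2)"
    using integrable_lborel_shift[OF f2] integral_lborel_shift[of "\<lambda>x. (norm (f x))\<^sup>2" t] by auto
  have fprod: "integrable lborel (\<lambda>x. f x * cnj (f (x + t)))"
    using f2 fs2(1) by (intro integrable_L2_product) auto
  have iR: "integrable lborel (\<lambda>x. Re (f x * cnj (f (x + t))))" using fprod by (rule integrable_Re)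
  have R: "Re (LINT x|lborel. f x * cnj (f (x + t))) = (LINT x|lborel. Re (f x * cnj (f (x + t))))"
    using integral_Re[OF fprod] by simp
  have pt: "(norm (a - b))\<^sup>2 = (norm a)\<^sup>2 + (norm b)\<^sup>2 - 2 * Re (b * cnj a)" for a b :: complex
    by (simp only: cmod_power2) (simp add: power2_eq_square algebra_simps)
  have "(LINT x|lborel. (norm (f (x + t) - f x))\<^sup>2) = (LINT x|lborel. (norm (f (x + t)))\<^sup>2 + (norm (f x))\<^sup>2 - 2 * Re (f x * cnj (f (x + t))))"
    by (simp only: pt)
  also have "\<dots> = (LINT x|lborel. (norm (f x))\<^sup>2) + (LINT x|lborel. (norm (f x))\<^sup>2) - 2 * (LINT x|lborel. Re (f x * cnj (f (x + t))))"
  proof -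
    define h where "h = (\<lambda>x. Re (f x * cnj (f (x + t))))"
    have "integrable lborel h" using iR by (simp only: h_def)
    then have "(LINT x|lborel. (norm (f (x + t)))\<^sup>2 + (norm (f x))\<^sup>2 - 2 * h x) = (LINT x|lborel. (norm (f x))\<^sup>2) + (LINT x|lborel. (norm (f x))\<^sup>2) - 2 * (LINT x|lborel. h x)"
      using f2 fs2 by simp
    then show ?thesis by (simp only: h_def)
  qed
  finally show "Re (LINT x|lborel. f x * cnj (f (x + t))) = (LINT x|lborel. (norm (f x))\<^sup>2) - (LINT x|lborel. (norm (f (x + t) - f x))\<^sup>2) / 2"
    unfolding R by linarith
  have "\<bar>LINT x|lborel. Re (f x * cnj (f (x + t)))\<bar> \<le> (LINT x|lborel. ((norm (f x))\<^sup>2 + (norm (f (x + t)))\<^sup>2) / 2)"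
  proof (rule integral_abs_bound_integral)
    show "\<bar>Re (f x * cnj (f (x + t)))\<bar> \<le> ((norm (f x))\<^sup>2 + (norm (f (x + t)))\<^sup>2) / 2" for x
      using sum_squares_bound[of "norm (f x)" "norm (f (x + t))"] abs_Re_le_cmod[of "f x * cnj (f (x + t))"]
      by (simp add: norm_mult)
  qed (use iR f2 fs2 in auto)
  also have "\<dots> = (LINT x|lborel. (norm (f x))\<^sup>2)" using f2 fs2 by simp
  finally show "\<bar>Re (LINT x|lborel. f x * cnj (f (x + t)))\<bar> \<le> (LINT x|lborel. (norm (f x))\<^sup>2)"
    unfolding R .
qed

text \<open>The width \<delta> tends to 0 in \<open>gaussian_mean_of_ft\<close>. On the frequency
  side the damping factors increase to 1, so monotone convergence applies although the limit is not
  yet known to be finite; on the space side the limit follows by dominated convergence and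
  \<open>L2_shift_continuous\<close>.\<close>

theorem plancherel_L1_L2:
  fixes f :: "plane \<Rightarrow> complex"
  assumes [measurable]: "f \<in> borel_measurable borel" and f1: "integrable lborel f"
    and f2: "integrable lborel (\<lambda>x. (norm (f x))\<^sup>2)"
  shows "nnL2 (ft f) = ennreal (LINT x|lborel. (norm (f x))\<^sup>2)"
proof -
  define N where "N = (LINT x|lborel. (norm (f x))\<^sup>2)"
  define \<delta> where "\<delta> n = 1 / real (Suc n)" for n
  have \<delta>: "\<delta> n > 0" "\<delta> (Suc n) \<le> \<delta> n" for n unfolding \<delta>_def by (auto simp: field_simps)
  have \<delta>0: "\<delta> \<longlonglongrightarrow> 0" unfolding \<delta>_def using LIMSEQ_inverse_real_of_nat by (simp add: inverse_eq_divide)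
  have gi: "integrable lborel gauss2" "integral\<^sup>L lborel gauss2 = 1" using gauss2_integral by (auto simp: has_bochner_integral_iff)
  define G where "G n w = gauss2 w * Re (LINT x|lborel. f x * cnj (f (x + \<delta> n *\<^sub>R w)))" for n and w :: "plane"
  define k where "k n \<xi> = 2 * pi * gauss2 ((2 * pi * \<delta> n) *\<^sub>R \<xi>)" for n \<xi>
  have [measurable]: "k n \<in> borel_measurable borel" for n unfolding k_def by measurable
  have "(\<lambda>n. LINT w|lborel. G n w) \<longlonglongrightarrow> (LINT w|lborel. gauss2 w * N)"
  proof (rule integral_dominated_convergence[where w="\<lambda>w. gauss2 w * N"])
    show "AE w in lborel. (\<lambda>n. G n w) \<longlonglongrightarrow> gauss2 w * N"
    proof (intro AE_I2)
      fix w :: "plane"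
      have "(\<lambda>n. \<delta> n *\<^sub>R w) \<longlonglongrightarrow> 0 *\<^sub>R w" by (intro tendsto_intros \<delta>0)
      then have "(\<lambda>n. LINT x|lborel. (norm (f (x + \<delta> n *\<^sub>R w) - f x))\<^sup>2) \<longlonglongrightarrow> 0"
        by (intro L2_shift_continuous f2) auto
      then have "(\<lambda>n. gauss2 w * (N - (LINT x|lborel. (norm (f (x + \<delta> n *\<^sub>R w) - f x))\<^sup>2) / 2)) \<longlonglongrightarrow> gauss2 w * (N - 0 / 2)"
        by (intro tendsto_intros) auto
      then show "(\<lambda>n. G n w) \<longlonglongrightarrow> gauss2 w * N"
        unfolding G_def Re_autocorrelation(1)[OF assms(1) f2] N_def by simp
    qed
    show "AE w in lborel. norm (G n w) \<le> gauss2 w * N" for n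
      using Re_autocorrelation(2)[OF assms(1) f2] gauss2_pos
      by (intro AE_I2) (auto simp: G_def N_def abs_mult abs_of_pos intro!: mult_left_mono)
  qed (use gi in \<open>auto simp: G_def\<close>)
  then have lim: "(\<lambda>n. LINT \<xi>|lborel. k n \<xi> * (norm (ft f \<xi>))\<^sup>2) \<longlonglongrightarrow> N"
    using gi by (simp add: k_def G_def gaussian_mean_of_ft(2)[OF assms \<delta>(1)])
  have ki: "integrable lborel (\<lambda>\<xi>. k n \<xi> * (norm (ft f \<xi>))\<^sup>2)" for n
    unfolding k_def by (rule gaussian_mean_of_ft(1)[OF assms \<delta>(1)])
  have k0: "k n \<xi> \<ge> 0" for n \<xi> using gauss2_pos[of "(2 * pi * \<delta> n) *\<^sub>R \<xi>"] by (simp add: k_def)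
  have kexp: "k n \<xi> = exp (- ((2 * pi * \<delta> n) * norm \<xi>)\<^sup>2 / 2)" for n \<xi>
    using \<delta>(1)[of n] by (simp add: k_def gauss2_eq abs_of_pos)
  have "(\<lambda>n. \<integral>\<^sup>+\<xi>. ennreal (k n \<xi> * (norm (ft f \<xi>))\<^sup>2) \<partial>lborel) \<longlonglongrightarrow> nnL2 (ft f)"
  proof (rule nn_integral_LIMSEQ)
    show "incseq (\<lambda>n \<xi>. ennreal (k n \<xi> * (norm (ft f \<xi>))\<^sup>2))"
    proof (intro incseq_SucI le_funI ennreal_leI mult_right_mono)
      fix n \<xi>
      show "k n \<xi> \<le> k (Suc n) \<xi>"
        unfolding kexp using \<delta>(2)[of n] less_imp_le[OF \<delta>(1)[of "Suc n"]]
        by (intro iffD2[OF exp_le_cancel_iff] divide_right_mono le_imp_neg_le power_mono mult_right_mono mult_left_mono) auto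
    qed auto
    show "(\<lambda>n. ennreal (k n \<xi> * (norm (ft f \<xi>))\<^sup>2)) \<longlonglongrightarrow> ennreal ((norm (ft f \<xi>))\<^sup>2)" for \<xi>
    proof (rule tendsto_ennrealI)
      have "(\<lambda>n. exp (- ((2 * pi * \<delta> n) * norm \<xi>)\<^sup>2 / 2) * (norm (ft f \<xi>))\<^sup>2) \<longlonglongrightarrow> exp (- ((2 * pi * 0) * norm \<xi>)\<^sup>2 / 2) * (norm (ft f \<xi>))\<^sup>2"
        by (intro tendsto_intros \<delta>0) auto
      then show "(\<lambda>n. k n \<xi> * (norm (ft f \<xi>))\<^sup>2) \<longlonglongrightarrow> (norm (ft f \<xi>))\<^sup>2" unfolding kexp by simp
    qed
  qed measurable
  moreover have "(\<integral>\<^sup>+\<xi>. ennreal (k n \<xi> * (norm (ft f \<xi>))\<^sup>2) \<partial>lborel) = ennreal (LINT \<xi>|lborel. k n \<xi> * (norm (ft f \<xi>))\<^sup>2)" for n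
    using ki k0 by (intro nn_integral_eq_integral) auto
  ultimately have "(\<lambda>n. ennreal (LINT \<xi>|lborel. k n \<xi> * (norm (ft f \<xi>))\<^sup>2)) \<longlonglongrightarrow> nnL2 (ft f)" by simp
  moreover have "(\<lambda>n. ennreal (LINT \<xi>|lborel. k n \<xi> * (norm (ft f \<xi>))\<^sup>2)) \<longlonglongrightarrow> ennreal N"
    by (rule tendsto_ennrealI[OF lim])
  ultimately show ?thesis unfolding N_def by (rule LIMSEQ_unique)
qed

section \<open>Means over squares and their Fourier multipliers\<close>

definition qbox :: "real \<Rightarrow> plane set" where "qbox r = {0..r} \<times> {0..r}"

text \<open>Used as a frequency cutoff: on the Fourier side it multiplies by \<open>qmult r\<close>,
  which is close to 1 far below the frequency 1/r and small far above it, while in space it is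
  positive and of finite range.\<close>

definition avg :: "real \<Rightarrow> (plane \<Rightarrow> 'b) \<Rightarrow> plane \<Rightarrow> 'b::{banach, second_countable_topology}" where
  "avg r f x = (1 / r\<^sup>2) *\<^sub>R (LINT y|lborel. indicator (qbox r) y *\<^sub>R f (x + y))"

lemma qbox_measurable [measurable]: "qbox r \<in> sets borel"
  unfolding qbox_def by (intro borel_closed closed_Times) auto

lemma unit_square_measurable [measurable]: "unit_square \<in> sets borel"
  using qbox_measurable[of 1] by (simp add: qbox_def)

lemma emeasure_qbox: "r \<ge> 0 \<Longrightarrow> emeasure lborel (qbox r) = ennreal (r\<^sup>2)"
proof -
  assume r: "r \<ge> 0"
  have "emeasure (lborel \<Otimes>\<^sub>M lborel) ({0..r} \<times> {0..r}) = ennreal r * ennreal r"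
    using r by (subst lborel.emeasure_pair_measure_Times) auto
  then show ?thesis using r by (simp add: qbox_def lborel_prod power2_eq_square ennreal_mult)
qed

lemma measure_qbox [simp]: "r \<ge> 0 \<Longrightarrow> measure lborel (qbox r) = r\<^sup>2"
  by (simp add: measure_def emeasure_qbox)

lemma integrable_qbox [simp]: "integrable lborel (indicator (qbox r) :: _ \<Rightarrow> real)"
proof (cases "r \<ge> 0")
  case True then show ?thesis by (simp add: integrable_indicator_iff emeasure_qbox)
next
  case False then have "qbox r = {}" by (auto simp: qbox_def)
  then show ?thesis by simp
qed

lemma avg_measurable [measurable]:
  assumes [measurable]: "f \<in> borel_measurable borel"
  shows "avg r f \<in> borel_measurable borel"
  unfolding avg_def by measurable

text \<open>The phase has the sign opposite to that in \<open>ft\<close>, because \<open>avg\<close>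
  takes f at x + y and not at x - y.\<close>

definition qmult :: "real \<Rightarrow> plane \<Rightarrow> complex" where
  "qmult r \<xi> = (1 / r\<^sup>2) *\<^sub>R (LINT y|lborel. indicator (qbox r) y *\<^sub>R cis (2 * pi * (y \<bullet> \<xi>)))"

lemma qmult_measurable [measurable]: "qmult r \<in> borel_measurable borel"
  unfolding qmult_def by measurable

lemma ft_avg:
  fixes f :: "plane \<Rightarrow> complex"
  assumes f: "integrable lborel f"
  shows "ft (avg r f) \<xi> = qmult r \<xi> * ft f \<xi>"
proof -
  have [measurable]: "f \<in> borel_measurable borel" using f by auto
  let ?c = "\<lambda>x. cis (- 2 * pi * (x \<bullet> \<xi>))"
  have i: "integrable lborel (\<lambda>x. f x * ?c x)"
    by (rule Bochner_Integration.integrable_bound[OF f]) (auto simp: norm_mult)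
  have "(LINT x|lborel. LINT y|lborel. (indicator (qbox r) y *\<^sub>R f (x + y)) * ?c x)
     = (LINT y|lborel. LINT x|lborel. (indicator (qbox r) y *\<^sub>R f (x + y)) * ?c x)"
  proof -
    have "integrable (lborel \<Otimes>\<^sub>M lborel) (\<lambda>z. (indicator (qbox r) (fst z) *\<^sub>R f (snd z + fst z)) * ?c (snd z))"
    proof (rule lborel_pair.Fubini_integrable)
      show "AE y in lborel. integrable lborel (\<lambda>x. (indicator (qbox r) (fst (y,x)) *\<^sub>R f (snd (y,x) + fst (y,x))) * ?c (snd (y,x)))"
      proof (intro AE_I2)
        fix y
        show "integrable lborel (\<lambda>x. (indicator (qbox r) (fst (y,x)) *\<^sub>R f (snd (y,x) + fst (y,x))) * ?c (snd (y,x)))"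
          by (rule Bochner_Integration.integrable_bound[OF integrable_lborel_shift[OF f, of y]]) (auto simp: norm_mult split: split_indicator)
      qed
      have "(\<lambda>y. LINT x|lborel. norm ((indicator (qbox r) y *\<^sub>R f (x + y)) * ?c x)) = (\<lambda>y. indicator (qbox r) y * (LINT x|lborel. norm (f x)))"
        using integral_lborel_shift[of "\<lambda>x. norm (f x)"] by (simp add: norm_mult fun_eq_iff)
      then show "integrable lborel (\<lambda>y. LINT x|lborel. norm ((indicator (qbox r) (fst (y,x)) *\<^sub>R f (snd (y,x) + fst (y,x))) * ?c (snd (y,x))))"
        unfolding fst_conv snd_conv by (simp only: integrable_mult_left integrable_qbox)
    qed measurable
    then show ?thesis using lborel_pair.Fubini_integral[of "\<lambda>y x. (indicator (qbox r) y *\<^sub>R f (x + y)) * ?c x"]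
      by (simp add: case_prod_beta')
  qed
  moreover have "(LINT x|lborel. (indicator (qbox r) y *\<^sub>R f (x + y)) * ?c x) = (indicator (qbox r) y *\<^sub>R cis (2 * pi * (y \<bullet> \<xi>))) * ft f \<xi>" for y
  proof -
    have "ft f \<xi> = (LINT x|lborel. f (x + y) * ?c (x + y))"
      unfolding ft_def by (rule integral_lborel_shift[symmetric]) measurable
    then have "(indicator (qbox r) y *\<^sub>R cis (2 * pi * (y \<bullet> \<xi>))) * ft f \<xi> = (LINT x|lborel. (indicator (qbox r) y *\<^sub>R cis (2 * pi * (y \<bullet> \<xi>))) * (f (x + y) * ?c (x + y)))"
      by (simp only: integral_mult_right_zero)
    also have "\<dots> = (LINT x|lborel. (indicator (qbox r) y *\<^sub>R f (x + y)) * ?c x)"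
    proof (intro Bochner_Integration.integral_cong refl)
      fix x
      have "cis (2 * pi * (y \<bullet> \<xi>)) * ?c (x + y) = ?c x" by (simp add: cis_mult inner_add_left algebra_simps)
      then show "(indicator (qbox r) y *\<^sub>R cis (2 * pi * (y \<bullet> \<xi>))) * (f (x + y) * ?c (x + y)) = (indicator (qbox r) y *\<^sub>R f (x + y)) * ?c x"
        by (simp add: scaleR_conv_of_real)
    qed
    finally show ?thesis ..
  qed
  ultimately have H: "(LINT x|lborel. LINT y|lborel. (indicator (qbox r) y *\<^sub>R f (x + y)) * ?c x) = (LINT y|lborel. indicator (qbox r) y *\<^sub>R cis (2 * pi * (y \<bullet> \<xi>))) * ft f \<xi>"
    by (simp only: integral_mult_left_zero)
  have "ft (avg r f) \<xi> = (LINT x|lborel. (1 / r\<^sup>2) *\<^sub>R (LINT y|lborel. (indicator (qbox r) y *\<^sub>R f (x + y)) * ?c x))"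
    unfolding ft_def[of "avg r f"] avg_def mult_scaleR_left[of "1 / r\<^sup>2"] integral_mult_left_zero ..
  also have "\<dots> = (1 / r\<^sup>2) *\<^sub>R (LINT x|lborel. LINT y|lborel. (indicator (qbox r) y *\<^sub>R f (x + y)) * ?c x)"
    by (rule integral_scaleR_right)
  also have "\<dots> = qmult r \<xi> * ft f \<xi>" unfolding H by (simp add: qmult_def)
  finally show ?thesis .
qed

lemma norm_sq_add_le: "(norm (a + b))\<^sup>2 \<le> 2 * (norm a)\<^sup>2 + 2 * (norm (b::'a::real_normed_vector))\<^sup>2"
proof -
  have "(norm (a + b))\<^sup>2 \<le> (norm a + norm b)\<^sup>2" by (intro power_mono norm_triangle_ineq) simp
  also have "\<dots> \<le> 2 * (norm a)\<^sup>2 + 2 * (norm b)\<^sup>2"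
    using sum_squares_bound[of "norm a" "norm b"] by (simp add: power2_sum)
  finally show ?thesis .
qed

text \<open>If f is not integrable, the left side is 0, the default value of the Bochner
  integral.\<close>

lemma ennreal_norm_integral_le:
  fixes f :: "'a \<Rightarrow> 'b::{banach, second_countable_topology}"
  shows "ennreal (norm (integral\<^sup>L M f)) \<le> (\<integral>\<^sup>+x. ennreal (norm (f x)) \<partial>M)"
  by (cases "integrable M f") (auto simp: integral_norm_bound_ennreal not_integrable_integral_eq)

lemma avg_norm_le:
  fixes f :: "plane \<Rightarrow> 'b::{banach, second_countable_topology}"
  assumes [measurable]: "f \<in> borel_measurable borel"
  shows "ennreal (norm (avg r f x)) \<le> ennreal (1 / r\<^sup>2) * (\<integral>\<^sup>+y. indicator (qbox r) y * ennreal (norm (f (x + y))) \<partial>lborel)"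
proof -
  have "ennreal (norm (LINT y|lborel. indicator (qbox r) y *\<^sub>R f (x + y))) \<le> (\<integral>\<^sup>+y. ennreal (norm (indicator (qbox r) y *\<^sub>R f (x + y))) \<partial>lborel)"
    by (rule ennreal_norm_integral_le)
  also have "\<dots> = (\<integral>\<^sup>+y. indicator (qbox r) y * ennreal (norm (f (x + y))) \<partial>lborel)"
    by (intro nn_integral_cong) (auto split: split_indicator)
  finally have F: "ennreal (norm (LINT y|lborel. indicator (qbox r) y *\<^sub>R f (x + y))) \<le> (\<integral>\<^sup>+y. indicator (qbox r) y * ennreal (norm (f (x + y))) \<partial>lborel)" .
  have e: "norm (avg r f x) = (1 / r\<^sup>2) * norm (LINT y|lborel. indicator (qbox r) y *\<^sub>R f (x + y))"
    by (simp add: avg_def)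
  show ?thesis unfolding e by (subst ennreal_mult) (use F in \<open>auto intro: mult_left_mono\<close>)
qed

lemma avg_norm_sq_le:
  fixes f :: "plane \<Rightarrow> 'b::{banach, second_countable_topology}"
  assumes [measurable]: "f \<in> borel_measurable borel" and r: "r > 0"
  shows "ennreal ((norm (avg r f x))\<^sup>2) \<le> ennreal (1 / r\<^sup>2) * (\<integral>\<^sup>+y. indicator (qbox r) y * ennreal ((norm (f (x + y)))\<^sup>2) \<partial>lborel)"
proof -
  have "ennreal ((norm (avg r f x))\<^sup>2) = (ennreal (norm (avg r f x)))\<^sup>2" by (simp add: ennreal_power)
  also have "\<dots> \<le> (ennreal (1 / r\<^sup>2) * (\<integral>\<^sup>+y. indicator (qbox r) y * (indicator (qbox r) y * ennreal (norm (f (x + y)))) \<partial>lborel))\<^sup>2"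
    using avg_norm_le[OF assms(1), of r x] by (intro power_mono) (auto simp: mult.assoc[symmetric] indicator_inter_arith[symmetric])
  also have "\<dots> \<le> (ennreal (1 / r\<^sup>2))\<^sup>2 * ((\<integral>\<^sup>+y. (indicator (qbox r) y)\<^sup>2 \<partial>lborel) * (\<integral>\<^sup>+y. (indicator (qbox r) y * ennreal (norm (f (x + y))))\<^sup>2 \<partial>lborel))"
    by (subst power_mult_distrib, intro mult_left_mono Cauchy_Schwarz_nn_integral) auto
  also have "(\<integral>\<^sup>+y. (indicator (qbox r) y :: ennreal)\<^sup>2 \<partial>lborel) = (\<integral>\<^sup>+y. indicator (qbox r) y \<partial>lborel)"
    by (intro nn_integral_cong) (auto split: split_indicator)
  also have "\<dots> = ennreal (r\<^sup>2)" using r by (simp add: emeasure_qbox)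
  also have "(\<integral>\<^sup>+y. (indicator (qbox r) y * ennreal (norm (f (x + y))))\<^sup>2 \<partial>lborel) = (\<integral>\<^sup>+y. indicator (qbox r) y * ennreal ((norm (f (x + y)))\<^sup>2) \<partial>lborel)"
    by (intro nn_integral_cong) (auto split: split_indicator simp: ennreal_power)
  also have "(ennreal (1 / r\<^sup>2))\<^sup>2 * (ennreal (r\<^sup>2) * (\<integral>\<^sup>+y. indicator (qbox r) y * ennreal ((norm (f (x + y)))\<^sup>2) \<partial>lborel))
     = ennreal (1 / r\<^sup>2) * (\<integral>\<^sup>+y. indicator (qbox r) y * ennreal ((norm (f (x + y)))\<^sup>2) \<partial>lborel)"
    unfolding mult.assoc[symmetric] using r by (simp add: ennreal_power ennreal_mult[symmetric] power2_eq_square)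
  finally show ?thesis .
qed

lemma nn_integral_avg_le:
  assumes [measurable]: "h \<in> borel_measurable (borel :: plane measure)" and r: "r > 0"
  shows "(\<integral>\<^sup>+x. ennreal (1 / r\<^sup>2) * (\<integral>\<^sup>+y. indicator (qbox r) y * h (x + y) \<partial>lborel) \<partial>lborel) = (\<integral>\<^sup>+x. h x \<partial>lborel)"
proof -
  have "(\<integral>\<^sup>+x. (\<integral>\<^sup>+y. indicator (qbox r) y * h (x + y) \<partial>lborel) \<partial>lborel) = (\<integral>\<^sup>+y. (\<integral>\<^sup>+x. indicator (qbox r) y * h (x + y) \<partial>lborel) \<partial>lborel)"
    by (rule lborel_pair.Fubini') measurable
  also have "\<dots> = (\<integral>\<^sup>+y. indicator (qbox r) y * (\<integral>\<^sup>+x. h x \<partial>lborel) \<partial>lborel)"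
  proof (intro nn_integral_cong)
    fix y :: "plane"
    have "(\<integral>\<^sup>+x. h (x + y) \<partial>lborel) = (\<integral>\<^sup>+x. h x \<partial>lborel)"
      using nn_integral_distr[of "(+) y" lborel borel h] by (simp add: lborel_distr_plus add.commute)
    then show "(\<integral>\<^sup>+x. indicator (qbox r) y * h (x + y) \<partial>lborel) = indicator (qbox r) y * (\<integral>\<^sup>+x. h x \<partial>lborel)"
      by (simp add: nn_integral_cmult)
  qed
  also have "\<dots> = ennreal (r\<^sup>2) * (\<integral>\<^sup>+x. h x \<partial>lborel)" using r by (simp add: nn_integral_multc emeasure_qbox)
  finally show ?thesis
    using r by (simp add: nn_integral_cmult mult.assoc[symmetric] ennreal_mult[symmetric])
qed

lemma avg_L1:
  fixes f :: "plane \<Rightarrow> 'b::{banach, second_countable_topology}"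
  assumes [measurable]: "f \<in> borel_measurable borel" and r: "r > 0"
  shows "nnL1 (avg r f) \<le> nnL1 f"
  using nn_integral_mono[of lborel "\<lambda>x. ennreal (norm (avg r f x))", OF avg_norm_le[OF assms(1), of r]]
    nn_integral_avg_le[of "\<lambda>x. ennreal (norm (f x))" r] r by simp

lemma avg_L2:
  fixes f :: "plane \<Rightarrow> 'b::{banach, second_countable_topology}"
  assumes [measurable]: "f \<in> borel_measurable borel" and r: "r > 0"
  shows "nnL2 (avg r f) \<le> nnL2 f"
  using nn_integral_mono[of lborel "\<lambda>x. ennreal ((norm (avg r f x))\<^sup>2)", OF avg_norm_sq_le[OF assms]]
    nn_integral_avg_le[of "\<lambda>x. ennreal ((norm (f x))\<^sup>2)" r] r by simp

text \<open>The first bound is the trivial one; the second comes from the antiderivative h / (2 pi s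
  i), of modulus 1 / (2 pi |s|) at both end points.\<close>

lemma cis_segment_integral:
  assumes r: "r > 0"
  shows "\<exists>I. has_bochner_integral lborel (\<lambda>y. indicator {0..r} y *\<^sub>R cis (2 * pi * (y * s))) I \<and> norm I \<le> r \<and> norm I * (pi * \<bar>s\<bar>) \<le> 1"
proof -
  define h where "h y = cis (2 * pi * (y * s))" for y
  have cont: "continuous_on S h" for S unfolding h_def by (intro continuous_intros)
  have i: "integrable lborel (\<lambda>y. indicator {0..r} y *\<^sub>R h y)"
    using borel_integrable_atLeastAtMost'[OF cont, of 0 r] by (simp add: set_integrable_def)
  define I where "I = (LINT y|lborel. indicator {0..r} y *\<^sub>R h y)"
  have "norm I \<le> (LINT y|lborel. norm (indicator {0..r} y *\<^sub>R h y))"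
    unfolding I_def by (rule Bochner_Integration.integral_norm_bound)
  also have "\<dots> = (LINT y|lborel. indicator {0..r} y)" by (simp add: h_def)
  also have "\<dots> = r" using r by simp
  finally have 1: "norm I \<le> r" .
  have 2: "norm I * (pi * \<bar>s\<bar>) \<le> 1"
  proof (cases "s = 0")
    case False
    define F where "F y = h y / (2 * pi * s * \<i>)" for y
    have "has_bochner_integral lborel (\<lambda>y. indicator {0..r} y *\<^sub>R h y) (F r - F 0)"
    proof (rule has_bochner_integral_FTC_Icc[OF _ _ cont])
      show "0 \<le> r" using r by simp
      fix y assume "0 \<le> y" "y \<le> r"
      have "(h has_vector_derivative (2 * pi * s * \<i>) * h y) (at y within {0..r})"
        using exp_scaleR_has_vector_derivative_right[of "2 * pi * s * \<i>" y "{0..r}"]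
        unfolding h_def cis_conv_exp by (simp add: scaleR_conv_of_real mult_ac)
      then have "(F has_vector_derivative ((2 * pi * s * \<i>) * h y) / (2 * pi * s * \<i>)) (at y within {0..r})"
        unfolding F_def by (rule has_vector_derivative_divide)
      then show "(F has_vector_derivative h y) (at y within {0..r})" using False by simp
    qed
    then have "I = F r - F 0" by (simp add: I_def has_bochner_integral_iff)
    then have I: "norm I \<le> norm (F r) + norm (F 0)" using norm_triangle_ineq4 by metis
    have nF: "norm (F y) = 1 / (2 * pi * \<bar>s\<bar>)" for y unfolding F_def h_def by (simp add: norm_divide norm_mult)
    show ?thesis using I False unfolding nF by (simp add: field_simps)
  qed simp
  show ?thesis
    using i 1 2 unfolding I_def h_def by (intro exI) (auto simp: has_bochner_integral_iff)
qed

text \<open>The exponential factors over the coordinates, so the multiplier is a product of two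
  segment integrals. The decay bounds norm \<xi> by the sum of the moduli of its coordinates and
  spends 2 \<le> pi; the bound near frequency 0 uses |1 - cis a| \<le> |a| and norm y \<le> 2 r on
  the square.\<close>

lemma qmult_bounds:
  assumes r: "r > 0"
  shows "norm (qmult r \<xi>) \<le> 1" "norm (qmult r \<xi>) * (r * norm \<xi>) \<le> 1" "norm (1 - qmult r \<xi>) \<le> 4 * pi * (r * norm \<xi>)"
proof -
  obtain I1 where I1: "has_bochner_integral lborel (\<lambda>y. indicator {0..r} y *\<^sub>R cis (2 * pi * (y * fst \<xi>))) I1" "norm I1 \<le> r" "norm I1 * (pi * \<bar>fst \<xi>\<bar>) \<le> 1"
    using cis_segment_integral[OF r] by blast
  obtain I2 where I2: "has_bochner_integral lborel (\<lambda>y. indicator {0..r} y *\<^sub>R cis (2 * pi * (y * snd \<xi>))) I2" "norm I2 \<le> r" "norm I2 * (pi * \<bar>snd \<xi>\<bar>) \<le> 1"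
    using cis_segment_integral[OF r] by blast
  have "(\<lambda>z. (indicator {0..r} (fst z) *\<^sub>R cis (2 * pi * (fst z * fst \<xi>))) * (indicator {0..r} (snd z) *\<^sub>R cis (2 * pi * (snd z * snd \<xi>))))
     = (\<lambda>y. indicator (qbox r) y *\<^sub>R cis (2 * pi * (y \<bullet> \<xi>)))"
    by (auto simp: fun_eq_iff qbox_def inner_prod_def cis_mult distrib_left split: split_indicator)
  then have I: "has_bochner_integral lborel (\<lambda>y. indicator (qbox r) y *\<^sub>R cis (2 * pi * (y \<bullet> \<xi>))) (I1 * I2)"
    using has_bochner_integral_pair_mult[OF I1(1) I2(1)] by simp
  then have m: "qmult r \<xi> = (1 / r\<^sup>2) *\<^sub>R (I1 * I2)" by (simp add: qmult_def has_bochner_integral_iff)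
  then have nm: "norm (qmult r \<xi>) = norm I1 * norm I2 / r\<^sup>2" by (simp add: norm_mult divide_inverse mult.commute)
  have "norm I1 * norm I2 \<le> r * r" using I1 I2 r by (intro mult_mono) auto
  then show "norm (qmult r \<xi>) \<le> 1" unfolding nm using r by (simp add: power2_eq_square divide_le_eq)
  have n: "norm \<xi> \<le> \<bar>fst \<xi>\<bar> + \<bar>snd \<xi>\<bar>" using norm_Pair_le[of "fst \<xi>" "snd \<xi>"] by simp
  have "norm I1 * norm I2 * (norm \<xi> * pi) \<le> norm I1 * norm I2 * ((\<bar>fst \<xi>\<bar> + \<bar>snd \<xi>\<bar>) * pi)"
    using n by (intro mult_left_mono mult_right_mono) auto
  also have "\<dots> = (norm I1 * (pi * \<bar>fst \<xi>\<bar>)) * norm I2 + (norm I2 * (pi * \<bar>snd \<xi>\<bar>)) * norm I1" by (simp add: algebra_simps)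
  also have "\<dots> \<le> 1 * r + 1 * r" using I1 I2 r by (intro add_mono mult_mono) auto
  also have "\<dots> \<le> r * pi" using r pi_ge_two by simp
  finally have "norm I1 * norm I2 * norm \<xi> \<le> r" by (simp add: mult.assoc[symmetric])
  then show "norm (qmult r \<xi>) * (r * norm \<xi>) \<le> 1" unfolding nm using r by (simp add: power2_eq_square field_simps)
  have "1 - qmult r \<xi> = (1 / r\<^sup>2) *\<^sub>R (LINT y|lborel. indicator (qbox r) y *\<^sub>R (1 - cis (2 * pi * (y \<bullet> \<xi>))))"
  proof -
    have i1: "integrable lborel (\<lambda>y. indicator (qbox r) y *\<^sub>R (1::complex))" by simp
    have "(LINT y|lborel. indicator (qbox r) y *\<^sub>R (1::complex) - indicator (qbox r) y *\<^sub>R cis (2 * pi * (y \<bullet> \<xi>)))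
      = (LINT y|lborel. indicator (qbox r) y *\<^sub>R (1::complex)) - I1 * I2"
      using Bochner_Integration.integral_diff[OF i1, of "\<lambda>y. indicator (qbox r) y *\<^sub>R cis (2 * pi * (y \<bullet> \<xi>))"] I by (simp add: has_bochner_integral_iff)
    moreover have "(LINT y|lborel. indicator (qbox r) y *\<^sub>R (1::complex)) = of_real (r\<^sup>2)"
      using r by (simp add: scaleR_conv_of_real)
    ultimately show ?thesis using r m by (simp only: scaleR_diff_right) (simp add: scaleR_conv_of_real)
  qed
  also have "norm \<dots> \<le> (1 / r\<^sup>2) * (LINT y|lborel. indicator (qbox r) y * (4 * pi * (r * norm \<xi>)))"
  proof -
    have "norm (LINT y|lborel. indicator (qbox r) y *\<^sub>R (1 - cis (2 * pi * (y \<bullet> \<xi>)))) \<le> (LINT y|lborel. indicator (qbox r) y * (4 * pi * (r * norm \<xi>)))"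
    proof (rule Bochner_Integration.integral_norm_bound_integral)
      show "integrable lborel (\<lambda>y. indicator (qbox r) y *\<^sub>R (1 - cis (2 * pi * (y \<bullet> \<xi>))))"
        using I by (simp add: scaleR_diff_right has_bochner_integral_iff)
      fix y
      have "norm (1 - cis (2 * pi * (y \<bullet> \<xi>))) \<le> 4 * pi * (r * norm \<xi>)" if "y \<in> qbox r"
      proof -
        have "norm (1 - cis (2 * pi * (y \<bullet> \<xi>))) \<le> \<bar>2 * pi * (y \<bullet> \<xi>)\<bar>"
          using iexp_approx1[of "2 * pi * (y \<bullet> \<xi>)" 0] by (simp add: cis_conv_exp norm_minus_commute)
        also have "\<dots> \<le> 2 * pi * (norm y * norm \<xi>)" using Cauchy_Schwarz_ineq2[of y \<xi>] by (simp add: abs_mult)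
        also have "\<dots> \<le> 2 * pi * (2 * r * norm \<xi>)"
        proof -
          have "norm y \<le> 2 * r" using that norm_Pair_le[of "fst y" "snd y"] by (auto simp: qbox_def)
          then show ?thesis by (intro mult_left_mono mult_right_mono) auto
        qed
        finally show ?thesis by simp
      qed
      then show "norm (indicator (qbox r) y *\<^sub>R (1 - cis (2 * pi * (y \<bullet> \<xi>)))) \<le> indicator (qbox r) y * (4 * pi * (r * norm \<xi>))"
        by (auto split: split_indicator)
    qed simp
    then show ?thesis using r by (simp add: field_simps)
  qed
  also have "\<dots> = 4 * pi * (r * norm \<xi>)" using r by simp
  finally show "norm (1 - qmult r \<xi>) \<le> 4 * pi * (r * norm \<xi>)" .
qed

lemma ft_add_scale:
  assumes f: "integrable lborel f" and g: "integrable lborel g"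
  shows "ft (\<lambda>x. a *\<^sub>R f x + b *\<^sub>R g x) \<xi> = a *\<^sub>R ft f \<xi> + b *\<^sub>R ft g \<xi>"
proof -
  have i: "integrable lborel (\<lambda>x. h x * cis (- 2 * pi * (x \<bullet> \<xi>)))" if h: "integrable lborel h" for h :: "plane \<Rightarrow> complex"
  proof -
    have [measurable]: "h \<in> borel_measurable borel" using h by auto
    show ?thesis by (rule Bochner_Integration.integrable_bound[OF h]) (auto simp: norm_mult)
  qed
  have "ft (\<lambda>x. a *\<^sub>R f x + b *\<^sub>R g x) \<xi>
      = (LINT x|lborel. a *\<^sub>R (f x * cis (- 2 * pi * (x \<bullet> \<xi>))) + b *\<^sub>R (g x * cis (- 2 * pi * (x \<bullet> \<xi>))))"
    unfolding ft_def by (simp add: distrib_right)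
  also have "\<dots> = a *\<^sub>R ft f \<xi> + b *\<^sub>R ft g \<xi>"
    unfolding ft_def using i[OF f] i[OF g] by (simp add: Bochner_Integration.integral_add)
  finally show ?thesis .
qed

lemma nn_integral_plancherel:
  fixes f :: "plane \<Rightarrow> complex"
  assumes [measurable]: "f \<in> borel_measurable borel" and f1: "integrable lborel f"
    and f2: "nnL2 f < \<infinity>"
  shows "nnL2 (ft f) = nnL2 f"
proof -
  have i: "integrable lborel (\<lambda>x. (norm (f x))\<^sup>2)"
    using f2 by (intro integrableI_bounded) auto
  show ?thesis unfolding plancherel_L1_L2[OF assms(1) f1 i]
    by (rule nn_integral_eq_integral[OF i, symmetric]) simp
qed

text \<open>Plancherel is at hand for integrable functions only, hence the detour through the
  truncations \<open>F n\<close>. Their transforms tend to g in L^2, and the multiplier is at most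
  \<kappa> where g does not vanish. Elsewhere it is still at most 2, and what it meets there tends
  to 0. The pairs (a, b) of interest are (1, -1) and (0, 1).\<close>

lemma multiplier_L2_bound:
  fixes f g :: "plane \<Rightarrow> complex"
  assumes [measurable]: "f \<in> borel_measurable borel" "g \<in> borel_measurable borel"
    and f2: "nnL2 f < \<infinity>"
    and lim: "(\<lambda>n. \<integral>\<^sup>+\<xi>. ennreal ((norm (ft (\<lambda>x. indicator (ball 0 (real n)) x * f x) \<xi> - g \<xi>))\<^sup>2) \<partial>lborel) \<longlonglongrightarrow> 0"
    and r: "r > 0" and ab: "\<bar>a\<bar> + \<bar>b\<bar> \<le> 2" and \<kappa>: "AE \<xi> in lborel. g \<xi> \<noteq> 0 \<longrightarrow> norm (a *\<^sub>R 1 + b *\<^sub>R qmult r \<xi>) \<le> \<kappa>"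
    and \<kappa>0: "\<kappa> \<ge> 0"
  shows "(\<integral>\<^sup>+x. ennreal ((norm (a *\<^sub>R f x + b *\<^sub>R avg r f x))\<^sup>2) \<partial>lborel) \<le> ennreal (4 * \<kappa>\<^sup>2) * nnL2 f"
proof -
  define F where "F n x = indicator (ball 0 (real n)) x * f x" for n x
  have [measurable]: "ball (0 :: plane) (real n) \<in> sets borel" for n by simp
  have [measurable]: "F n \<in> borel_measurable borel" for n unfolding F_def by measurable
  define T where "T h x = a *\<^sub>R h x + b *\<^sub>R avg r h x" for h :: "plane \<Rightarrow> complex" and x
  define m where "m \<xi> = a *\<^sub>R 1 + b *\<^sub>R qmult r \<xi>" for \<xi>
  define N where "N = nnL2 f"
  define e where "e n = (\<integral>\<^sup>+\<xi>. ennreal ((norm (ft (F n) \<xi> - g \<xi>))\<^sup>2) \<partial>lborel)" for n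
  have [measurable]: "m \<in> borel_measurable borel" unfolding m_def by measurable
  have m2: "norm (m \<xi>) \<le> 2" for \<xi>
  proof -
    have "norm (m \<xi>) \<le> \<bar>a\<bar> * 1 + \<bar>b\<bar> * norm (qmult r \<xi>)"
      unfolding m_def by (rule order_trans[OF norm_triangle_ineq]) simp
    also have "\<dots> \<le> \<bar>a\<bar> * 1 + \<bar>b\<bar> * 1" using qmult_bounds(1)[OF r] by (intro add_left_mono mult_left_mono) auto
    finally show ?thesis using ab by simp
  qed
  have FN: "nnL2 (F n) \<le> N" for n
    unfolding N_def F_def by (intro nn_integral_mono) (auto split: split_indicator)
  have F1: "integrable lborel (F n)" for n
  proof (rule Bochner_Integration.integrable_bound)
    show "integrable lborel (\<lambda>x. indicator (ball 0 (real n)) x + (norm (f x))\<^sup>2)"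
    proof (rule Bochner_Integration.integrable_add)
      show "integrable lborel (\<lambda>x. (norm (f x))\<^sup>2)" using f2 by (intro integrableI_bounded) auto
    qed (use emeasure_bounded_finite[of "ball (0 :: plane) (real n)"] in \<open>simp add: integrable_indicator_iff\<close>)
    show "AE x in lborel. norm (F n x) \<le> norm (indicator (ball 0 (real n)) x + (norm (f x))\<^sup>2)"
    proof (intro AE_I2)
      fix x
      have "norm (f x) \<le> 1 + (norm (f x))\<^sup>2"
      proof -
        have "2 * norm (f x) \<le> 1 + (norm (f x))\<^sup>2" using sum_squares_bound[of 1 "norm (f x)"] by simp
        then show ?thesis using norm_ge_zero[of "f x"] by linarith
      qed
      then show "norm (F n x) \<le> norm (indicator (ball 0 (real n)) x + (norm (f x))\<^sup>2)"
        by (auto simp: F_def abs_of_nonneg split: split_indicator)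
    qed
  qed measurable
  have aF1: "integrable lborel (avg r (F n))" for n
    using F1[of n] avg_L1[of "F n", OF _ r] by (intro integrableI_bounded) (auto simp: integrable_iff_bounded intro: le_less_trans)
  have TF1: "integrable lborel (T (F n))" for n
    unfolding T_def using F1 aF1 by auto
  have TF2: "(\<integral>\<^sup>+x. ennreal ((norm (T (F n) x))\<^sup>2) \<partial>lborel) < \<infinity>" for n
  proof -
    have "(\<integral>\<^sup>+x. ennreal ((norm (T (F n) x))\<^sup>2) \<partial>lborel) \<le> (\<integral>\<^sup>+x. ennreal (2 * a\<^sup>2) * ennreal ((norm (F n x))\<^sup>2) + ennreal (2 * b\<^sup>2) * ennreal ((norm (avg r (F n) x))\<^sup>2) \<partial>lborel)"
    proof (intro nn_integral_mono)
      fix x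
      have "(norm (T (F n) x))\<^sup>2 \<le> 2 * a\<^sup>2 * (norm (F n x))\<^sup>2 + 2 * b\<^sup>2 * (norm (avg r (F n) x))\<^sup>2"
        using norm_sq_add_le[of "a *\<^sub>R F n x" "b *\<^sub>R avg r (F n) x"] by (simp add: T_def power_mult_distrib)
      then show "ennreal ((norm (T (F n) x))\<^sup>2) \<le> ennreal (2 * a\<^sup>2) * ennreal ((norm (F n x))\<^sup>2) + ennreal (2 * b\<^sup>2) * ennreal ((norm (avg r (F n) x))\<^sup>2)"
        by (simp add: ennreal_mult[symmetric] ennreal_plus[symmetric] ennreal_leI del: ennreal_plus)
    qed
    also have "\<dots> = ennreal (2 * a\<^sup>2) * nnL2 (F n) + ennreal (2 * b\<^sup>2) * (\<integral>\<^sup>+x. ennreal ((norm (avg r (F n) x))\<^sup>2) \<partial>lborel)"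
      by (simp add: nn_integral_add nn_integral_cmult)
    also have "\<dots> \<le> ennreal (2 * a\<^sup>2) * N + ennreal (2 * b\<^sup>2) * N"
      using FN avg_L2[of "F n", OF _ r] by (intro add_mono mult_left_mono) (auto intro: order_trans)
    also have "\<dots> < \<infinity>" using f2 by (simp add: N_def ennreal_mult_less_top)
    finally show ?thesis .
  qed
  have main: "(\<integral>\<^sup>+x. ennreal ((norm (T (F n) x))\<^sup>2) \<partial>lborel) \<le> ennreal (8 + 4 * \<kappa>\<^sup>2) * e n + ennreal (4 * \<kappa>\<^sup>2) * N" for n
  proof -
    have "(\<integral>\<^sup>+x. ennreal ((norm (T (F n) x))\<^sup>2) \<partial>lborel) = (\<integral>\<^sup>+\<xi>. ennreal ((norm (ft (T (F n)) \<xi>))\<^sup>2) \<partial>lborel)"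
      by (rule nn_integral_plancherel[OF _ TF1 TF2, symmetric]) (unfold T_def, measurable)
    also have "\<dots> \<le> (\<integral>\<^sup>+\<xi>. ennreal (8 + 4 * \<kappa>\<^sup>2) * ennreal ((norm (ft (F n) \<xi> - g \<xi>))\<^sup>2) + ennreal (4 * \<kappa>\<^sup>2) * ennreal ((norm (ft (F n) \<xi>))\<^sup>2) \<partial>lborel)"
    proof (rule nn_integral_mono_AE)
      show "AE \<xi> in lborel. ennreal ((norm (ft (T (F n)) \<xi>))\<^sup>2) \<le> ennreal (8 + 4 * \<kappa>\<^sup>2) * ennreal ((norm (ft (F n) \<xi> - g \<xi>))\<^sup>2) + ennreal (4 * \<kappa>\<^sup>2) * ennreal ((norm (ft (F n) \<xi>))\<^sup>2)"
        using \<kappa>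
      proof (rule AE_mp, intro AE_I2 impI)
        fix \<xi> assume k: "g \<xi> \<noteq> 0 \<longrightarrow> norm (a *\<^sub>R 1 + b *\<^sub>R qmult r \<xi>) \<le> \<kappa>"
        \<comment> \<open>The multiplier is bounded by 2 on the difference to g and by \<kappa> on
          g. Afterwards g is traded back for the transform of \<open>F n\<close>, whose norm
          Plancherel gives.\<close>
        have e1: "ft (T (F n)) \<xi> = m \<xi> * (ft (F n) \<xi> - g \<xi>) + m \<xi> * g \<xi>"
          unfolding T_def ft_add_scale[OF F1 aF1] ft_avg[OF F1] m_def by (simp add: algebra_simps scaleR_conv_of_real)
        have mg: "norm (m \<xi> * g \<xi>) \<le> \<kappa> * norm (g \<xi>)"
          using k by (cases "g \<xi> = 0") (auto simp: norm_mult m_def intro: mult_right_mono)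
        have mf: "norm (m \<xi> * (ft (F n) \<xi> - g \<xi>)) \<le> 2 * norm (ft (F n) \<xi> - g \<xi>)"
          using m2[of \<xi>] by (auto simp: norm_mult intro: mult_right_mono)
        have "(norm (ft (T (F n)) \<xi>))\<^sup>2 \<le> 2 * (norm (m \<xi> * (ft (F n) \<xi> - g \<xi>)))\<^sup>2 + 2 * (norm (m \<xi> * g \<xi>))\<^sup>2"
          unfolding e1 by (rule norm_sq_add_le)
        also have "\<dots> \<le> 2 * (2 * norm (ft (F n) \<xi> - g \<xi>))\<^sup>2 + 2 * (\<kappa> * norm (g \<xi>))\<^sup>2"
          using mg mf by (intro add_mono mult_left_mono power_mono) auto
        also have "\<dots> = 8 * (norm (ft (F n) \<xi> - g \<xi>))\<^sup>2 + 2 * \<kappa>\<^sup>2 * (norm ((g \<xi> - ft (F n) \<xi>) + ft (F n) \<xi>))\<^sup>2"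
          by (simp add: power_mult_distrib)
        also have "\<dots> \<le> 8 * (norm (ft (F n) \<xi> - g \<xi>))\<^sup>2 + 2 * \<kappa>\<^sup>2 * (2 * (norm (g \<xi> - ft (F n) \<xi>))\<^sup>2 + 2 * (norm (ft (F n) \<xi>))\<^sup>2)"
          by (intro add_left_mono mult_left_mono norm_sq_add_le) auto
        also have "\<dots> = (8 + 4 * \<kappa>\<^sup>2) * (norm (ft (F n) \<xi> - g \<xi>))\<^sup>2 + 4 * \<kappa>\<^sup>2 * (norm (ft (F n) \<xi>))\<^sup>2"
          by (simp add: norm_minus_commute algebra_simps)
        finally have le: "(norm (ft (T (F n)) \<xi>))\<^sup>2 \<le> (8 + 4 * \<kappa>\<^sup>2) * (norm (ft (F n) \<xi> - g \<xi>))\<^sup>2 + 4 * \<kappa>\<^sup>2 * (norm (ft (F n) \<xi>))\<^sup>2" .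
        have E: "ennreal (8 + 4 * \<kappa>\<^sup>2) * ennreal ((norm (ft (F n) \<xi> - g \<xi>))\<^sup>2) + ennreal (4 * \<kappa>\<^sup>2) * ennreal ((norm (ft (F n) \<xi>))\<^sup>2)
          = ennreal ((8 + 4 * \<kappa>\<^sup>2) * (norm (ft (F n) \<xi> - g \<xi>))\<^sup>2 + 4 * \<kappa>\<^sup>2 * (norm (ft (F n) \<xi>))\<^sup>2)"
          by (subst ennreal_mult[symmetric], simp, simp, subst ennreal_mult[symmetric], simp, simp, subst ennreal_plus[symmetric], simp_all)
        show "ennreal ((norm (ft (T (F n)) \<xi>))\<^sup>2) \<le> ennreal (8 + 4 * \<kappa>\<^sup>2) * ennreal ((norm (ft (F n) \<xi> - g \<xi>))\<^sup>2) + ennreal (4 * \<kappa>\<^sup>2) * ennreal ((norm (ft (F n) \<xi>))\<^sup>2)"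
          unfolding E by (rule ennreal_leI[OF le])
      qed
    qed
    also have "\<dots> = ennreal (8 + 4 * \<kappa>\<^sup>2) * e n + ennreal (4 * \<kappa>\<^sup>2) * (\<integral>\<^sup>+\<xi>. ennreal ((norm (ft (F n) \<xi>))\<^sup>2) \<partial>lborel)"
      unfolding e_def by (subst nn_integral_add) (auto simp: nn_integral_cmult)
    also have "(\<integral>\<^sup>+\<xi>. ennreal ((norm (ft (F n) \<xi>))\<^sup>2) \<partial>lborel) = nnL2 (F n)"
      by (rule nn_integral_plancherel[OF _ F1]) (use FN[of n] f2 in \<open>auto simp: N_def intro: le_less_trans\<close>)
    finally show ?thesis using FN[of n] by (auto elim!: order_trans intro!: add_left_mono mult_left_mono)
  qed
  \<comment> \<open>The operator has range at most 2 r, so at a given x the truncation is invisible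
    as soon as n exceeds norm x + 2 r. Fatou's lemma then carries the bounds for \<open>F n\<close>
    over to f.\<close>
  have ev: "eventually (\<lambda>n. T (F n) x = T f x) sequentially" for x
  proof -
    obtain K :: nat where K: "real K > norm x + 2 * r" using reals_Archimedean2 by blast
    have "T (F n) x = T f x" if "n \<ge> K" for n
    proof -
      have in_ball: "x + y \<in> ball 0 (real n)" if "y \<in> qbox r" for y
      proof -
        have "norm y \<le> 2 * r" using that norm_Pair_le[of "fst y" "snd y"] by (auto simp: qbox_def)
        then have "norm (x + y) \<le> norm x + 2 * r" by (intro order_trans[OF norm_triangle_ineq] add_left_mono)
        then show ?thesis using K \<open>n \<ge> K\<close> by simp
      qed
      have "0 \<in> qbox r" using r by (simp add: qbox_def zero_prod_def)
      then have "F n x = f x" using in_ball[of 0] by (simp add: F_def del: mem_ball mem_ball_0)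
      moreover have "avg r (F n) x = avg r f x"
        unfolding avg_def using in_ball
        by (intro arg_cong[where f="\<lambda>z. (1 / r\<^sup>2) *\<^sub>R z"] Bochner_Integration.integral_cong refl)
           (auto simp: F_def split: split_indicator)
      ultimately show ?thesis by (simp add: T_def)
    qed
    then show ?thesis by (auto simp: eventually_sequentially)
  qed
  have "nnL2 (T f) = (\<integral>\<^sup>+x. liminf (\<lambda>n. ennreal ((norm (T (F n) x))\<^sup>2)) \<partial>lborel)"
  proof (intro nn_integral_cong)
    fix x
    have "(\<lambda>n. ennreal ((norm (T (F n) x))\<^sup>2)) \<longlonglongrightarrow> ennreal ((norm (T f x))\<^sup>2)"
      using ev[of x] by (intro tendsto_eventually) (auto elim: eventually_mono)
    then show "ennreal ((norm (T f x))\<^sup>2) = liminf (\<lambda>n. ennreal ((norm (T (F n) x))\<^sup>2))"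
      by (rule lim_imp_Liminf[OF trivial_limit_sequentially, symmetric])
  qed
  also have "\<dots> \<le> liminf (\<lambda>n. \<integral>\<^sup>+x. ennreal ((norm (T (F n) x))\<^sup>2) \<partial>lborel)"
    by (rule nn_integral_liminf) (unfold T_def, measurable)
  also have "\<dots> \<le> liminf (\<lambda>n. ennreal (8 + 4 * \<kappa>\<^sup>2) * e n + ennreal (4 * \<kappa>\<^sup>2) * N)"
    by (intro Liminf_mono always_eventually allI main)
  also have "\<dots> = ennreal (4 * \<kappa>\<^sup>2) * N"
  proof -
    have "(\<lambda>n. ennreal (8 + 4 * \<kappa>\<^sup>2) * e n + ennreal (4 * \<kappa>\<^sup>2) * N) \<longlonglongrightarrow> ennreal (8 + 4 * \<kappa>\<^sup>2) * 0 + ennreal (4 * \<kappa>\<^sup>2) * N"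
      using lim unfolding e_def F_def by (intro tendsto_add ennreal_tendsto_cmult tendsto_const) auto
    then show ?thesis by (simp add: lim_imp_Liminf)
  qed
  finally show ?thesis unfolding T_def N_def .
qed

section \<open>Borel representatives and the frequency support\<close>

lemma lebesgue_borel_representative:
  fixes f :: "plane \<Rightarrow> complex"
  assumes f: "f \<in> borel_measurable lebesgue"
  obtains f' where "f' \<in> borel_measurable borel" "AE x in lborel. f x = f' x"
proof -
  have "(\<lambda>x. Re (f x)) \<in> borel_measurable (completion lborel)" "(\<lambda>x. Im (f x)) \<in> borel_measurable (completion lborel)"
    using f by auto
  then obtain a b where a: "a \<in> borel_measurable lborel" "AE x in lborel. Re (f x) = a x"
    and b: "b \<in> borel_measurable lborel" "AE x in lborel. Im (f x) = b x"
    using completion_ex_borel_measurable_real by blast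
  show thesis
  proof (rule that)
    show "(\<lambda>x. Complex (a x) (b x)) \<in> borel_measurable borel"
      using a b by (simp add: borel_measurable_complex_iff)
    show "AE x in lborel. f x = Complex (a x) (b x)"
      using a(2) b(2) by eventually_elim (simp add: complex_eq_iff)
  qed
qed

lemma L2_borel_representative:
  assumes f: "f \<in> L2"
  obtains f' where "f' \<in> borel_measurable borel" "AE x in lborel. f x = f' x"
    "nnL2 f' = ennreal ((L2_norm f)\<^sup>2)"
proof -
  have fm: "f \<in> borel_measurable lebesgue" and fi: "integrable lebesgue (\<lambda>x. (norm (f x))\<^sup>2)"
    using f by (auto simp: L2_def)
  obtain f' where f': "f' \<in> borel_measurable borel" "AE x in lborel. f x = f' x"
    using lebesgue_borel_representative[OF fm] by blast
  have "nnL2 f' = nnL2 f"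
    using f'(2) by (intro nn_integral_cong_AE) (auto elim: eventually_mono)
  also have "\<dots> = (\<integral>\<^sup>+x. ennreal ((norm (f x))\<^sup>2) \<partial>lebesgue)" by (simp add: nn_integral_completion)
  also have "\<dots> = ennreal (LINT x|lebesgue. (norm (f x))\<^sup>2)"
    using fi by (intro nn_integral_eq_integral) auto
  also have "\<dots> = ennreal ((L2_norm f)\<^sup>2)"
    unfolding L2_norm_def by (subst real_sqrt_pow2) (auto intro: Bochner_Integration.integral_nonneg)
  finally show thesis using f' that by blast
qed

text \<open>The complement of the support is a union of possibly uncountably many open sets on which
  g vanishes almost everywhere; by the Lindelof property countably many of them suffice.\<close>

lemma AE_outside_ess_support:
  "AE \<xi> in lborel. g \<xi> \<noteq> 0 \<longrightarrow> \<xi> \<in> ess_support g"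
proof -
  define F where "F = {U. open U \<and> (AE \<xi> in lebesgue. \<xi> \<in> U \<longrightarrow> g \<xi> = 0)}"
  obtain F' where F': "F' \<subseteq> F" "countable F'" "\<Union>F' = \<Union>F"
    using Lindelof[of F] unfolding F_def by blast
  have "AE \<xi> in lebesgue. \<forall>U\<in>F'. \<xi> \<in> U \<longrightarrow> g \<xi> = 0"
    using F' by (subst AE_ball_countable) (auto simp: F_def)
  then have "AE \<xi> in lborel. \<forall>U\<in>F'. \<xi> \<in> U \<longrightarrow> g \<xi> = 0"
    by (simp add: AE_completion_iff)
  then show ?thesis
  proof (rule AE_mp, intro AE_I2 impI)
    fix \<xi> assume *: "\<forall>U\<in>F'. \<xi> \<in> U \<longrightarrow> g \<xi> = 0" "g \<xi> \<noteq> 0"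
    then have "\<xi> \<notin> \<Union>F'" by blast
    then show "\<xi> \<in> ess_support g" using F'(3) by (auto simp: ess_support_def F_def)
  qed
qed

text \<open>All that the rest of the proof uses of the frequency condition. At scales far below 1 /
  \<open>lam\<close> the function almost equals its mean, by the outer radius of the annulus; at
  scales far above, the mean almost vanishes, by the inner radius.\<close>

proposition annulus_frequency_bounds:
  assumes ft: "has_fourier_transform f g" and supp: "ess_support g \<subseteq> ball 0 (2 * lam) - ball 0 lam" and lam: "lam > 0"
    and f'[measurable]: "f' \<in> borel_measurable borel" and ff': "AE x in lborel. f x = f' x"
    and r: "r > 0"
  shows "(\<integral>\<^sup>+x. ennreal ((norm (f' x - avg r f' x))\<^sup>2) \<partial>lborel) \<le> ennreal (4 * (8 * pi * (r * lam))\<^sup>2) * nnL2 f'"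
    and "nnL2 (avg r f') \<le> ennreal (4 * (1 / (r * lam))\<^sup>2) * nnL2 f'"
proof -
  have fL: "f \<in> L2" and gL: "g \<in> L2"
    and lim: "(\<lambda>n. \<integral>\<^sup>+ \<xi>. ennreal ((norm (fourier_L1 (\<lambda>x. indicator (ball 0 (real n)) x * f x) \<xi> - g \<xi>))\<^sup>2) \<partial>lebesgue) \<longlonglongrightarrow> 0"
    using ft by (auto simp: has_fourier_transform_def)
  have [measurable]: "f \<in> borel_measurable lebesgue" using fL by (auto simp: L2_def)
  have [measurable]: "f' \<in> borel_measurable lebesgue" using measurable_completion[of f' lborel borel] f' by simp
  have [measurable]: "ball (0 :: plane) (real n) \<in> sets borel" for n by simp
  obtain g' where g'[measurable]: "g' \<in> borel_measurable borel" and gg': "AE x in lborel. g x = g' x"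
    using lebesgue_borel_representative[of g] gL by (auto simp: L2_def)
  have "nnL2 f' = (\<integral>\<^sup>+x. ennreal ((norm (f x))\<^sup>2) \<partial>lebesgue)"
    unfolding nn_integral_completion using ff' by (intro nn_integral_cong_AE) (auto elim: eventually_mono)
  also have "\<dots> < \<infinity>" using fL by (auto simp: L2_def integrable_iff_bounded)
  finally have fin: "nnL2 f' < \<infinity>" .
  have fteq: "fourier_L1 (\<lambda>x. indicator (ball 0 (real n)) x * f x) \<xi> = ft (\<lambda>x. indicator (ball 0 (real n)) x * f' x) \<xi>" for n \<xi>
  proof -
    let ?h = "\<lambda>f x. indicator (ball 0 (real n)) x * f x * cis (- 2 * pi * (x \<bullet> \<xi>)) :: complex"
    have m': "?h f' \<in> borel_measurable lborel" by measurable
    have "(\<lambda>x. indicator (ball 0 (real n)) x * cis (- 2 * pi * (x \<bullet> \<xi>)) :: complex) \<in> borel_measurable lborel" by measurable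
    then have "(\<lambda>x. (indicator (ball 0 (real n)) x * cis (- 2 * pi * (x \<bullet> \<xi>)) :: complex) * f x) \<in> borel_measurable lebesgue"
      by (rule borel_measurable_times[OF measurable_completion \<open>f \<in> borel_measurable lebesgue\<close>])
    then have ml: "?h f \<in> borel_measurable lebesgue" by (simp add: mult_ac)
    have "AE x in lebesgue. ?h f x = ?h f' x"
      using AE_completion[OF ff'] by eventually_elim simp
    moreover have m'l: "?h f' \<in> borel_measurable lebesgue" using measurable_completion[OF m'] by simp
    ultimately have "integral\<^sup>L lebesgue (?h f) = integral\<^sup>L lebesgue (?h f')"
      using ml by (intro integral_cong_AE)
    also have "\<dots> = integral\<^sup>L lborel (?h f')" by (rule integral_completion[OF m'])
    finally show ?thesis by (simp add: fourier_L1_def ft_def)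
  qed
  have lim': "(\<lambda>n. \<integral>\<^sup>+ \<xi>. ennreal ((norm (ft (\<lambda>x. indicator (ball 0 (real n)) x * f' x) \<xi> - g' \<xi>))\<^sup>2) \<partial>lborel) \<longlonglongrightarrow> 0"
  proof -
    have "(\<integral>\<^sup>+ \<xi>. ennreal ((norm (fourier_L1 (\<lambda>x. indicator (ball 0 (real n)) x * f x) \<xi> - g \<xi>))\<^sup>2) \<partial>lebesgue)
      = (\<integral>\<^sup>+ \<xi>. ennreal ((norm (ft (\<lambda>x. indicator (ball 0 (real n)) x * f' x) \<xi> - g' \<xi>))\<^sup>2) \<partial>lborel)" for n
      unfolding nn_integral_completion fteq using gg' by (intro nn_integral_cong_AE) (auto elim: eventually_mono)
    then show ?thesis using lim by simp
  qed
  have ann: "AE \<xi> in lborel. g' \<xi> \<noteq> 0 \<longrightarrow> lam \<le> norm \<xi> \<and> norm \<xi> \<le> 2 * lam"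
    using AE_outside_ess_support[of g] gg'
    by eventually_elim (use supp in \<open>force\<close>)
  have "(\<integral>\<^sup>+x. ennreal ((norm (1 *\<^sub>R f' x + (-1) *\<^sub>R avg r f' x))\<^sup>2) \<partial>lborel) \<le> ennreal (4 * (8 * pi * (r * lam))\<^sup>2) * nnL2 f'"
  proof (rule multiplier_L2_bound[OF f' g' fin lim' r])
    show "AE \<xi> in lborel. g' \<xi> \<noteq> 0 \<longrightarrow> norm (1 *\<^sub>R 1 + (-1) *\<^sub>R qmult r \<xi>) \<le> 8 * pi * (r * lam)"
      using ann
    proof eventually_elim
      case (elim \<xi>)
      have "4 * pi * (r * norm \<xi>) \<le> 4 * pi * (r * (2 * lam))" if "norm \<xi> \<le> 2 * lam"
        using r that by (intro mult_left_mono) auto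
      then have "norm (1 - qmult r \<xi>) \<le> 8 * pi * (r * lam)" if "norm \<xi> \<le> 2 * lam"
        using order_trans[OF qmult_bounds(3)[OF r, of \<xi>]] that by (simp add: mult_ac)
      then show ?case using elim by simp
    qed
  qed (use r lam in auto)
  then show "(\<integral>\<^sup>+x. ennreal ((norm (f' x - avg r f' x))\<^sup>2) \<partial>lborel) \<le> ennreal (4 * (8 * pi * (r * lam))\<^sup>2) * nnL2 f'"
    by simp
  have "(\<integral>\<^sup>+x. ennreal ((norm (0 *\<^sub>R f' x + 1 *\<^sub>R avg r f' x))\<^sup>2) \<partial>lborel) \<le> ennreal (4 * (1 / (r * lam))\<^sup>2) * nnL2 f'"
  proof (rule multiplier_L2_bound[OF f' g' fin lim' r])
    show "AE \<xi> in lborel. g' \<xi> \<noteq> 0 \<longrightarrow> norm (0 *\<^sub>R 1 + 1 *\<^sub>R qmult r \<xi>) \<le> 1 / (r * lam)"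
      using ann
    proof eventually_elim
      case (elim \<xi>)
      have "norm (qmult r \<xi>) * (r * lam) \<le> norm (qmult r \<xi>) * (r * norm \<xi>)" if "lam \<le> norm \<xi>"
        using r that by (intro mult_left_mono) auto
      then show ?case using qmult_bounds(2)[OF r, of \<xi>] elim r lam by (auto simp: pos_le_divide_eq)
    qed
  qed (use r lam in auto)
  then show "nnL2 (avg r f') \<le> ennreal (4 * (1 / (r * lam))\<^sup>2) * nnL2 f'"
    by simp
qed

section \<open>The four-point configuration\<close>

text \<open>A matrix is the pair of its rows; the norm of the product type is then the Frobenius
  norm.\<close>

type_synonym mat = "plane \<times> plane"

definition mv :: "mat \<Rightarrow> plane \<Rightarrow> plane" where
  "mv M v = (fst M \<bullet> v, snd M \<bullet> v)"

text \<open>The adjugate. It stands in for the inverse, so that solutions stay polynomial and a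
  single division by one determinant is left for the end.\<close>

definition adj :: "mat \<Rightarrow> mat" where
  "adj M = ((snd (snd M), - snd (fst M)), (- fst (snd M), fst (fst M)))"

definition det2 :: "mat \<Rightarrow> real" where
  "det2 M = fst (fst M) * snd (snd M) - snd (fst M) * fst (snd M)"

definition mm :: "mat \<Rightarrow> mat \<Rightarrow> mat" where
  "mm M N = ((fst (fst M) * fst (fst N) + snd (fst M) * fst (snd N), fst (fst M) * snd (fst N) + snd (fst M) * snd (snd N)),
             (fst (snd M) * fst (fst N) + snd (snd M) * fst (snd N), fst (snd M) * snd (fst N) + snd (snd M) * snd (snd N)))"

lemma mv_simps:
  "mv (M + N) v = mv M v + mv N v" "mv (M - N) v = mv M v - mv N v" "mv (c *\<^sub>R M) v = c *\<^sub>R mv M v"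
  "mv M (v + w) = mv M v + mv M w" "mv M (v - w) = mv M v - mv M w" "mv M (c *\<^sub>R v) = c *\<^sub>R mv M v"
  "mv M (- v) = - mv M v" "mv M 0 = 0"
  by (simp_all add: mv_def inner_add_left inner_diff_left inner_add_right inner_diff_right prod_eq_iff)

lemma mv_mm: "mv (mm M N) v = mv M (mv N v)"
  by (simp add: mv_def mm_def inner_prod_def algebra_simps)

lemma mv_adj: "mv M (mv (adj M) v) = det2 M *\<^sub>R v"
  by (simp add: mv_def adj_def det2_def inner_prod_def prod_eq_iff algebra_simps)

lemma norm_mv: "norm (mv M v) \<le> norm M * norm v"
proof -
  have "(norm (mv M v))\<^sup>2 = (fst M \<bullet> v)\<^sup>2 + (snd M \<bullet> v)\<^sup>2" by (simp add: mv_def norm_prod_def)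
  also have "\<dots> \<le> (norm (fst M) * norm v)\<^sup>2 + (norm (snd M) * norm v)\<^sup>2"
    by (intro add_mono) (metis Cauchy_Schwarz_ineq2 abs_ge_zero power2_abs power_mono)+
  also have "\<dots> = (norm M * norm v)\<^sup>2" by (simp add: power_mult_distrib norm_prod_def distrib_right)
  finally show ?thesis by (rule power2_le_imp_le) simp
qed

lemma norm_adj: "norm (adj M) = norm M"
  by (simp add: adj_def norm_prod_def algebra_simps)

lemma abs_det2: "\<bar>det2 M\<bar> \<le> (norm M)\<^sup>2"
proof -
  have "(norm M)\<^sup>2 = (fst (fst M))\<^sup>2 + (snd (fst M))\<^sup>2 + ((fst (snd M))\<^sup>2 + (snd (snd M))\<^sup>2)"
    by (simp add: norm_prod_def)
  moreover have "\<bar>p * s - q * r\<bar> \<le> p\<^sup>2 + q\<^sup>2 + (r\<^sup>2 + s\<^sup>2)" for p q r s :: real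
  proof -
    have "0 \<le> (p + s)\<^sup>2 + (q - r)\<^sup>2" "0 \<le> (p - s)\<^sup>2 + (q + r)\<^sup>2" "0 \<le> p\<^sup>2 + q\<^sup>2 + (r\<^sup>2 + s\<^sup>2)" by simp_all
    then show ?thesis unfolding abs_le_iff by (simp add: power2_eq_square algebra_simps)
  qed
  ultimately show ?thesis unfolding det2_def by (metis (no_types, opaque_lifting))
qed

text \<open>The Jacobian matrix of \<open>power_sum_map\<close>.\<close>

definition DP :: "plane \<Rightarrow> mat" where
  "DP t = ((2 * fst t, 2 * snd t), (3 * (fst t)\<^sup>2, 3 * (snd t)\<^sup>2))"

text \<open>The matrix of \<open>aniso_dilation R\<close> for u = 1/R.\<close>

definition Bmat :: "real \<Rightarrow> mat" where "Bmat u = ((u, 0), (0, u\<^sup>2))"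

text \<open>A Schur complement of the system in \<open>four_point_solution\<close>. Take dt' to be a
  multiple of a vector v and eliminate dx, ds and dt by the second, fourth and first equation; the
  third then contains this matrix applied to v, once the denominators \<open>det2 A\<close> and
  \<open>det2 (C' - B)\<close> are cleared.\<close>

definition pencil :: "mat \<Rightarrow> mat \<Rightarrow> mat \<Rightarrow> mat \<Rightarrow> mat \<Rightarrow> mat" where
  "pencil A A' C C' B = det2 A *\<^sub>R mm (C - B) (mm (adj (C' - B)) (C' - A')) + (det2 A * det2 (C' - B)) *\<^sub>R A'
      - det2 (C' - B) *\<^sub>R mm C (mm (adj A) A')"

text \<open>Cramer's rule for the linear system that moves the first of the four points by \<open>a\<close> and fixes the other three.\<close>

lemma four_point_solution:
  fixes A A' C C' B :: mat and L :: real
  assumes nz: "det2 A * det2 (pencil A A' C C' B) \<noteq> 0"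
    and L: "norm A \<le> L" "norm A' \<le> L" "norm C \<le> L" "norm C' \<le> L" "norm B \<le> L" "1 \<le> L"
  obtains dx dt dt' ds where
    "dx + mv A dt = a" "dx + mv A' dt' = 0" "dx - mv B ds + mv C (dt + ds) = 0" "dx - mv B ds + mv C' (dt' + ds) = 0"
    "norm dx \<le> 400 * L ^ 12 * norm a / \<bar>det2 A * det2 (pencil A A' C C' B)\<bar>"
    "norm dt \<le> 400 * L ^ 12 * norm a / \<bar>det2 A * det2 (pencil A A' C C' B)\<bar>"
    "norm dt' \<le> 400 * L ^ 12 * norm a / \<bar>det2 A * det2 (pencil A A' C C' B)\<bar>"
    "norm ds \<le> 400 * L ^ 12 * norm a / \<bar>det2 A * det2 (pencil A A' C C' B)\<bar>"
proof -
  define \<alpha> \<beta> N where "\<alpha> = det2 A" and "\<beta> = det2 (C' - B)" and "N = pencil A A' C C' B"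
  define J where "J = \<alpha> * det2 N"
  have J0: "J \<noteq> 0" using nz by (simp add: J_def \<alpha>_def N_def)
  \<comment> \<open>The common denominator J is factored out of the solution. For given w, the
    second, fourth and first equation yield X and T', then S, then T; the third becomes N w = - det2
    N b, which the adjugate of N solves.\<close>
  define b where "b = mv C (mv (adj A) a)"
  define w where "w = - mv (adj N) b"
  have Nv: "mv N v = \<alpha> *\<^sub>R mv (C - B) (mv (adj (C' - B)) (mv (C' - A') v)) + (\<alpha> * \<beta>) *\<^sub>R mv A' v - \<beta> *\<^sub>R mv C (mv (adj A) (mv A' v))" for v
    by (simp add: N_def pencil_def mv_simps(1,2,3) mv_mm \<alpha>_def \<beta>_def del: mv_simps)
       (simp only: mv_simps(1,2,3) mv_mm)
  have Nw: "mv N w = - (det2 N *\<^sub>R b)" by (simp add: w_def mv_simps mv_adj)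
  define X where "X = (\<alpha> * \<beta>) *\<^sub>R mv A' w"
  define T where "T = mv (adj A) (det2 N *\<^sub>R a - \<beta> *\<^sub>R mv A' w)"
  define T' where "T' = - ((\<alpha> * \<beta>) *\<^sub>R w)"
  define S where "S = \<alpha> *\<^sub>R mv (adj (C' - B)) (mv (C' - A') w)"
  have e1: "X + mv A T = J *\<^sub>R a"
    by (simp add: X_def T_def mv_adj \<alpha>_def[symmetric] J_def algebra_simps)
  have e2: "X + mv A' T' = 0" by (simp add: X_def T'_def mv_simps)
  have e3: "X - mv B S + mv C (T + S) = 0"
  proof -
    have "X - mv B S + mv C (T + S) = X + mv (C - B) S + mv C T" by (simp add: mv_simps)
    also have "\<dots> = mv N w + det2 N *\<^sub>R b"
      unfolding Nv by (simp add: X_def T_def S_def b_def mv_simps)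
    finally show ?thesis by (simp add: Nw)
  qed
  have e4: "X - mv B S + mv C' (T' + S) = 0"
  proof -
    have "X - mv B S + mv C' (T' + S) = X + mv (C' - B) S + mv C' T'" by (simp add: mv_simps)
    also have "mv (C' - B) S = (\<alpha> * \<beta>) *\<^sub>R mv (C' - A') w" unfolding S_def by (simp only: mv_simps(6) mv_adj \<beta>_def scaleR_scaleR)
    finally show ?thesis by (simp add: X_def T'_def mv_simps scaleR_diff_right)
  qed
  have L0: "0 \<le> L" using L by simp
  have d: "norm (C - B) \<le> 2 * L" "norm (C' - B) \<le> 2 * L" "norm (C' - A') \<le> 2 * L"
    using norm_triangle_ineq4[of C B] norm_triangle_ineq4[of C' B] norm_triangle_ineq4[of C' A'] L by auto
  have mvb: "norm (mv M v) \<le> p * q" if "norm M \<le> p" "norm v \<le> q" for M v p q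
    by (rule order_trans[OF norm_mv]) (use that in \<open>auto intro!: mult_mono intro: order_trans[OF norm_ge_zero]\<close>)
  have adjb: "norm (mv (adj M) v) \<le> p * q" if "norm M \<le> p" "norm v \<le> q" for M v p q
    using mvb[of "adj M" p v q] that by (simp add: norm_adj)
  have scb: "norm (c *\<^sub>R v) \<le> p * q" if "\<bar>c\<bar> \<le> p" "norm v \<le> q" for c p q and v :: "plane"
    using that by (auto intro!: mult_mono intro: order_trans[OF norm_ge_zero] order_trans[OF abs_ge_zero])
  have \<alpha>: "\<bar>\<alpha>\<bar> \<le> L\<^sup>2" unfolding \<alpha>_def using order_trans[OF abs_det2[of A] power_mono[OF L(1) norm_ge_zero, of 2]] .
  have \<beta>: "\<bar>\<beta>\<bar> \<le> 4 * L\<^sup>2" unfolding \<beta>_def using order_trans[OF abs_det2[of "C' - B"] power_mono[OF d(2) norm_ge_zero, of 2]] by (simp add: power_mult_distrib)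
  have mmb: "norm (mm M M') \<le> p * q" if "norm M \<le> p" "norm M' \<le> q" for M M' p q
  proof -
    have "(norm (mm M M'))\<^sup>2 \<le> (norm M * norm M')\<^sup>2"
    proof -
      define r1 r2 c1 c2 where "r1 = fst M" "r2 = snd M" "c1 = (fst (fst M'), fst (snd M'))" "c2 = (snd (fst M'), snd (snd M'))"
      note defs = this
      have "(norm (mm M M'))\<^sup>2 = (r1 \<bullet> c1)\<^sup>2 + (r1 \<bullet> c2)\<^sup>2 + ((r2 \<bullet> c1)\<^sup>2 + (r2 \<bullet> c2)\<^sup>2)"
        by (simp add: mm_def norm_prod_def inner_prod_def defs)
      also have "\<dots> \<le> (norm r1 * norm c1)\<^sup>2 + (norm r1 * norm c2)\<^sup>2 + ((norm r2 * norm c1)\<^sup>2 + (norm r2 * norm c2)\<^sup>2)"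
        by (intro add_mono) (metis Cauchy_Schwarz_ineq2 abs_ge_zero power2_abs power_mono)+
      also have "\<dots> = ((norm r1)\<^sup>2 + (norm r2)\<^sup>2) * ((norm c1)\<^sup>2 + (norm c2)\<^sup>2)" by (simp add: power_mult_distrib algebra_simps)
      also have "\<dots> = (norm M * norm M')\<^sup>2"
        by (simp add: power_mult_distrib norm_prod_def defs algebra_simps)
      finally show ?thesis .
    qed
    then have "norm (mm M M') \<le> norm M * norm M'" by (rule power2_le_imp_le) simp
    also have "\<dots> \<le> p * q" using that by (auto intro!: mult_mono intro: order_trans[OF norm_ge_zero])
    finally show ?thesis .
  qed
  have N: "norm N \<le> 16 * L ^ 5"
  proof -
    have 1: "norm (\<alpha> *\<^sub>R mm (C - B) (mm (adj (C' - B)) (C' - A'))) \<le> L\<^sup>2 * ((2 * L) * ((2 * L) * (2 * L)))"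
      unfolding norm_scaleR using \<alpha> d by (intro mult_mono mmb) (auto simp: norm_adj)
    have 2: "norm ((\<alpha> * \<beta>) *\<^sub>R A') \<le> (L\<^sup>2 * (4 * L\<^sup>2)) * L"
      unfolding norm_scaleR abs_mult using \<alpha> \<beta> L by (intro mult_mono) auto
    have 3: "norm (\<beta> *\<^sub>R mm C (mm (adj A) A')) \<le> (4 * L\<^sup>2) * (L * (L * L))"
      unfolding norm_scaleR using \<beta> L by (intro mult_mono mmb) (auto simp: norm_adj)
    have "norm N \<le> L\<^sup>2 * ((2 * L) * ((2 * L) * (2 * L))) + (L\<^sup>2 * (4 * L\<^sup>2)) * L + (4 * L\<^sup>2) * (L * (L * L))"
      unfolding N_def pencil_def \<alpha>_def[symmetric] \<beta>_def[symmetric]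
      by (intro order_trans[OF norm_triangle_ineq4] order_trans[OF norm_triangle_ineq] add_mono 1 2 3)
    also have "\<dots> = 16 * L ^ 5" by (simp add: power_numeral_reduce eval_nat_numeral)
    finally show ?thesis .
  qed
  have dN: "\<bar>det2 N\<bar> \<le> 256 * L ^ 10"
    using abs_det2[of N] power_mono[OF N, of 2] by (simp add: power_mult_distrib)
  have b: "norm b \<le> L * (L * norm a)" unfolding b_def by (intro mvb adjb L order_refl)
  have w: "norm w \<le> 16 * L ^ 5 * (L * (L * norm a))" unfolding w_def norm_minus_cancel by (intro adjb N b)
  \<comment> \<open>The four components come out at most 64 or 320 times a power of L with exponent
    11 or 12; 400 and 12 are common bounds, as L \<ge> 1.\<close>
  have up: "c * L ^ k * norm a \<le> 400 * L ^ 12 * norm a" if "k \<le> 12" "0 \<le> c" "c \<le> 400" for c k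
    using that L by (intro mult_right_mono mult_mono power_increasing) auto
  have X: "norm X \<le> 400 * L ^ 12 * norm a"
  proof -
    have "norm X \<le> (L\<^sup>2 * (4 * L\<^sup>2)) * (L * (16 * L ^ 5 * (L * (L * norm a))))"
      unfolding X_def by (intro scb mvb L w) (use \<alpha> \<beta> in \<open>auto simp: abs_mult intro: mult_mono\<close>)
    also have "\<dots> = 64 * L ^ 12 * norm a" by (simp add: eval_nat_numeral)
    finally show ?thesis by (rule order_trans[OF _ up]) simp_all
  qed
  have T': "norm T' \<le> 400 * L ^ 12 * norm a"
  proof -
    have "norm T' \<le> (L\<^sup>2 * (4 * L\<^sup>2)) * (16 * L ^ 5 * (L * (L * norm a)))"
      unfolding T'_def norm_minus_cancel by (intro scb w) (use \<alpha> \<beta> in \<open>auto simp: abs_mult intro: mult_mono\<close>)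
    also have "\<dots> = 64 * L ^ 11 * norm a" by (simp add: eval_nat_numeral)
    finally show ?thesis by (rule order_trans[OF _ up]) simp_all
  qed
  have S: "norm S \<le> 400 * L ^ 12 * norm a"
  proof -
    have "norm S \<le> L\<^sup>2 * ((2 * L) * ((2 * L) * (16 * L ^ 5 * (L * (L * norm a)))))"
      unfolding S_def by (intro scb mvb adjb \<alpha> d w)
    also have "\<dots> = 64 * L ^ 11 * norm a" by (simp add: eval_nat_numeral)
    finally show ?thesis by (rule order_trans[OF _ up]) simp_all
  qed
  have T: "norm T \<le> 400 * L ^ 12 * norm a"
  proof -
    have "norm T \<le> L * (256 * L ^ 10 * norm a + (4 * L\<^sup>2) * (L * (16 * L ^ 5 * (L * (L * norm a)))))"
      unfolding T_def by (intro adjb L order_trans[OF norm_triangle_ineq4] add_mono scb mvb w \<beta> dN order_refl)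
    also have "\<dots> = 320 * L ^ 11 * norm a" by (simp add: eval_nat_numeral algebra_simps)
    finally show ?thesis by (rule order_trans[OF _ up]) simp_all
  qed
  show thesis
  proof (rule that[of "(1/J) *\<^sub>R X" "(1/J) *\<^sub>R T" "(1/J) *\<^sub>R T'" "(1/J) *\<^sub>R S"])
    show "(1/J) *\<^sub>R X + mv A ((1/J) *\<^sub>R T) = a"
      using arg_cong[OF e1, of "\<lambda>v. (1/J) *\<^sub>R v"] J0 by (simp add: mv_simps scaleR_add_right)
    show "(1/J) *\<^sub>R X + mv A' ((1/J) *\<^sub>R T') = 0"
      using arg_cong[OF e2, of "\<lambda>v. (1/J) *\<^sub>R v"] by (simp add: mv_simps scaleR_add_right)
    show "(1/J) *\<^sub>R X - mv B ((1/J) *\<^sub>R S) + mv C ((1/J) *\<^sub>R T + (1/J) *\<^sub>R S) = 0"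
      using arg_cong[OF e3, of "\<lambda>v. (1/J) *\<^sub>R v"] by (simp add: mv_simps scaleR_add_right scaleR_diff_right)
    show "(1/J) *\<^sub>R X - mv B ((1/J) *\<^sub>R S) + mv C' ((1/J) *\<^sub>R T' + (1/J) *\<^sub>R S) = 0"
      using arg_cong[OF e4, of "\<lambda>v. (1/J) *\<^sub>R v"] by (simp add: mv_simps scaleR_add_right scaleR_diff_right)
    have dv: "norm ((1/J) *\<^sub>R Y) \<le> 400 * L ^ 12 * norm a / \<bar>det2 A * det2 (pencil A A' C C' B)\<bar>" if "norm Y \<le> 400 * L ^ 12 * norm a" for Y :: "plane"
      using divide_right_mono[OF that, of "\<bar>J\<bar>"] by (simp add: J_def \<alpha>_def N_def)
    show "norm ((1/J) *\<^sub>R X) \<le> 400 * L ^ 12 * norm a / \<bar>det2 A * det2 (pencil A A' C C' B)\<bar>" by (rule dv[OF X])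
    show "norm ((1/J) *\<^sub>R T) \<le> 400 * L ^ 12 * norm a / \<bar>det2 A * det2 (pencil A A' C C' B)\<bar>" by (rule dv[OF T])
    show "norm ((1/J) *\<^sub>R T') \<le> 400 * L ^ 12 * norm a / \<bar>det2 A * det2 (pencil A A' C C' B)\<bar>" by (rule dv[OF T'])
    show "norm ((1/J) *\<^sub>R S) \<le> 400 * L ^ 12 * norm a / \<bar>det2 A * det2 (pencil A A' C C' B)\<bar>" by (rule dv[OF S])
  qed
qed

section \<open>The Jacobian determinant of a configuration\<close>

text \<open>A point ((x, t), (t', s)) of R^8: a base point x, two parameters t and t', and a common
  increment s of both.\<close>

type_synonym quad = "(plane \<times> plane) \<times> (plane \<times> plane)"

text \<open>The denominator in \<open>four_point_solution\<close> when A, A', C, C' are the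
  derivatives of P at t, t', t + s, t' + s.\<close>

definition quad_jac :: "real \<Rightarrow> quad \<Rightarrow> real" where
  "quad_jac u z = (case z of ((x, t), (t', s)) \<Rightarrow>
     det2 (DP t) * det2 (pencil (DP t) (DP t') (DP (t + s)) (DP (t' + s)) (Bmat u)))"

definition polymat :: "nat \<Rightarrow> (real \<Rightarrow> mat) \<Rightarrow> bool" where
  "polymat d M \<longleftrightarrow> polyfun d (\<lambda>r. fst (fst (M r))) \<and> polyfun d (\<lambda>r. snd (fst (M r))) \<and>
     polyfun d (\<lambda>r. fst (snd (M r))) \<and> polyfun d (\<lambda>r. snd (snd (M r)))"

lemma polyfun_add': "polyfun d f \<Longrightarrow> polyfun d g \<Longrightarrow> polyfun d (\<lambda>x. f x + g x)"
  using polyfun_add[of d f d g] by simp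

lemma polyfun_diff': "polyfun d f \<Longrightarrow> polyfun d g \<Longrightarrow> polyfun d (\<lambda>x. f x - g x)"
  using polyfun_diff[of d f d g] by simp

lemma polyfun_const': "polyfun d (\<lambda>_. c)" using polyfun_const polyfun_mono by blast

lemma polyfun_cmult: "polyfun d f \<Longrightarrow> polyfun d (\<lambda>x. c * f x)"
  using polyfun_mult[OF polyfun_const[of c], of d f] by simp

lemma polyfun_uminus: "polyfun d f \<Longrightarrow> polyfun d (\<lambda>x. - f x)"
  using polyfun_cmult[of d f "-1"] by simp

lemma polymat_add: "polymat d M \<Longrightarrow> polymat d N \<Longrightarrow> polymat d (\<lambda>r. M r + N r)"
  by (auto simp: polymat_def intro: polyfun_add')

lemma polymat_diff: "polymat d M \<Longrightarrow> polymat d N \<Longrightarrow> polymat d (\<lambda>r. M r - N r)"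
  by (auto simp: polymat_def intro: polyfun_diff')

lemma polymat_scale: "polyfun a f \<Longrightarrow> polymat b M \<Longrightarrow> polymat (a + b) (\<lambda>r. f r *\<^sub>R M r)"
  by (auto simp: polymat_def intro: polyfun_mult)

lemma polymat_mm: "polymat a M \<Longrightarrow> polymat b N \<Longrightarrow> polymat (a + b) (\<lambda>r. mm (M r) (N r))"
  by (auto simp: polymat_def mm_def intro!: polyfun_add' polyfun_mult)

lemma polymat_adj: "polymat a M \<Longrightarrow> polymat a (\<lambda>r. adj (M r))"
  by (auto simp: polymat_def adj_def intro!: polyfun_uminus)

lemma polyfun_det2: "polymat a M \<Longrightarrow> polyfun (a + a) (\<lambda>r. det2 (M r))"
  by (auto simp: polymat_def det2_def intro!: polyfun_diff' polyfun_mult)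

lemma polymat_const: "polymat d (\<lambda>_. M)"
  by (auto simp: polymat_def polyfun_const')

lemma polyfun_affine: "polyfun 1 (\<lambda>r. a + r * b)"
  by (rule polyfun_add'[OF polyfun_const']) (use polyfun_mult[OF polyfun_ident polyfun_const[of b]] in simp)

lemma polymat_DP: 
  assumes "polyfun 1 (\<lambda>r. fst (t r))" "polyfun 1 (\<lambda>r. snd (t r))"
  shows "polymat 2 (\<lambda>r. DP (t r))"
proof -
  have "polyfun 2 (\<lambda>r. c * fst (t r))" "polyfun 2 (\<lambda>r. c * snd (t r))" for c
    using assms by (auto intro!: polyfun_cmult intro: polyfun_mono)
  moreover have "polyfun 2 (\<lambda>r. c * (fst (t r))\<^sup>2)" "polyfun 2 (\<lambda>r. c * (snd (t r))\<^sup>2)" for c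
    using polyfun_power[OF assms(1), of 2] polyfun_power[OF assms(2), of 2] by (auto intro!: polyfun_cmult)
  ultimately show ?thesis by (simp add: polymat_def DP_def)
qed

text \<open>The entries of \<open>DP\<close> are quadratic, so \<open>pencil\<close> has degree at
  most 10 and its determinant at most 20; with \<open>det2 (DP t)\<close> this makes 24, rounded up
  to 32.\<close>

lemma quad_jac_polyfun: "polyfun 32 (\<lambda>r. quad_jac u (z + r *\<^sub>R v))"
proof -
  obtain x t t' s where z: "z = ((x, t), (t', s))" by (metis prod.exhaust)
  obtain x1 t1 t1' s1 where v: "v = ((x1, t1), (t1', s1))" by (metis prod.exhaust)
  have aff: "polyfun 1 (\<lambda>r. fst (a + r *\<^sub>R b))" "polyfun 1 (\<lambda>r. snd (a + r *\<^sub>R b))" for a b :: "plane"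
    using polyfun_affine by auto
  have A: "polymat 2 (\<lambda>r. DP (t + r *\<^sub>R t1))" and A': "polymat 2 (\<lambda>r. DP (t' + r *\<^sub>R t1'))"
    by (intro polymat_DP aff)+
  have C: "polymat 2 (\<lambda>r. DP ((t + r *\<^sub>R t1) + (s + r *\<^sub>R s1)))" and C': "polymat 2 (\<lambda>r. DP ((t' + r *\<^sub>R t1') + (s + r *\<^sub>R s1)))"
    by (intro polymat_DP; unfold fst_add[of "_ + _"] snd_add[of "_ + _"]; intro polyfun_add' aff)+
  note B = polymat_const[of 2 "Bmat u"]
  note CB = polymat_diff[OF C B] and CB' = polymat_diff[OF C' B]
  have "polymat (4 + (2 + (2 + 2))) (\<lambda>r. det2 (DP (t + r *\<^sub>R t1)) *\<^sub>R mm (DP ((t + r *\<^sub>R t1) + (s + r *\<^sub>R s1)) - Bmat u)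
      (mm (adj (DP ((t' + r *\<^sub>R t1') + (s + r *\<^sub>R s1)) - Bmat u)) (DP ((t' + r *\<^sub>R t1') + (s + r *\<^sub>R s1)) - DP (t' + r *\<^sub>R t1'))))"
    using polyfun_det2[OF A] by (intro polymat_scale polymat_mm polymat_adj CB CB' polymat_diff C' A') simp
  moreover have "polymat ((4 + 4) + 2) (\<lambda>r. (det2 (DP (t + r *\<^sub>R t1)) * det2 (DP ((t' + r *\<^sub>R t1') + (s + r *\<^sub>R s1)) - Bmat u)) *\<^sub>R DP (t' + r *\<^sub>R t1'))"
    using polyfun_det2[OF A] polyfun_det2[OF CB'] by (intro polymat_scale polyfun_mult A') simp_all
  moreover have "polymat (4 + (2 + (2 + 2))) (\<lambda>r. det2 (DP ((t' + r *\<^sub>R t1') + (s + r *\<^sub>R s1)) - Bmat u) *\<^sub>R mm (DP ((t + r *\<^sub>R t1) + (s + r *\<^sub>R s1)))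
      (mm (adj (DP (t + r *\<^sub>R t1))) (DP (t' + r *\<^sub>R t1'))))"
    using polyfun_det2[OF CB'] by (intro polymat_scale polymat_mm polymat_adj C A A') simp
  ultimately have "polymat 10 (\<lambda>r. pencil (DP (t + r *\<^sub>R t1)) (DP (t' + r *\<^sub>R t1')) (DP ((t + r *\<^sub>R t1) + (s + r *\<^sub>R s1))) (DP ((t' + r *\<^sub>R t1') + (s + r *\<^sub>R s1))) (Bmat u))"
    unfolding pencil_def by (intro polymat_add polymat_diff) simp_all
  from polyfun_mult[OF polyfun_det2[OF A] polyfun_det2[OF this]] show ?thesis
    unfolding z v by (auto simp: quad_jac_def intro: polyfun_mono)
qed

text \<open>Chosen so that \<open>quad_jac\<close> becomes, up to sign, a polynomial in u with
  positive coefficients and is thus bounded below for all u \<ge> 0 at once. The sublevel estimate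
  only asks that this point lie within bounded distance of the configurations that occur.\<close>

definition quad_base :: quad where "quad_base = ((0, (-1, 1)), ((-1, -1), (-1, 0)))"

lemma quad_jac_base: "0 \<le> u \<Longrightarrow> \<bar>quad_jac u quad_base\<bar> \<ge> 1"
proof -
  assume u: "0 \<le> u"
  have "quad_jac u quad_base = - 12 * (746496 + 373248 * u + 108864 * u^2 + 248832 * u^3 + 46656 * u^4)"
    unfolding quad_jac_def quad_base_def pencil_def
    by (simp add: DP_def Bmat_def mm_def adj_def det2_def) (simp add: algebra_simps eval_nat_numeral)
  moreover have "746496 + 373248 * u + 108864 * u^2 + 248832 * u^3 + 46656 * u^4 \<ge> 746496" using u by simp
  ultimately show ?thesis by (simp add: abs_mult)
qed

lemma quad_jac_continuous: "continuous_on UNIV (quad_jac u)"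
  unfolding quad_jac_def case_prod_unfold pencil_def mm_def adj_def det2_def DP_def Bmat_def
  by (intro continuous_intros)

section \<open>The four points and their first-order displacement\<close>

definition Bu :: "real \<Rightarrow> plane \<Rightarrow> plane" where "Bu u t = (u * fst t, u\<^sup>2 * snd t)"

text \<open>The arguments of F that remain after two applications of the Cauchy-Schwarz inequality.
  The first pairs t with t + s while x + B t is held fixed, which moves x by - B s; the second
  doubles t into t'.\<close>

definition pt1 :: "quad \<Rightarrow> plane" where "pt1 z = fst (fst z) + power_sum_map (snd (fst z))"
definition pt2 :: "real \<Rightarrow> quad \<Rightarrow> plane" where
  "pt2 u z = fst (fst z) - Bu u (snd (snd z)) + power_sum_map (snd (fst z) + snd (snd z))"
definition pt3 :: "quad \<Rightarrow> plane" where "pt3 z = fst (fst z) + power_sum_map (fst (snd z))"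
definition pt4 :: "real \<Rightarrow> quad \<Rightarrow> plane" where
  "pt4 u z = fst (fst z) - Bu u (snd (snd z)) + power_sum_map (fst (snd z) + snd (snd z))"

text \<open>Linearised at t and not at t + y, so that one increment w can serve all y in a
  neighbourhood, at the price of a term norm y times norm w. The coordinates have degree at most 3,
  so the remainder is explicit.\<close>

lemma power_sum_map_taylor:
  assumes t: "norm t \<le> 30" and y: "norm y \<le> 4" and w: "norm w \<le> 4"
  shows "norm (power_sum_map (t + y + w) - power_sum_map (t + y) - mv (DP t) w) \<le> 1000 * (norm y + norm w) * norm w"
proof -
  have sq: "\<bar>(a + y + w)\<^sup>2 - (a + y)\<^sup>2 - 2 * a * w\<bar> \<le> 2 * (p + q) * q"
    if "\<bar>y\<bar> \<le> p" "\<bar>w\<bar> \<le> q" for a y w p q :: real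
  proof -
    have "\<bar>(a + y + w)\<^sup>2 - (a + y)\<^sup>2 - 2 * a * w\<bar> = \<bar>2 * y + w\<bar> * \<bar>w\<bar>"
      unfolding abs_mult[symmetric] by (simp add: power2_eq_square algebra_simps)
    also have "\<dots> \<le> (2 * (p + q)) * q" using that by (intro mult_mono) auto
    finally show ?thesis .
  qed
  have cu: "\<bar>(a + y + w) ^ 3 - (a + y) ^ 3 - 3 * a\<^sup>2 * w\<bar> \<le> 200 * (p + q) * q"
    if "\<bar>a\<bar> \<le> 30" "\<bar>y\<bar> \<le> p" "\<bar>w\<bar> \<le> q" "p \<le> 4" "q \<le> 4" for a y w p q :: real
  proof -
    have p0: "0 \<le> p" "0 \<le> q" using that by auto
    have "(a + y + w) ^ 3 - (a + y) ^ 3 - 3 * a\<^sup>2 * w = (6 * a * y + 3 * y * y + 3 * a * w + 3 * y * w + w * w) * w"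
      by (simp add: eval_nat_numeral algebra_simps)
    moreover have "\<bar>6 * a * y + 3 * y * y + 3 * a * w + 3 * y * w + w * w\<bar> \<le> 200 * (p + q)"
    proof -
      have "\<bar>6 * a * y\<bar> \<le> 180 * p" "\<bar>3 * a * w\<bar> \<le> 90 * q"
        using that p0 mult_mono[of "\<bar>a\<bar>" 30 "\<bar>y\<bar>" p] mult_mono[of "\<bar>a\<bar>" 30 "\<bar>w\<bar>" q] by (auto simp: abs_mult)
      moreover have "\<bar>3 * y * y\<bar> \<le> 12 * p" "\<bar>3 * y * w\<bar> \<le> 12 * q" "\<bar>w * w\<bar> \<le> 4 * q"
        using that p0 mult_mono[of "\<bar>y\<bar>" 4 "\<bar>y\<bar>" p] mult_mono[of "\<bar>y\<bar>" 4 "\<bar>w\<bar>" q] mult_mono[of "\<bar>w\<bar>" 4 "\<bar>w\<bar>" q] by (auto simp: abs_mult mult_ac)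
      ultimately show ?thesis using p0 unfolding distrib_left by linarith
    qed
    ultimately show ?thesis using that p0 by (simp only: abs_mult) (intro mult_mono, auto)
  qed
  define p q where "p = norm y" and "q = norm w"
  have p0: "p \<ge> 0" "q \<ge> 0" by (auto simp: p_def q_def)
  have c: "\<bar>fst t\<bar> \<le> 30" "\<bar>snd t\<bar> \<le> 30" "\<bar>fst y\<bar> \<le> p" "\<bar>snd y\<bar> \<le> p" "\<bar>fst w\<bar> \<le> q" "\<bar>snd w\<bar> \<le> q" "p \<le> 4" "q \<le> 4"
    using norm_fst_le[of "fst t" "snd t"] norm_snd_le[of "snd t" "fst t"] norm_fst_le[of "fst y" "snd y"] norm_snd_le[of "snd y" "fst y"]
      norm_fst_le[of "fst w" "snd w"] norm_snd_le[of "snd w" "fst w"] t y w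
    by (auto simp: p_def q_def)
  have "norm (power_sum_map (t + y + w) - power_sum_map (t + y) - mv (DP t) w)
     \<le> \<bar>((fst t + fst y + fst w)\<^sup>2 - (fst t + fst y)\<^sup>2 - 2 * fst t * fst w) + ((snd t + snd y + snd w)\<^sup>2 - (snd t + snd y)\<^sup>2 - 2 * snd t * snd w)\<bar>
     + \<bar>((fst t + fst y + fst w) ^ 3 - (fst t + fst y) ^ 3 - 3 * (fst t)\<^sup>2 * fst w) + ((snd t + snd y + snd w) ^ 3 - (snd t + snd y) ^ 3 - 3 * (snd t)\<^sup>2 * snd w)\<bar>"
  proof -
    have e: "power_sum_map (t + y + w) - power_sum_map (t + y) - mv (DP t) w =
      (((fst t + fst y + fst w)\<^sup>2 - (fst t + fst y)\<^sup>2 - 2 * fst t * fst w) + ((snd t + snd y + snd w)\<^sup>2 - (snd t + snd y)\<^sup>2 - 2 * snd t * snd w),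
       ((fst t + fst y + fst w) ^ 3 - (fst t + fst y) ^ 3 - 3 * (fst t)\<^sup>2 * fst w) + ((snd t + snd y + snd w) ^ 3 - (snd t + snd y) ^ 3 - 3 * (snd t)\<^sup>2 * snd w))"
      by (simp add: power_sum_map_def mv_def DP_def inner_prod_def)
    show ?thesis unfolding e by (rule order_trans[OF norm_Pair_le]) simp
  qed
  also have "\<dots> \<le> (2 * (p + q) * q + 2 * (p + q) * q) + (200 * (p + q) * q + 200 * (p + q) * q)"
    by (intro add_mono order_trans[OF abs_triangle_ineq] sq cu c)
  also have "\<dots> = 404 * ((p + q) * q)" by (simp add: algebra_simps)
  also have "\<dots> \<le> 1000 * (p + q) * q" unfolding mult.assoc using p0 by (intro mult_right_mono) auto
  finally show ?thesis by (simp add: p_def q_def)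
qed

lemma Bu_mv: "Bu u t = mv (Bmat u) t" by (simp add: Bu_def mv_def Bmat_def inner_prod_def)

lemma norm_quad_parts:
  assumes "norm (((x, t), (t', s)) :: quad) \<le> c"
  shows "norm x \<le> c" "norm t \<le> c" "norm t' \<le> c" "norm s \<le> c"
  using assms norm_fst_le[of "(x,t)" "(t',s)"] norm_snd_le[of "(t',s)" "(x,t)"] norm_fst_le[of x t] norm_snd_le[of t x]
    norm_fst_le[of t' s] norm_snd_le[of s t'] by linarith+

lemma norm_quad_le: "norm (((x, t), (t', s)) :: quad) \<le> norm x + norm t + norm t' + norm s"
  using norm_Pair_le[of "(x,t)" "(t',s)"] norm_Pair_le[of x t] norm_Pair_le[of t' s] by linarith

lemma norm_DP: "norm t \<le> c \<Longrightarrow> 1 \<le> c \<Longrightarrow> norm (DP t) \<le> 10 * c\<^sup>2"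
proof -
  assume t: "norm t \<le> c" and c: "1 \<le> c"
  have f: "\<bar>fst t\<bar> \<le> c" "\<bar>snd t\<bar> \<le> c" using t norm_fst_le[of "fst t" "snd t"] norm_snd_le[of "snd t" "fst t"] by auto
  have cc: "c \<le> c\<^sup>2" using c by (simp add: power2_eq_square)
  have "norm (DP t) \<le> (\<bar>2 * fst t\<bar> + \<bar>2 * snd t\<bar>) + (\<bar>3 * (fst t)\<^sup>2\<bar> + \<bar>3 * (snd t)\<^sup>2\<bar>)"
    unfolding DP_def by (rule order_trans[OF norm_Pair_le], intro add_mono) (rule order_trans[OF norm_Pair_le], simp)+
  also have "\<dots> \<le> (2 * c + 2 * c) + (3 * c\<^sup>2 + 3 * c\<^sup>2)"
    using f power_mono[OF f(1) abs_ge_zero, of 2] power_mono[OF f(2) abs_ge_zero, of 2] by (intro add_mono) auto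
  also have "\<dots> \<le> 10 * c\<^sup>2" using cc by simp
  finally show ?thesis .
qed

text \<open>The vector w solves the linear system at z alone and is then used at every z + y. There
  the first point moves by a and the others stay, up to Taylor remainders of second order.\<close>

lemma shift_first_point:
  obtains K where "K \<ge> (1::real)"
    "\<And>u z a. 0 \<le> u \<Longrightarrow> u \<le> 1 \<Longrightarrow> norm z \<le> 12 \<Longrightarrow> quad_jac u z \<noteq> 0 \<Longrightarrow>
      \<exists>w. norm w \<le> K * norm a / \<bar>quad_jac u z\<bar> \<and>
       (\<forall>y. norm y \<le> 2 \<and> norm w \<le> 2 \<longrightarrow>
         norm (pt1 (z + y + w) - (pt1 (z + y) + a)) \<le> K * (norm y + norm w) * norm w \<and>
         norm (pt2 u (z + y + w) - pt2 u (z + y)) \<le> K * (norm y + norm w) * norm w \<and>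
         norm (pt3 (z + y + w) - pt3 (z + y)) \<le> K * (norm y + norm w) * norm w \<and>
         norm (pt4 u (z + y + w) - pt4 u (z + y)) \<le> K * (norm y + norm w) * norm w)"
proof -
  \<comment> \<open>Four components, each at most 400 L^12 norm a / |J| with L = 10000; this L
    bounds \<open>DP\<close> on the ball of radius 24, where t + s and t' + s lie.\<close>
  define K :: real where "K = 1600 * 10000 ^ 12"
  have K1: "K \<ge> 4000" by (simp add: K_def)
  have "\<exists>w. norm w \<le> K * norm a / \<bar>quad_jac u z\<bar> \<and>
       (\<forall>y. norm y \<le> 2 \<and> norm w \<le> 2 \<longrightarrow>
         norm (pt1 (z + y + w) - (pt1 (z + y) + a)) \<le> K * (norm y + norm w) * norm w \<and>
         norm (pt2 u (z + y + w) - pt2 u (z + y)) \<le> K * (norm y + norm w) * norm w \<and>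
         norm (pt3 (z + y + w) - pt3 (z + y)) \<le> K * (norm y + norm w) * norm w \<and>
         norm (pt4 u (z + y + w) - pt4 u (z + y)) \<le> K * (norm y + norm w) * norm w)"
    if u: "0 \<le> u" "u \<le> 1" and z: "norm z \<le> 12" and J: "quad_jac u z \<noteq> 0" for u z a
  proof -
    obtain x t t' s where zz: "z = ((x, t), (t', s))" by (metis prod.exhaust)
    note zn = norm_quad_parts[OF z[unfolded zz]]
    have ts: "norm (t + s) \<le> 24" "norm (t' + s) \<le> 24" using zn norm_triangle_ineq[of t s] norm_triangle_ineq[of t' s] by linarith+
    have DPb: "norm (DP v) \<le> 10000" if "norm v \<le> 24" for v using norm_DP[OF that] by simp
    have Bb: "norm (Bmat u) \<le> 10000"
    proof -
      have "norm (Bmat u) \<le> norm (u, 0::real) + norm (0::real, u\<^sup>2)" unfolding Bmat_def by (rule norm_Pair_le)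
      also have "\<dots> = u + u\<^sup>2" using u by (simp add: norm_Pair1 norm_Pair2)
      also have "u\<^sup>2 \<le> 1" using u by (simp add: power_le_one)
      finally show ?thesis using u by simp
    qed
    have J': "quad_jac u z = det2 (DP t) * det2 (pencil (DP t) (DP t') (DP (t + s)) (DP (t' + s)) (Bmat u))"
      by (simp add: quad_jac_def zz)
    obtain dx dt dt' ds where eq:
      "dx + mv (DP t) dt = a" "dx + mv (DP t') dt' = 0" "dx - mv (Bmat u) ds + mv (DP (t + s)) (dt + ds) = 0" "dx - mv (Bmat u) ds + mv (DP (t' + s)) (dt' + ds) = 0"
      and b: "norm dx \<le> 400 * 10000 ^ 12 * norm a / \<bar>quad_jac u z\<bar>" "norm dt \<le> 400 * 10000 ^ 12 * norm a / \<bar>quad_jac u z\<bar>"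
        "norm dt' \<le> 400 * 10000 ^ 12 * norm a / \<bar>quad_jac u z\<bar>" "norm ds \<le> 400 * 10000 ^ 12 * norm a / \<bar>quad_jac u z\<bar>"
    proof (rule four_point_solution[of "DP t" "DP t'" "DP (t + s)" "DP (t' + s)" "Bmat u" 10000 a])
      show "det2 (DP t) * det2 (pencil (DP t) (DP t') (DP (t + s)) (DP (t' + s)) (Bmat u)) \<noteq> 0" using J J' by simp
    qed (use DPb ts zn Bb J' in \<open>auto intro: that\<close>)
    define w :: quad where "w = ((dx, dt), (dt', ds))"
    have "norm w \<le> norm dx + norm dt + norm dt' + norm ds" unfolding w_def by (rule norm_quad_le)
    also have "\<dots> \<le> 4 * (400 * 10000 ^ 12 * norm a / \<bar>quad_jac u z\<bar>)" using b by linarith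
    also have "\<dots> = K * norm a / \<bar>quad_jac u z\<bar>" by (simp add: K_def)
    finally have wb: "norm w \<le> K * norm a / \<bar>quad_jac u z\<bar>" .
    have "norm (pt1 (z + y + w) - (pt1 (z + y) + a)) \<le> K * (norm y + norm w) * norm w \<and>
         norm (pt2 u (z + y + w) - pt2 u (z + y)) \<le> K * (norm y + norm w) * norm w \<and>
         norm (pt3 (z + y + w) - pt3 (z + y)) \<le> K * (norm y + norm w) * norm w \<and>
         norm (pt4 u (z + y + w) - pt4 u (z + y)) \<le> K * (norm y + norm w) * norm w"
      if y: "norm y \<le> 2" and w2: "norm w \<le> 2" for y
    proof -
      obtain y1 y2 y3 y4 where yy: "y = ((y1, y2), (y3, y4))" by (metis prod.exhaust)
      note yn = norm_quad_parts[OF order_refl, where x=y1 and t=y2 and t'=y3 and s=y4, folded yy]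
      note wn = norm_quad_parts[OF order_refl, where x=dx and t=dt and t'=dt' and s=ds, folded w_def]
      have main: "norm (power_sum_map (v + p + q) - power_sum_map (v + p) - mv (DP v) q) \<le> K * (norm y + norm w) * norm w"
        if "norm v \<le> 24" "norm p \<le> 2 * norm y" "norm q \<le> 2 * norm w" for v p q
      proof -
        have "norm (power_sum_map (v + p + q) - power_sum_map (v + p) - mv (DP v) q) \<le> 1000 * (norm p + norm q) * norm q"
          using that y w2 by (intro power_sum_map_taylor) auto
        also have "\<dots> \<le> 1000 * (2 * norm y + 2 * norm w) * (2 * norm w)"
          using that by (intro mult_mono) auto
        also have "\<dots> = 4000 * ((norm y + norm w) * norm w)" by (simp add: algebra_simps)
        also have "\<dots> \<le> K * ((norm y + norm w) * norm w)" using K1 by (intro mult_right_mono) auto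
        finally show ?thesis by (simp add: mult.assoc)
      qed
      have ys: "norm y2 \<le> 2 * norm y" "norm y3 \<le> 2 * norm y" "norm dt \<le> 2 * norm w" "norm dt' \<le> 2 * norm w" "norm (y2 + y4) \<le> 2 * norm y" "norm (y3 + y4) \<le> 2 * norm y" "norm (dt + ds) \<le> 2 * norm w" "norm (dt' + ds) \<le> 2 * norm w"
        using yn wn norm_ge_zero[of y] norm_ge_zero[of w] norm_triangle_ineq[of y2 y4] norm_triangle_ineq[of y3 y4] norm_triangle_ineq[of dt ds] norm_triangle_ineq[of dt' ds] by linarith+
      \<comment> \<open>The linear equations cancel the first-order terms, and what is left is the
        Taylor remainder at t, t', t + s and t' + s respectively.\<close>
      have "pt1 (z + y + w) - (pt1 (z + y) + a) = power_sum_map (t + y2 + dt) - power_sum_map (t + y2) - mv (DP t) dt"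
        by (simp add: pt1_def zz yy w_def eq(1)[symmetric] algebra_simps)
      moreover have "pt3 (z + y + w) - pt3 (z + y) = power_sum_map (t' + y3 + dt') - power_sum_map (t' + y3) - mv (DP t') dt' + (dx + mv (DP t') dt')"
        by (simp add: pt3_def zz yy w_def algebra_simps)
      moreover have "pt2 u (z + y + w) - pt2 u (z + y) = power_sum_map ((t + s) + (y2 + y4) + (dt + ds)) - power_sum_map ((t + s) + (y2 + y4)) - mv (DP (t + s)) (dt + ds)
          + (dx - mv (Bmat u) ds + mv (DP (t + s)) (dt + ds))"
        by (simp add: pt2_def zz yy w_def Bu_mv mv_simps algebra_simps)
      moreover have "pt4 u (z + y + w) - pt4 u (z + y) = power_sum_map ((t' + s) + (y3 + y4) + (dt' + ds)) - power_sum_map ((t' + s) + (y3 + y4)) - mv (DP (t' + s)) (dt' + ds)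
          + (dx - mv (Bmat u) ds + mv (DP (t' + s)) (dt' + ds))"
        by (simp add: pt4_def zz yy w_def Bu_mv mv_simps algebra_simps)
      ultimately show ?thesis
        using main[of t y2 dt] main[of t' y3 dt'] main[of "t + s" "y2 + y4" "dt + ds"] main[of "t' + s" "y3 + y4" "dt' + ds"]
          zn yn wn ys ts unfolding eq by simp
    qed
    with wb show ?thesis by blast
  qed
  with K1 show thesis by (intro that[of K]) auto
qed

section \<open>Localisation and averaging over configurations\<close>

lemma integrable_continuous_bounded_support:
  fixes f :: "'a::euclidean_space \<Rightarrow> 'b::{banach, second_countable_topology}"
  assumes c: "continuous_on UNIV f" and s: "\<And>x. norm x > r \<Longrightarrow> f x = 0"
  shows "integrable lborel f"
proof -
  have "integrable lborel (\<lambda>x. indicator (cball 0 r) x *\<^sub>R f x)"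
    by (rule borel_integrable_compact) (use c in \<open>auto intro: continuous_on_subset\<close>)
  also have "(\<lambda>x. indicator (cball 0 r) x *\<^sub>R f x) = f"
    using s by (force simp: fun_eq_iff not_le split: split_indicator)
  finally show ?thesis .
qed

lemma lipschitz_imp_continuous:
  fixes f :: "'a::real_normed_vector \<Rightarrow> real"
  assumes "\<And>x y. \<bar>f x - f y\<bar> \<le> L * norm (x - y)"
  shows "continuous_on UNIV f"
proof -
  have "(max L 0)-lipschitz_on UNIV f"
  proof (rule lipschitz_onI)
    fix x y
    have "\<bar>f x - f y\<bar> \<le> L * norm (x - y)" by (rule assms)
    also have "\<dots> \<le> max L 0 * norm (x - y)" by (intro mult_right_mono) auto
    finally show "dist (f x) (f y) \<le> max L 0 * dist x y" by (simp add: dist_norm)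
  qed simp
  then show ?thesis by (rule lipschitz_on_continuous_on)
qed

lemma prod4_diff_le:
  fixes a b c d a' b' c' d' :: real
  assumes "\<bar>a\<bar> \<le> M" "\<bar>b\<bar> \<le> M" "\<bar>c\<bar> \<le> M" "\<bar>d\<bar> \<le> M" "\<bar>a'\<bar> \<le> M" "\<bar>b'\<bar> \<le> M" "\<bar>c'\<bar> \<le> M" "\<bar>d'\<bar> \<le> M"
    and "\<bar>a - a'\<bar> \<le> e" "\<bar>b - b'\<bar> \<le> e" "\<bar>c - c'\<bar> \<le> e" "\<bar>d - d'\<bar> \<le> e"
  shows "\<bar>a * b * c * d - a' * b' * c' * d'\<bar> \<le> 4 * M ^ 3 * e"
proof -
  have M: "0 \<le> M" using assms(1) abs_ge_zero[of a] by linarith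
  have e: "0 \<le> e" using assms(9) abs_ge_zero[of "a - a'"] by linarith
  have "a * b * c * d - a' * b' * c' * d' = (a - a') * b * c * d + a' * (b - b') * c * d + a' * b' * (c - c') * d + a' * b' * c' * (d - d')"
    by (simp add: algebra_simps)
  also have "\<bar>\<dots>\<bar> \<le> \<bar>(a - a') * b * c * d\<bar> + \<bar>a' * (b - b') * c * d\<bar> + \<bar>a' * b' * (c - c') * d\<bar> + \<bar>a' * b' * c' * (d - d')\<bar>"
    by (intro order_trans[OF abs_triangle_ineq] add_mono order_refl)
  also have "\<dots> \<le> e * M * M * M + M * e * M * M + M * M * e * M + M * M * M * e"
    unfolding abs_mult by (intro add_mono mult_mono assms) (simp_all add: M e)
  also have "\<dots> = 4 * M ^ 3 * e" by (simp add: eval_nat_numeral)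
  finally show ?thesis .
qed

text \<open>A Lipschitz bump: translating it by w changes it by at most norm w / \<rho>, a bound
  that an indicator does not have.\<close>

definition tent :: "real \<Rightarrow> 'a::euclidean_space \<Rightarrow> real" where
  "tent \<rho> y = max 0 (1 - norm y / \<rho>)"

lemma tent_props:
  fixes x y :: "'a::euclidean_space"
  assumes "\<rho> > 0"
  shows "0 \<le> tent \<rho> y" "tent \<rho> y \<le> 1" "norm y \<ge> \<rho> \<Longrightarrow> tent \<rho> y = 0" "\<bar>tent \<rho> x - tent \<rho> y\<bar> \<le> norm (x - y) / \<rho>"
    "continuous_on UNIV (tent \<rho> :: 'a \<Rightarrow> real)"
proof -
  have 4: "\<bar>tent \<rho> x - tent \<rho> y\<bar> \<le> norm (x - y) / \<rho>" for x y :: 'a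
  proof -
    have "\<bar>norm x / \<rho> - norm y / \<rho>\<bar> = \<bar>norm x - norm y\<bar> / \<rho>" using assms by (simp add: diff_divide_distrib[symmetric])
    also have "\<dots> \<le> norm (x - y) / \<rho>" using assms norm_triangle_ineq3[of x y] by (intro divide_right_mono) auto
    finally show ?thesis unfolding tent_def by (auto simp: max_def abs_if split: if_splits)
  qed
  show "\<bar>tent \<rho> x - tent \<rho> y\<bar> \<le> norm (x - y) / \<rho>" by (rule 4)
  show "continuous_on UNIV (tent \<rho> :: 'a \<Rightarrow> real)"
    by (rule lipschitz_imp_continuous[of _ "1/\<rho>"]) (use 4 in simp)
qed (use assms in \<open>auto simp: tent_def field_simps\<close>)

text \<open>The third bound allows errors supported on the doubled ball to be measured in units of
  the mass of the bump: the bump is at least 1/2 on the ball of radius \<rho>/2, whose radius is a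
  quarter of 2 \<rho>.\<close>

lemma tent_integral:
  assumes \<rho>: "\<rho> > 0"
  shows "integrable lborel (tent \<rho> :: 'a::euclidean_space \<Rightarrow> real)"
    and "0 < (LINT y|lborel. tent \<rho> (y::'a))"
    and "measure lborel (cball (0::'a) (2 * \<rho>)) \<le> 2 * 4 ^ DIM('a) * (LINT y|lborel. tent \<rho> (y::'a))"
proof -
  show i: "integrable lborel (tent \<rho> :: 'a \<Rightarrow> real)"
    by (rule integrable_continuous_bounded_support[of _ \<rho>]) (intro tent_props(3,5)[OF \<rho>] less_imp_le)+
  have fin: "emeasure lborel (cball (0::'a) r) < \<infinity>" for r by (rule emeasure_bounded_finite) simp
  have ic: "integrable lborel (indicator (cball (0::'a) r) :: 'a \<Rightarrow> real)" for r
    using fin[of r] by (simp add: integrable_indicator_iff)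
  have "(LINT y|lborel. (1/2) * indicator (cball (0::'a) (\<rho>/2)) y) \<le> (LINT y|lborel. tent \<rho> (y::'a))"
  proof (rule integral_mono)
    show "(1/2) * indicator (cball 0 (\<rho>/2)) y \<le> tent \<rho> y" for y :: 'a
      using \<rho> tent_props(1)[OF \<rho>, of y] by (auto simp: tent_def field_simps split: split_indicator)
  qed (use i ic in auto)
  then have h: "measure lborel (cball (0::'a) (\<rho>/2)) \<le> 2 * (LINT y|lborel. tent \<rho> (y::'a))" by simp
  have c: "measure lborel (cball (0::'a) r) = unit_ball_vol DIM('a) * r ^ DIM('a)" if "r \<ge> 0" for r
    using content_cball[of r "0::'a"] that by simp
  have "measure lborel (cball (0::'a) (2 * \<rho>)) = 4 ^ DIM('a) * measure lborel (cball (0::'a) (\<rho>/2))"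
  proof -
    have "(2 * \<rho>) ^ DIM('a) = 4 ^ DIM('a) * (\<rho> / 2) ^ DIM('a)" by (subst power_mult_distrib[symmetric]) simp
    then show ?thesis using \<rho> by (simp add: c)
  qed
  with h show "measure lborel (cball (0::'a) (2 * \<rho>)) \<le> 2 * 4 ^ DIM('a) * (LINT y|lborel. tent \<rho> (y::'a))" by simp
  have "0 < measure lborel (cball (0::'a) (\<rho>/2))" using \<rho> by (simp add: c)
  then show "0 < (LINT y|lborel. tent \<rho> (y::'a))" using h by linarith
qed

lemma quad_points_continuous:
  "continuous_on UNIV pt1" "continuous_on UNIV (pt2 u)" "continuous_on UNIV pt3" "continuous_on UNIV (pt4 u)"
  unfolding pt1_def pt2_def pt3_def pt4_def power_sum_map_def Bu_def by (intro continuous_intros)+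

definition quad_prod :: "real \<Rightarrow> (plane \<Rightarrow> real) \<Rightarrow> quad \<Rightarrow> real" where
  "quad_prod u F z = F (pt1 z) * F (pt2 u z) * F (pt3 z) * F (pt4 u z)"

text \<open>The contribution of a neighbourhood of a nondegenerate \<open>z\<close>: shifting the variable of integration by \<open>w\<close>
  moves only the argument of the first factor, by \<open>a\<close>, up to a second-order error; then average over \<open>a\<close>.\<close>

lemma local_quad_bound:
  fixes F :: "plane \<Rightarrow> real" and W :: "quad \<Rightarrow> real"
  assumes K: "K \<ge> 1" and Kw: "\<And>a. \<exists>w. norm w \<le> K * norm a / \<bar>quad_jac u z\<bar> \<and>
       (\<forall>y. norm y \<le> 2 \<and> norm w \<le> 2 \<longrightarrow>
         norm (pt1 (z + y + w) - (pt1 (z + y) + a)) \<le> K * (norm y + norm w) * norm w \<and>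
         norm (pt2 u (z + y + w) - pt2 u (z + y)) \<le> K * (norm y + norm w) * norm w \<and>
         norm (pt3 (z + y + w) - pt3 (z + y)) \<le> K * (norm y + norm w) * norm w \<and>
         norm (pt4 u (z + y + w) - pt4 u (z + y)) \<le> K * (norm y + norm w) * norm w)"
    and W1: "\<And>z. \<bar>W z\<bar> \<le> 1" and WL: "\<And>z z'. \<bar>W z - W z'\<bar> \<le> LW * norm (z - z')"
    and FM: "\<And>p. \<bar>F p\<bar> \<le> M" and FL: "\<And>p q. \<bar>F p - F q\<bar> \<le> \<Lambda> * norm (p - q)"
    and Fav: "\<And>p. \<bar>avg s F p\<bar> \<le> \<eta>"
    and \<rho>: "0 < \<rho>" "\<rho> \<le> 1" and s: "0 < s" and \<epsilon>: "0 < \<epsilon>" "\<epsilon> \<le> \<bar>quad_jac u z\<bar>"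
    and sm: "2 * K * s / \<epsilon> \<le> \<rho>"
  shows "\<bar>LINT y|lborel. tent \<rho> y * (W (z + y) * quad_prod u F (z + y))\<bar>
     \<le> (LINT y|lborel. tent \<rho> (y::quad)) * (M ^ 3 * \<eta> + 2 * 4 ^ DIM(quad) *
        (M ^ 4 * (2 * K * s / \<epsilon>) / \<rho> + 3 * LW * \<rho> * M ^ 4 + 12 * M ^ 3 * \<Lambda> * K * \<rho> * (2 * K * s / \<epsilon>)))"
proof -
  define N where "N = (LINT y|lborel. tent \<rho> (y::quad))"
  define E where "E = M ^ 4 * (2 * K * s / \<epsilon>) / \<rho> + 3 * LW * \<rho> * M ^ 4 + 12 * M ^ 3 * \<Lambda> * K * \<rho> * (2 * K * s / \<epsilon>)"
  have M0: "0 \<le> M" using FM[of 0] by simp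
  have \<Lambda>0: "0 \<le> \<Lambda>" using order_trans[OF abs_ge_zero FL[of "SOME i. i \<in> Basis" 0]] by simp
  have LW0: "0 \<le> LW" using order_trans[OF abs_ge_zero WL[of "SOME i. i \<in> Basis" 0]] by simp
  have Fc: "continuous_on UNIV F" by (rule lipschitz_imp_continuous[OF FL])
  have Wc: "continuous_on UNIV W" by (rule lipschitz_imp_continuous[OF WL])
  have Fc': "continuous_on S (\<lambda>y. F (h y))" if "continuous_on S h" for S and h :: "'b::topological_space \<Rightarrow> plane"
    by (rule continuous_on_compose2[OF Fc that]) simp
  have Wc': "continuous_on S (\<lambda>y. W (h y))" if "continuous_on S h" for S and h :: "'b::topological_space \<Rightarrow> quad"
    by (rule continuous_on_compose2[OF Wc that]) simp
  have pc: "continuous_on S (\<lambda>y. pt1 (h y))" "continuous_on S (\<lambda>y. pt2 u (h y))" "continuous_on S (\<lambda>y. pt3 (h y))" "continuous_on S (\<lambda>y. pt4 u (h y))"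
    if "continuous_on S h" for S and h :: "'b::topological_space \<Rightarrow> quad"
    using quad_points_continuous by (auto intro: continuous_on_compose2[OF _ that])
  have tc: "continuous_on S (\<lambda>y. tent \<rho> (h y))" if "continuous_on S h" for S and h :: "'b::topological_space \<Rightarrow> quad"
    by (rule continuous_on_compose2[OF tent_props(5)[OF \<rho>(1)] that]) simp
  define H where "H y = tent \<rho> y * (W (z + y) * quad_prod u F (z + y))" for y
  \<comment> \<open>The model for H (y + w): the bump is taken at y, the weight frozen at z, the
    first argument moved by a and the other three left in place.\<close>
  define R where "R a y = tent \<rho> y * (W z * (F (pt1 (z + y) + a) * F (pt2 u (z + y)) * F (pt3 (z + y)) * F (pt4 u (z + y))))" for a y
  have Hc: "continuous_on UNIV H" unfolding H_def quad_prod_def by (intro continuous_intros Fc' Wc' pc tc)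
  have Rc: "continuous_on UNIV (R a)" for a unfolding R_def by (intro continuous_intros Fc' pc tc)
  have Hm[measurable]: "H \<in> borel_measurable borel" by (rule borel_measurable_continuous_onI[OF Hc])
  have H0: "H y = 0" if "norm y \<ge> \<rho>" for y using tent_props(3)[OF \<rho>(1) that] by (simp add: H_def)
  have R0: "R a y = 0" if "norm y \<ge> \<rho>" for a y using tent_props(3)[OF \<rho>(1) that] by (simp add: R_def)
  have Hi: "integrable lborel H" by (rule integrable_continuous_bounded_support[OF Hc, of \<rho>]) (simp add: H0)
  have Ri: "integrable lborel (R a)" for a by (rule integrable_continuous_bounded_support[OF Rc, of \<rho>]) (simp add: R0)
  have prod_le: "\<bar>F a * F b * F c * F d\<bar> \<le> M ^ 4" for a b c d
  proof -
    have "\<bar>F a\<bar> * \<bar>F b\<bar> * \<bar>F c\<bar> * \<bar>F d\<bar> \<le> M * M * M * M" by (intro mult_mono FM) (simp_all add: M0)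
    then show ?thesis by (simp add: abs_mult eval_nat_numeral mult.assoc)
  qed
  have step: "\<bar>(LINT y|lborel. H y) - (LINT y|lborel. R a y)\<bar> \<le> N * (2 * 4 ^ DIM(quad) * E)" if a: "a \<in> qbox s" for a
  proof -
    obtain w where w: "norm w \<le> K * norm a / \<bar>quad_jac u z\<bar>" and
      wy: "\<And>y. norm y \<le> 2 \<Longrightarrow> norm w \<le> 2 \<Longrightarrow>
         norm (pt1 (z + y + w) - (pt1 (z + y) + a)) \<le> K * (norm y + norm w) * norm w \<and>
         norm (pt2 u (z + y + w) - pt2 u (z + y)) \<le> K * (norm y + norm w) * norm w \<and>
         norm (pt3 (z + y + w) - pt3 (z + y)) \<le> K * (norm y + norm w) * norm w \<and>
         norm (pt4 u (z + y + w) - pt4 u (z + y)) \<le> K * (norm y + norm w) * norm w"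
      using Kw[of a] by blast
    have na: "norm a \<le> 2 * s" using a norm_Pair_le[of "fst a" "snd a"] by (auto simp: qbox_def)
    define \<tau> where "\<tau> = 2 * K * s / \<epsilon>"
    have "norm w \<le> K * (2 * s) / \<epsilon>"
      by (rule order_trans[OF w]) (use na \<epsilon> K s in \<open>intro frac_le mult_left_mono, auto\<close>)
    then have w\<tau>: "norm w \<le> \<tau>" by (simp add: \<tau>_def mult_ac)
    have \<tau>\<rho>: "\<tau> \<le> \<rho>" using sm by (simp add: \<tau>_def)
    have \<tau>0: "0 \<le> \<tau>" using K s \<epsilon> by (simp add: \<tau>_def)
    have shift: "(LINT y|lborel. H y) = (LINT y|lborel. H (y + w))" by (rule integral_lborel_shift[symmetric]) measurable
    have Hwi: "integrable lborel (\<lambda>y. H (y + w))" by (rule integrable_lborel_shift[OF Hi])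
    \<comment> \<open>Outside the ball of radius 2 \<rho> both terms vanish, since norm w \<le>
      \<rho>. Inside, the summands of E are in turn the costs of moving the bump, of freezing the
      weight, and of the second-order displacement of the four points.\<close>
    have pw: "\<bar>H (y + w) - R a y\<bar> \<le> indicator (cball 0 (2 * \<rho>)) y * E" for y
    proof (cases "norm y \<le> 2 * \<rho>")
      case False
      have "norm y \<le> norm (y + w) + norm w" using norm_triangle_ineq4[of "y + w" w] by simp
      then have "norm (y + w) \<ge> \<rho>" using False w\<tau> \<tau>\<rho> by linarith
      then show ?thesis using False H0 R0 \<rho> by simp
    next
      case True
      have y2: "norm y \<le> 2" "norm w \<le> 2" using True \<rho> w\<tau> \<tau>\<rho> by linarith+
      define d where "d = \<Lambda> * (K * (3 * \<rho>) * \<tau>)"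
      have dd: "\<Lambda> * norm (p - q) \<le> d" if "norm (p - q) \<le> K * (norm y + norm w) * norm w" for p q :: "plane"
      proof -
        have "K * (norm y + norm w) * norm w \<le> K * (3 * \<rho>) * \<tau>"
          using True w\<tau> \<tau>\<rho> K \<tau>0 \<rho> by (intro mult_mono) auto
        then show ?thesis unfolding d_def using that \<Lambda>0 by (intro mult_left_mono) auto
      qed
      note wy' = wy[OF y2]
      have fd: "\<bar>F (pt1 (z + y + w)) - F (pt1 (z + y) + a)\<bar> \<le> d" "\<bar>F (pt2 u (z + y + w)) - F (pt2 u (z + y))\<bar> \<le> d"
        "\<bar>F (pt3 (z + y + w)) - F (pt3 (z + y))\<bar> \<le> d" "\<bar>F (pt4 u (z + y + w)) - F (pt4 u (z + y))\<bar> \<le> d"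
        using wy' by (auto intro!: order_trans[OF FL] dd)
      define g where "g = quad_prod u F (z + y + w)"
      define g' where "g' = F (pt1 (z + y) + a) * F (pt2 u (z + y)) * F (pt3 (z + y)) * F (pt4 u (z + y))"
      have gg: "\<bar>g - g'\<bar> \<le> 4 * M ^ 3 * d"
        unfolding g_def g'_def quad_prod_def by (intro prod4_diff_le FM fd)
      have gM: "\<bar>g\<bar> \<le> M ^ 4" unfolding g_def quad_prod_def by (rule prod_le)
      have t1: "\<bar>tent \<rho> (y + w) - tent \<rho> y\<bar> \<le> \<tau> / \<rho>"
        using order_trans[OF tent_props(4)[OF \<rho>(1), of "y + w" y]] w\<tau> \<rho> by (simp add: divide_right_mono)
      have W2: "\<bar>W (z + y + w) - W z\<bar> \<le> LW * (3 * \<rho>)"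
      proof -
        have "norm (y + w) \<le> 3 * \<rho>" using norm_triangle_ineq[of y w] True w\<tau> \<tau>\<rho> by linarith
        then show ?thesis using order_trans[OF WL[of "z + y + w" z] mult_left_mono[OF _ LW0]] by (simp add: add.assoc)
      qed
      have "H (y + w) - R a y = (tent \<rho> (y + w) - tent \<rho> y) * (W (z + y + w) * g) + tent \<rho> y * ((W (z + y + w) - W z) * g) + tent \<rho> y * (W z * (g - g'))"
        by (simp add: H_def R_def g_def g'_def add.assoc algebra_simps)
      also have "\<bar>\<dots>\<bar> \<le> \<bar>(tent \<rho> (y + w) - tent \<rho> y) * (W (z + y + w) * g)\<bar> + \<bar>tent \<rho> y * ((W (z + y + w) - W z) * g)\<bar> + \<bar>tent \<rho> y * (W z * (g - g'))\<bar>"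
        by (intro order_trans[OF abs_triangle_ineq] add_mono order_refl)
      also have "\<dots> \<le> \<tau> / \<rho> * (1 * M ^ 4) + 1 * (LW * (3 * \<rho>) * M ^ 4) + 1 * (1 * (4 * M ^ 3 * d))"
        unfolding abs_mult using t1 W1 gM W2 gg tent_props(1,2)[OF \<rho>(1), of y] M0 \<tau>0 \<rho> LW0
        by (intro add_mono mult_mono) auto
      also have "\<dots> = E" by (simp add: E_def \<tau>_def[symmetric] d_def)
      finally show ?thesis using True by simp
    qed
    have ic: "integrable lborel (\<lambda>y::quad. indicator (cball 0 (2 * \<rho>)) y * E)"
      using emeasure_bounded_finite[of "cball (0::quad) (2 * \<rho>)"] by (intro integrable_mult_left) (simp add: integrable_indicator_iff)
    have "(LINT y|lborel. H y) - (LINT y|lborel. R a y) = (LINT y|lborel. H (y + w) - R a y)"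
      unfolding shift using Hwi Ri by simp
    also have "\<bar>\<dots>\<bar> \<le> (LINT y|lborel. indicator (cball (0::quad) (2 * \<rho>)) y * E)"
      by (rule integral_abs_bound_integral) (use Hwi Ri ic pw in auto)
    also have "\<dots> = measure lborel (cball (0::quad) (2 * \<rho>)) * E" by simp
    also have "\<dots> \<le> (2 * 4 ^ DIM(quad) * N) * E"
    proof (intro mult_right_mono)
      show "measure lborel (cball (0::quad) (2 * \<rho>)) \<le> 2 * 4 ^ DIM(quad) * N" unfolding N_def by (rule tent_integral(3)[OF \<rho>(1)])
      show "0 \<le> E" using M0 K s \<epsilon> \<rho> LW0 \<Lambda>0 by (auto simp: E_def)
    qed
    finally show ?thesis by (simp add: mult_ac)
  qed
  have N0: "N > 0" unfolding N_def by (rule tent_integral(2)[OF \<rho>(1)])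
  \<comment> \<open>After an interchange the integral over a is s^2 times the mean of F over the
    square of side s at the first point; here the smallness \<eta> enters.\<close>
  have Ravg: "\<bar>LINT a|lborel. indicator (qbox s) a * (LINT y|lborel. R a y)\<bar> \<le> s\<^sup>2 * (N * (M ^ 3 * \<eta>))"
  proof -
    have \<eta>0: "0 \<le> \<eta>" using Fav[of 0] by simp
    have "(LINT a|lborel. indicator (qbox s) a * (LINT y|lborel. R a y)) = (LINT a|lborel. LINT y|lborel. indicator (qbox s) a * R a y)"
      by simp
    also have "\<dots> = (LINT y|lborel. LINT a|lborel. indicator (qbox s) a * R a y)"
    proof (rule Fubini_dominated)
      show "(\<lambda>(a, y). indicator (qbox s) a * R a y) \<in> borel_measurable (borel \<Otimes>\<^sub>M borel)"
      proof -
        have "continuous_on UNIV (\<lambda>q. R (fst q) (snd q))"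
          unfolding R_def by (intro continuous_intros Fc' pc tc)
        then have [measurable]: "(\<lambda>q. R (fst q) (snd q)) \<in> borel_measurable (borel \<Otimes>\<^sub>M borel)"
          unfolding borel_prod by (rule borel_measurable_continuous_onI)
        have "(\<lambda>q. indicator (qbox s) (fst q) * R (fst q) (snd q)) \<in> borel_measurable (borel \<Otimes>\<^sub>M borel)" by measurable
        then show ?thesis by (simp add: case_prod_beta')
      qed
      show "integrable lborel (\<lambda>y::quad. tent \<rho> y * M ^ 4)" by (simp add: tent_integral(1)[OF \<rho>(1)])
      show "norm (indicator (qbox s) a * R a y) \<le> indicator (qbox s) a * (tent \<rho> y * M ^ 4)" for a y
      proof -
        have "\<bar>R a y\<bar> \<le> tent \<rho> y * (1 * M ^ 4)"
          unfolding R_def abs_mult[of "tent \<rho> y"] abs_mult[of "W z"]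
          using tent_props(1)[OF \<rho>(1), of y] W1[of z] prod_le by (intro mult_mono) auto
        then show ?thesis by (auto split: split_indicator)
      qed
    qed simp
    also have "\<bar>\<dots>\<bar> \<le> (LINT y|lborel. tent \<rho> (y::quad) * (s\<^sup>2 * (M ^ 3 * \<eta>)))"
    proof (rule integral_abs_bound_integral)
      have inner: "(LINT a|lborel. indicator (qbox s) a * R a y) = tent \<rho> y * (W z * ((s\<^sup>2 * avg s F (pt1 (z + y))) * (F (pt2 u (z + y)) * F (pt3 (z + y)) * F (pt4 u (z + y)))))" for y
      proof -
        have "(LINT a|lborel. indicator (qbox s) a * R a y) = (LINT a|lborel. (tent \<rho> y * W z * (F (pt2 u (z + y)) * F (pt3 (z + y)) * F (pt4 u (z + y)))) * (indicator (qbox s) a *\<^sub>R F (pt1 (z + y) + a)))"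
          by (intro Bochner_Integration.integral_cong refl) (simp add: R_def mult_ac)
        also have "\<dots> = (tent \<rho> y * W z * (F (pt2 u (z + y)) * F (pt3 (z + y)) * F (pt4 u (z + y)))) * (s\<^sup>2 * avg s F (pt1 (z + y)))"
          using s by (simp only: integral_mult_right_zero) (simp add: avg_def)
        finally show ?thesis by (simp add: mult_ac)
      qed
      have fm: "continuous_on UNIV (avg s F)"
      proof (rule lipschitz_imp_continuous)
        fix p q
        have ia: "integrable lborel (\<lambda>y. indicator (qbox s) y *\<^sub>R F (p + y))" for p
        proof (rule Bochner_Integration.integrable_bound)
          show "integrable lborel (\<lambda>y. indicator (qbox s) y * M :: real)" by simp
          have [measurable]: "F \<in> borel_measurable borel" by (rule borel_measurable_continuous_onI[OF Fc])
          show "(\<lambda>y. indicator (qbox s) y *\<^sub>R F (p + y)) \<in> borel_measurable lborel" by measurable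
          show "AE y in lborel. norm (indicator (qbox s) y *\<^sub>R F (p + y)) \<le> norm (indicator (qbox s) y * M :: real)"
            by (intro AE_I2) (simp add: FM M0 split: split_indicator)
        qed
        have "avg s F p - avg s F q = (1 / s\<^sup>2) * (LINT y|lborel. indicator (qbox s) y *\<^sub>R F (p + y) - indicator (qbox s) y *\<^sub>R F (q + y))"
          unfolding avg_def using ia by (subst Bochner_Integration.integral_diff) (auto simp: right_diff_distrib)
        also have "\<bar>\<dots>\<bar> \<le> (1 / s\<^sup>2) * (LINT y|lborel. indicator (qbox s) y * (\<Lambda> * norm (p - q)))"
        proof -
          have "\<bar>LINT y|lborel. indicator (qbox s) y *\<^sub>R F (p + y) - indicator (qbox s) y *\<^sub>R F (q + y)\<bar> \<le> (LINT y|lborel. indicator (qbox s) y * (\<Lambda> * norm (p - q)))"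
          proof (rule integral_abs_bound_integral)
            show "\<bar>indicator (qbox s) y *\<^sub>R F (p + y) - indicator (qbox s) y *\<^sub>R F (q + y)\<bar> \<le> indicator (qbox s) y * (\<Lambda> * norm (p - q))" for y
              using FL[of "p + y" "q + y"] by (auto split: split_indicator)
          qed (use ia in auto)
          then show ?thesis unfolding abs_mult using s by (intro mult_mono) auto
        qed
        also have "\<dots> = \<Lambda> * norm (p - q)" using s by simp
        finally show "\<bar>avg s F p - avg s F q\<bar> \<le> \<Lambda> * norm (p - q)" .
      qed
      have ac: "continuous_on UNIV (\<lambda>y. avg s F (pt1 (z + y)))"
        by (rule continuous_on_compose2[OF fm]) (auto intro!: pc continuous_intros)
      show "integrable lborel (\<lambda>y. LINT a|lborel. indicator (qbox s) a * R a y)"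
        unfolding inner
        by (rule integrable_continuous_bounded_support[of _ \<rho>]) (auto simp: tent_props(3)[OF \<rho>(1)] intro!: continuous_intros ac Fc' pc tc)
      show "integrable lborel (\<lambda>y::quad. tent \<rho> y * (s\<^sup>2 * (M ^ 3 * \<eta>)))" by (simp add: tent_integral(1)[OF \<rho>(1)])
      show "\<bar>LINT a|lborel. indicator (qbox s) a * R a y\<bar> \<le> tent \<rho> y * (s\<^sup>2 * (M ^ 3 * \<eta>))" for y
      proof -
        have "\<bar>tent \<rho> y * (W z * ((s\<^sup>2 * avg s F (pt1 (z + y))) * (F (pt2 u (z + y)) * F (pt3 (z + y)) * F (pt4 u (z + y)))))\<bar>
          \<le> tent \<rho> y * (1 * ((s\<^sup>2 * \<eta>) * (M * M * M)))"
          unfolding abs_mult by (intro mult_mono FM Fav W1) (simp_all add: M0 \<eta>0 abs_of_nonneg[OF tent_props(1)[OF \<rho>(1)]] tent_props(1)[OF \<rho>(1)])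
        then show ?thesis unfolding inner by (simp add: eval_nat_numeral mult_ac)
      qed
    qed
    also have "\<dots> = s\<^sup>2 * (N * (M ^ 3 * \<eta>))" by (simp add: N_def)
    finally show ?thesis .
  qed
  \<comment> \<open>I does not depend on a, so it may be averaged over the a in the square of side
    s, each a being compared with its own R a.\<close>
  define I where "I = (LINT y|lborel. H y)"
  have "s\<^sup>2 * \<bar>I\<bar> = \<bar>LINT a|lborel. indicator (qbox s) a * I\<bar>" using s by (simp add: abs_mult)
  also have "\<dots> \<le> s\<^sup>2 * (N * (M ^ 3 * \<eta>)) + s\<^sup>2 * (N * (2 * 4 ^ DIM(quad) * E))"
  proof -
    have Rm: "integrable lborel (\<lambda>a. indicator (qbox s) a * (LINT y|lborel. R a y))"
    proof (rule Bochner_Integration.integrable_bound)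
      show "integrable lborel (\<lambda>a. indicator (qbox s) a * (N * M ^ 4) :: real)" by simp
      have "continuous_on UNIV (\<lambda>q. R (fst q) (snd q))"
        unfolding R_def by (intro continuous_intros Fc' pc tc)
      then have [measurable]: "(\<lambda>q. R (fst q) (snd q)) \<in> borel_measurable (borel \<Otimes>\<^sub>M borel)"
        unfolding borel_prod by (rule borel_measurable_continuous_onI)
      have "(\<lambda>a. LINT y|lborel. R (fst (a, y)) (snd (a, y))) \<in> borel_measurable borel"
        by (intro lborel.borel_measurable_lebesgue_integral) (simp add: case_prod_beta')
      then show "(\<lambda>a. indicator (qbox s) a * (LINT y|lborel. R a y)) \<in> borel_measurable lborel" by simp
      show "AE a in lborel. norm (indicator (qbox s) a * (LINT y|lborel. R a y)) \<le> norm (indicator (qbox s) a * (N * M ^ 4))"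
      proof (intro AE_I2)
        fix a
        have "\<bar>LINT y|lborel. R a y\<bar> \<le> (LINT y|lborel. tent \<rho> (y::quad) * M ^ 4)"
        proof (rule integral_abs_bound_integral[OF Ri])
          show "\<bar>R a y\<bar> \<le> tent \<rho> y * M ^ 4" for y
          proof -
            have "\<bar>R a y\<bar> \<le> tent \<rho> y * (1 * M ^ 4)"
              unfolding R_def abs_mult[of "tent \<rho> y"] abs_mult[of "W z"]
              using tent_props(1)[OF \<rho>(1), of y] W1[of z] prod_le by (intro mult_mono) auto
            then show ?thesis by simp
          qed
        qed (simp add: tent_integral(1)[OF \<rho>(1)])
        also have "\<dots> = N * M ^ 4" by (simp add: N_def)
        finally show "norm (indicator (qbox s) a * (LINT y|lborel. R a y)) \<le> norm (indicator (qbox s) a * (N * M ^ 4))"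
          by (auto split: split_indicator)
      qed
    qed
    have "(LINT a|lborel. indicator (qbox s) a * I) = (LINT a|lborel. indicator (qbox s) a * (LINT y|lborel. R a y)) + (LINT a|lborel. indicator (qbox s) a * I - indicator (qbox s) a * (LINT y|lborel. R a y))"
      using Rm by simp
    moreover have "\<bar>LINT a|lborel. indicator (qbox s) a * I - indicator (qbox s) a * (LINT y|lborel. R a y)\<bar> \<le> (LINT a|lborel. indicator (qbox s) a * (N * (2 * 4 ^ DIM(quad) * E)))"
    proof (rule integral_abs_bound_integral)
      show "\<bar>indicator (qbox s) a * I - indicator (qbox s) a * (LINT y|lborel. R a y)\<bar> \<le> indicator (qbox s) a * (N * (2 * 4 ^ DIM(quad) * E))" for a
        using step[of a] by (auto simp: I_def split: split_indicator)
    qed (use Rm in auto)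
    moreover have "(LINT a|lborel. indicator (qbox s) a * (N * (2 * 4 ^ DIM(quad) * E))) = s\<^sup>2 * (N * (2 * 4 ^ DIM(quad) * E))" using s by simp
    ultimately show ?thesis using Ravg by linarith
  qed
  also have "\<dots> = s\<^sup>2 * (N * (M ^ 3 * \<eta> + 2 * 4 ^ DIM(quad) * E))" by (simp add: algebra_simps)
  finally have "\<bar>I\<bar> \<le> N * (M ^ 3 * \<eta> + 2 * 4 ^ DIM(quad) * E)" using s by simp
  then show ?thesis unfolding I_def H_def N_def E_def .
qed

text \<open>Smearing with the bump writes the integral as a mean of local contributions k z. Where
  the modulus of \<open>quad_jac\<close> exceeds \<epsilon>, \<open>local_quad_bound\<close>
  applies; the remaining z have measure O(\<delta>) and are estimated trivially. The five terms
  stand for degenerate configurations, the mean of F, the motion of the bump, the freezing of the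
  weight, and the second-order error.\<close>

proposition quad_form_bound:
  obtains K where "K \<ge> (1::real)"
    "\<And>u W F M LW \<Lambda> \<eta> \<rho> s \<epsilon> \<delta>. 0 \<le> u \<Longrightarrow> u \<le> 1 \<Longrightarrow> (\<And>z. \<bar>W z\<bar> \<le> 1) \<Longrightarrow> (\<And>z z'. \<bar>W z - W z'\<bar> \<le> LW * norm (z - z')) \<Longrightarrow>
      (\<And>z. norm z > 10 \<Longrightarrow> W z = 0) \<Longrightarrow> (\<And>p. \<bar>F p\<bar> \<le> M) \<Longrightarrow> (\<And>p q. \<bar>F p - F q\<bar> \<le> \<Lambda> * norm (p - q)) \<Longrightarrow>
      (\<And>p. \<bar>avg s F p\<bar> \<le> \<eta>) \<Longrightarrow> 0 < \<rho> \<Longrightarrow> \<rho> \<le> 1 \<Longrightarrow> 0 < s \<Longrightarrow> 0 < \<epsilon> \<Longrightarrow> 0 < \<delta> \<Longrightarrow> K * s / \<epsilon> \<le> \<rho> \<Longrightarrow> K * \<epsilon> \<le> \<delta> ^ 32 \<Longrightarrow>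
      \<bar>LINT z|lborel. W z * quad_prod u F z\<bar> \<le> K * (M ^ 4 * \<delta> + M ^ 3 * \<eta> + M ^ 4 * (s / \<epsilon>) / \<rho> + LW * \<rho> * M ^ 4 + M ^ 3 * \<Lambda> * \<rho> * (s / \<epsilon>))"
proof -
  obtain K0 where K0: "K0 \<ge> (1::real)" and sh: "\<And>u z a. 0 \<le> u \<Longrightarrow> u \<le> 1 \<Longrightarrow> norm z \<le> 12 \<Longrightarrow> quad_jac u z \<noteq> 0 \<Longrightarrow>
      \<exists>w. norm w \<le> K0 * norm a / \<bar>quad_jac u z\<bar> \<and>
       (\<forall>y. norm y \<le> 2 \<and> norm w \<le> 2 \<longrightarrow>
         norm (pt1 (z + y + w) - (pt1 (z + y) + a)) \<le> K0 * (norm y + norm w) * norm w \<and>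
         norm (pt2 u (z + y + w) - pt2 u (z + y)) \<le> K0 * (norm y + norm w) * norm w \<and>
         norm (pt3 (z + y + w) - pt3 (z + y)) \<le> K0 * (norm y + norm w) * norm w \<and>
         norm (pt4 u (z + y + w) - pt4 u (z + y)) \<le> K0 * (norm y + norm w) * norm w)"
    by (rule shift_first_point) blast
  obtain Cs where Cs: "Cs > 0" and sub: "\<And>(f::quad \<Rightarrow> real) \<theta> \<rho> \<epsilon> \<delta>.
    f \<in> borel_measurable borel \<Longrightarrow> (\<forall>v. polyfun 32 (\<lambda>r. f (\<theta> + r *\<^sub>R v))) \<Longrightarrow> \<bar>f \<theta>\<bar> \<ge> 1 \<Longrightarrow>
    0 < \<rho> \<Longrightarrow> 0 < \<delta> \<Longrightarrow> Cs * \<epsilon> \<le> \<delta> ^ 32 \<Longrightarrow>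
    emeasure lborel {z \<in> cball \<theta> \<rho>. \<bar>f z\<bar> \<le> \<epsilon>} \<le> ennreal (2 * \<delta>) * emeasure lborel (cball \<theta> (2 * \<rho>))"
    using sublevel_measure[of 32, where 'a=quad] by auto
  \<comment> \<open>The weight lives in the ball of radius 10, and 12 leaves room for the bump. That
    ball lies within distance 20 of \<open>quad_base\<close>, and the sublevel estimate doubles the
    radius to 40.\<close>
  define B12 B40 where "B12 = measure lborel (cball (0::quad) 12)" and "B40 = measure lborel (cball quad_base 40)"
  define D where "D = (2::real) * 4 ^ DIM(quad)"
  have D1: "D \<ge> 1" by (simp add: D_def)
  define K where "K = max (max (2 * K0) Cs) (max (2 * B40) (24 * K0\<^sup>2 * D * (B12 + 1)))"
  have B0: "0 \<le> B12" "0 \<le> B40" by (auto simp: B12_def B40_def)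
  have K2: "K \<ge> 2 * K0" "K \<ge> Cs" "K \<ge> 2 * B40" and K24: "K \<ge> 24 * K0\<^sup>2 * D * (B12 + 1)" by (auto simp: K_def)
  have "\<bar>LINT z|lborel. W z * quad_prod u F z\<bar> \<le> K * (M ^ 4 * \<delta> + M ^ 3 * \<eta> + M ^ 4 * (s / \<epsilon>) / \<rho> + LW * \<rho> * M ^ 4 + M ^ 3 * \<Lambda> * \<rho> * (s / \<epsilon>))"
    if u: "0 \<le> u" "u \<le> 1" and W1: "\<And>z. \<bar>W z\<bar> \<le> 1" and WL: "\<And>z z'. \<bar>W z - W z'\<bar> \<le> LW * norm (z - z')" and
      W0: "\<And>z. norm z > 10 \<Longrightarrow> W z = 0" and FM: "\<And>p. \<bar>F p\<bar> \<le> M" and FL: "\<And>p q. \<bar>F p - F q\<bar> \<le> \<Lambda> * norm (p - q)" and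
      Fav: "\<And>p. \<bar>avg s F p\<bar> \<le> \<eta>" and \<rho>: "0 < \<rho>" "\<rho> \<le> 1" and s: "0 < s" and \<epsilon>: "0 < \<epsilon>" and \<delta>: "0 < \<delta>"
      and Ks: "K * s / \<epsilon> \<le> \<rho>" and K\<epsilon>: "K * \<epsilon> \<le> \<delta> ^ 32"
    for u W F M LW \<Lambda> \<eta> \<rho> s \<epsilon> \<delta>
  proof -
    have M0: "0 \<le> M" using order_trans[OF abs_ge_zero FM] .
    have \<Lambda>0: "0 \<le> \<Lambda>" using order_trans[OF abs_ge_zero FL[of "SOME i. i \<in> Basis" 0]] by simp
    have LW0: "0 \<le> LW" using order_trans[OF abs_ge_zero WL[of "SOME i. i \<in> Basis" 0]] by simp
    have \<eta>0: "0 \<le> \<eta>" using order_trans[OF abs_ge_zero Fav] .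
    define h where "h z = W z * quad_prod u F z" for z
    define N where "N = (LINT y|lborel. tent \<rho> (y::quad))"
    have N0: "0 < N" unfolding N_def by (rule tent_integral(2)[OF \<rho>(1)])
    have ti: "integrable lborel (tent \<rho> :: quad \<Rightarrow> real)" by (rule tent_integral(1)[OF \<rho>(1)])
    have Fc: "continuous_on UNIV F" by (rule lipschitz_imp_continuous[OF FL])
    have Wc: "continuous_on UNIV W" by (rule lipschitz_imp_continuous[OF WL])
    have hc: "continuous_on UNIV h"
      unfolding h_def quad_prod_def by (intro continuous_intros Wc continuous_on_compose2[OF Fc] quad_points_continuous) auto
    have [measurable]: "h \<in> borel_measurable borel" by (rule borel_measurable_continuous_onI[OF hc])
    have [measurable]: "tent \<rho> \<in> borel_measurable (borel :: quad measure)" by (rule borel_measurable_continuous_onI[OF tent_props(5)[OF \<rho>(1)]])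
    have prod_le: "\<bar>quad_prod u F z\<bar> \<le> M ^ 4" for z
    proof -
      have "\<bar>F (pt1 z)\<bar> * \<bar>F (pt2 u z)\<bar> * \<bar>F (pt3 z)\<bar> * \<bar>F (pt4 u z)\<bar> \<le> M * M * M * M" by (intro mult_mono FM) (simp_all add: M0)
      then show ?thesis by (simp add: quad_prod_def abs_mult eval_nat_numeral mult.assoc)
    qed
    have hM: "\<bar>h z\<bar> \<le> M ^ 4" for z
      using mult_mono[OF W1 prod_le, of z z] by (simp add: h_def abs_mult)
    have h0: "h z = 0" if "norm z > 10" for z using W0[OF that] by (simp add: h_def)
    define k where "k z = (LINT y|lborel. tent \<rho> y * h (z + y))" for z
    have ic: "integrable lborel (indicator (cball (0::quad) r) :: quad \<Rightarrow> real)" for r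
      using emeasure_bounded_finite[of "cball (0::quad) r"] by (simp add: integrable_indicator_iff)
    have th: "\<bar>tent \<rho> y * h (z + y)\<bar> \<le> indicator (cball 0 12) z * M ^ 4 * tent \<rho> y" for y z
    proof (cases "norm z \<le> 12 \<or> norm y \<ge> \<rho>")
      case True
      then show ?thesis
      proof
        assume "norm z \<le> 12"
        then show ?thesis using mult_left_mono[OF hM[of "z + y"] tent_props(1)[OF \<rho>(1), of y]]
          by (simp add: abs_mult abs_of_nonneg[OF tent_props(1)[OF \<rho>(1)]] mult.commute)
      next
        assume "norm y \<ge> \<rho>" then show ?thesis by (simp add: tent_props(3)[OF \<rho>(1)])
      qed
    next
      case False
      have "norm z \<le> norm (z + y) + norm y" using norm_triangle_ineq4[of "z + y" y] by simp
      then have "norm (z + y) > 10" using False \<rho> by linarith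
      then show ?thesis using False by (simp add: h0)
    qed
    have V: "N * (LINT z|lborel. h z) = (LINT z|lborel. k z)"
    proof -
      have "(LINT z|lborel. k z) = (LINT y|lborel. LINT z|lborel. tent \<rho> y * h (z + y))"
        unfolding k_def
      proof (rule Fubini_dominated)
        show "integrable lborel (\<lambda>z::quad. indicator (cball 0 12) z * M ^ 4)" using ic by simp
        show "integrable lborel (tent \<rho> :: quad \<Rightarrow> real)" by (rule ti)
        show "norm (tent \<rho> y * h (z + y)) \<le> indicator (cball 0 12) z * M ^ 4 * tent \<rho> y" for z y using th by simp
      qed measurable
      also have "\<dots> = (LINT y|lborel. tent \<rho> (y::quad) * (LINT z|lborel. h z))"
        by (simp add: integral_lborel_shift)
      finally show ?thesis by (simp add: N_def)
    qed
    have ti': "integrable lborel (\<lambda>y. tent \<rho> y * h (z + y))" for z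
      by (rule Bochner_Integration.integrable_bound[of _ "\<lambda>y. indicator (cball 0 12) z * M ^ 4 * tent \<rho> y"])
         (use ti th[of _ z] in \<open>auto intro!: AE_I2 intro: order_trans[OF _ abs_ge_self]\<close>)
    have kb: "\<bar>k z\<bar> \<le> N * (indicator (cball 0 12) z * M ^ 4)" for z
    proof -
      have "\<bar>k z\<bar> \<le> (LINT y|lborel. indicator (cball 0 12) z * M ^ 4 * tent \<rho> (y::quad))"
        unfolding k_def by (rule integral_abs_bound_integral) (use ti ti' th in auto)
      then show ?thesis by (simp add: N_def mult.commute)
    qed
    define bad where "bad = {z \<in> cball 0 12. \<bar>quad_jac u z\<bar> \<le> \<epsilon>}"
    have [measurable]: "quad_jac u \<in> borel_measurable borel" by (rule borel_measurable_continuous_onI[OF quad_jac_continuous])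
    have [measurable]: "cball (0::quad) 12 \<in> sets borel" "cball quad_base 20 \<in> sets borel" by simp_all
    have bm[measurable]: "bad \<in> sets borel" unfolding bad_def by measurable
    have bad_le: "measure lborel bad \<le> 2 * \<delta> * B40"
    proof -
      have nb: "norm quad_base \<le> 8"
      proof -
        have "norm quad_base \<le> norm (0 :: plane) + norm (-1::real, 1::real) + norm (-1::real, -1::real) + norm (-1::real, 0::real)"
          unfolding quad_base_def by (rule norm_quad_le)
        also have "\<dots> \<le> 0 + (1 + 1) + (1 + 1) + 1"
          by (intro add_mono order_trans[OF norm_Pair_le]) auto
        finally show ?thesis by simp
      qed
      have sub': "bad \<subseteq> {z \<in> cball quad_base 20. \<bar>quad_jac u z\<bar> \<le> \<epsilon>}"
      proof
        fix z assume z: "z \<in> bad"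
        then have "norm z \<le> 12" by (simp add: bad_def)
        with nb have "norm (quad_base - z) \<le> 20" using norm_triangle_ineq4[of quad_base z] by linarith
        then show "z \<in> {z \<in> cball quad_base 20. \<bar>quad_jac u z\<bar> \<le> \<epsilon>}" using z by (simp add: bad_def dist_norm)
      qed
      have "emeasure lborel bad \<le> emeasure lborel {z \<in> cball quad_base 20. \<bar>quad_jac u z\<bar> \<le> \<epsilon>}"
        by (rule emeasure_mono[OF sub']) measurable
      also have "\<dots> \<le> ennreal (2 * \<delta>) * emeasure lborel (cball quad_base (2 * 20))"
      proof (rule sub)
        have "Cs * \<epsilon> \<le> K * \<epsilon>" using K2 \<epsilon> by (intro mult_right_mono) auto
        then show "Cs * \<epsilon> \<le> \<delta> ^ 32" using K\<epsilon> by simp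
      qed (use quad_jac_polyfun quad_jac_base[OF u(1)] \<delta> in auto)
      also have "\<dots> = ennreal (2 * \<delta> * B40)"
        using emeasure_bounded_finite[of "cball quad_base 40"] \<delta> unfolding B40_def
        by (simp add: emeasure_eq_ennreal_measure ennreal_mult)
      finally show ?thesis unfolding measure_def using \<delta> B0 by (intro enn2real_leI) auto
    qed
    define E where "E = M ^ 3 * \<eta> + D * (M ^ 4 * (2 * K0 * s / \<epsilon>) / \<rho> + 3 * LW * \<rho> * M ^ 4 + 12 * M ^ 3 * \<Lambda> * K0 * \<rho> * (2 * K0 * s / \<epsilon>))"
    have E0: "0 \<le> E" unfolding E_def using M0 \<Lambda>0 LW0 \<eta>0 \<rho> s \<epsilon> K0 D1 by (intro add_nonneg_nonneg mult_nonneg_nonneg divide_nonneg_pos) auto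
    have kb': "\<bar>k z\<bar> \<le> N * (M ^ 4 * indicator bad z + E * indicator (cball 0 12) z)" for z
    proof (cases "norm z \<le> 12 \<and> \<bar>quad_jac u z\<bar> > \<epsilon>")
      case False
      have "N * (indicator (cball 0 12) z * M ^ 4) \<le> N * (M ^ 4 * indicator bad z + E * indicator (cball 0 12) z)"
        using False N0 E0 M0 by (intro mult_left_mono) (auto simp: bad_def split: split_indicator)
      then show ?thesis using kb[of z] by linarith
    next
      case True
      have "2 * K0 * s / \<epsilon> \<le> K * s / \<epsilon>" using K2 s \<epsilon> by (intro divide_right_mono mult_right_mono) auto
      then have "2 * K0 * s / \<epsilon> \<le> \<rho>" using Ks by linarith
      then have "\<bar>k z\<bar> \<le> N * E"
        unfolding k_def h_def N_def E_def D_def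
        using sh[OF u, of z] True \<epsilon> by (intro local_quad_bound K0 W1 WL FM FL Fav \<rho> s) auto
      moreover have "N * E \<le> N * (M ^ 4 * indicator bad z + E * indicator (cball 0 12) z)"
        using True N0 M0 by (intro mult_left_mono) (auto split: split_indicator)
      ultimately show ?thesis by linarith
    qed
    have bfin: "emeasure lborel bad < \<infinity>"
      by (rule emeasure_bounded_finite, rule bounded_subset[of "cball 0 12"]) (auto simp: bad_def)
    have ii: "integrable lborel (\<lambda>z. N * (M ^ 4 * indicator bad z + E * indicator (cball 0 12) z))"
      using bfin ic[of 12] by (intro integrable_mult_right Bochner_Integration.integrable_add) (auto simp: integrable_indicator_iff)
    have ik: "integrable lborel k"
      by (rule Bochner_Integration.integrable_bound[OF ii])
         (use kb' in \<open>auto simp: k_def[abs_def] intro!: AE_I2 intro: order_trans[OF _ abs_ge_self]\<close>)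
    have "N * \<bar>LINT z|lborel. h z\<bar> = \<bar>LINT z|lborel. k z\<bar>" unfolding V[symmetric] using N0 by (simp add: abs_mult)
    also have "\<dots> \<le> (LINT z|lborel. N * (M ^ 4 * indicator bad z + E * indicator (cball 0 12) z))"
      by (rule integral_abs_bound_integral[OF ik ii kb'])
    also have "\<dots> = N * (M ^ 4 * measure lborel bad + E * B12)"
      using bfin ic[of 12] by (simp add: B12_def integrable_indicator_iff)
    finally have "\<bar>LINT z|lborel. h z\<bar> \<le> M ^ 4 * measure lborel bad + E * B12" using N0 by simp
    also have "\<dots> \<le> M ^ 4 * (2 * \<delta> * B40) + E * B12" using bad_le M0 E0 by (intro add_mono mult_left_mono) auto
    also have "\<dots> \<le> K * (M ^ 4 * \<delta>) + K * (M ^ 3 * \<eta> + M ^ 4 * (s / \<epsilon>) / \<rho> + LW * \<rho> * M ^ 4 + M ^ 3 * \<Lambda> * \<rho> * (s / \<epsilon>))"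
    proof (rule add_mono)
      show "M ^ 4 * (2 * \<delta> * B40) \<le> K * (M ^ 4 * \<delta>)"
        using mult_right_mono[OF K2(3), of "M ^ 4 * \<delta>"] M0 \<delta> by (simp add: mult_ac)
      define p1 p2 p3 p4 where "p1 = M ^ 3 * \<eta>" and "p2 = M ^ 4 * (s / \<epsilon>) / \<rho>" and "p3 = LW * \<rho> * M ^ 4" and "p4 = M ^ 3 * \<Lambda> * \<rho> * (s / \<epsilon>)"
      have p: "0 \<le> p1" "0 \<le> p2" "0 \<le> p3" "0 \<le> p4" using M0 \<Lambda>0 LW0 \<eta>0 \<rho> s \<epsilon> by (auto simp: p1_def p2_def p3_def p4_def)
      have Ee: "E = p1 + D * (2 * K0 * p2 + 3 * p3 + 24 * K0\<^sup>2 * p4)"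
        by (simp add: E_def p1_def p2_def p3_def p4_def power2_eq_square mult_ac)
      have KK: "1 \<le> K0\<^sup>2" "K0 \<le> K0\<^sup>2" using K0 by (auto simp: power2_eq_square mult_ge1_I)
      have DK: "1 \<le> D * K0\<^sup>2" using mult_mono[OF D1 KK(1)] D1 by simp
      have "E \<le> (24 * K0\<^sup>2 * D) * (p1 + p2 + p3 + p4)"
      proof -
        have "p1 \<le> (24 * K0\<^sup>2 * D) * p1" using DK p(1) mult_right_mono[of 1 "24 * K0\<^sup>2 * D" p1] by (simp add: mult_ac)
        moreover have "D * (2 * K0 * p2) \<le> (24 * K0\<^sup>2 * D) * p2"
          using mult_right_mono[of "2 * K0" "24 * K0\<^sup>2" "D * p2"] KK p D1 K0 by (simp add: mult_ac)
        moreover have "D * (3 * p3) \<le> (24 * K0\<^sup>2 * D) * p3"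
          using mult_right_mono[of "3" "24 * K0\<^sup>2" "D * p3"] KK p D1 by (simp add: mult_ac)
        moreover have "D * (24 * K0\<^sup>2 * p4) = (24 * K0\<^sup>2 * D) * p4" by simp
        ultimately show ?thesis unfolding Ee distrib_left by linarith
      qed
      then have "E * B12 \<le> (24 * K0\<^sup>2 * D) * (p1 + p2 + p3 + p4) * (B12 + 1)"
        using p B0 E0 D1 K0 by (intro mult_mono) auto
      also have "\<dots> = (24 * K0\<^sup>2 * D * (B12 + 1)) * (p1 + p2 + p3 + p4)" by simp
      also have "\<dots> \<le> K * (p1 + p2 + p3 + p4)" using K24 p by (intro mult_right_mono) auto
      finally show "E * B12 \<le> K * (M ^ 3 * \<eta> + M ^ 4 * (s / \<epsilon>) / \<rho> + LW * \<rho> * M ^ 4 + M ^ 3 * \<Lambda> * \<rho> * (s / \<epsilon>))"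
        by (simp add: p1_def p2_def p3_def p4_def)
    qed
    also have "\<dots> = K * (M ^ 4 * \<delta> + M ^ 3 * \<eta> + M ^ 4 * (s / \<epsilon>) / \<rho> + LW * \<rho> * M ^ 4 + M ^ 3 * \<Lambda> * \<rho> * (s / \<epsilon>))"
      by (simp add: algebra_simps)
    finally show ?thesis unfolding h_def .
  qed
  moreover have "K \<ge> 1" using K2 K0 by linarith
  ultimately show thesis by (rule that[rotated])
qed

section \<open>Cauchy-Schwarz\<close>

lemma Cauchy_Schwarz_integral:
  fixes f g :: "'a \<Rightarrow> real"
  assumes [measurable]: "f \<in> borel_measurable M" "g \<in> borel_measurable M"
    and f: "integrable M (\<lambda>x. (f x)\<^sup>2)" and g: "integrable M (\<lambda>x. (g x)\<^sup>2)"
  shows "(LINT x|M. f x * g x)\<^sup>2 \<le> (LINT x|M. (f x)\<^sup>2) * (LINT x|M. (g x)\<^sup>2)"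
proof -
  have "ennreal \<bar>LINT x|M. f x * g x\<bar> \<le> (\<integral>\<^sup>+x. ennreal \<bar>f x\<bar> * ennreal \<bar>g x\<bar> \<partial>M)"
    using ennreal_norm_integral_le[of M "\<lambda>x. f x * g x"] by (simp add: abs_mult ennreal_mult)
  then have "(ennreal \<bar>LINT x|M. f x * g x\<bar>)\<^sup>2 \<le> (\<integral>\<^sup>+x. ennreal \<bar>f x\<bar> * ennreal \<bar>g x\<bar> \<partial>M)\<^sup>2"
    by (rule power_mono) simp
  also have "\<dots> \<le> (\<integral>\<^sup>+x. (ennreal \<bar>f x\<bar>)\<^sup>2 \<partial>M) * (\<integral>\<^sup>+x. (ennreal \<bar>g x\<bar>)\<^sup>2 \<partial>M)"
    by (rule Cauchy_Schwarz_nn_integral) measurable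
  also have "(\<lambda>x. (ennreal \<bar>f x\<bar>)\<^sup>2) = (\<lambda>x. ennreal ((f x)\<^sup>2))" by (simp add: ennreal_power fun_eq_iff)
  also have "(\<lambda>x. (ennreal \<bar>g x\<bar>)\<^sup>2) = (\<lambda>x. ennreal ((g x)\<^sup>2))" by (simp add: ennreal_power fun_eq_iff)
  finally have "ennreal ((LINT x|M. f x * g x)\<^sup>2) \<le> ennreal ((LINT x|M. (f x)\<^sup>2) * (LINT x|M. (g x)\<^sup>2))"
    using f g by (simp add: nn_integral_eq_integral ennreal_mult ennreal_power)
  then show ?thesis by (simp add: ennreal_le_iff)
qed

lemma lipschitz_mult:
  fixes f g :: "'a::real_normed_vector \<Rightarrow> real"
  assumes "\<And>x. \<bar>f x\<bar> \<le> 1" "\<And>x. \<bar>g x\<bar> \<le> 1" "\<And>x y. \<bar>f x - f y\<bar> \<le> a * norm (x - y)" "\<And>x y. \<bar>g x - g y\<bar> \<le> b * norm (x - y)"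
  shows "\<bar>f x * g x - f y * g y\<bar> \<le> (a + b) * norm (x - y)"
proof -
  have "f x * g x - f y * g y = (f x - f y) * g x + f y * (g x - g y)" by (simp add: algebra_simps)
  also have "\<bar>\<dots>\<bar> \<le> \<bar>f x - f y\<bar> * \<bar>g x\<bar> + \<bar>f y\<bar> * \<bar>g x - g y\<bar>"
    by (rule order_trans[OF abs_triangle_ineq]) (simp add: abs_mult)
  also have "\<dots> \<le> (a * norm (x - y)) * 1 + 1 * (b * norm (x - y))"
    by (intro add_mono mult_mono assms order_trans[OF abs_ge_zero assms(3)] order_trans[OF abs_ge_zero assms(4)]) auto
  finally show ?thesis by (simp add: distrib_right)
qed

lemma norm_Bu: "0 \<le> u \<Longrightarrow> u \<le> 1 \<Longrightarrow> norm (Bu u t) \<le> norm t"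
proof -
  assume u: "0 \<le> u" "u \<le> 1"
  have u2: "u\<^sup>2 \<le> 1" "(u\<^sup>2)\<^sup>2 \<le> 1" using u by (auto intro!: power_le_one)
  have "(u * fst t)\<^sup>2 + (u\<^sup>2 * snd t)\<^sup>2 \<le> (fst t)\<^sup>2 + (snd t)\<^sup>2"
    unfolding power_mult_distrib using u2 by (intro add_mono mult_left_le_one_le) auto
  then show ?thesis by (simp add: norm_prod_def Bu_def)
qed

lemma Bu_add: "Bu u (s + t) = Bu u s + Bu u t"
  by (simp add: Bu_def algebra_simps)

lemma Bu_measurable [measurable]: "Bu u \<in> borel_measurable borel"
  unfolding Bu_def by (intro borel_measurable_continuous_onI continuous_intros)

lemma power_sum_map_measurable [measurable]: "power_sum_map \<in> borel_measurable borel"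
  unfolding power_sum_map_def by (intro borel_measurable_continuous_onI continuous_intros)

text \<open>The cutoffs of the four parameters, times a bump in x. The bump dominates, up to a
  factor 2, the indicator of a ball around the unit square, and unlike that indicator it is
  Lipschitz, as \<open>quad_form_bound\<close> demands.\<close>

definition quad_weight :: "(plane \<Rightarrow> real) \<Rightarrow> quad \<Rightarrow> real" where
  "quad_weight \<phi> z = tent 3 (fst (fst z)) * \<phi> (snd (fst z)) * \<phi> (snd (fst z) + snd (snd z)) * \<phi> (fst (snd z)) * \<phi> (fst (snd z) + snd (snd z))"

text \<open>The five factors have Lipschitz constants 1, L, 2 L, L and 2 L, together at most 10 L.
  On the support s is a difference of two points of norm at most 3/2, so norm z is at most 3 + 3/2 +
  3/2 + 3 < 10.\<close>

lemma quad_weight_props: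
  assumes \<phi>: "\<And>t. 0 \<le> \<phi> t" "\<And>t. \<phi> t \<le> 1" "\<And>t. norm t > 3/2 \<Longrightarrow> \<phi> t = 0" and L: "\<And>s t. \<bar>\<phi> s - \<phi> t\<bar> \<le> L * norm (s - t)" and L1: "L \<ge> 1"
  shows "\<bar>quad_weight \<phi> z\<bar> \<le> 1" "\<bar>quad_weight \<phi> z - quad_weight \<phi> z'\<bar> \<le> 10 * L * norm (z - z')" "norm z > 10 \<Longrightarrow> quad_weight \<phi> z = 0"
proof -
  have a\<phi>: "\<bar>\<phi> t\<bar> \<le> 1" for t using \<phi> by (simp add: abs_le_iff)
  have t1: "\<bar>tent 3 (x :: plane)\<bar> \<le> 1" for x using tent_props(1,2)[of 3 x] by simp
  have m1: "\<bar>a * b\<bar> \<le> 1" if "\<bar>a\<bar> \<le> 1" "\<bar>b\<bar> \<le> 1" for a b :: real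
    using mult_mono[OF that] by (simp add: abs_mult)
  show "\<bar>quad_weight \<phi> z\<bar> \<le> 1" unfolding quad_weight_def by (intro m1 t1 a\<phi>)
  have part: "norm (fst (fst z) - fst (fst z')) \<le> norm (z - z')" "norm (snd (fst z) - snd (fst z')) \<le> norm (z - z')"
     "norm (fst (snd z) - fst (snd z')) \<le> norm (z - z')" "norm (snd (snd z) - snd (snd z')) \<le> norm (z - z')" for z z' :: quad
  proof -
    have "z - z' = ((fst (fst z) - fst (fst z'), snd (fst z) - snd (fst z')), (fst (snd z) - fst (snd z'), snd (snd z) - snd (snd z')))"
      by (simp add: prod_eq_iff)
    then have "norm (((fst (fst z) - fst (fst z'), snd (fst z) - snd (fst z')), (fst (snd z) - fst (snd z'), snd (snd z) - snd (snd z'))) :: quad) \<le> norm (z - z')"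
      by simp
    from norm_quad_parts[OF this] show "norm (fst (fst z) - fst (fst z')) \<le> norm (z - z')" "norm (snd (fst z) - snd (fst z')) \<le> norm (z - z')"
     "norm (fst (snd z) - fst (snd z')) \<le> norm (z - z')" "norm (snd (snd z) - snd (snd z')) \<le> norm (z - z')" .
  qed
  have l1: "\<bar>tent 3 (fst (fst z)) - tent 3 (fst (fst z'))\<bar> \<le> 1 * norm (z - z')" for z z' :: quad
  proof -
    have "\<bar>tent 3 (fst (fst z)) - tent 3 (fst (fst z'))\<bar> \<le> norm (fst (fst z) - fst (fst z')) / 3" by (rule tent_props(4)) simp
    then show ?thesis using part(1)[of z z'] norm_ge_zero[of "fst (fst z) - fst (fst z')"] by linarith
  qed
  have l2: "\<bar>\<phi> (snd (fst z)) - \<phi> (snd (fst z'))\<bar> \<le> L * norm (z - z')" for z z' :: quad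
    by (rule order_trans[OF L]) (use part L1 in \<open>intro mult_left_mono, auto\<close>)
  have l3: "\<bar>\<phi> (snd (fst z) + snd (snd z)) - \<phi> (snd (fst z') + snd (snd z'))\<bar> \<le> (2 * L) * norm (z - z')" for z z' :: quad
  proof -
    have "norm ((snd (fst z) + snd (snd z)) - (snd (fst z') + snd (snd z'))) \<le> 2 * norm (z - z')"
      using norm_triangle_ineq[of "snd (fst z) - snd (fst z')" "snd (snd z) - snd (snd z')"] part[of z z'] by (simp add: algebra_simps)
    then have "L * norm ((snd (fst z) + snd (snd z)) - (snd (fst z') + snd (snd z'))) \<le> L * (2 * norm (z - z'))" using L1 by (intro mult_left_mono) auto
    then show ?thesis by (intro order_trans[OF L]) simp
  qed
  have l4: "\<bar>\<phi> (fst (snd z)) - \<phi> (fst (snd z'))\<bar> \<le> L * norm (z - z')" for z z' :: quad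
    by (rule order_trans[OF L]) (use part L1 in \<open>intro mult_left_mono, auto\<close>)
  have l5: "\<bar>\<phi> (fst (snd z) + snd (snd z)) - \<phi> (fst (snd z') + snd (snd z'))\<bar> \<le> (2 * L) * norm (z - z')" for z z' :: quad
  proof -
    have "norm ((fst (snd z) + snd (snd z)) - (fst (snd z') + snd (snd z'))) \<le> 2 * norm (z - z')"
      using norm_triangle_ineq[of "fst (snd z) - fst (snd z')" "snd (snd z) - snd (snd z')"] part[of z z'] by (simp add: algebra_simps)
    then have "L * norm ((fst (snd z) + snd (snd z)) - (fst (snd z') + snd (snd z'))) \<le> L * (2 * norm (z - z'))" using L1 by (intro mult_left_mono) auto
    then show ?thesis by (intro order_trans[OF L]) simp
  qed
  have "\<bar>quad_weight \<phi> z - quad_weight \<phi> z'\<bar> \<le> ((((1 + L) + 2 * L) + L) + 2 * L) * norm (z - z')"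
    unfolding quad_weight_def by (intro lipschitz_mult m1 t1 a\<phi> l1 l2 l3 l4 l5)
  also have "\<dots> \<le> (10 * L) * norm (z - z')" using L1 by (intro mult_right_mono) auto
  finally show "\<bar>quad_weight \<phi> z - quad_weight \<phi> z'\<bar> \<le> 10 * L * norm (z - z')" .
  show "quad_weight \<phi> z = 0" if z: "norm z > 10"
  proof (rule ccontr)
    assume "quad_weight \<phi> z \<noteq> 0"
    then have nz: "tent 3 (fst (fst z)) \<noteq> 0" "\<phi> (snd (fst z)) \<noteq> 0" "\<phi> (snd (fst z) + snd (snd z)) \<noteq> 0" "\<phi> (fst (snd z)) \<noteq> 0"
      by (auto simp: quad_weight_def)
    have "norm (fst (fst z)) < 3" using nz(1) tent_props(3)[of 3 "fst (fst z)"] by force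
    moreover have b: "norm (snd (fst z)) \<le> 3/2" "norm (snd (fst z) + snd (snd z)) \<le> 3/2" "norm (fst (snd z)) \<le> 3/2"
      using nz(2-4) \<phi>(3) not_le by blast+
    moreover have "norm (snd (snd z)) \<le> norm (snd (fst z) + snd (snd z)) + norm (snd (fst z))"
      using norm_triangle_ineq4[of "snd (fst z) + snd (snd z)" "snd (fst z)"] by simp
    moreover have "norm z \<le> norm (fst (fst z)) + norm (snd (fst z)) + norm (fst (snd z)) + norm (snd (snd z))"
      using norm_quad_le[of "fst (fst z)" "snd (fst z)" "fst (snd z)" "snd (snd z)"] by simp
    ultimately show False using z by linarith
  qed
qed

lemma integrable_mult_indicator_bounded:
  fixes f :: "'a::euclidean_space \<Rightarrow> real"
  assumes [measurable]: "f \<in> borel_measurable borel" and "\<And>x. \<bar>f x\<bar> \<le> C * indicator (cball 0 r) x"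
  shows "integrable lborel f"
proof (rule Bochner_Integration.integrable_bound)
  show "integrable lborel (\<lambda>x::'a. C * indicator (cball 0 r) x)"
    using emeasure_bounded_finite[of "cball (0::'a) r"] by (intro integrable_mult_right) (simp add: integrable_indicator_iff)
  show "AE x in lborel. norm (f x) \<le> norm (C * indicator (cball 0 r) x)"
    using assms(2) by (intro AE_I2) (auto intro: order_trans[OF _ abs_ge_self])
qed simp

text \<open>In the non-integrable case the left side is 0 by default.\<close>

lemma integral_bound_cball:
  fixes f :: "'a::euclidean_space \<Rightarrow> real"
  assumes b: "\<And>x. \<bar>f x\<bar> \<le> C * indicator (cball 0 r) x" and C: "0 \<le> C"
  shows "\<bar>LINT x|lborel. f x\<bar> \<le> C * measure lborel (cball (0::'a) r)"
proof -
  have i: "integrable lborel (\<lambda>x::'a. C * indicator (cball 0 r) x)"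
    using emeasure_bounded_finite[of "cball (0::'a) r"] by (intro integrable_mult_right) (simp add: integrable_indicator_iff)
  have "\<bar>LINT x|lborel. f x\<bar> \<le> (LINT x|lborel. C * indicator (cball (0::'a) r) x)"
  proof (cases "integrable lborel f")
    case True then show ?thesis by (intro integral_abs_bound_integral i b)
  next
    case False
    have "0 \<le> (LINT x|lborel. C * indicator (cball (0::'a) r) x)"
      by (rule Bochner_Integration.integral_nonneg) (simp add: C)
    then show ?thesis using False by (simp add: not_integrable_integral_eq)
  qed
  then show ?thesis by simp
qed

text \<open>The order x, s, t, t' puts the doubled parameters innermost, so that for fixed x and s
  the double integral can be recognised as a square.\<close>

lemma quad_integral_iterated:
  fixes k :: "quad \<Rightarrow> real"
  assumes kc: "continuous_on UNIV k" and k0: "\<And>z. norm z > r \<Longrightarrow> k z = 0" and kM: "\<And>z. \<bar>k z\<bar> \<le> C"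
  shows "(LINT z|lborel. k z) = (LINT x|lborel. LINT s|lborel. LINT t|lborel. LINT t'|lborel. k ((x, t), (t', s)))"
proof -
  have C0: "0 \<le> C" using order_trans[OF abs_ge_zero kM] .
  have kb: "\<bar>k ((x, t), (t', s))\<bar> \<le> C * indicator (cball 0 r) x * indicator (cball 0 r) t * indicator (cball 0 r) t' * indicator (cball 0 r) s" for x t t' s
  proof (cases "norm (((x, t), (t', s)) :: quad) > r")
    case True then show ?thesis using k0 C0 by simp
  next
    case False
    then have "norm x \<le> r" "norm t \<le> r" "norm t' \<le> r" "norm s \<le> r" using norm_quad_parts[of x t t' s r] by auto
    then show ?thesis using kM by simp
  qed
  have ib: "integrable lborel (\<lambda>x::plane. indicator (cball 0 r) x :: real)"
    using emeasure_bounded_finite[of "cball (0::plane) r"] by (simp add: integrable_indicator_iff)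
  define m where "m = measure lborel (cball (0::plane) r)"
  have [measurable]: "k \<in> borel_measurable borel" by (rule borel_measurable_continuous_onI[OF kc])
  have kk: "(\<lambda>q. k ((x, t), q)) \<in> borel_measurable borel" for x t
    by (rule borel_measurable_continuous_onI) (rule continuous_on_compose2[OF kc], auto intro!: continuous_intros)
  have k4: "(\<lambda>(t, t', s). k ((x, t), (t', s))) \<in> borel_measurable borel" for x
    by (rule borel_measurable_continuous_onI, unfold case_prod_unfold) (rule continuous_on_compose2[OF kc], auto intro!: continuous_intros)
  have ki: "integrable lborel k" by (rule integrable_continuous_bounded_support[OF kc k0])
  have "(LINT z|lborel. k z) = integral\<^sup>L (lborel \<Otimes>\<^sub>M lborel) k" by (simp add: lborel_prod)
  also have "\<dots> = (LINT p|lborel. LINT q|lborel. k (p, q))"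
    using ki by (intro lborel_pair.integral_fst'[symmetric]) (simp add: lborel_prod)
  also have "\<dots> = integral\<^sup>L (lborel \<Otimes>\<^sub>M lborel) (\<lambda>p. LINT q|lborel. k (p, q))" by (simp add: lborel_prod)
  also have "\<dots> = (LINT x|lborel. LINT t|lborel. LINT q|lborel. k ((x, t), q))"
  proof (rule lborel_pair.integral_fst'[symmetric])
    have "integrable lborel (\<lambda>p. LINT q|lborel. k (p, q))"
      using lborel_pair.integrable_fst'[of k] ki by (simp add: lborel_prod)
    then show "integrable (lborel \<Otimes>\<^sub>M lborel) (\<lambda>p. LINT q|lborel. k (p, q))" by (simp add: lborel_prod)
  qed
  also have "\<dots> = (LINT x|lborel. LINT t|lborel. LINT t'|lborel. LINT s|lborel. k ((x, t), (t', s)))"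
  proof (intro Bochner_Integration.integral_cong refl)
    fix x t :: "plane"
    have "integrable lborel (\<lambda>q. k ((x, t), q))"
    proof (rule integrable_continuous_bounded_support[of _ r])
      show "continuous_on UNIV (\<lambda>q. k ((x, t), q))" by (rule continuous_on_compose2[OF kc]) (auto intro!: continuous_intros)
      show "k ((x, t), q) = 0" if "norm q > r" for q
        using that norm_snd_le[of q "(x, t)"] by (intro k0) linarith
    qed
    then have "integral\<^sup>L (lborel \<Otimes>\<^sub>M lborel) (\<lambda>q. k ((x, t), q)) = (LINT t'|lborel. LINT s|lborel. k ((x, t), (t', s)))"
      by (intro lborel_pair.integral_fst'[symmetric]) (simp add: lborel_prod)
    then show "(LINT q|lborel. k ((x, t), q)) = (LINT t'|lborel. LINT s|lborel. k ((x, t), (t', s)))" by (simp add: lborel_prod)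
  qed
  also have "\<dots> = (LINT x|lborel. LINT t|lborel. LINT s|lborel. LINT t'|lborel. k ((x, t), (t', s)))"
  proof (rule Bochner_Integration.integral_cong, rule refl, rule Bochner_Integration.integral_cong, rule refl)
    fix x t :: "plane"
    show "(LINT t'|lborel. LINT s|lborel. k ((x, t), (t', s))) = (LINT s|lborel. LINT t'|lborel. k ((x, t), (t', s)))"
    proof (rule Fubini_dominated)
      show "(\<lambda>(t', s). k ((x, t), (t', s))) \<in> borel_measurable (borel \<Otimes>\<^sub>M borel)"
        using kk[of x t] by (simp add: borel_prod case_prod_beta')
      show "norm (k ((x, t), (t', s))) \<le> (C * indicator (cball 0 r) t') * indicator (cball 0 r) s" for t' s
        using kb[of x t t' s] C0 by (auto split: split_indicator_asm)
    qed (use ib in auto)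
  qed
  also have "\<dots> = (LINT x|lborel. LINT s|lborel. LINT t|lborel. LINT t'|lborel. k ((x, t), (t', s)))"
  proof (rule Bochner_Integration.integral_cong, rule refl)
    fix x :: "plane"
    show "(LINT t|lborel. LINT s|lborel. LINT t'|lborel. k ((x, t), (t', s))) = (LINT s|lborel. LINT t|lborel. LINT t'|lborel. k ((x, t), (t', s)))"
    proof (rule Fubini_dominated)
      have "(\<lambda>q. k ((x, fst (fst q)), (snd q, snd (fst q)))) \<in> borel_measurable borel"
        by (rule borel_measurable_continuous_onI) (rule continuous_on_compose2[OF kc], auto intro!: continuous_intros)
      then have "(\<lambda>q. k ((x, fst (fst q)), (snd q, snd (fst q)))) \<in> borel_measurable ((borel \<Otimes>\<^sub>M borel) \<Otimes>\<^sub>M lborel)"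
        by (simp add: borel_prod cong: measurable_cong_sets)
      then have "(\<lambda>p. LINT t'|lborel. k ((x, fst p), (t', snd p))) \<in> borel_measurable (borel \<Otimes>\<^sub>M borel)"
        by (intro lborel.borel_measurable_lebesgue_integral) (simp add: case_prod_beta')
      then show "(\<lambda>(t, s). LINT t'|lborel. k ((x, t), (t', s))) \<in> borel_measurable (borel \<Otimes>\<^sub>M borel)"
        by (simp add: case_prod_beta')
      show "norm (LINT t'|lborel. k ((x, t), (t', s))) \<le> (C * m * indicator (cball 0 r) t) * indicator (cball 0 r) s" for t s
      proof -
        have "\<bar>LINT t'|lborel. k ((x, t), (t', s))\<bar> \<le> (C * indicator (cball 0 r) t * indicator (cball 0 r) s) * m"
          unfolding m_def
        proof (rule integral_bound_cball)
          show "\<bar>k ((x, t), (t', s))\<bar> \<le> C * indicator (cball 0 r) t * indicator (cball 0 r) s * indicator (cball 0 r) t'" for t'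
            using kb[of x t t' s] C0 by (auto split: split_indicator_asm split_indicator)
        qed (use C0 in simp)
        then show ?thesis by (simp add: mult_ac)
      qed
    qed (use ib in auto)
  qed
  finally show ?thesis .
qed

text \<open>Two applications of the Cauchy-Schwarz inequality, removing first \<open>f\<close> and then \<open>h\<close>.\<close>

proposition form_le_quad:
  fixes h f F \<phi> :: "plane \<Rightarrow> real"
  assumes u: "0 \<le> u" "u \<le> 1" and [measurable]: "h \<in> borel_measurable borel" and h: "\<And>x. \<bar>h x\<bar> \<le> indicator unit_square x"
    and [measurable]: "f \<in> borel_measurable borel" and f2: "integrable lborel (\<lambda>x. (f x)\<^sup>2)"
    and Fc: "continuous_on UNIV F" and FM: "\<And>p. \<bar>F p\<bar> \<le> M"
    and \<phi>c: "continuous_on UNIV \<phi>" and \<phi>: "\<And>t. 0 \<le> \<phi> t" "\<And>t. \<phi> t \<le> 1" "\<And>t. norm t > 3/2 \<Longrightarrow> \<phi> t = 0"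
    and Wb: "\<And>z. \<bar>quad_weight \<phi> z\<bar> \<le> 1" "\<And>z. norm z > 10 \<Longrightarrow> quad_weight \<phi> z = 0"
  shows "(LINT x|lborel. LINT t|lborel. h x * f (x + Bu u t) * F (x + power_sum_map t) * \<phi> t) ^ 4
     \<le> 100 * (LINT x|lborel. (f x)\<^sup>2)\<^sup>2 * (LINT z|lborel. quad_weight \<phi> z * quad_prod u F z)"
proof -
  define m where "m r = measure lborel (cball (0::plane) r)" for r
  have mpos: "0 \<le> m r" for r by (simp add: m_def)
  have M0: "0 \<le> M" using order_trans[OF abs_ge_zero FM] .
  have [measurable]: "F \<in> borel_measurable borel" "\<phi> \<in> borel_measurable borel"
    using Fc \<phi>c by (auto intro: borel_measurable_continuous_onI)
  have ib: "integrable lborel (\<lambda>x::plane. indicator (cball 0 r) x :: real)" for r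
    using emeasure_bounded_finite[of "cball (0::plane) r"] by (simp add: integrable_indicator_iff)
  have [measurable]: "cball (0 :: plane) r \<in> sets borel" for r by simp
  have hb: "\<bar>h x\<bar> \<le> indicator (cball 0 (3/2)) x" for x
  proof (cases "x \<in> unit_square")
    case True
    have "(fst x)\<^sup>2 \<le> 1" "(snd x)\<^sup>2 \<le> 1" using True by (auto intro!: power_le_one)
    then have "(norm x)\<^sup>2 \<le> (3/2)\<^sup>2" by (simp add: norm_prod_def power2_eq_square)
    then have "norm x \<le> 3/2" by (rule power2_le_imp_le) simp
    then show ?thesis using h[of x] True by simp
  next
    case False then have "h x = 0" using h[of x] by simp
    then show ?thesis by simp
  qed
  have h1: "\<bar>h x\<bar> \<le> 1" for x using h[of x] by (auto split: split_indicator_asm intro: order_trans)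
  have \<phi>b: "\<bar>\<phi> t\<bar> \<le> indicator (cball 0 (3/2)) t" for t
    using \<phi>[of t] by (cases "norm t \<le> 3/2") (auto simp: abs_of_nonneg)
  define A2 where "A2 = (LINT x|lborel. (f x)\<^sup>2)"
  have A0: "0 \<le> A2" unfolding A2_def by (rule Bochner_Integration.integral_nonneg) simp
  define \<Lambda> where "\<Lambda> = (LINT x|lborel. LINT t|lborel. h x * f (x + Bu u t) * F (x + power_sum_map t) * \<phi> t)"
  \<comment> \<open>In the variable v = x + B t the factor f depends on v alone; it can be split
    off, and only the integral of H over t gets squared.\<close>
  define H where "H v t = h (v - Bu u t) * F (v - Bu u t + power_sum_map t) * \<phi> t" for v t
  have Hm[measurable]: "(\<lambda>p. H (fst p) (snd p)) \<in> borel_measurable (borel \<Otimes>\<^sub>M borel)" unfolding H_def by measurable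
  have Hb: "\<bar>H v t\<bar> \<le> M * indicator (cball 0 3) v * indicator (cball 0 (3/2)) t" for v t
  proof (cases "norm t \<le> 3/2 \<and> norm (v - Bu u t) \<le> 3/2")
    case True
    have "norm v \<le> norm (v - Bu u t) + norm (Bu u t)" using norm_triangle_ineq[of "v - Bu u t" "Bu u t"] by simp
    then have "norm v \<le> 3" using True norm_Bu[OF u, of t] by linarith
    moreover have "\<bar>H v t\<bar> \<le> 1 * M * 1"
      unfolding H_def abs_mult using h1 FM M0 \<phi>[of t] by (intro mult_mono) auto
    ultimately show ?thesis using True by simp
  next
    case False
    then have "H v t = 0" using hb[of "v - Bu u t"] \<phi>b[of t] by (auto simp: H_def)
    then show ?thesis using M0 by simp
  qed
  define \<Phi> where "\<Phi> v = (LINT t|lborel. H v t)" for v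
  have [measurable]: "\<Phi> \<in> borel_measurable borel"
    unfolding \<Phi>_def by (rule lborel.borel_measurable_lebesgue_integral) (simp add: case_prod_beta')
  have \<Phi>b: "\<bar>\<Phi> v\<bar> \<le> M * m (3/2) * indicator (cball 0 3) v" for v
  proof -
    have "\<bar>\<Phi> v\<bar> \<le> (M * indicator (cball 0 3) v) * m (3/2)"
      unfolding \<Phi>_def m_def by (rule integral_bound_cball) (use Hb[of v] M0 in auto)
    then show ?thesis by (simp add: mult_ac)
  qed
  have step1: "\<Lambda> = (LINT v|lborel. f v * \<Phi> v)"
  proof -
    let ?G = "\<lambda>t x. h x * f (x + Bu u t) * F (x + power_sum_map t) * \<phi> t"
    have dom: "integrable lborel (\<lambda>x. indicator (cball 0 (3/2)) x + (f (x + w))\<^sup>2)" for w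
      using integrable_lborel_shift[OF f2, of w] ib by (intro Bochner_Integration.integrable_add) auto
    have Gb: "\<bar>?G t x\<bar> \<le> M * indicator (cball 0 (3/2)) t * (indicator (cball 0 (3/2)) x + (f (x + Bu u t))\<^sup>2)" for t x
    proof -
      have "\<bar>h x\<bar> * \<bar>f (x + Bu u t)\<bar> \<le> (h x)\<^sup>2 + (f (x + Bu u t))\<^sup>2"
      proof -
        have "2 * (\<bar>h x\<bar> * \<bar>f (x + Bu u t)\<bar>) \<le> (h x)\<^sup>2 + (f (x + Bu u t))\<^sup>2"
          using sum_squares_bound[of "\<bar>h x\<bar>" "\<bar>f (x + Bu u t)\<bar>"] by simp
        moreover have "0 \<le> \<bar>h x\<bar> * \<bar>f (x + Bu u t)\<bar>" by simp
        ultimately show ?thesis by linarith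
      qed
      also have "(h x)\<^sup>2 \<le> indicator (cball 0 (3/2)) x"
        using power_mono[OF hb[of x] abs_ge_zero, of 2] by (auto split: split_indicator_asm)
      finally have "(\<bar>h x\<bar> * \<bar>f (x + Bu u t)\<bar>) * \<bar>F (x + power_sum_map t)\<bar> * \<bar>\<phi> t\<bar> \<le> (indicator (cball 0 (3/2)) x + (f (x + Bu u t))\<^sup>2) * M * indicator (cball 0 (3/2)) t"
        using FM M0 \<phi>b by (intro mult_mono) auto
      then show ?thesis by (simp add: abs_mult mult_ac)
    qed
    have Gi: "integrable lborel (?G t)" for t
      by (rule Bochner_Integration.integrable_bound[OF integrable_mult_right[OF dom[of "Bu u t"], of "M * indicator (cball 0 (3/2)) t"]])
         (auto intro!: AE_I2 order_trans[OF Gb abs_ge_self])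
    have Gm[measurable]: "(\<lambda>p. ?G (fst p) (snd p)) \<in> borel_measurable (borel \<Otimes>\<^sub>M borel)" by measurable
    have GI: "integrable (lborel \<Otimes>\<^sub>M lborel) (\<lambda>p. ?G (fst p) (snd p))"
    proof (rule lborel_pair.Fubini_integrable)
      show "(\<lambda>p. ?G (fst p) (snd p)) \<in> borel_measurable (lborel \<Otimes>\<^sub>M lborel)" using Gm by (simp cong: measurable_cong_sets)
      show "AE t in lborel. integrable lborel (\<lambda>x. ?G (fst (t, x)) (snd (t, x)))" using Gi by simp
      show "integrable lborel (\<lambda>t. LINT x|lborel. norm (?G (fst (t, x)) (snd (t, x))))"
      proof (rule integrable_mult_indicator_bounded)
        show "(\<lambda>t. LINT x|lborel. norm (?G (fst (t, x)) (snd (t, x)))) \<in> borel_measurable borel"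
          by (rule lborel.borel_measurable_lebesgue_integral) (simp add: case_prod_beta')
        fix t
        have "(LINT x|lborel. \<bar>?G t x\<bar>) \<le> (LINT x|lborel. M * indicator (cball 0 (3/2)) t * (indicator (cball 0 (3/2)) x + (f (x + Bu u t))\<^sup>2))"
          by (rule integral_mono) (use Gi[of t] dom[of "Bu u t"] Gb[where t=t] in \<open>auto simp del: integrable_mult_right_iff intro: integrable_mult_right\<close>)
        also have "\<dots> = M * indicator (cball 0 (3/2)) t * (m (3/2) + A2)"
          using integral_lborel_shift[of "\<lambda>x. (f x)\<^sup>2" "Bu u t"] ib integrable_lborel_shift[OF f2, of "Bu u t"]
          by (simp add: m_def A2_def)
        finally have "(LINT x|lborel. \<bar>?G t x\<bar>) \<le> (M * (m (3/2) + A2)) * indicator (cball 0 (3/2)) t" by (simp add: mult_ac)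
        moreover have "0 \<le> (LINT x|lborel. \<bar>?G t x\<bar>)" by (rule Bochner_Integration.integral_nonneg) simp
        ultimately show "\<bar>LINT x|lborel. norm (?G (fst (t, x)) (snd (t, x)))\<bar> \<le> (M * (m (3/2) + A2)) * indicator (cball 0 (3/2)) t" by simp
      qed
    qed
    have "\<Lambda> = (LINT t|lborel. LINT x|lborel. ?G t x)"
      unfolding \<Lambda>_def using lborel_pair.Fubini_integral[of ?G] GI by (simp add: case_prod_beta')
    also have "\<dots> = (LINT t|lborel. LINT v|lborel. f v * H v t)"
    proof (rule Bochner_Integration.integral_cong, rule refl)
      fix t
      have "(LINT x|lborel. ?G t x) = (LINT v|lborel. ?G t (v + - Bu u t))"
        by (rule integral_lborel_shift[symmetric]) measurable
      then show "(LINT x|lborel. ?G t x) = (LINT v|lborel. f v * H v t)" by (simp add: H_def mult_ac)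
    qed
    also have "\<dots> = (LINT v|lborel. LINT t|lborel. f v * H v t)"
    proof (rule Fubini_dominated)
      show "integrable lborel (\<lambda>t::real\<times>real. M * indicator (cball 0 (3/2)) t)" using ib by simp
      show "integrable lborel (\<lambda>v. indicator (cball 0 3) v * \<bar>f v\<bar>)"
      proof (rule Bochner_Integration.integrable_bound)
        show "integrable lborel (\<lambda>v. indicator (cball 0 3) v + (f v)\<^sup>2)" using f2 ib by simp
        show "AE v in lborel. norm (indicator (cball 0 3) v * \<bar>f v\<bar>) \<le> norm (indicator (cball 0 3) v + (f v)\<^sup>2)"
        proof (intro AE_I2)
          fix v
          have "\<bar>f v\<bar> \<le> 1 + (f v)\<^sup>2"
          proof -
            have "2 * \<bar>f v\<bar> \<le> 1 + (f v)\<^sup>2" using sum_squares_bound[of 1 "\<bar>f v\<bar>"] by simp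
            then show ?thesis by linarith
          qed
          then show "norm (indicator (cball 0 3) v * \<bar>f v\<bar>) \<le> norm (indicator (cball 0 3) v + (f v)\<^sup>2)"
            by (auto simp: abs_of_nonneg split: split_indicator)
        qed
      qed measurable
      have "(\<lambda>p. f (snd p) * H (snd p) (fst p)) \<in> borel_measurable (borel \<Otimes>\<^sub>M borel)" unfolding H_def by measurable
      then show "(\<lambda>(t, v). f v * H v t) \<in> borel_measurable (borel \<Otimes>\<^sub>M borel)" by (simp add: case_prod_beta')
      show "norm (f v * H v t) \<le> M * indicator (cball 0 (3/2)) t * (indicator (cball 0 3) v * \<bar>f v\<bar>)" for t v
        using mult_left_mono[OF Hb[of v t], of "\<bar>f v\<bar>"] by (simp add: abs_mult mult_ac)
    qed
    finally show ?thesis by (simp add: \<Phi>_def)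
  qed
  have \<Phi>2: "integrable lborel (\<lambda>v. (\<Phi> v)\<^sup>2)"
  proof (rule integrable_mult_indicator_bounded)
    show "\<bar>(\<Phi> v)\<^sup>2\<bar> \<le> (M * m (3/2))\<^sup>2 * indicator (cball 0 3) v" for v
      using power_mono[OF \<Phi>b[of v] abs_ge_zero, of 2] by (auto simp: power_mult_distrib split: split_indicator_asm)
  qed measurable
  define S where "S = (LINT v|lborel. (\<Phi> v)\<^sup>2)"
  have step2: "\<Lambda>\<^sup>2 \<le> A2 * S"
    unfolding step1 A2_def S_def by (rule Cauchy_Schwarz_integral) (use f2 \<Phi>2 in auto)
  have S0: "0 \<le> S" unfolding S_def by (rule Bochner_Integration.integral_nonneg) simp
  \<comment> \<open>Squaring \<Phi> introduces a second parameter, written s + t. Back in the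
    variable x = v - B t, the factors of h combine to \<open>hh x s\<close>, which is independent of
    t and can be removed by Cauchy-Schwarz in s.\<close>
  define g where "g x s t = F (x + power_sum_map t) * F (x - Bu u s + power_sum_map (t + s)) * \<phi> t * \<phi> (t + s)" for x s t
  define hh where "hh x s = h x * h (x - Bu u s)" for x s
  define \<Gamma> where "\<Gamma> x s = (LINT t|lborel. g x s t)" for x s
  have gb: "\<bar>g x s t\<bar> \<le> M\<^sup>2 * indicator (cball 0 (3/2)) t * indicator (cball 0 3) s" for x s t
  proof (cases "norm t \<le> 3/2 \<and> norm (t + s) \<le> 3/2")
    case True
    have "norm s \<le> norm (t + s) + norm t" using norm_triangle_ineq4[of "t + s" t] by simp
    then have "norm s \<le> 3" using True by linarith
    moreover have "\<bar>g x s t\<bar> \<le> M * M * 1 * 1" unfolding g_def abs_mult using \<phi>[of t] \<phi>[of "t + s"] M0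
      by (intro mult_mono FM) auto
    ultimately show ?thesis using True by (simp add: power2_eq_square)
  next
    case False
    then have "\<phi> t = 0 \<or> \<phi> (t + s) = 0" using \<phi>(3)[of t] \<phi>(3)[of "t + s"] by linarith
    then have "g x s t = 0" by (auto simp: g_def)
    then show ?thesis by simp
  qed
  have gm[measurable]: "(\<lambda>q. g (fst q) (fst (snd q)) (snd (snd q))) \<in> borel_measurable (borel \<Otimes>\<^sub>M borel \<Otimes>\<^sub>M borel)"
    unfolding g_def by measurable
  have hm[measurable]: "(\<lambda>q. hh (fst q) (snd q)) \<in> borel_measurable (borel \<Otimes>\<^sub>M borel)"
    unfolding hh_def by measurable
  have hhb: "\<bar>hh x s\<bar> \<le> indicator (cball 0 (3/2)) x" for x s
    using mult_mono[OF hb[of x] h1[of "x - Bu u s"]] by (simp add: hh_def abs_mult)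
  have step3: "S = (LINT x|lborel. LINT s|lborel. hh x s * \<Gamma> x s)"
  proof -
    have e1: "(\<Phi> v)\<^sup>2 = (LINT t|lborel. LINT s|lborel. H v t * H v (s + t))" for v
    proof -
      have [measurable]: "H v \<in> borel_measurable borel" unfolding H_def by measurable
      have "(LINT s|lborel. H v (s + t)) = \<Phi> v" for t
        unfolding \<Phi>_def by (rule integral_lborel_shift) measurable
      then show ?thesis by (simp add: power2_eq_square \<Phi>_def[of v])
    qed
    have "S = (LINT v|lborel. LINT t|lborel. LINT s|lborel. H v t * H v (s + t))"
      unfolding S_def e1 ..
    also have "\<dots> = (LINT t|lborel. LINT v|lborel. LINT s|lborel. H v t * H v (s + t))"
    proof (rule Fubini_dominated)
      have "(\<lambda>q. H (fst (fst q)) (snd (fst q)) * H (fst (fst q)) (snd q + snd (fst q))) \<in> borel_measurable ((borel \<Otimes>\<^sub>M borel) \<Otimes>\<^sub>M lborel)"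
        unfolding H_def by measurable
      then have "(\<lambda>p. LINT s|lborel. H (fst p) (snd p) * H (fst p) (s + snd p)) \<in> borel_measurable (borel \<Otimes>\<^sub>M borel)"
        by (intro lborel.borel_measurable_lebesgue_integral) (simp add: case_prod_beta')
      then show "(\<lambda>(v, t). LINT s|lborel. H v t * H v (s + t)) \<in> borel_measurable (borel \<Otimes>\<^sub>M borel)" by (simp add: case_prod_beta')
      show "integrable lborel (\<lambda>v::real\<times>real. M * indicator (cball 0 3) v)" "integrable lborel (\<lambda>t::real\<times>real. indicator (cball 0 (3/2)) t * (M * m 3))" using ib by auto
      show "norm (LINT s|lborel. H v t * H v (s + t)) \<le> M * indicator (cball 0 3) v * (indicator (cball 0 (3/2)) t * (M * m 3))" for v t
      proof -
        have "\<bar>LINT s|lborel. H v t * H v (s + t)\<bar> \<le> (M * indicator (cball 0 3) v * indicator (cball 0 (3/2)) t * M) * m 3"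
          unfolding m_def
        proof (rule integral_bound_cball)
          fix s
          show "\<bar>H v t * H v (s + t)\<bar> \<le> M * indicator (cball 0 3) v * indicator (cball 0 (3/2)) t * M * indicator (cball 0 3) s"
          proof (cases "norm t \<le> 3/2 \<and> norm s > 3")
            case True
            have "norm s \<le> norm (s + t) + norm t" using norm_triangle_ineq4[of "s + t" t] by simp
            then have "norm (s + t) > 3/2" using True by linarith
            then show ?thesis using Hb[of v "s + t"] M0 by simp
          next
            case False
            have "\<bar>H v t\<bar> * \<bar>H v (s + t)\<bar> \<le> (M * indicator (cball 0 3) v * indicator (cball 0 (3/2)) t) * M"
              using Hb[of v t] Hb[of v "s + t"] M0 by (intro mult_mono) (auto split: split_indicator split_indicator_asm)
            then show ?thesis using False by (auto simp: abs_mult split: split_indicator)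
          qed
        qed (use M0 in simp)
        then show ?thesis by (simp add: mult_ac)
      qed
    qed
    also have "\<dots> = (LINT t|lborel. LINT x|lborel. LINT s|lborel. hh x s * g x s t)"
    proof (rule Bochner_Integration.integral_cong, rule refl)
      fix t :: "plane"
      have "(\<lambda>q. H (fst q) t * H (fst q) (snd q + t)) \<in> borel_measurable (borel \<Otimes>\<^sub>M lborel)" unfolding H_def by measurable
      then have [measurable]: "(\<lambda>v. LINT s|lborel. H v t * H v (s + t)) \<in> borel_measurable borel"
        by (intro lborel.borel_measurable_lebesgue_integral) (simp add: case_prod_beta')
      have "(LINT v|lborel. LINT s|lborel. H v t * H v (s + t)) = (LINT x|lborel. LINT s|lborel. H (x + Bu u t) t * H (x + Bu u t) (s + t))"
        by (rule integral_lborel_shift[symmetric]) measurable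
      also have "(\<lambda>x s. H (x + Bu u t) t * H (x + Bu u t) (s + t)) = (\<lambda>x s. hh x s * g x s t)"
      proof (intro ext)
        fix x s
        have e: "x + Bu u t - Bu u (t + s) = x - Bu u s" by (simp add: Bu_add)
        have st: "s + t = t + s" by (rule add.commute)
        show "H (x + Bu u t) t * H (x + Bu u t) (s + t) = hh x s * g x s t"
          unfolding st H_def e hh_def g_def by simp
      qed
      finally show "(LINT v|lborel. LINT s|lborel. H v t * H v (s + t)) = (LINT x|lborel. LINT s|lborel. hh x s * g x s t)" .
    qed
    also have "\<dots> = (LINT x|lborel. LINT t|lborel. LINT s|lborel. hh x s * g x s t)"
    proof (rule Fubini_dominated)
      have "(\<lambda>q. hh (snd (fst q)) (snd q) * g (snd (fst q)) (snd q) (fst (fst q))) \<in> borel_measurable ((borel \<Otimes>\<^sub>M borel) \<Otimes>\<^sub>M lborel)"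
        unfolding hh_def g_def by measurable
      then have "(\<lambda>p. LINT s|lborel. hh (snd p) s * g (snd p) s (fst p)) \<in> borel_measurable (borel \<Otimes>\<^sub>M borel)"
        by (intro lborel.borel_measurable_lebesgue_integral) (simp add: case_prod_beta')
      then show "(\<lambda>(t, x). LINT s|lborel. hh x s * g x s t) \<in> borel_measurable (borel \<Otimes>\<^sub>M borel)" by (simp add: case_prod_beta')
      show "integrable lborel (\<lambda>t::real\<times>real. M\<^sup>2 * indicator (cball 0 (3/2)) t)" "integrable lborel (\<lambda>x::real\<times>real. indicator (cball 0 (3/2)) x * m 3)" using ib by auto
      show "norm (LINT s|lborel. hh x s * g x s t) \<le> M\<^sup>2 * indicator (cball 0 (3/2)) t * (indicator (cball 0 (3/2)) x * m 3)" for t x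
      proof -
        have "\<bar>LINT s|lborel. hh x s * g x s t\<bar> \<le> (indicator (cball 0 (3/2)) x * (M\<^sup>2 * indicator (cball 0 (3/2)) t)) * m 3"
          unfolding m_def
        proof (rule integral_bound_cball)
          show "\<bar>hh x s * g x s t\<bar> \<le> indicator (cball 0 (3/2)) x * (M\<^sup>2 * indicator (cball 0 (3/2)) t) * indicator (cball 0 3) s" for s
            using mult_mono[OF hhb[of x s] gb[of x s t]] by (simp add: abs_mult mult.assoc)
        qed simp
        then show ?thesis by (simp add: mult_ac)
      qed
    qed
    also have "\<dots> = (LINT x|lborel. LINT s|lborel. LINT t|lborel. hh x s * g x s t)"
    proof (rule Bochner_Integration.integral_cong, rule refl)
      fix x :: "plane"
      show "(LINT t|lborel. LINT s|lborel. hh x s * g x s t) = (LINT s|lborel. LINT t|lborel. hh x s * g x s t)"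
      proof (rule Fubini_dominated)
        have "(\<lambda>q. hh x (snd q) * g x (snd q) (fst q)) \<in> borel_measurable (borel \<Otimes>\<^sub>M borel)" unfolding hh_def g_def by measurable
        then show "(\<lambda>(t, s). hh x s * g x s t) \<in> borel_measurable (borel \<Otimes>\<^sub>M borel)" by (simp add: case_prod_beta')
        show "integrable lborel (\<lambda>t::real\<times>real. M\<^sup>2 * indicator (cball 0 (3/2)) t)" "integrable lborel (\<lambda>s::real\<times>real. indicator (cball 0 3) s :: real)" using ib by auto
        show "norm (hh x s * g x s t) \<le> M\<^sup>2 * indicator (cball 0 (3/2)) t * indicator (cball 0 3) s" for t s
          using mult_mono[OF order_trans[OF hhb[of x s] indicator_le_1] gb[of x s t]] by (simp add: abs_mult)
      qed
    qed
    finally show ?thesis by (simp add: \<Gamma>_def)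
  qed
  have \<Gamma>b: "\<bar>\<Gamma> x s\<bar> \<le> M\<^sup>2 * m (3/2) * indicator (cball 0 3) s" for x s
  proof -
    have "\<bar>\<Gamma> x s\<bar> \<le> (M\<^sup>2 * indicator (cball 0 3) s) * m (3/2)"
      unfolding \<Gamma>_def m_def by (rule integral_bound_cball) (use gb[of x s] in \<open>auto simp: mult_ac\<close>)
    then show ?thesis by (simp add: mult_ac)
  qed
  have \<Gamma>m[measurable]: "(\<lambda>p. \<Gamma> (fst p) (snd p)) \<in> borel_measurable (borel \<Otimes>\<^sub>M borel)"
  proof -
    have "(\<lambda>q. g (fst (fst q)) (snd (fst q)) (snd q)) \<in> borel_measurable ((borel \<Otimes>\<^sub>M borel) \<Otimes>\<^sub>M lborel)" unfolding g_def by measurable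
    then show ?thesis unfolding \<Gamma>_def by (intro lborel.borel_measurable_lebesgue_integral) (simp add: case_prod_beta')
  qed
  have \<Gamma>m1[measurable]: "\<Gamma> x \<in> borel_measurable borel" for x
    using measurable_compose[OF _ \<Gamma>m, of "\<lambda>s. (x, s)" borel] by simp
  have hm1[measurable]: "hh x \<in> borel_measurable borel" for x unfolding hh_def by measurable
  define Q2 where "Q2 x = (LINT s|lborel. (\<Gamma> x s)\<^sup>2)" for x
  have \<Gamma>2b: "\<bar>(\<Gamma> x s)\<^sup>2\<bar> \<le> (M\<^sup>2 * m (3/2))\<^sup>2 * indicator (cball 0 3) s" for x s
    using power_mono[OF \<Gamma>b[of x s] abs_ge_zero, of 2] by (auto simp: power_mult_distrib split: split_indicator_asm)
  have Q2m[measurable]: "Q2 \<in> borel_measurable borel"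
  proof -
    have "(\<lambda>p. (\<Gamma> (fst p) (snd p))\<^sup>2) \<in> borel_measurable (borel \<Otimes>\<^sub>M lborel)" using \<Gamma>m by (intro borel_measurable_power) (simp cong: measurable_cong_sets)
    then show ?thesis unfolding Q2_def by (intro lborel.borel_measurable_lebesgue_integral) (simp add: case_prod_beta')
  qed
  have Q2b: "\<bar>Q2 x\<bar> \<le> (M\<^sup>2 * m (3/2))\<^sup>2 * m 3" for x
    unfolding Q2_def m_def[of 3] by (rule integral_bound_cball[OF \<Gamma>2b]) simp
  have Q20: "0 \<le> Q2 x" for x unfolding Q2_def by (rule Bochner_Integration.integral_nonneg) simp
  define k where "k x = (LINT s|lborel. hh x s * \<Gamma> x s)" for x
  have k2: "(k x)\<^sup>2 \<le> indicator (cball 0 (3/2)) x * (m 3 * Q2 x)" for x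
  proof -
    \<comment> \<open>The cutoff to norm s \<le> 3 changes nothing, as \<Gamma> vanishes beyond, and
      makes the factor square integrable in s.\<close>
    define c where "c s = hh x s * indicator (cball 0 3) s" for s
    have [measurable]: "c \<in> borel_measurable borel" unfolding c_def by measurable
    have cb: "(c s)\<^sup>2 \<le> indicator (cball 0 (3/2)) x * indicator (cball 0 3) s" for s
      using power_mono[OF hhb[of x s] abs_ge_zero, of 2] by (auto simp: c_def power_mult_distrib split: split_indicator split_indicator_asm)
    have ci: "integrable lborel (\<lambda>s. (c s)\<^sup>2)"
      by (rule integrable_mult_indicator_bounded) (use cb in auto)
    have ke: "k x = (LINT s|lborel. c s * \<Gamma> x s)"
      unfolding k_def
    proof (rule Bochner_Integration.integral_cong, rule refl)
      show "hh x s * \<Gamma> x s = c s * \<Gamma> x s" for s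
        using \<Gamma>b[of x s] by (cases "norm s \<le> 3") (auto simp: c_def)
    qed
    have gi: "integrable lborel (\<lambda>s. (\<Gamma> x s)\<^sup>2)"
      by (rule integrable_mult_indicator_bounded[OF _ \<Gamma>2b]) measurable
    have "(k x)\<^sup>2 \<le> (LINT s|lborel. (c s)\<^sup>2) * Q2 x"
      unfolding ke Q2_def by (rule Cauchy_Schwarz_integral[OF _ _ ci gi]) simp_all
    also have "\<dots> \<le> (indicator (cball 0 (3/2)) x * m 3) * Q2 x"
    proof (rule mult_right_mono[OF _ Q20])
      have "(LINT s|lborel. (c s)\<^sup>2) \<le> (LINT s|lborel. indicator (cball 0 (3/2)) x * indicator (cball (0::real\<times>real) 3) s)"
        by (rule integral_mono[OF ci]) (use cb ib in auto)
      then show "(LINT s|lborel. (c s)\<^sup>2) \<le> indicator (cball 0 (3/2)) x * m 3" by (simp add: m_def)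
    qed
    finally show ?thesis by (simp add: mult_ac)
  qed
  have kh: "k x = indicator unit_square x * k x" for x
    using h[of x] by (cases "x \<in> unit_square") (auto simp: k_def hh_def)
  have us: "emeasure lborel unit_square = 1"
    using emeasure_qbox[of 1] by (simp add: qbox_def)
  have usm[measurable]: "unit_square \<in> sets borel" using qbox_measurable[of 1] by (simp add: qbox_def)
  have km[measurable]: "k \<in> borel_measurable borel"
  proof -
    have "(\<lambda>p. hh (fst p) (snd p) * \<Gamma> (fst p) (snd p)) \<in> borel_measurable (borel \<Otimes>\<^sub>M lborel)" using \<Gamma>m hm by (intro borel_measurable_times) (simp_all cong: measurable_cong_sets)
    then show ?thesis unfolding k_def by (intro lborel.borel_measurable_lebesgue_integral) (simp add: case_prod_beta')
  qed
  \<comment> \<open>Trades the sharp cutoff in x for the Lipschitz bump of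
    \<open>quad_weight\<close>.\<close>
  have tw: "indicator (cball 0 (3/2)) x \<le> 2 * tent 3 (x::real\<times>real)" for x
    using tent_props(1)[of 3 x] by (auto simp: tent_def split: split_indicator)
  have Wi: "integrable lborel (\<lambda>x. 2 * m 3 * (tent 3 x * Q2 x))"
  proof (rule integrable_mult_indicator_bounded)
    show "\<bar>2 * m 3 * (tent 3 x * Q2 x)\<bar> \<le> 2 * m 3 * ((M\<^sup>2 * m (3/2))\<^sup>2 * m 3) * indicator (cball 0 3) x" for x
    proof (cases "norm x \<le> 3")
      case True
      have "tent 3 x * Q2 x \<le> 1 * ((M\<^sup>2 * m (3/2))\<^sup>2 * m 3)"
        using tent_props(1,2)[of 3 x] Q2b[of x] Q20[of x] by (intro mult_mono) auto
      then show ?thesis using True mpos[of 3] tent_props(1)[of 3 x] Q20[of x] by (simp add: abs_mult mult_left_mono mult.assoc)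
    next
      case False then show ?thesis using tent_props(3)[of 3 x] by simp
    qed
    have [measurable]: "tent 3 \<in> borel_measurable (borel :: plane measure)"
      using tent_props(5)[of 3] by (intro borel_measurable_continuous_onI) auto
    show "(\<lambda>x. 2 * m 3 * (tent 3 x * Q2 x)) \<in> borel_measurable borel" by measurable
  qed
  have k2le: "(k x)\<^sup>2 \<le> 2 * m 3 * (tent 3 x * Q2 x)" for x
  proof -
    have "indicator (cball 0 (3/2)) x * (m 3 * Q2 x) \<le> (2 * tent 3 x) * (m 3 * Q2 x)"
      using tw[of x] mpos Q20 by (intro mult_right_mono) auto
    then show ?thesis using k2[of x] by (simp add: mult_ac)
  qed
  have k2i: "integrable lborel (\<lambda>x. (k x)\<^sup>2)"
    by (rule Bochner_Integration.integrable_bound[OF Wi]) (use k2le in \<open>auto intro!: AE_I2 intro: order_trans[OF _ abs_ge_self]\<close>)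
  define V where "V = (LINT x|lborel. tent 3 x * Q2 x)"
  \<comment> \<open>The Cauchy-Schwarz inequality in x, against the indicator of the unit square,
    whose measure is 1.\<close>
  have step4: "S\<^sup>2 \<le> 2 * m 3 * V"
  proof -
    have iu: "(\<lambda>x. (indicator unit_square x :: real)\<^sup>2) = indicator unit_square" by (auto simp: fun_eq_iff split: split_indicator)
    have Se: "S = (LINT x|lborel. indicator unit_square x * k x)"
      unfolding step3 k_def[symmetric] by (rule Bochner_Integration.integral_cong, rule refl, rule kh)
    have ui: "integrable lborel (\<lambda>x. (indicator unit_square x :: real)\<^sup>2)"
      unfolding iu using us by (simp add: integrable_indicator_iff)
    have "S\<^sup>2 \<le> (LINT x|lborel. (indicator unit_square x :: real)\<^sup>2) * (LINT x|lborel. (k x)\<^sup>2)"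
      unfolding Se by (rule Cauchy_Schwarz_integral[OF _ _ ui k2i]) (use usm in measurable)
    also have "\<dots> = (LINT x|lborel. (k x)\<^sup>2)" using us by (simp only: iu) (simp add: measure_def)
    also have "\<dots> \<le> (LINT x|lborel. 2 * m 3 * (tent 3 x * Q2 x))" by (rule integral_mono[OF k2i Wi k2le])
    finally show ?thesis by (simp add: V_def)
  qed
  have step5: "V = (LINT z|lborel. quad_weight \<phi> z * quad_prod u F z)"
  proof -
    have Wc: "continuous_on UNIV (\<lambda>z. quad_weight \<phi> z * quad_prod u F z)"
      unfolding quad_weight_def quad_prod_def
      by (intro continuous_intros continuous_on_compose2[OF Fc] continuous_on_compose2[OF \<phi>c] continuous_on_compose2[OF tent_props(5)[of 3]] quad_points_continuous) auto
    have prod_le: "\<bar>quad_prod u F z\<bar> \<le> M ^ 4" for z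
    proof -
      have "\<bar>F (pt1 z)\<bar> * \<bar>F (pt2 u z)\<bar> * \<bar>F (pt3 z)\<bar> * \<bar>F (pt4 u z)\<bar> \<le> M * M * M * M" by (intro mult_mono FM) (simp_all add: M0)
      then show ?thesis by (simp add: quad_prod_def abs_mult eval_nat_numeral mult.assoc)
    qed
    have "(LINT z|lborel. quad_weight \<phi> z * quad_prod u F z) =
      (LINT x|lborel. LINT s|lborel. LINT t|lborel. LINT t'|lborel. quad_weight \<phi> ((x, t), (t', s)) * quad_prod u F ((x, t), (t', s)))"
    proof (rule quad_integral_iterated[OF Wc])
      show "quad_weight \<phi> z * quad_prod u F z = 0" if "norm z > 10" for z using Wb(2)[OF that] by simp
      show "\<bar>quad_weight \<phi> z * quad_prod u F z\<bar> \<le> M ^ 4" for z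
        using mult_mono[OF Wb(1)[of z] prod_le[of z]] by (simp add: abs_mult)
    qed
    also have "\<dots> = (LINT x|lborel. LINT s|lborel. LINT t|lborel. LINT t'|lborel. tent 3 x * (g x s t * g x s t'))"
      by (simp add: quad_weight_def quad_prod_def pt1_def pt2_def pt3_def pt4_def g_def mult_ac)
    also have "\<dots> = V"
      by (simp add: V_def Q2_def \<Gamma>_def power2_eq_square)
    finally show ?thesis ..
  qed
  have V0: "0 \<le> V" unfolding V_def
    by (rule Bochner_Integration.integral_nonneg) (simp add: tent_props(1) Q20)
  have m3: "2 * m 3 \<le> 100"
  proof -
    have "m 3 = pi * 9" using content_cball[of 3 "0::real\<times>real"] unit_ball_vol_2 by (simp add: m_def)
    then show ?thesis using pi_less_4 by simp
  qed
  have "\<Lambda> ^ 4 = (\<Lambda>\<^sup>2)\<^sup>2" by simp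
  also have "\<dots> \<le> (A2 * S)\<^sup>2" using step2 by (intro power_mono) auto
  also have "\<dots> = A2\<^sup>2 * S\<^sup>2" by (simp add: power_mult_distrib)
  also have "\<dots> \<le> A2\<^sup>2 * (2 * m 3 * V)" using step4 by (intro mult_left_mono) auto
  also have "\<dots> \<le> A2\<^sup>2 * (100 * V)" using m3 V0 by (intro mult_left_mono mult_right_mono) auto
  finally show ?thesis unfolding \<Lambda>_def A2_def step5 by (simp add: mult_ac)
qed

section \<open>The phase and the improving estimate\<close>

text \<open>The displacement between the arguments of the two functions: after the shift of x by B
  t, the form pairs the first function at x with the second at x + \<open>phase u t\<close>.\<close>

definition phase :: "real \<Rightarrow> plane \<Rightarrow> plane" where "phase u t = power_sum_map t - Bu u t"

definition phase_jac :: "real \<Rightarrow> plane \<Rightarrow> real" where "phase_jac u t = det2 (DP t - Bmat u)"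

lemma phase_jac_continuous: "continuous_on UNIV (phase_jac u)"
  unfolding phase_jac_def det2_def DP_def Bmat_def by (intro continuous_intros)

lemma phase_jac_measurable [measurable]: "phase_jac u \<in> borel_measurable borel"
  by (rule borel_measurable_continuous_onI[OF phase_jac_continuous])

lemma phase_measurable [measurable]: "phase u \<in> borel_measurable borel"
  unfolding phase_def by measurable

lemma phase_jac_polyfun: "polyfun 4 (\<lambda>r. phase_jac u (t + r *\<^sub>R v))"
proof -
  have "polyfun 1 (\<lambda>r. fst (t + r *\<^sub>R v))" "polyfun 1 (\<lambda>r. snd (t + r *\<^sub>R v))"
    using polyfun_affine by auto
  from polyfun_det2[OF polymat_diff[OF polymat_DP[OF this] polymat_const[of 2 "Bmat u"]]] show ?thesis
    by (simp add: phase_jac_def)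
qed

text \<open>At (-1, 1) the determinant is - (2 + u) (3 - u^2) - 6, two terms of the same sign for u
  in [0,1]. The sublevel estimate for the phase is anchored at this point.\<close>

lemma phase_jac_base: "0 \<le> u \<Longrightarrow> u \<le> 1 \<Longrightarrow> \<bar>phase_jac u (-1, 1)\<bar> \<ge> 1"
proof -
  assume u: "0 \<le> u" "u \<le> 1"
  have "u\<^sup>2 \<le> 1" using u by (simp add: power_le_one)
  then have "2 * 2 \<le> (2 + u) * (3 - u\<^sup>2)" using u by (intro mult_mono) auto
  moreover have "phase_jac u (-1, 1) = - ((2 + u) * (3 - u\<^sup>2)) - 6"
    by (simp add: phase_jac_def det2_def DP_def Bmat_def algebra_simps)
  ultimately show ?thesis by linarith
qed

text \<open>A quantitative inverse function theorem. By the adjugate the linear part expands by at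
  least \<epsilon> / 50, the matrix having norm at most 50; for norm w \<le> \<epsilon> / 100000 the
  Taylor remainder takes away at most \<epsilon> / 100 of this.\<close>

lemma phase_expanding:
  assumes u: "0 \<le> u" "u \<le> 1" and t: "norm t \<le> 2" and w: "norm w \<le> \<epsilon> / 100000" and \<epsilon>: "0 < \<epsilon>" "\<epsilon> \<le> 1" "\<epsilon> \<le> \<bar>phase_jac u t\<bar>"
  shows "\<epsilon> / 100 * norm w \<le> norm (phase u (t + w) - phase u t)"
proof -
  define M where "M = DP t - Bmat u"
  have Bb: "norm (Bmat u) \<le> 2"
  proof -
    have "norm (Bmat u) \<le> norm (u, 0::real) + norm (0::real, u\<^sup>2)" unfolding Bmat_def by (rule norm_Pair_le)
    also have "\<dots> = u + u\<^sup>2" using u by (simp add: norm_Pair1 norm_Pair2)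
    also have "u\<^sup>2 \<le> 1" using u by (simp add: power_le_one)
    finally show ?thesis using u by simp
  qed
  have Mb: "norm M \<le> 50" unfolding M_def using norm_triangle_ineq4[of "DP t" "Bmat u"] norm_DP[OF t] Bb by simp
  have inv: "mv (adj N) (mv N v) = det2 N *\<^sub>R v" for N v
    by (simp add: mv_def adj_def det2_def inner_prod_def prod_eq_iff algebra_simps)
  have "\<bar>det2 M\<bar> * norm w = norm (mv (adj M) (mv M w))" by (simp add: inv)
  also have "\<dots> \<le> norm M * norm (mv M w)" using norm_mv[of "adj M" "mv M w"] by (simp add: norm_adj)
  also have "\<dots> \<le> 50 * norm (mv M w)" using Mb by (intro mult_right_mono) auto
  finally have 1: "\<epsilon> * norm w \<le> 50 * norm (mv M w)"
    using mult_right_mono[OF \<epsilon>(3), of "norm w"] by (simp add: phase_jac_def M_def)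
  have w4: "norm w \<le> 4" using w \<epsilon> by simp
  have e: "phase u (t + w) - phase u t = mv M w + (power_sum_map (t + 0 + w) - power_sum_map (t + 0) - mv (DP t) w)"
    by (simp add: phase_def M_def Bu_mv mv_simps)
  have 2: "norm (power_sum_map (t + 0 + w) - power_sum_map (t + 0) - mv (DP t) w) \<le> 1000 * (norm (0::real\<times>real) + norm w) * norm w"
    using t w4 by (intro power_sum_map_taylor) auto
  have "1000 * norm w * norm w \<le> (\<epsilon> / 100) * norm w" using w by (intro mult_right_mono) auto
  then have 3: "norm (power_sum_map (t + 0 + w) - power_sum_map (t + 0) - mv (DP t) w) \<le> (\<epsilon> / 100) * norm w" using 2 by simp
  have "norm (mv M w) \<le> norm (phase u (t + w) - phase u t) + norm (power_sum_map (t + 0 + w) - power_sum_map (t + 0) - mv (DP t) w)"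
    unfolding e using norm_triangle_ineq4[of "mv M w + (power_sum_map (t + 0 + w) - power_sum_map (t + 0) - mv (DP t) w)" "power_sum_map (t + 0 + w) - power_sum_map (t + 0) - mv (DP t) w"] by simp
  then show ?thesis using 1 3 by linarith
qed

text \<open>On a cell of diameter at most \<epsilon> / 100000 the phase is expanding, so the part of
  the preimage in that cell lies in a disc of radius O(r / \<epsilon>). There are O(1 /
  \<epsilon>^2) cells, whence \<epsilon>^4 in the denominator. Counting cells stands in for global
  injectivity and for the change of variables formula.\<close>

lemma phase_preimage_measure:
  obtains K where "K \<ge> (1::real)"
    "\<And>u \<epsilon> r y. 0 \<le> u \<Longrightarrow> u \<le> 1 \<Longrightarrow> 0 < \<epsilon> \<Longrightarrow> \<epsilon> \<le> 1 \<Longrightarrow> 0 < r \<Longrightarrow>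
      emeasure lborel {t \<in> unit_square. \<epsilon> < \<bar>phase_jac u t\<bar> \<and> y - phase u t \<in> qbox r} \<le> ennreal (K / \<epsilon> ^ 4 * r\<^sup>2)"
proof -
  define K where "K = (400002::real)\<^sup>2 * 160000"
  have "emeasure lborel {t \<in> unit_square. \<epsilon> < \<bar>phase_jac u t\<bar> \<and> y - phase u t \<in> qbox r} \<le> ennreal (K / \<epsilon> ^ 4 * r\<^sup>2)"
    if u: "0 \<le> u" "u \<le> 1" and \<epsilon>: "0 < \<epsilon>" "\<epsilon> \<le> 1" and r: "0 < r" for u \<epsilon> r y
  proof -
    define E where "E = {t \<in> unit_square. \<epsilon> < \<bar>phase_jac u t\<bar> \<and> y - phase u t \<in> qbox r}"
    have usm[measurable]: "unit_square \<in> sets borel" using qbox_measurable[of 1] by (simp add: qbox_def)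
    have Em[measurable]: "E \<in> sets borel" unfolding E_def by measurable
    \<comment> \<open>Cells of side 1/n \<le> \<epsilon> / 200000 have diameter at most \<epsilon> /
      100000. The cell indices run up to n inclusive, because a coordinate may equal 1.\<close>
    define n where "n = nat \<lceil>200000 / \<epsilon>\<rceil>"
    have n: "200000 / \<epsilon> \<le> real n" "real n \<le> 200000 / \<epsilon> + 1" using \<epsilon> unfolding n_def by (auto intro: real_nat_ceiling_ge)
    have n0: "real n > 0" using n(1) \<epsilon> by (smt (verit) divide_pos_pos)
    define c where "c t = (nat \<lfloor>real n * fst t\<rfloor>, nat \<lfloor>real n * snd t\<rfloor>)" for t :: "plane"
    define I where "I = {..n} \<times> {..n}"
    define cell where "cell p = {t \<in> E. nat \<lfloor>real n * fst t\<rfloor> = fst p \<and> nat \<lfloor>real n * snd t\<rfloor> = snd p}" for p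
    have fm: "fst \<in> borel_measurable (borel :: plane measure)" "snd \<in> borel_measurable (borel :: plane measure)"
      by (intro borel_measurable_continuous_onI continuous_intros)+
    have cm: "cell p \<in> sets borel" for p unfolding cell_def using fm by measurable
    have cover: "E \<subseteq> (\<Union>p\<in>I. cell p)"
    proof
      fix t assume t: "t \<in> E"
      then have "0 \<le> fst t" "fst t \<le> 1" "0 \<le> snd t" "snd t \<le> 1" by (auto simp: E_def)
      then have "real n * fst t \<le> real n * 1" "real n * snd t \<le> real n * 1" by (intro mult_left_mono; simp)+
      then have "nat \<lfloor>real n * fst t\<rfloor> \<le> n" "nat \<lfloor>real n * snd t\<rfloor> \<le> n" by linarith+
      then show "t \<in> (\<Union>p\<in>I. cell p)" using t unfolding I_def cell_def by (intro UN_I[of "c t"]) (auto simp: c_def)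
    qed
    have small: "emeasure lborel (cell p) \<le> ennreal (160000 * r\<^sup>2 / \<epsilon>\<^sup>2)" for p
    proof (cases "cell p = {}")
      case False
      then obtain t0 where t0: "t0 \<in> cell p" by blast
      have "cell p \<subseteq> cball t0 (200 * r / \<epsilon>)"
      proof
        fix t assume t: "t \<in> cell p"
        have pos: "0 \<le> real n * fst t" "0 \<le> real n * snd t" "0 \<le> real n * fst t0" "0 \<le> real n * snd t0"
          using t t0 by (auto simp: cell_def E_def)
        have "\<lfloor>real n * fst t\<rfloor> = \<lfloor>real n * fst t0\<rfloor>" "\<lfloor>real n * snd t\<rfloor> = \<lfloor>real n * snd t0\<rfloor>"
          using t t0 pos by (auto simp: cell_def) (metis nat_eq_iff2 eq_nat_nat_iff zero_le_floor)+
        then have "\<bar>real n * fst t - real n * fst t0\<bar> \<le> 1" "\<bar>real n * snd t - real n * snd t0\<bar> \<le> 1"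
          by linarith+
        then have "real n * \<bar>fst t - fst t0\<bar> \<le> 1" "real n * \<bar>snd t - snd t0\<bar> \<le> 1"
          using n0 by (simp_all add: right_diff_distrib[symmetric] abs_mult)
        moreover have "d \<le> \<epsilon> / 200000" if "real n * d \<le> 1" "0 \<le> d" for d
          using order_trans[OF mult_right_mono[OF n(1) that(2)] that(1)] \<epsilon> by (simp add: field_simps)
        ultimately have "\<bar>fst t - fst t0\<bar> \<le> \<epsilon> / 200000" "\<bar>snd t - snd t0\<bar> \<le> \<epsilon> / 200000" by simp_all
        then have w: "norm (t - t0) \<le> \<epsilon> / 100000"
          using norm_Pair_le[of "fst t - fst t0" "snd t - snd t0"] by (simp add: minus_prod_def[symmetric])
        have "(fst t0)\<^sup>2 \<le> 1" "(snd t0)\<^sup>2 \<le> 1" using t0 by (auto simp: cell_def E_def intro!: power_le_one)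
        then have "(norm t0)\<^sup>2 \<le> 2\<^sup>2" by (simp add: norm_prod_def)
        then have n2: "norm t0 \<le> 2" by (rule power2_le_imp_le) simp
        have "\<epsilon> / 100 * norm (t - t0) \<le> norm (phase u (t0 + (t - t0)) - phase u t0)"
          using t0 by (intro phase_expanding u n2 w \<epsilon>) (auto simp: cell_def E_def)
        also have "\<dots> \<le> 2 * r"
        proof -
          have "y - phase u t \<in> qbox r" "y - phase u t0 \<in> qbox r" using t t0 by (auto simp: cell_def E_def)
          then have "\<bar>fst (phase u t - phase u t0)\<bar> \<le> r" "\<bar>snd (phase u t - phase u t0)\<bar> \<le> r"
            by (auto simp: qbox_def mem_Times_iff abs_le_iff)
          then show ?thesis using norm_Pair_le[of "fst (phase u t - phase u t0)" "snd (phase u t - phase u t0)"]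
            unfolding prod.collapse real_norm_def add_diff_cancel_left' diff_add_cancel add.commute[of t0 "t - t0"] by linarith
        qed
        finally have "norm (t - t0) \<le> 200 * r / \<epsilon>" using \<epsilon> by (simp add: field_simps)
        then show "t \<in> cball t0 (200 * r / \<epsilon>)" by (simp add: dist_norm norm_minus_commute)
      qed
      then have "emeasure lborel (cell p) \<le> emeasure lborel (cball t0 (200 * r / \<epsilon>))" by (intro emeasure_mono) auto
      also have "\<dots> = ennreal (pi * (200 * r / \<epsilon>)\<^sup>2)"
        using emeasure_cball[of "200 * r / \<epsilon>" t0] r \<epsilon> unit_ball_vol_2 by (simp add: power2_eq_square)
      also have "\<dots> \<le> ennreal (4 * (200 * r / \<epsilon>)\<^sup>2)"
        using pi_less_4 by (intro ennreal_leI mult_right_mono) auto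
      also have "4 * (200 * r / \<epsilon>)\<^sup>2 = 160000 * r\<^sup>2 / \<epsilon>\<^sup>2" by (simp add: power2_eq_square)
      finally show ?thesis .
    qed simp
    have "emeasure lborel E \<le> emeasure lborel (\<Union>p\<in>I. cell p)"
      by (rule emeasure_mono[OF cover]) (use cm in \<open>auto simp: I_def intro!: sets.finite_UN\<close>)
    also have "\<dots> \<le> (\<Sum>p\<in>I. emeasure lborel (cell p))"
      by (rule emeasure_subadditive_finite) (use cm in \<open>auto simp: I_def\<close>)
    also have "\<dots> \<le> (\<Sum>p\<in>I. ennreal (160000 * r\<^sup>2 / \<epsilon>\<^sup>2))" by (intro sum_mono small)
    also have "\<dots> = ennreal (\<Sum>p\<in>I. 160000 * r\<^sup>2 / \<epsilon>\<^sup>2)" by (rule sum_ennreal) simp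
    also have "(\<Sum>p\<in>I. 160000 * r\<^sup>2 / \<epsilon>\<^sup>2) = (real n + 1)\<^sup>2 * (160000 * r\<^sup>2 / \<epsilon>\<^sup>2)"
    proof -
      have "real (card I) = (real n + 1)\<^sup>2" by (simp add: I_def power2_eq_square algebra_simps)
      then show ?thesis by (simp only: sum_constant)
    qed
    also have "\<dots> \<le> ennreal (K / \<epsilon> ^ 4 * r\<^sup>2)"
    proof (intro ennreal_leI)
      have "real n + 1 \<le> 400002 / \<epsilon>" using n(2) \<epsilon> by (simp add: field_simps)
      then have "(real n + 1)\<^sup>2 \<le> (400002 / \<epsilon>)\<^sup>2" by (intro power_mono) auto
      then have "(real n + 1)\<^sup>2 * (160000 * r\<^sup>2 / \<epsilon>\<^sup>2) \<le> (400002 / \<epsilon>)\<^sup>2 * (160000 * r\<^sup>2 / \<epsilon>\<^sup>2)" by (intro mult_right_mono) auto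
      also have "\<dots> = K / \<epsilon> ^ 4 * r\<^sup>2" by (simp add: K_def power_divide eval_nat_numeral)
      finally show "(real n + 1)\<^sup>2 * (160000 * r\<^sup>2 / \<epsilon>\<^sup>2) \<le> K / \<epsilon> ^ 4 * r\<^sup>2" .
    qed
    finally show ?thesis unfolding E_def .
  qed
  moreover have "K \<ge> 1" by (simp add: K_def)
  ultimately show thesis by (rule that[rotated])
qed

section \<open>The form with absolute values, on L^2 and on L^1\<close>

text \<open>Takes values in \<open>ennreal\<close>, so that Tonelli's theorem applies throughout; S
  singles out the parameters t under consideration, such as the nondegenerate ones or a rim.\<close>

definition nnform :: "real \<Rightarrow> plane set \<Rightarrow> (plane \<Rightarrow> ennreal) \<Rightarrow> (plane \<Rightarrow> ennreal) \<Rightarrow> ennreal" where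
  "nnform u S a b = (\<integral>\<^sup>+t. \<integral>\<^sup>+x. indicator S t * indicator unit_square x * a (x + Bu u t) * b (x + power_sum_map t) \<partial>lborel \<partial>lborel)"

lemma Cauchy_Schwarz_nn_pair:
  fixes f g :: "plane \<Rightarrow> plane \<Rightarrow> ennreal"
  assumes [measurable]: "(\<lambda>p. f (fst p) (snd p)) \<in> borel_measurable (borel \<Otimes>\<^sub>M borel)" "(\<lambda>p. g (fst p) (snd p)) \<in> borel_measurable (borel \<Otimes>\<^sub>M borel)"
  shows "(\<integral>\<^sup>+t. \<integral>\<^sup>+x. f t x * g t x \<partial>lborel \<partial>lborel)\<^sup>2 \<le> (\<integral>\<^sup>+t. \<integral>\<^sup>+x. (f t x)\<^sup>2 \<partial>lborel \<partial>lborel) * (\<integral>\<^sup>+t. \<integral>\<^sup>+x. (g t x)\<^sup>2 \<partial>lborel \<partial>lborel)"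
proof -
  have m: "(\<lambda>p. f (fst p) (snd p)) \<in> borel_measurable (lborel \<Otimes>\<^sub>M lborel)" "(\<lambda>p. g (fst p) (snd p)) \<in> borel_measurable (lborel \<Otimes>\<^sub>M lborel)"
    by (simp_all cong: measurable_cong_sets)
  have e: "(\<integral>\<^sup>+t. \<integral>\<^sup>+x. h t x \<partial>lborel \<partial>lborel) = (\<integral>\<^sup>+p. h (fst p) (snd p) \<partial>(lborel \<Otimes>\<^sub>M lborel))"
    if "(\<lambda>p. h (fst p) (snd p)) \<in> borel_measurable (lborel \<Otimes>\<^sub>M lborel)" for h :: "plane \<Rightarrow> plane \<Rightarrow> ennreal"
    using lborel.nn_integral_fst[OF that] by simp
  show ?thesis
    using Cauchy_Schwarz_nn_integral[OF m] m
    by (subst (1 2 3) e) (auto intro: borel_measurable_times_ennreal borel_measurable_power)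
qed

lemma nn_integral_shift_Bu:
  fixes a :: "plane \<Rightarrow> ennreal"
  assumes [measurable]: "a \<in> borel_measurable borel"
  shows "(\<integral>\<^sup>+x. a (x + w) \<partial>lborel) = (\<integral>\<^sup>+x. a x \<partial>lborel)"
  using nn_integral_lborel_shift[OF assms, of w] by (simp add: add.commute)

text \<open>The cutoff of x to the unit square is spent on the second factor. Keeping it there,
  instead of passing to the norm of b, is what later gives a constant below 1.\<close>

lemma nnform_Cauchy_Schwarz:
  assumes [measurable]: "S \<in> sets borel" "a \<in> borel_measurable borel" "b \<in> borel_measurable borel"
  shows "(nnform u S a b)\<^sup>2 \<le> (emeasure lborel S * (\<integral>\<^sup>+x. (a x)\<^sup>2 \<partial>lborel)) *
     (\<integral>\<^sup>+t. \<integral>\<^sup>+x. indicator S t * indicator unit_square x * (b (x + power_sum_map t))\<^sup>2 \<partial>lborel \<partial>lborel)"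
proof -
  define f where "f t x = indicator S t * a (x + Bu u t)" for t x
  define g where "g t x = indicator S t * indicator unit_square x * b (x + power_sum_map t)" for t x
  have "nnform u S a b = (\<integral>\<^sup>+t. \<integral>\<^sup>+x. f t x * g t x \<partial>lborel \<partial>lborel)"
    unfolding nnform_def f_def g_def by (intro nn_integral_cong) (auto split: split_indicator)
  then have "(nnform u S a b)\<^sup>2 \<le> (\<integral>\<^sup>+t. \<integral>\<^sup>+x. (f t x)\<^sup>2 \<partial>lborel \<partial>lborel) * (\<integral>\<^sup>+t. \<integral>\<^sup>+x. (g t x)\<^sup>2 \<partial>lborel \<partial>lborel)"
    by (simp only:) (rule Cauchy_Schwarz_nn_pair; unfold f_def g_def; measurable)
  also have "(\<integral>\<^sup>+t. \<integral>\<^sup>+x. (f t x)\<^sup>2 \<partial>lborel \<partial>lborel) = (\<integral>\<^sup>+t. indicator S t * (\<integral>\<^sup>+x. (a x)\<^sup>2 \<partial>lborel) \<partial>lborel)"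
  proof (rule nn_integral_cong)
    fix t
    have "(\<integral>\<^sup>+x. (f t x)\<^sup>2 \<partial>lborel) = (\<integral>\<^sup>+x. indicator S t * (a (x + Bu u t))\<^sup>2 \<partial>lborel)"
      by (intro nn_integral_cong) (auto simp: f_def split: split_indicator)
    also have "\<dots> = indicator S t * (\<integral>\<^sup>+x. (a (x + Bu u t))\<^sup>2 \<partial>lborel)" by (rule nn_integral_cmult) measurable
    also have "(\<integral>\<^sup>+x. (a (x + Bu u t))\<^sup>2 \<partial>lborel) = (\<integral>\<^sup>+x. (a x)\<^sup>2 \<partial>lborel)" by (rule nn_integral_shift_Bu) measurable
    finally show "(\<integral>\<^sup>+x. (f t x)\<^sup>2 \<partial>lborel) = indicator S t * (\<integral>\<^sup>+x. (a x)\<^sup>2 \<partial>lborel)" .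
  qed
  also have "\<dots> = emeasure lborel S * (\<integral>\<^sup>+x. (a x)\<^sup>2 \<partial>lborel)" by (simp add: nn_integral_multc)
  also have "(\<integral>\<^sup>+t. \<integral>\<^sup>+x. (g t x)\<^sup>2 \<partial>lborel \<partial>lborel) = (\<integral>\<^sup>+t. \<integral>\<^sup>+x. indicator S t * indicator unit_square x * (b (x + power_sum_map t))\<^sup>2 \<partial>lborel \<partial>lborel)"
    by (intro nn_integral_cong) (auto simp: g_def split: split_indicator)
  finally show ?thesis .
qed

lemma nnform_le_norms:
  assumes [measurable]: "S \<in> sets borel" "a \<in> borel_measurable borel" "b \<in> borel_measurable borel"
  shows "(nnform u S a b)\<^sup>2 \<le> (emeasure lborel S)\<^sup>2 * ((\<integral>\<^sup>+x. (a x)\<^sup>2 \<partial>lborel) * (\<integral>\<^sup>+x. (b x)\<^sup>2 \<partial>lborel))"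
proof -
  have "(\<integral>\<^sup>+t. \<integral>\<^sup>+x. indicator S t * indicator unit_square x * (b (x + power_sum_map t))\<^sup>2 \<partial>lborel \<partial>lborel)
      \<le> (\<integral>\<^sup>+t. indicator S t * (\<integral>\<^sup>+x. (b x)\<^sup>2 \<partial>lborel) \<partial>lborel)"
  proof (rule nn_integral_mono)
    fix t
    have "(\<integral>\<^sup>+x. indicator S t * indicator unit_square x * (b (x + power_sum_map t))\<^sup>2 \<partial>lborel) \<le> (\<integral>\<^sup>+x. indicator S t * (b (x + power_sum_map t))\<^sup>2 \<partial>lborel)"
      by (intro nn_integral_mono) (auto split: split_indicator)
    also have "\<dots> = indicator S t * (\<integral>\<^sup>+x. (b (x + power_sum_map t))\<^sup>2 \<partial>lborel)" by (rule nn_integral_cmult) measurable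
    also have "(\<integral>\<^sup>+x. (b (x + power_sum_map t))\<^sup>2 \<partial>lborel) = (\<integral>\<^sup>+x. (b x)\<^sup>2 \<partial>lborel)" by (rule nn_integral_shift_Bu) measurable
    finally show "(\<integral>\<^sup>+x. indicator S t * indicator unit_square x * (b (x + power_sum_map t))\<^sup>2 \<partial>lborel) \<le> indicator S t * (\<integral>\<^sup>+x. (b x)\<^sup>2 \<partial>lborel)" .
  qed
  also have "\<dots> = emeasure lborel S * (\<integral>\<^sup>+x. (b x)\<^sup>2 \<partial>lborel)" by (simp add: nn_integral_multc)
  finally have "(nnform u S a b)\<^sup>2 \<le> (emeasure lborel S * (\<integral>\<^sup>+x. (a x)\<^sup>2 \<partial>lborel)) * (emeasure lborel S * (\<integral>\<^sup>+x. (b x)\<^sup>2 \<partial>lborel))"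
    using nnform_Cauchy_Schwarz[OF assms, of u] by (auto elim!: order_trans intro: mult_left_mono)
  then show ?thesis by (simp add: power2_eq_square mult_ac)
qed

text \<open>Off the degenerate set the distribution of the phase has bounded density, which gives a
  bound of type L^1 times L^1. The density is controlled on squares of side r, which is why b enters
  through its mean over such squares; the resulting constant does not involve r.\<close>

lemma nnform_improving:
  obtains K where "K \<ge> (1::real)"
    "\<And>u \<epsilon> r a b. 0 \<le> u \<Longrightarrow> u \<le> 1 \<Longrightarrow> 0 < \<epsilon> \<Longrightarrow> \<epsilon> \<le> 1 \<Longrightarrow> 0 < r \<Longrightarrow> a \<in> borel_measurable borel \<Longrightarrow> b \<in> borel_measurable borel \<Longrightarrow>
      nnform u {t \<in> unit_square. \<epsilon> < \<bar>phase_jac u t\<bar>} a (\<lambda>x. ennreal (1 / r\<^sup>2) * (\<integral>\<^sup>+y. indicator (qbox r) y * b (x + y) \<partial>lborel))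
        \<le> ennreal (K / \<epsilon> ^ 4) * ((\<integral>\<^sup>+x. a x \<partial>lborel) * (\<integral>\<^sup>+x. b x \<partial>lborel))"
proof -
  obtain K where K: "K \<ge> (1::real)" and dens: "\<And>u \<epsilon> r y. 0 \<le> u \<Longrightarrow> u \<le> 1 \<Longrightarrow> 0 < \<epsilon> \<Longrightarrow> \<epsilon> \<le> 1 \<Longrightarrow> 0 < r \<Longrightarrow>
      emeasure lborel {t \<in> unit_square. \<epsilon> < \<bar>phase_jac u t\<bar> \<and> y - phase u t \<in> qbox r} \<le> ennreal (K / \<epsilon> ^ 4 * r\<^sup>2)"
    by (rule phase_preimage_measure) blast
  have "nnform u {t \<in> unit_square. \<epsilon> < \<bar>phase_jac u t\<bar>} a (\<lambda>x. ennreal (1 / r\<^sup>2) * (\<integral>\<^sup>+y. indicator (qbox r) y * b (x + y) \<partial>lborel))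
        \<le> ennreal (K / \<epsilon> ^ 4) * ((\<integral>\<^sup>+x. a x \<partial>lborel) * (\<integral>\<^sup>+x. b x \<partial>lborel))"
    if u: "0 \<le> u" "u \<le> 1" and \<epsilon>: "0 < \<epsilon>" "\<epsilon> \<le> 1" and r: "0 < r" and [measurable]: "a \<in> borel_measurable borel" "b \<in> borel_measurable borel" for u \<epsilon> r a b
  proof -
    define G where "G = {t \<in> unit_square. \<epsilon> < \<bar>phase_jac u t\<bar>}"
    have [measurable]: "G \<in> sets borel" unfolding G_def by measurable
    define c where "c = ennreal (1 / r\<^sup>2)"
    define B where "B x = c * (\<integral>\<^sup>+y. indicator (qbox r) y * b (x + y) \<partial>lborel)" for x
    have [measurable]: "B \<in> borel_measurable borel" unfolding B_def by measurable
    have "nnform u G a B \<le> (\<integral>\<^sup>+t. \<integral>\<^sup>+x. indicator G t * (a x * B (x + phase u t)) \<partial>lborel \<partial>lborel)"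
      unfolding nnform_def
    proof (rule nn_integral_mono)
      fix t
      have "(\<integral>\<^sup>+x. indicator G t * indicator unit_square x * a (x + Bu u t) * B (x + power_sum_map t) \<partial>lborel)
         \<le> (\<integral>\<^sup>+x. indicator G t * (a (x + Bu u t) * B ((x + Bu u t) + phase u t)) \<partial>lborel)"
        by (intro nn_integral_mono) (auto simp: phase_def split: split_indicator)
      also have "\<dots> = (\<integral>\<^sup>+x. indicator G t * (a x * B (x + phase u t)) \<partial>lborel)"
        by (rule nn_integral_shift_Bu) measurable
      finally show "(\<integral>\<^sup>+x. indicator G t * indicator unit_square x * a (x + Bu u t) * B (x + power_sum_map t) \<partial>lborel)
         \<le> (\<integral>\<^sup>+x. indicator G t * (a x * B (x + phase u t)) \<partial>lborel)" .
    qed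
    also have "\<dots> = (\<integral>\<^sup>+x. \<integral>\<^sup>+t. indicator G t * (a x * B (x + phase u t)) \<partial>lborel \<partial>lborel)"
      by (rule lborel_pair.Fubini') measurable
    also have "\<dots> \<le> (\<integral>\<^sup>+x. a x * (ennreal (K / \<epsilon> ^ 4) * (\<integral>\<^sup>+x. b x \<partial>lborel)) \<partial>lborel)"
    proof (rule nn_integral_mono)
      fix x
      have "(\<integral>\<^sup>+t. indicator G t * (a x * B (x + phase u t)) \<partial>lborel) = a x * (\<integral>\<^sup>+t. indicator G t * B (x + phase u t) \<partial>lborel)"
        by (subst nn_integral_cmult[symmetric]) (measurable, simp add: mult_ac)
      also have "(\<integral>\<^sup>+t. indicator G t * B (x + phase u t) \<partial>lborel) = (\<integral>\<^sup>+t. \<integral>\<^sup>+y. c * (indicator G t * (indicator (qbox r) y * b (x + phase u t + y))) \<partial>lborel \<partial>lborel)"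
      proof (rule nn_integral_cong)
        fix t
        have "(\<integral>\<^sup>+y. (c * indicator G t) * (indicator (qbox r) y * b (x + phase u t + y)) \<partial>lborel)
           = (c * indicator G t) * (\<integral>\<^sup>+y. indicator (qbox r) y * b (x + phase u t + y) \<partial>lborel)"
          by (rule nn_integral_cmult) measurable
        then show "indicator G t * B (x + phase u t) = (\<integral>\<^sup>+y. c * (indicator G t * (indicator (qbox r) y * b (x + phase u t + y))) \<partial>lborel)"
          unfolding B_def by (simp only: mult.assoc mult.left_commute[of "indicator G t" c])
      qed
      \<comment> \<open>After the substitution v = y + \<open>phase u t\<close> the integral over t
        becomes the measure of those t for which v - \<open>phase u t\<close> lies in the square of
        side r.\<close>
      also have "\<dots> = (\<integral>\<^sup>+t. \<integral>\<^sup>+v. c * (indicator G t * (indicator (qbox r) (v - phase u t) * b (x + v))) \<partial>lborel \<partial>lborel)"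
      proof (rule nn_integral_cong)
        fix t
        have "(\<integral>\<^sup>+v. c * (indicator G t * (indicator (qbox r) (v - phase u t) * b (x + v))) \<partial>lborel)
          = (\<integral>\<^sup>+y. c * (indicator G t * (indicator (qbox r) ((y + phase u t) - phase u t) * b (x + (y + phase u t)))) \<partial>lborel)"
          by (rule nn_integral_shift_Bu[symmetric]) measurable
        then show "(\<integral>\<^sup>+y. c * (indicator G t * (indicator (qbox r) y * b (x + phase u t + y))) \<partial>lborel)
          = (\<integral>\<^sup>+v. c * (indicator G t * (indicator (qbox r) (v - phase u t) * b (x + v))) \<partial>lborel)"
          by (simp add: add_ac)
      qed
      also have "\<dots> = (\<integral>\<^sup>+v. \<integral>\<^sup>+t. c * (indicator G t * (indicator (qbox r) (v - phase u t) * b (x + v))) \<partial>lborel \<partial>lborel)"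
        by (rule lborel_pair.Fubini') measurable
      also have "\<dots> \<le> (\<integral>\<^sup>+v. ennreal (K / \<epsilon> ^ 4) * b (x + v) \<partial>lborel)"
      proof (rule nn_integral_mono)
        fix v
        have "(\<integral>\<^sup>+t. c * (indicator G t * (indicator (qbox r) (v - phase u t) * b (x + v))) \<partial>lborel)
          = (\<integral>\<^sup>+t. (c * b (x + v)) * indicator {t \<in> unit_square. \<epsilon> < \<bar>phase_jac u t\<bar> \<and> v - phase u t \<in> qbox r} t \<partial>lborel)"
          by (intro nn_integral_cong) (auto simp: G_def mult_ac split: split_indicator)
        also have "\<dots> = (c * b (x + v)) * emeasure lborel {t \<in> unit_square. \<epsilon> < \<bar>phase_jac u t\<bar> \<and> v - phase u t \<in> qbox r}"
          by (rule nn_integral_cmult_indicator) measurable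
        also have "\<dots> \<le> (c * b (x + v)) * ennreal (K / \<epsilon> ^ 4 * r\<^sup>2)" by (intro mult_left_mono dens u \<epsilon> r) auto
        also have "\<dots> = (c * ennreal (K / \<epsilon> ^ 4 * r\<^sup>2)) * b (x + v)" by (simp add: mult_ac)
        also have "c * ennreal (K / \<epsilon> ^ 4 * r\<^sup>2) = ennreal (K / \<epsilon> ^ 4)"
          unfolding c_def using r K \<epsilon> by (subst ennreal_mult[symmetric]) auto
        finally show "(\<integral>\<^sup>+t. c * (indicator G t * (indicator (qbox r) (v - phase u t) * b (x + v))) \<partial>lborel) \<le> ennreal (K / \<epsilon> ^ 4) * b (x + v)" .
      qed
      also have "\<dots> = ennreal (K / \<epsilon> ^ 4) * (\<integral>\<^sup>+x. b x \<partial>lborel)"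
        using nn_integral_lborel_shift[of b x] by (simp add: nn_integral_cmult)
      finally show "(\<integral>\<^sup>+t. indicator G t * (a x * B (x + phase u t)) \<partial>lborel) \<le> a x * (ennreal (K / \<epsilon> ^ 4) * (\<integral>\<^sup>+x. b x \<partial>lborel))"
        by (simp add: mult_left_mono)
    qed
    also have "\<dots> = ennreal (K / \<epsilon> ^ 4) * ((\<integral>\<^sup>+x. a x \<partial>lborel) * (\<integral>\<^sup>+x. b x \<partial>lborel))"
      by (simp add: nn_integral_multc mult_ac)
    finally show ?thesis unfolding G_def B_def c_def .
  qed
  with K show thesis by (rule that)
qed

section \<open>Decomposition of the high-frequency function\<close>

lemma interval_shift_integral:
  fixes \<delta> r :: real
  assumes "r > 0"
  shows "integrable lborel (\<lambda>a. \<bar>indicator {0..r} a - indicator {0..r} (a - \<delta>)\<bar> :: real)"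
    and "(LINT a|lborel. \<bar>indicator {0..r} a - indicator {0..r} (a - \<delta>)\<bar> :: real) \<le> 2 * \<bar>\<delta>\<bar>"
proof -
  have i: "integrable lborel (\<lambda>a. indicator {min 0 \<delta>..max 0 \<delta>} a + indicator {min r (r + \<delta>)..max r (r + \<delta>)} a :: real)"
    by (intro Bochner_Integration.integrable_add) (auto simp: integrable_indicator_iff emeasure_lborel_Icc_eq)
  have b: "\<bar>indicator {0..r} a - indicator {0..r} (a - \<delta>)\<bar> \<le> (indicator {min 0 \<delta>..max 0 \<delta>} a + indicator {min r (r + \<delta>)..max r (r + \<delta>)} a :: real)" for a
    using assms by (cases "0 \<le> \<delta>") (auto simp: min_def max_def split: split_indicator)
  show ii: "integrable lborel (\<lambda>a. \<bar>indicator {0..r} a - indicator {0..r} (a - \<delta>)\<bar> :: real)"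
    by (rule Bochner_Integration.integrable_bound[OF i]) (auto intro!: AE_I2 b)
  have "(LINT a|lborel. \<bar>indicator {0..r} a - indicator {0..r} (a - \<delta>)\<bar> :: real) \<le> (LINT a|lborel. indicator {min 0 \<delta>..max 0 \<delta>} a + indicator {min r (r + \<delta>)..max r (r + \<delta>)} a)"
    by (rule integral_mono[OF ii i b])
  also have "\<dots> = (max 0 \<delta> - min 0 \<delta>) + (max r (r + \<delta>) - min r (r + \<delta>))"
    by (subst Bochner_Integration.integral_add) (auto simp: integrable_indicator_iff emeasure_lborel_Icc_eq)
  also have "\<dots> = 2 * \<bar>\<delta>\<bar>" by (auto simp: min_def max_def)
  finally show "(LINT a|lborel. \<bar>indicator {0..r} a - indicator {0..r} (a - \<delta>)\<bar> :: real) \<le> 2 * \<bar>\<delta>\<bar>" .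
qed

lemma qbox_shift_integral:
  assumes r: "r > 0"
  shows "(LINT v|lborel. \<bar>indicator (qbox r) v - indicator (qbox r) (v - d)\<bar> :: real) \<le> 4 * r * norm d"
    and "integrable lborel (\<lambda>v. \<bar>indicator (qbox r) v - indicator (qbox r) (v - d)\<bar> :: real)"
proof -
  define D where "D \<delta> a = (\<bar>indicator {0..r} a - indicator {0..r} (a - \<delta>)\<bar> :: real)" for \<delta> a
  define I1 where "I1 a = (indicator {0..r} a :: real)" for a
  have Dh: "has_bochner_integral lborel (D \<delta>) (integral\<^sup>L lborel (D \<delta>))" "integral\<^sup>L lborel (D \<delta>) \<le> 2 * \<bar>\<delta>\<bar>" for \<delta>
    using interval_shift_integral[OF r, of \<delta>] by (auto simp: D_def[abs_def] has_bochner_integral_iff)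
  have Ih: "has_bochner_integral lborel I1 r" unfolding I1_def using r has_bochner_integral_real_indicator[of "{0..r}" lborel] by simp
  have I2h: "has_bochner_integral lborel (\<lambda>a. I1 (a - \<delta>)) r" for \<delta>
  proof -
    have "integrable lborel I1" using Ih by (simp add: has_bochner_integral_iff)
    then have "integrable lborel (\<lambda>a. I1 (a + (- \<delta>)))" by (rule integrable_lborel_shift)
    moreover have "(LINT a|lborel. I1 (a + (- \<delta>))) = (LINT a|lborel. I1 a)" by (rule integral_lborel_shift) (simp add: I1_def)
    ultimately show ?thesis using Ih by (simp add: has_bochner_integral_iff)
  qed
  have h: "has_bochner_integral lborel (\<lambda>v. D (fst d) (fst v) * I1 (snd v) + I1 (fst v - fst d) * D (snd d) (snd v))
     (integral\<^sup>L lborel (D (fst d)) * r + r * integral\<^sup>L lborel (D (snd d)))"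
    by (intro has_bochner_integral_add has_bochner_integral_pair_mult[OF Dh(1) Ih] has_bochner_integral_pair_mult[OF I2h Dh(1)])
  have b: "\<bar>indicator (qbox r) v - indicator (qbox r) (v - d)\<bar> \<le> D (fst d) (fst v) * I1 (snd v) + I1 (fst v - fst d) * D (snd d) (snd v)" for v
  proof -
    have q: "indicator (qbox r) v = I1 (fst v) * I1 (snd v)" for v
      by (cases v) (auto simp: qbox_def I1_def split: split_indicator)
    have I1: "0 \<le> I1 a" for a by (simp add: I1_def)
    have "indicator (qbox r) v - indicator (qbox r) (v - d) = (I1 (fst v) - I1 (fst v - fst d)) * I1 (snd v) + I1 (fst v - fst d) * (I1 (snd v) - I1 (snd v - snd d))"
      unfolding q by (simp add: algebra_simps)
    also have "\<bar>\<dots>\<bar> \<le> \<bar>I1 (fst v) - I1 (fst v - fst d)\<bar> * I1 (snd v) + I1 (fst v - fst d) * \<bar>I1 (snd v) - I1 (snd v - snd d)\<bar>"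
      by (rule order_trans[OF abs_triangle_ineq]) (simp add: abs_mult I1)
    finally show ?thesis by (simp add: D_def I1_def)
  qed
  show i: "integrable lborel (\<lambda>v. \<bar>indicator (qbox r) v - indicator (qbox r) (v - d)\<bar> :: real)"
  proof (rule Bochner_Integration.integrable_bound)
    show "integrable lborel (\<lambda>v. D (fst d) (fst v) * I1 (snd v) + I1 (fst v - fst d) * D (snd d) (snd v))"
      using h by (simp add: has_bochner_integral_iff)
    show "AE v in lborel. norm \<bar>indicator (qbox r) v - indicator (qbox r) (v - d) :: real\<bar> \<le> norm (D (fst d) (fst v) * I1 (snd v) + I1 (fst v - fst d) * D (snd d) (snd v))"
      using b by (auto intro!: AE_I2 order_trans[OF b abs_ge_self])
  qed simp
  have "(LINT v|lborel. \<bar>indicator (qbox r) v - indicator (qbox r) (v - d)\<bar> :: real) \<le> integral\<^sup>L lborel (D (fst d)) * r + r * integral\<^sup>L lborel (D (snd d))"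
    using integral_mono[OF i _ b] h by (simp add: has_bochner_integral_iff)
  also have "\<dots> \<le> (2 * \<bar>fst d\<bar>) * r + r * (2 * \<bar>snd d\<bar>)"
    using Dh(2) r by (intro add_mono mult_right_mono mult_left_mono) auto
  also have "\<dots> = r * (2 * \<bar>fst d\<bar> + 2 * \<bar>snd d\<bar>)" by (simp add: algebra_simps)
  also have "\<dots> \<le> r * (4 * norm d)"
    using norm_fst_le[of "fst d" "snd d"] norm_snd_le[of "snd d" "fst d"] r by (intro mult_left_mono) auto
  finally show "(LINT v|lborel. \<bar>indicator (qbox r) v - indicator (qbox r) (v - d)\<bar> :: real) \<le> 4 * r * norm d" by simp
qed

lemma avg_integrable_bounded:
  fixes b :: "plane \<Rightarrow> 'b::{banach, second_countable_topology}"
  assumes [measurable]: "b \<in> borel_measurable borel" and M: "\<And>x. norm (b x) \<le> M"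
  shows "integrable lborel (\<lambda>y. indicator (qbox r) y *\<^sub>R b (x + y))"
proof (rule Bochner_Integration.integrable_bound)
  show "integrable lborel (\<lambda>y. indicator (qbox r) y * M :: real)" by simp
  show "AE y in lborel. norm (indicator (qbox r) y *\<^sub>R b (x + y)) \<le> norm (indicator (qbox r) y * M)"
  proof (intro AE_I2)
    fix y
    have "norm (b (x + y)) \<le> \<bar>M\<bar>" by (rule order_trans[OF M abs_ge_self])
    then show "norm (indicator (qbox r) y *\<^sub>R b (x + y)) \<le> norm (indicator (qbox r) y * M)" by (simp split: split_indicator)
  qed
qed measurable

lemma avg_bounded:
  fixes b :: "plane \<Rightarrow> real"
  assumes [measurable]: "b \<in> borel_measurable borel" and M: "\<And>x. \<bar>b x\<bar> \<le> M" and r: "r > 0"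
  shows "\<bar>avg r b x\<bar> \<le> M"
proof -
  have "\<bar>LINT y|lborel. indicator (qbox r) y *\<^sub>R b (x + y)\<bar> \<le> (LINT y|lborel. indicator (qbox r) y * M)"
  proof (rule integral_abs_bound_integral)
    show "integrable lborel (\<lambda>y. indicator (qbox r) y *\<^sub>R b (x + y))" using M by (intro avg_integrable_bounded) auto
    show "\<bar>indicator (qbox r) y *\<^sub>R b (x + y)\<bar> \<le> indicator (qbox r) y * M" for y using M by (simp split: split_indicator)
  qed simp
  also have "\<dots> = r\<^sup>2 * M" using r by simp
  finally have "\<bar>LINT y|lborel. indicator (qbox r) y *\<^sub>R b (x + y)\<bar> \<le> r\<^sup>2 * M" .
  then show ?thesis using r by (simp add: avg_def abs_mult field_simps)
qed

text \<open>Written as an integral over a translated square, the mean transfers the difference from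
  b to the squares, whose symmetric difference has area at most 4 r norm (p - q).\<close>

lemma avg_lipschitz:
  fixes b :: "plane \<Rightarrow> real"
  assumes [measurable]: "b \<in> borel_measurable borel" and M: "\<And>x. \<bar>b x\<bar> \<le> M" and r: "r > 0"
  shows "\<bar>avg r b p - avg r b q\<bar> \<le> 4 * M / r * norm (p - q)"
proof -
  have M0: "0 \<le> M" using order_trans[OF abs_ge_zero M] .
  have e: "(LINT y|lborel. indicator (qbox r) y *\<^sub>R b (x + y)) = (LINT v|lborel. indicator (qbox r) (v - x) *\<^sub>R b v)" for x
  proof -
    have "(LINT v|lborel. indicator (qbox r) (v - x) *\<^sub>R b v) = (LINT y|lborel. indicator (qbox r) ((y + x) - x) *\<^sub>R b (y + x))"
      by (rule integral_lborel_shift[symmetric]) measurable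
    then show ?thesis by (simp add: add.commute)
  qed
  have i: "integrable lborel (\<lambda>v. indicator (qbox r) (v - x) *\<^sub>R b v)" for x
  proof -
    have "integrable lborel (\<lambda>y. indicator (qbox r) y *\<^sub>R b (x + y))" using M by (intro avg_integrable_bounded) auto
    from integrable_lborel_shift[OF this, of "- x"] show ?thesis by simp
  qed
  define d where "d = q - p"
  have si: "integrable lborel (\<lambda>v. \<bar>indicator (qbox r) (v - p) - indicator (qbox r) (v - q)\<bar> :: real)"
    using integrable_lborel_shift[OF qbox_shift_integral(2)[OF r, of d], of "- p"] by (simp add: d_def algebra_simps)
  have se: "(LINT v|lborel. \<bar>indicator (qbox r) (v - p) - indicator (qbox r) (v - q)\<bar> :: real) \<le> 4 * r * norm d"
  proof -
    have "(LINT v|lborel. \<bar>indicator (qbox r) (v + (- p)) - indicator (qbox r) (v + (- p) - d)\<bar> :: real) = (LINT v|lborel. \<bar>indicator (qbox r) v - indicator (qbox r) (v - d)\<bar>)"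
      by (rule integral_lborel_shift) measurable
    then show ?thesis using qbox_shift_integral(1)[OF r, of d] by (simp add: d_def algebra_simps)
  qed
  have "\<bar>(LINT v|lborel. indicator (qbox r) (v - p) *\<^sub>R b v) - (LINT v|lborel. indicator (qbox r) (v - q) *\<^sub>R b v)\<bar>
     = \<bar>LINT v|lborel. indicator (qbox r) (v - p) *\<^sub>R b v - indicator (qbox r) (v - q) *\<^sub>R b v\<bar>"
    by (subst Bochner_Integration.integral_diff[OF i i]) simp
  also have "\<dots> \<le> (LINT v|lborel. \<bar>indicator (qbox r) (v - p) - indicator (qbox r) (v - q)\<bar> * M)"
  proof (rule integral_abs_bound_integral)
    show "\<bar>indicator (qbox r) (v - p) *\<^sub>R b v - indicator (qbox r) (v - q) *\<^sub>R b v\<bar> \<le> \<bar>indicator (qbox r) (v - p) - indicator (qbox r) (v - q)\<bar> * M" for v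
      using M by (simp add: left_diff_distrib[symmetric] abs_mult mult_left_mono)
  qed (use i si in auto)
  also have "\<dots> \<le> (4 * r * norm d) * M" using se M0 by (simp add: mult_right_mono)
  finally have "\<bar>(LINT v|lborel. indicator (qbox r) (v - p) *\<^sub>R b v) - (LINT v|lborel. indicator (qbox r) (v - q) *\<^sub>R b v)\<bar> \<le> (4 * r * norm d) * M" .
  moreover have "avg r b p - avg r b q = (1 / r\<^sup>2) * ((LINT v|lborel. indicator (qbox r) (v - p) *\<^sub>R b v) - (LINT v|lborel. indicator (qbox r) (v - q) *\<^sub>R b v))"
    unfolding avg_def e by (simp add: right_diff_distrib)
  ultimately have "\<bar>avg r b p - avg r b q\<bar> \<le> (1 / r\<^sup>2) * ((4 * r * norm d) * M)"
    using r by (simp add: abs_mult divide_right_mono)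
  also have "\<dots> = 4 * M / r * norm (p - q)" using r by (simp add: d_def power2_eq_square norm_minus_commute)
  finally show ?thesis .
qed

text \<open>Means commute, so the mean of side r may be taken last, of \<open>avg s b\<close>, which
  is Lipschitz with constant 4 M / s. Hence \<open>avg r b - avg q b\<close> has tiny means at any
  scale s far above r and q: this is the cancellation behind \<open>quad_form_small\<close>.\<close>

lemma avg_avg_close:
  fixes b :: "plane \<Rightarrow> real"
  assumes [measurable]: "b \<in> borel_measurable borel" and M: "\<And>x. \<bar>b x\<bar> \<le> M" and r: "r > 0" and s: "s > 0"
  shows "\<bar>avg s (avg r b) x - avg s b x\<bar> \<le> 8 * M * r / s"
proof -
  have M0: "0 \<le> M" using order_trans[OF abs_ge_zero M] .
  have sw: "avg s (avg r b) x = avg r (avg s b) x"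
  proof -
    have "(LINT y|lborel. LINT w|lborel. indicator (qbox s) y * (indicator (qbox r) w * b (x + y + w)))
       = (LINT w|lborel. LINT y|lborel. indicator (qbox s) y * (indicator (qbox r) w * b (x + y + w)))"
    proof (rule Fubini_dominated)
      show "integrable lborel (\<lambda>y. indicator (qbox s) y * M :: real)" "integrable lborel (\<lambda>w. indicator (qbox r) w :: real)" by simp_all
      show "norm (indicator (qbox s) y * (indicator (qbox r) w * b (x + y + w))) \<le> indicator (qbox s) y * M * indicator (qbox r) w" for y w
        using M by (simp split: split_indicator)
    qed measurable
    moreover have "avg s (avg r b) x = (1 / s\<^sup>2) * ((1 / r\<^sup>2) * (LINT y|lborel. LINT w|lborel. indicator (qbox s) y * (indicator (qbox r) w * b (x + y + w))))"
    proof -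
      have "indicator (qbox s) y *\<^sub>R avg r b (x + y) = (1 / r\<^sup>2) * (LINT w|lborel. indicator (qbox s) y * (indicator (qbox r) w * b (x + y + w)))" for y
        by (simp add: avg_def)
      then show ?thesis unfolding avg_def[of s "avg r b"] by simp
    qed
    moreover have "avg r (avg s b) x = (1 / r\<^sup>2) * ((1 / s\<^sup>2) * (LINT w|lborel. LINT y|lborel. indicator (qbox s) y * (indicator (qbox r) w * b (x + y + w))))"
    proof -
      have c: "indicator (qbox s) y * (indicator (qbox r) w * b (x + y + w)) = indicator (qbox r) w * (indicator (qbox s) y * b (x + w + y))" for w y
        by (simp add: ac_simps)
      have "indicator (qbox r) w *\<^sub>R avg s b (x + w) = (1 / s\<^sup>2) * (LINT y|lborel. indicator (qbox s) y * (indicator (qbox r) w * b (x + y + w)))" for w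
        unfolding c by (simp add: avg_def)
      then show ?thesis unfolding avg_def[of r "avg s b"] by simp
    qed
    ultimately show ?thesis by simp
  qed
  define B where "B = avg s b"
  have [measurable]: "B \<in> borel_measurable borel" unfolding B_def by measurable
  have BM: "\<bar>B y\<bar> \<le> M" for y unfolding B_def by (rule avg_bounded[OF assms(1) M s])
  have iB: "integrable lborel (\<lambda>y. indicator (qbox r) y *\<^sub>R B (x + y))" using BM by (intro avg_integrable_bounded) auto
  have e: "(LINT y|lborel. indicator (qbox r) y *\<^sub>R B (x + y) - indicator (qbox r) y *\<^sub>R B x)
     = (LINT y|lborel. indicator (qbox r) y *\<^sub>R B (x + y)) - r\<^sup>2 * B x"
    using iB r by (subst Bochner_Integration.integral_diff) auto
  have "\<bar>LINT y|lborel. indicator (qbox r) y *\<^sub>R B (x + y) - indicator (qbox r) y *\<^sub>R B x\<bar> \<le> (LINT y|lborel. indicator (qbox r) y * (8 * M * r / s))"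
  proof (rule integral_abs_bound_integral)
    fix y
    have "\<bar>B (x + y) - B x\<bar> \<le> 8 * M * r / s" if y: "y \<in> qbox r"
    proof -
      have "norm y \<le> 2 * r" using y norm_Pair_le[of "fst y" "snd y"] by (auto simp: qbox_def)
      then have "4 * M / s * norm (x + y - x) \<le> 4 * M / s * (2 * r)" using M0 s by (intro mult_left_mono) auto
      then show ?thesis using avg_lipschitz[OF assms(1) M s, of "x + y" x] by (simp add: B_def)
    qed
    then show "\<bar>indicator (qbox r) y *\<^sub>R B (x + y) - indicator (qbox r) y *\<^sub>R B x\<bar> \<le> indicator (qbox r) y * (8 * M * r / s)"
      by (simp split: split_indicator)
  qed (use iB in auto)
  also have "\<dots> = r\<^sup>2 * (8 * M * r / s)" using r by simp
  finally have "\<bar>(LINT y|lborel. indicator (qbox r) y *\<^sub>R B (x + y)) - r\<^sup>2 * B x\<bar> \<le> r\<^sup>2 * (8 * M * r / s)" unfolding e .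
  moreover have "(LINT y|lborel. indicator (qbox r) y *\<^sub>R B (x + y)) = r\<^sup>2 * avg r B x" using r by (simp add: avg_def)
  ultimately have "r\<^sup>2 * \<bar>avg r B x - B x\<bar> \<le> r\<^sup>2 * (8 * M * r / s)"
    by (simp add: right_diff_distrib[symmetric] abs_mult)
  then have "\<bar>avg r B x - B x\<bar> \<le> 8 * M * r / s" by (rule mult_left_le_imp_le) (use r in simp)
  then show ?thesis unfolding sw B_def .
qed

text \<open>If f is not integrable, the left side is 0; if g has infinite norm, the right side is
  infinite. In the remaining case h is integrable and the triangle inequality applies.\<close>

lemma ennreal_norm_integral_add_le:
  fixes f g h :: "'a \<Rightarrow> 'b::{banach, second_countable_topology}"
  assumes [measurable]: "g \<in> borel_measurable M" and f: "\<And>x. f x = g x + h x"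
  shows "ennreal (norm (integral\<^sup>L M f)) \<le> (\<integral>\<^sup>+x. ennreal (norm (g x)) \<partial>M) + ennreal (norm (integral\<^sup>L M h))"
proof (cases "integrable M f \<and> (\<integral>\<^sup>+x. ennreal (norm (g x)) \<partial>M) < \<infinity>")
  case True
  then have g: "integrable M g" and fi: "integrable M f" by (auto intro: integrableI_bounded)
  have "h = (\<lambda>x. f x - g x)" using f by (auto simp: fun_eq_iff)
  then have h: "integrable M h" using g fi by simp
  have "integral\<^sup>L M f = integral\<^sup>L M g + integral\<^sup>L M h"
    using Bochner_Integration.integral_add[OF g h] f by (simp add: fun_eq_iff cong: Bochner_Integration.integral_cong)
  then have "norm (integral\<^sup>L M f) \<le> norm (integral\<^sup>L M g) + norm (integral\<^sup>L M h)" by (simp add: norm_triangle_ineq)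
  then have "ennreal (norm (integral\<^sup>L M f)) \<le> ennreal (norm (integral\<^sup>L M g)) + ennreal (norm (integral\<^sup>L M h))"
    by (simp add: ennreal_plus[symmetric] ennreal_leI del: ennreal_plus)
  also have "\<dots> \<le> (\<integral>\<^sup>+x. ennreal (norm (g x)) \<partial>M) + ennreal (norm (integral\<^sup>L M h))"
    by (intro add_right_mono ennreal_norm_integral_le)
  finally show ?thesis .
next
  case False
  then show ?thesis by (auto simp: not_integrable_integral_eq not_less top_unique)
qed

lemma ennreal_le_of_square_le: "a\<^sup>2 \<le> ennreal (x\<^sup>2) \<Longrightarrow> 0 \<le> x \<Longrightarrow> a \<le> ennreal x"
proof (cases a)
  case (real c)
  assume a: "a\<^sup>2 \<le> ennreal (x\<^sup>2)" and x: "0 \<le> x"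
  then have "c\<^sup>2 \<le> x\<^sup>2" using real by (simp add: ennreal_power ennreal_le_iff)
  then show ?thesis using real x by (auto intro: ennreal_leI power2_le_imp_le)
qed (simp add: top_unique)

section \<open>Algebra of the absolute form and the size of the degenerate set\<close>

lemma nnform_add:
  assumes [measurable]: "S \<in> sets borel" "a \<in> borel_measurable borel" "b \<in> borel_measurable borel" "c \<in> borel_measurable borel"
  shows "nnform u S a (\<lambda>x. b x + c x) = nnform u S a b + nnform u S a c"
proof -
  show ?thesis
    unfolding nnform_def distrib_left
    by (subst nn_integral_add[symmetric]) (measurable, intro nn_integral_cong nn_integral_add, measurable)
qed

lemma nnform_mono:
  assumes "S \<subseteq> S'" "\<And>x. a x \<le> a' x" "\<And>x. b x \<le> b' x"
  shows "nnform u S a b \<le> nnform u S' a' b'"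
  unfolding nnform_def
  by (intro nn_integral_mono mult_mono) (use assms in \<open>auto split: split_indicator\<close>)

lemma nnform_Un:
  assumes [measurable]: "S \<in> sets borel" "S' \<in> sets borel" "a \<in> borel_measurable borel" "b \<in> borel_measurable borel"
  shows "nnform u (S \<union> S') a b \<le> nnform u S a b + nnform u S' a b"
proof -
  have "nnform u (S \<union> S') a b \<le> (\<integral>\<^sup>+t. \<integral>\<^sup>+x. indicator S t * indicator unit_square x * a (x + Bu u t) * b (x + power_sum_map t)
      + indicator S' t * indicator unit_square x * a (x + Bu u t) * b (x + power_sum_map t) \<partial>lborel \<partial>lborel)"
    unfolding nnform_def by (intro nn_integral_mono) (auto split: split_indicator)
  also have "\<dots> = nnform u S a b + nnform u S' a b"
    unfolding nnform_def
    by (subst nn_integral_add[symmetric]) (measurable, intro nn_integral_cong nn_integral_add, measurable)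
  finally show ?thesis .
qed

lemma nnform_add_left:
  assumes [measurable]: "S \<in> sets borel" "a \<in> borel_measurable borel" "b \<in> borel_measurable borel" "c \<in> borel_measurable borel"
  shows "nnform u S (\<lambda>x. a x + c x) b = nnform u S a b + nnform u S c b"
proof -
  show ?thesis
    unfolding nnform_def distrib_left distrib_right
    by (subst nn_integral_add[symmetric]) (measurable, intro nn_integral_cong nn_integral_add, measurable)
qed

lemma nnform_const_left:
  assumes [measurable]: "b \<in> borel_measurable borel"
  shows "nnform u unit_square (\<lambda>_. c) b \<le> c * (\<integral>\<^sup>+x. b x \<partial>lborel)"
proof -
  have us: "emeasure lborel unit_square = 1" using emeasure_qbox[of 1] by (simp add: qbox_def)
  have "nnform u unit_square (\<lambda>_. c) b \<le> (\<integral>\<^sup>+t. indicator unit_square t * (c * (\<integral>\<^sup>+x. b x \<partial>lborel)) \<partial>lborel)"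
    unfolding nnform_def
  proof (rule nn_integral_mono)
    fix t
    have "(\<integral>\<^sup>+x. indicator unit_square t * indicator unit_square x * c * b (x + power_sum_map t) \<partial>lborel)
      \<le> (\<integral>\<^sup>+x. (indicator unit_square t * c) * b (x + power_sum_map t) \<partial>lborel)"
      by (intro nn_integral_mono) (auto split: split_indicator)
    also have "\<dots> = (indicator unit_square t * c) * (\<integral>\<^sup>+x. b (x + power_sum_map t) \<partial>lborel)" by (rule nn_integral_cmult) measurable
    also have "(\<integral>\<^sup>+x. b (x + power_sum_map t) \<partial>lborel) = (\<integral>\<^sup>+x. b x \<partial>lborel)" by (rule nn_integral_shift_Bu) measurable
    finally show "(\<integral>\<^sup>+x. indicator unit_square t * indicator unit_square x * c * b (x + power_sum_map t) \<partial>lborel)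
      \<le> indicator unit_square t * (c * (\<integral>\<^sup>+x. b x \<partial>lborel))" by (simp add: mult.assoc)
  qed
  also have "\<dots> = c * (\<integral>\<^sup>+x. b x \<partial>lborel)" using us by (simp add: nn_integral_multc)
  finally show ?thesis .
qed

lemma nnform_le_of_norms:
  assumes m: "S \<in> sets borel" "a \<in> borel_measurable borel" "b \<in> borel_measurable borel"
    and S: "emeasure lborel S \<le> ennreal \<sigma>" and a: "(\<integral>\<^sup>+x. (a x)\<^sup>2 \<partial>lborel) \<le> 1" and b: "(\<integral>\<^sup>+x. (b x)\<^sup>2 \<partial>lborel) \<le> ennreal (\<beta>\<^sup>2)"
    and pos: "0 \<le> \<sigma>" "0 \<le> \<beta>"
  shows "nnform u S a b \<le> ennreal (\<sigma> * \<beta>)"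
proof (rule ennreal_le_of_square_le)
  have "(nnform u S a b)\<^sup>2 \<le> (emeasure lborel S)\<^sup>2 * ((\<integral>\<^sup>+x. (a x)\<^sup>2 \<partial>lborel) * (\<integral>\<^sup>+x. (b x)\<^sup>2 \<partial>lborel))"
    by (rule nnform_le_norms[OF m])
  also have "\<dots> \<le> (ennreal \<sigma>)\<^sup>2 * (1 * ennreal (\<beta>\<^sup>2))"
    using S a b by (intro mult_mono power_mono) auto
  also have "\<dots> = ennreal ((\<sigma> * \<beta>)\<^sup>2)" using pos by (simp add: ennreal_power ennreal_mult[symmetric] power_mult_distrib)
  finally show "(nnform u S a b)\<^sup>2 \<le> ennreal ((\<sigma> * \<beta>)\<^sup>2)" .
qed (use pos in simp)

text \<open>The sublevel estimate at (-1, 1), about which the ball of radius 4 contains the unit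
  square. The doubled ball has area 64 pi, and pi < 4 turns 128 pi into 512.\<close>

lemma phase_degenerate_measure:
  obtains K where "K \<ge> (1::real)"
    "\<And>u \<epsilon> \<delta>. 0 \<le> u \<Longrightarrow> u \<le> 1 \<Longrightarrow> 0 < \<delta> \<Longrightarrow> K * \<epsilon> \<le> \<delta> ^ 4 \<Longrightarrow>
      emeasure lborel {t \<in> unit_square. \<bar>phase_jac u t\<bar> \<le> \<epsilon>} \<le> ennreal (512 * \<delta>)"
proof -
  obtain Cs where Cs: "Cs > 0" and sub: "\<And>(f::plane \<Rightarrow> real) \<theta> \<rho> \<epsilon> \<delta>.
    f \<in> borel_measurable borel \<Longrightarrow> (\<forall>v. polyfun 4 (\<lambda>r. f (\<theta> + r *\<^sub>R v))) \<Longrightarrow> \<bar>f \<theta>\<bar> \<ge> 1 \<Longrightarrow>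
    0 < \<rho> \<Longrightarrow> 0 < \<delta> \<Longrightarrow> Cs * \<epsilon> \<le> \<delta> ^ 4 \<Longrightarrow>
    emeasure lborel {z \<in> cball \<theta> \<rho>. \<bar>f z\<bar> \<le> \<epsilon>} \<le> ennreal (2 * \<delta>) * emeasure lborel (cball \<theta> (2 * \<rho>))"
    using sublevel_measure[of 4, where 'a="plane"] by auto
  show thesis
  proof (rule that[of "max 1 Cs"])
    fix u \<epsilon> \<delta> :: real
    assume u: "0 \<le> u" "u \<le> 1" and \<delta>: "0 < \<delta>" and \<epsilon>: "max 1 Cs * \<epsilon> \<le> \<delta> ^ 4"
    show "emeasure lborel {t \<in> unit_square. \<bar>phase_jac u t\<bar> \<le> \<epsilon>} \<le> ennreal (512 * \<delta>)"
    proof (cases "0 \<le> \<epsilon>")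
      case False
      then have e: "{t \<in> unit_square. \<bar>phase_jac u t\<bar> \<le> \<epsilon>} = {}" by auto
      show ?thesis unfolding e by simp
    next
      case True
      have [measurable]: "cball (-1::real, 1::real) 4 \<in> sets borel" by simp
      have s: "{t \<in> unit_square. \<bar>phase_jac u t\<bar> \<le> \<epsilon>} \<subseteq> {t \<in> cball (-1, 1) 4. \<bar>phase_jac u t\<bar> \<le> \<epsilon>}"
      proof
        fix t assume t: "t \<in> {t \<in> unit_square. \<bar>phase_jac u t\<bar> \<le> \<epsilon>}"
        have "norm (- 1 - fst t, 1 - snd t) \<le> \<bar>- 1 - fst t\<bar> + \<bar>1 - snd t\<bar>" using norm_Pair_le[of "- 1 - fst t" "1 - snd t"] by simp
        also have "\<dots> \<le> 4" using t by auto
        finally have "dist (-1, 1) t \<le> 4" by (cases t) (simp add: dist_norm)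
        then show "t \<in> {t \<in> cball (-1, 1) 4. \<bar>phase_jac u t\<bar> \<le> \<epsilon>}" using t by simp
      qed
      have "emeasure lborel {t \<in> unit_square. \<bar>phase_jac u t\<bar> \<le> \<epsilon>} \<le> emeasure lborel {t \<in> cball (-1, 1) 4. \<bar>phase_jac u t\<bar> \<le> \<epsilon>}"
        by (rule emeasure_mono[OF s]) measurable
      also have "\<dots> \<le> ennreal (2 * \<delta>) * emeasure lborel (cball (-1::real, 1::real) (2 * 4))"
      proof (rule sub)
        have "Cs * \<epsilon> \<le> max 1 Cs * \<epsilon>" using True by (intro mult_right_mono) auto
        then show "Cs * \<epsilon> \<le> \<delta> ^ 4" using \<epsilon> by simp
      qed (use phase_jac_polyfun phase_jac_base[OF u] \<delta> in auto)
      also have "emeasure lborel (cball (-1::real, 1::real) (2 * 4)) = ennreal (pi * 64)"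
        using emeasure_cball[of 8 "(-1::real, 1::real)"] unit_ball_vol_2 by simp
      also have "ennreal (2 * \<delta>) * ennreal (pi * 64) = ennreal (2 * \<delta> * (pi * 64))" by (rule ennreal_mult[symmetric]) (use \<delta> in auto)
      also have "\<dots> \<le> ennreal (512 * \<delta>)" using pi_less_4 \<delta> by (intro ennreal_leI) auto
      finally show ?thesis .
    qed
  qed simp
qed

section \<open>Lipschitz cutoffs of a square\<close>

definition trapezoid :: "real \<Rightarrow> real \<Rightarrow> real \<Rightarrow> real" where
  "trapezoid \<kappa> l x = max 0 (min 1 (min x (l - x) / \<kappa>))"

lemma trapezoid_props:
  assumes \<kappa>: "\<kappa> > 0"
  shows "0 \<le> trapezoid \<kappa> l x" "trapezoid \<kappa> l x \<le> 1" "x \<notin> {0..l} \<Longrightarrow> trapezoid \<kappa> l x = 0"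
    "\<kappa> \<le> x \<Longrightarrow> x \<le> l - \<kappa> \<Longrightarrow> trapezoid \<kappa> l x = 1" "\<bar>trapezoid \<kappa> l x - trapezoid \<kappa> l y\<bar> \<le> 1 / \<kappa> * \<bar>x - y\<bar>"
proof -
  have mx: "\<bar>max 0 (min 1 a) - max 0 (min 1 b)\<bar> \<le> \<bar>a - b\<bar>" for a b :: real by linarith
  have "\<bar>min x (l - x) / \<kappa> - min y (l - y) / \<kappa>\<bar> = \<bar>min x (l - x) - min y (l - y)\<bar> / \<kappa>"
    using \<kappa> by (simp add: diff_divide_distrib[symmetric])
  also have "\<dots> \<le> \<bar>x - y\<bar> / \<kappa>" using \<kappa> by (intro divide_right_mono) linarith+
  finally show "\<bar>trapezoid \<kappa> l x - trapezoid \<kappa> l y\<bar> \<le> 1 / \<kappa> * \<bar>x - y\<bar>"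
    unfolding trapezoid_def using mx order_trans by (metis (no_types, lifting) mult.left_neutral times_divide_eq_left)
  show "x \<notin> {0..l} \<Longrightarrow> trapezoid \<kappa> l x = 0"
  proof -
    assume "x \<notin> {0..l}"
    then have "min x (l - x) < 0" by auto
    then have "min x (l - x) / \<kappa> < 0" using \<kappa> by (simp only: divide_neg_pos)
    then show ?thesis unfolding trapezoid_def by linarith
  qed
  show "\<kappa> \<le> x \<Longrightarrow> x \<le> l - \<kappa> \<Longrightarrow> trapezoid \<kappa> l x = 1"
  proof -
    assume "\<kappa> \<le> x" "x \<le> l - \<kappa>"
    then have "\<kappa> \<le> min x (l - x)" by auto
    then have "1 \<le> min x (l - x) / \<kappa>" using \<kappa> by (simp only: pos_le_divide_eq mult_1)
    then show ?thesis unfolding trapezoid_def by linarith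
  qed
qed (auto simp: trapezoid_def)

definition plateau :: "real \<Rightarrow> real \<Rightarrow> plane \<Rightarrow> real" where
  "plateau \<kappa> l t = trapezoid \<kappa> l (fst t) * trapezoid \<kappa> l (snd t)"

definition rim :: "real \<Rightarrow> real \<Rightarrow> plane set" where
  "rim \<kappa> l = ({0..\<kappa>} \<union> {l - \<kappa>..l}) \<times> {0..l} \<union> {0..l} \<times> ({0..\<kappa>} \<union> {l - \<kappa>..l})"

text \<open>Slope and measure of the rim are bounded in terms of \<kappa> alone, for every l in
  (0,1], also when 2 \<kappa> exceeds l and the rim covers the whole square. This makes the later
  decay uniform in l.\<close>

lemma plateau_props:
  assumes \<kappa>: "\<kappa> > 0" and l: "0 < l" "l \<le> 1"
  shows "0 \<le> plateau \<kappa> l t" "plateau \<kappa> l t \<le> 1" "norm t > 3/2 \<Longrightarrow> plateau \<kappa> l t = 0"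
    "\<bar>plateau \<kappa> l s - plateau \<kappa> l t\<bar> \<le> 2 / \<kappa> * norm (s - t)"
    "\<bar>indicator (qbox l) t - plateau \<kappa> l t\<bar> \<le> indicator (rim \<kappa> l) t"
    "rim \<kappa> l \<in> sets borel" "emeasure lborel (rim \<kappa> l) \<le> ennreal (4 * \<kappa>)"
proof -
  note tz = trapezoid_props[OF \<kappa>]
  have atz: "\<bar>trapezoid \<kappa> l x\<bar> \<le> 1" for x using tz(1,2)[of l x] by simp
  show p0: "0 \<le> plateau \<kappa> l t" for t unfolding plateau_def by (intro mult_nonneg_nonneg tz(1))
  show p1: "plateau \<kappa> l t \<le> 1" for t unfolding plateau_def by (intro mult_le_one tz)
  have out: "plateau \<kappa> l t = 0" if "t \<notin> qbox l" for t
    using that tz(3)[of "fst t" l] tz(3)[of "snd t" l] by (auto simp: plateau_def qbox_def mem_Times_iff)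
  show "plateau \<kappa> l t = 0" if n: "norm t > 3/2"
  proof (rule out, rule notI)
    assume t: "t \<in> qbox l"
    then have "\<bar>fst t\<bar> \<le> 1" "\<bar>snd t\<bar> \<le> 1" using l by (auto simp: qbox_def)
    then have "(fst t)\<^sup>2 \<le> 1" "(snd t)\<^sup>2 \<le> 1" by (simp_all add: abs_square_le_1)
    then have "(norm t)\<^sup>2 \<le> (3/2)\<^sup>2" by (simp add: norm_prod_def power2_eq_square)
    then have "norm t \<le> 3/2" by (rule power2_le_imp_le) simp
    then show False using n by simp
  qed
  have "\<bar>plateau \<kappa> l s - plateau \<kappa> l t\<bar> \<le> (1 / \<kappa> + 1 / \<kappa>) * norm (s - t)"
    unfolding plateau_def
  proof (intro lipschitz_mult atz)
    fix x y :: "plane"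
    have f: "\<bar>fst x - fst y\<bar> \<le> norm (x - y)" "\<bar>snd x - snd y\<bar> \<le> norm (x - y)"
      using norm_fst_le[of "fst (x - y)" "snd (x - y)", unfolded prod.collapse] norm_snd_le[of "snd (x - y)" "fst (x - y)", unfolded prod.collapse]
      by simp_all
    show "\<bar>trapezoid \<kappa> l (fst x) - trapezoid \<kappa> l (fst y)\<bar> \<le> 1 / \<kappa> * norm (x - y)"
      by (rule order_trans[OF tz(5)]) (use f \<kappa> in \<open>intro mult_left_mono, auto\<close>)
    show "\<bar>trapezoid \<kappa> l (snd x) - trapezoid \<kappa> l (snd y)\<bar> \<le> 1 / \<kappa> * norm (x - y)"
      by (rule order_trans[OF tz(5)]) (use f \<kappa> in \<open>intro mult_left_mono, auto\<close>)
  qed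
  then show "\<bar>plateau \<kappa> l s - plateau \<kappa> l t\<bar> \<le> 2 / \<kappa> * norm (s - t)" by simp
  show "\<bar>indicator (qbox l) t - plateau \<kappa> l t\<bar> \<le> indicator (rim \<kappa> l) t"
  proof (cases "t \<in> qbox l")
    case False then show ?thesis by (simp add: out)
  next
    case True
    show ?thesis
    proof (cases "t \<in> rim \<kappa> l")
      case True
      then show ?thesis using \<open>t \<in> qbox l\<close> p0[of t] p1[of t] by simp
    next
      case False
      then have "\<kappa> \<le> fst t" "fst t \<le> l - \<kappa>" "\<kappa> \<le> snd t" "snd t \<le> l - \<kappa>"
        using \<open>t \<in> qbox l\<close> by (auto simp: rim_def qbox_def mem_Times_iff)
      then have "plateau \<kappa> l t = 1" by (simp add: plateau_def tz(4))
      then show ?thesis using \<open>t \<in> qbox l\<close> by simp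
    qed
  qed
  have c: "closed (A \<times> B)" if "closed A" "closed B" for A B :: "real set" using that by (rule closed_Times)
  have Tm: "A \<times> B \<in> sets borel" if "closed A" "closed B" for A B :: "real set" using c[OF that] by simp
  have me: "emeasure lborel (A \<times> B) = emeasure lborel A * emeasure lborel B" if "A \<in> sets borel" "B \<in> sets borel" for A B :: "real set"
    using lborel.emeasure_pair_measure_Times[of A lborel B] that by (simp add: lborel_prod)
  have m1: "emeasure lborel ({0..\<kappa>} \<union> {l - \<kappa>..l}) \<le> ennreal (2 * \<kappa>)"
  proof -
    have "emeasure lborel ({0..\<kappa>} \<union> {l - \<kappa>..l}) \<le> emeasure lborel {0..\<kappa>} + emeasure lborel {l - \<kappa>..l}"
      by (rule emeasure_subadditive) auto
    also have "\<dots> = ennreal (2 * \<kappa>)" using \<kappa> by (simp add: ennreal_plus[symmetric] del: ennreal_plus)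
    finally show ?thesis .
  qed
  have m2: "emeasure lborel {0..l} \<le> 1" using l by simp
  show "rim \<kappa> l \<in> sets borel" unfolding rim_def by (intro sets.Un Tm closed_Un) auto
  have "emeasure lborel (rim \<kappa> l) \<le> emeasure lborel (({0..\<kappa>} \<union> {l - \<kappa>..l}) \<times> {0..l}) + emeasure lborel ({0..l} \<times> ({0..\<kappa>} \<union> {l - \<kappa>..l}))"
  proof -
    have "({0..\<kappa>} \<union> {l - \<kappa>..l}) \<times> {0..l} \<in> sets borel" "{0..l} \<times> ({0..\<kappa>} \<union> {l - \<kappa>..l}) \<in> sets borel"
      by (intro Tm closed_Un; simp)+
    then show ?thesis unfolding rim_def by (intro emeasure_subadditive) (simp_all only: sets_lborel)
  qed
  also have "\<dots> \<le> ennreal (2 * \<kappa>) * 1 + 1 * ennreal (2 * \<kappa>)"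
    using mult_mono[OF m1 m2] mult_mono[OF m2 m1] by (intro add_mono) (simp_all add: me)
  also have "\<dots> = ennreal (4 * \<kappa>)" using \<kappa> by (simp add: ennreal_plus[symmetric] del: ennreal_plus)
  finally show "emeasure lborel (rim \<kappa> l) \<le> ennreal (4 * \<kappa>)" .
qed

section \<open>The form with a Lipschitz cutoff\<close>

text \<open>The bilinear average with a general weight in t. Up to a null set,
  \<open>bilinear_avg R l\<close> is 2^(2l) times the case u = 1/R with the indicator of
  \<open>qbox (1 / 2 ^ l)\<close> as weight.\<close>

definition wform :: "real \<Rightarrow> (plane \<Rightarrow> real) \<Rightarrow> (plane \<Rightarrow> complex) \<Rightarrow> (plane \<Rightarrow> complex) \<Rightarrow> plane \<Rightarrow> complex" where
  "wform u w f F x = (LINT t|lborel. w t *\<^sub>R (f (x + Bu u t) * F (x + power_sum_map t)))"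

lemma emeasure_unit_square: "emeasure lborel unit_square = 1"
  using emeasure_qbox[of 1] by (simp add: qbox_def)

text \<open>Duality: pairing with the sign of the inner integral turns the L^1 norm into the form
  bounded by \<open>form_le_quad\<close>. Finiteness of the norm is settled beforehand, since a
  divergent Bochner integral would be 0 and bound nothing. The factor 4 absorbs 100, as 100 \<le>
  4^4.\<close>

lemma smooth_form_bound_real:
  fixes f F \<phi> :: "plane \<Rightarrow> real"
  assumes u: "0 \<le> u" "u \<le> 1" and fm[measurable]: "f \<in> borel_measurable borel" and f2: "(\<integral>\<^sup>+x. ennreal ((f x)\<^sup>2) \<partial>lborel) \<le> 1"
    and Fc: "continuous_on UNIV F" and FM: "\<And>p. \<bar>F p\<bar> \<le> M"
    and \<phi>: "\<And>t. 0 \<le> \<phi> t" "\<And>t. \<phi> t \<le> 1" "\<And>t. norm t > 3/2 \<Longrightarrow> \<phi> t = 0" "\<And>s t. \<bar>\<phi> s - \<phi> t\<bar> \<le> L * norm (s - t)" and L: "L \<ge> 1"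
    and \<phi>s: "\<And>t. \<phi> t \<le> indicator unit_square t"
    and V: "\<bar>LINT z|lborel. quad_weight \<phi> z * quad_prod u F z\<bar> \<le> v ^ 4" and v: "0 \<le> v"
  shows "(\<integral>\<^sup>+x. indicator unit_square x * ennreal \<bar>LINT t|lborel. f (x + Bu u t) * F (x + power_sum_map t) * \<phi> t\<bar> \<partial>lborel) \<le> ennreal (4 * v)"
proof -
  have M0: "0 \<le> M" using order_trans[OF abs_ge_zero FM] .
  have \<phi>c: "continuous_on UNIV \<phi>" by (rule lipschitz_imp_continuous[OF \<phi>(4)])
  have [measurable]: "F \<in> borel_measurable borel" "\<phi> \<in> borel_measurable borel"
    using Fc \<phi>c by (auto intro: borel_measurable_continuous_onI)
  define k where "k x = (LINT t|lborel. f (x + Bu u t) * F (x + power_sum_map t) * \<phi> t)" for x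
  have km[measurable]: "k \<in> borel_measurable borel" unfolding k_def by measurable
  have fi: "integrable lborel (\<lambda>x. (f x)\<^sup>2)" using f2 by (intro integrableI_bounded) (auto intro: le_less_trans)
  have fi1: "(LINT x|lborel. (f x)\<^sup>2) \<le> 1"
  proof -
    have "ennreal (LINT x|lborel. (f x)\<^sup>2) \<le> ennreal 1" using f2 nn_integral_eq_integral[OF fi] by simp
    then show ?thesis by (subst (asm) ennreal_le_iff) auto
  qed
  have "(\<integral>\<^sup>+x. indicator unit_square x * ennreal \<bar>k x\<bar> \<partial>lborel) \<le> (\<integral>\<^sup>+x. \<integral>\<^sup>+t. indicator unit_square t * indicator unit_square x * ennreal \<bar>f (x + Bu u t)\<bar> * ennreal M \<partial>lborel \<partial>lborel)"
  proof (rule nn_integral_mono)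
    fix x
    have "ennreal \<bar>k x\<bar> \<le> (\<integral>\<^sup>+t. ennreal \<bar>f (x + Bu u t) * F (x + power_sum_map t) * \<phi> t\<bar> \<partial>lborel)"
      using ennreal_norm_integral_le[of lborel "\<lambda>t. f (x + Bu u t) * F (x + power_sum_map t) * \<phi> t"] by (simp add: k_def)
    also have "\<dots> \<le> (\<integral>\<^sup>+t. indicator unit_square t * (ennreal \<bar>f (x + Bu u t)\<bar> * ennreal M) \<partial>lborel)"
    proof (rule nn_integral_mono)
      fix t
      have "\<bar>f (x + Bu u t)\<bar> * \<bar>F (x + power_sum_map t)\<bar> * \<bar>\<phi> t\<bar> \<le> \<bar>f (x + Bu u t)\<bar> * M * indicator unit_square t"
        using FM \<phi>(1)[of t] \<phi>s[of t] M0 by (intro mult_mono) auto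
      then have "ennreal \<bar>f (x + Bu u t) * F (x + power_sum_map t) * \<phi> t\<bar> \<le> ennreal (\<bar>f (x + Bu u t)\<bar> * M * indicator unit_square t)"
        by (intro ennreal_leI) (simp add: abs_mult)
      then show "ennreal \<bar>f (x + Bu u t) * F (x + power_sum_map t) * \<phi> t\<bar> \<le> indicator unit_square t * (ennreal \<bar>f (x + Bu u t)\<bar> * ennreal M)"
        using M0 by (auto simp: ennreal_mult split: split_indicator split_indicator_asm)
    qed
    finally show "indicator unit_square x * ennreal \<bar>k x\<bar> \<le> (\<integral>\<^sup>+t. indicator unit_square t * indicator unit_square x * ennreal \<bar>f (x + Bu u t)\<bar> * ennreal M \<partial>lborel)"
      by (auto simp: mult.assoc split: split_indicator)
  qed
  also have "\<dots> = nnform u unit_square (\<lambda>x. ennreal \<bar>f x\<bar>) (\<lambda>_. ennreal M)"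
    unfolding nnform_def by (rule lborel_pair.Fubini'[symmetric]) measurable
  also have "\<dots> < \<infinity>"
  proof -
    have "(nnform u unit_square (\<lambda>x. ennreal \<bar>f x\<bar>) (\<lambda>_. ennreal M))\<^sup>2 \<le> (emeasure lborel unit_square * (\<integral>\<^sup>+x. (ennreal \<bar>f x\<bar>)\<^sup>2 \<partial>lborel)) *
       (\<integral>\<^sup>+t. \<integral>\<^sup>+x. indicator unit_square t * indicator unit_square x * (ennreal M)\<^sup>2 \<partial>lborel \<partial>lborel)"
      by (rule nnform_Cauchy_Schwarz) measurable
    also have "(\<integral>\<^sup>+t. \<integral>\<^sup>+x. indicator unit_square t * indicator unit_square x * (ennreal M)\<^sup>2 \<partial>lborel \<partial>lborel) = (ennreal M)\<^sup>2"
      by (simp add: nn_integral_cmult nn_integral_multc emeasure_unit_square mult.assoc)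
    also have "(emeasure lborel unit_square * (\<integral>\<^sup>+x. (ennreal \<bar>f x\<bar>)\<^sup>2 \<partial>lborel)) * (ennreal M)\<^sup>2 \<le> 1 * (ennreal M)\<^sup>2"
      using f2 by (intro mult_right_mono) (simp_all add: emeasure_unit_square ennreal_power)
    finally have "(nnform u unit_square (\<lambda>x. ennreal \<bar>f x\<bar>) (\<lambda>_. ennreal M))\<^sup>2 \<le> 1 * (ennreal M)\<^sup>2" .
    then have "nnform u unit_square (\<lambda>x. ennreal \<bar>f x\<bar>) (\<lambda>_. ennreal M) \<le> ennreal M"
      unfolding mult_1 ennreal_power[OF M0] by (rule ennreal_le_of_square_le[OF _ M0])
    then show ?thesis by (rule le_less_trans) simp
  qed
  finally have fin: "(\<integral>\<^sup>+x. indicator unit_square x * ennreal \<bar>k x\<bar> \<partial>lborel) < \<infinity>" .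
  have en: "ennreal (indicator unit_square x * \<bar>k x\<bar>) = indicator unit_square x * ennreal \<bar>k x\<bar>" for x by (simp split: split_indicator)
  have ki: "integrable lborel (\<lambda>x. indicator unit_square x * \<bar>k x\<bar>)"
    using fin by (intro integrableI_bounded) (auto simp: en abs_mult)
  define h where "h x = indicator unit_square x * sgn (k x)" for x
  have [measurable]: "h \<in> borel_measurable borel" unfolding h_def by measurable
  have hb: "\<bar>h x\<bar> \<le> indicator unit_square x" for x by (auto simp: h_def abs_mult sgn_if split: split_indicator)
  have "(LINT x|lborel. LINT t|lborel. h x * f (x + Bu u t) * F (x + power_sum_map t) * \<phi> t) ^ 4
     \<le> 100 * (LINT x|lborel. (f x)\<^sup>2)\<^sup>2 * (LINT z|lborel. quad_weight \<phi> z * quad_prod u F z)"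
    by (rule form_le_quad[OF u _ hb fm fi Fc FM \<phi>c \<phi>(1-3)]) (use quad_weight_props[OF \<phi> L] in auto)
  also have "(LINT x|lborel. LINT t|lborel. h x * f (x + Bu u t) * F (x + power_sum_map t) * \<phi> t) = (LINT x|lborel. indicator unit_square x * \<bar>k x\<bar>)"
  proof (rule Bochner_Integration.integral_cong, rule refl)
    fix x
    have "(LINT t|lborel. h x * f (x + Bu u t) * F (x + power_sum_map t) * \<phi> t) = h x * k x"
      by (simp add: k_def mult.assoc)
    then show "(LINT t|lborel. h x * f (x + Bu u t) * F (x + power_sum_map t) * \<phi> t) = indicator unit_square x * \<bar>k x\<bar>"
      by (simp add: h_def abs_sgn mult.assoc mult.commute[of "sgn (k x)"])
  qed
  also have "100 * (LINT x|lborel. (f x)\<^sup>2)\<^sup>2 * (LINT z|lborel. quad_weight \<phi> z * quad_prod u F z) \<le> 100 * 1 * v ^ 4"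
  proof -
    have a: "0 \<le> (LINT x|lborel. (f x)\<^sup>2)" by (rule Bochner_Integration.integral_nonneg) simp
    have "100 * (LINT x|lborel. (f x)\<^sup>2)\<^sup>2 * (LINT z|lborel. quad_weight \<phi> z * quad_prod u F z)
      \<le> 100 * (LINT x|lborel. (f x)\<^sup>2)\<^sup>2 * \<bar>LINT z|lborel. quad_weight \<phi> z * quad_prod u F z\<bar>"
      by (intro mult_left_mono) auto
    also have "\<dots> \<le> 100 * 1 * v ^ 4" using a fi1 V by (intro mult_mono) (auto intro: power_le_one)
    finally show ?thesis .
  qed
  also have "100 * 1 * v ^ 4 \<le> (4 * v) ^ 4" using v by (simp add: power_mult_distrib)
  finally have "(LINT x|lborel. indicator unit_square x * \<bar>k x\<bar>) ^ Suc 3 \<le> (4 * v) ^ Suc 3" by simp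
  then have "(LINT x|lborel. indicator unit_square x * \<bar>k x\<bar>) \<le> 4 * v" by (rule power_le_imp_le_base) (use v in simp)
  then have "ennreal (LINT x|lborel. indicator unit_square x * \<bar>k x\<bar>) \<le> ennreal (4 * v)" by (rule ennreal_leI)
  moreover have "(\<integral>\<^sup>+x. indicator unit_square x * ennreal \<bar>k x\<bar> \<partial>lborel) = ennreal (LINT x|lborel. indicator unit_square x * \<bar>k x\<bar>)"
    unfolding en[symmetric] by (rule nn_integral_eq_integral[OF ki]) simp
  ultimately show ?thesis by (simp add: k_def)
qed

lemma ennreal_norm_complex_integral_le:
  fixes f g :: "'a \<Rightarrow> complex" and w :: "'a \<Rightarrow> real"
  assumes [measurable]: "f \<in> borel_measurable M" "g \<in> borel_measurable M" "w \<in> borel_measurable M"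
  shows "ennreal (norm (LINT t|M. w t *\<^sub>R (f t * g t))) \<le>
     (ennreal \<bar>LINT t|M. Re (f t) * Re (g t) * w t\<bar> + ennreal \<bar>LINT t|M. Im (f t) * Im (g t) * w t\<bar>) +
     (ennreal \<bar>LINT t|M. Re (f t) * Im (g t) * w t\<bar> + ennreal \<bar>LINT t|M. Im (f t) * Re (g t) * w t\<bar>)"
proof (cases "integrable M (\<lambda>t. w t *\<^sub>R (f t * g t))")
  case False then show ?thesis by (simp add: not_integrable_integral_eq)
next
  case True
  have i: "integrable M (\<lambda>t. p t * q t * w t)" if [measurable]: "p \<in> borel_measurable M" "q \<in> borel_measurable M"
    and "\<And>t. \<bar>p t\<bar> \<le> norm (f t)" "\<And>t. \<bar>q t\<bar> \<le> norm (g t)" for p q :: "'a \<Rightarrow> real"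
  proof (rule Bochner_Integration.integrable_bound[OF True])
    show "AE t in M. norm (p t * q t * w t) \<le> norm (w t *\<^sub>R (f t * g t))"
    proof (intro AE_I2)
      fix t
      have "\<bar>p t\<bar> * \<bar>q t\<bar> * \<bar>w t\<bar> \<le> norm (f t) * norm (g t) * \<bar>w t\<bar>"
        using that(3,4) by (intro mult_mono) auto
      then show "norm (p t * q t * w t) \<le> norm (w t *\<^sub>R (f t * g t))" by (simp add: abs_mult norm_mult mult_ac)
    qed
  qed measurable
  have i4: "integrable M (\<lambda>t. Re (f t) * Re (g t) * w t)" "integrable M (\<lambda>t. Im (f t) * Im (g t) * w t)"
    "integrable M (\<lambda>t. Re (f t) * Im (g t) * w t)" "integrable M (\<lambda>t. Im (f t) * Re (g t) * w t)"
    by (rule i; simp add: abs_Re_le_cmod abs_Im_le_cmod)+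
  have re: "Re (LINT t|M. w t *\<^sub>R (f t * g t)) = (LINT t|M. Re (f t) * Re (g t) * w t) - (LINT t|M. Im (f t) * Im (g t) * w t)"
  proof -
    have "Re (LINT t|M. w t *\<^sub>R (f t * g t)) = (LINT t|M. Re (w t *\<^sub>R (f t * g t)))" using integral_Re[OF True] by simp
    also have "\<dots> = (LINT t|M. Re (f t) * Re (g t) * w t - Im (f t) * Im (g t) * w t)"
      by (rule Bochner_Integration.integral_cong) (auto simp: algebra_simps)
    also have "\<dots> = (LINT t|M. Re (f t) * Re (g t) * w t) - (LINT t|M. Im (f t) * Im (g t) * w t)"
      by (rule Bochner_Integration.integral_diff[OF i4(1,2)])
    finally show ?thesis .
  qed
  have im: "Im (LINT t|M. w t *\<^sub>R (f t * g t)) = (LINT t|M. Re (f t) * Im (g t) * w t) + (LINT t|M. Im (f t) * Re (g t) * w t)"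
  proof -
    have "Im (LINT t|M. w t *\<^sub>R (f t * g t)) = (LINT t|M. Im (w t *\<^sub>R (f t * g t)))" using integral_Im[OF True] by simp
    also have "\<dots> = (LINT t|M. Re (f t) * Im (g t) * w t + Im (f t) * Re (g t) * w t)"
      by (rule Bochner_Integration.integral_cong) (auto simp: algebra_simps)
    also have "\<dots> = (LINT t|M. Re (f t) * Im (g t) * w t) + (LINT t|M. Im (f t) * Re (g t) * w t)"
      by (rule Bochner_Integration.integral_add[OF i4(3,4)])
    finally show ?thesis .
  qed
  have "norm (LINT t|M. w t *\<^sub>R (f t * g t)) \<le> \<bar>Re (LINT t|M. w t *\<^sub>R (f t * g t))\<bar> + \<bar>Im (LINT t|M. w t *\<^sub>R (f t * g t))\<bar>"
    by (rule cmod_le)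
  also have "\<dots> \<le> (\<bar>LINT t|M. Re (f t) * Re (g t) * w t\<bar> + \<bar>LINT t|M. Im (f t) * Im (g t) * w t\<bar>) + (\<bar>LINT t|M. Re (f t) * Im (g t) * w t\<bar> + \<bar>LINT t|M. Im (f t) * Re (g t) * w t\<bar>)"
    unfolding re im by (intro add_mono abs_triangle_ineq4 abs_triangle_ineq)
  finally have "ennreal (norm (LINT t|M. w t *\<^sub>R (f t * g t))) \<le> ennreal ((\<bar>LINT t|M. Re (f t) * Re (g t) * w t\<bar> + \<bar>LINT t|M. Im (f t) * Im (g t) * w t\<bar>) + (\<bar>LINT t|M. Re (f t) * Im (g t) * w t\<bar> + \<bar>LINT t|M. Im (f t) * Re (g t) * w t\<bar>))"
    by (rule ennreal_leI)
  then show ?thesis by simp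
qed

text \<open>Real and imaginary parts of the two functions give four real forms, each at most 4
  v.\<close>

lemma smooth_form_bound:
  fixes f F :: "plane \<Rightarrow> complex" and \<phi> :: "plane \<Rightarrow> real"
  assumes u: "0 \<le> u" "u \<le> 1" and fm[measurable]: "f \<in> borel_measurable borel" and f2: "nnL2 f \<le> 1"
    and Fc: "continuous_on UNIV (\<lambda>x. Re (F x))" "continuous_on UNIV (\<lambda>x. Im (F x))" and FM: "\<And>p. \<bar>Re (F p)\<bar> \<le> M" "\<And>p. \<bar>Im (F p)\<bar> \<le> M"
    and Fm[measurable]: "F \<in> borel_measurable borel"
    and \<phi>: "\<And>t. 0 \<le> \<phi> t" "\<And>t. \<phi> t \<le> 1" "\<And>t. norm t > 3/2 \<Longrightarrow> \<phi> t = 0" "\<And>s t. \<bar>\<phi> s - \<phi> t\<bar> \<le> L * norm (s - t)" and L: "L \<ge> 1"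
    and \<phi>s: "\<And>t. \<phi> t \<le> indicator unit_square t"
    and V: "\<bar>LINT z|lborel. quad_weight \<phi> z * quad_prod u (\<lambda>x. Re (F x)) z\<bar> \<le> v ^ 4" "\<bar>LINT z|lborel. quad_weight \<phi> z * quad_prod u (\<lambda>x. Im (F x)) z\<bar> \<le> v ^ 4" and v: "0 \<le> v"
  shows "nnL1_square (wform u \<phi> f F) \<le> ennreal (16 * v)"
proof -
  have [measurable]: "\<phi> \<in> borel_measurable borel"
    by (rule borel_measurable_continuous_onI[OF lipschitz_imp_continuous[OF \<phi>(4)]])
  define k where "k p q x = (LINT t|lborel. p (x + Bu u t) * q (x + power_sum_map t) * \<phi> t)" for p q :: "plane \<Rightarrow> real" and x
  have km: "(\<lambda>x. indicator unit_square x * ennreal \<bar>k p q x\<bar>) \<in> borel_measurable lborel" if [measurable]: "p \<in> borel_measurable borel" "q \<in> borel_measurable borel" for p q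
    unfolding k_def by measurable
  have le: "(\<integral>\<^sup>+x. ennreal ((p x)\<^sup>2) \<partial>lborel) \<le> 1" if "\<And>x. \<bar>p x\<bar> \<le> norm (f x)" for p :: "plane \<Rightarrow> real"
    by (rule order_trans[OF nn_integral_mono f2]) (use power_mono[OF that abs_ge_zero, where n=2] in \<open>auto intro!: ennreal_leI\<close>)
  have reim: "(\<integral>\<^sup>+x. ennreal ((Re (f x))\<^sup>2) \<partial>lborel) \<le> 1" "(\<integral>\<^sup>+x. ennreal ((Im (f x))\<^sup>2) \<partial>lborel) \<le> 1"
    by (rule le, simp add: abs_Re_le_cmod abs_Im_le_cmod)+
  have kb: "(\<integral>\<^sup>+x. indicator unit_square x * ennreal \<bar>k p q x\<bar> \<partial>lborel) \<le> ennreal (4 * v)"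
    if "p \<in> {\<lambda>x. Re (f x), \<lambda>x. Im (f x)}" "q \<in> {\<lambda>x. Re (F x), \<lambda>x. Im (F x)}" for p q
    unfolding k_def
  proof (rule smooth_form_bound_real[OF u _ _ _ _ \<phi> L \<phi>s _ v, where M=M])
    show "p \<in> borel_measurable borel" using that(1) by auto
    show "(\<integral>\<^sup>+x. ennreal ((p x)\<^sup>2) \<partial>lborel) \<le> 1" using that(1) reim by auto
    show "continuous_on UNIV q" using that(2) Fc by auto
    show "\<bar>q x\<bar> \<le> M" for x using that(2) FM(1)[of x] FM(2)[of x] by auto
    show "\<bar>LINT z|lborel. quad_weight \<phi> z * quad_prod u q z\<bar> \<le> v ^ 4" using that(2) V by auto
  qed
  let ?r = "\<lambda>x. Re (f x)" and ?i = "\<lambda>x. Im (f x)" and ?R = "\<lambda>x. Re (F x)" and ?I = "\<lambda>x. Im (F x)"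
  have "nnL1_square (wform u \<phi> f F)
     \<le> (\<integral>\<^sup>+x. (indicator unit_square x * ennreal \<bar>k ?r ?R x\<bar> + indicator unit_square x * ennreal \<bar>k ?i ?I x\<bar>)
        + (indicator unit_square x * ennreal \<bar>k ?r ?I x\<bar> + indicator unit_square x * ennreal \<bar>k ?i ?R x\<bar>) \<partial>lborel)"
  proof (rule nn_integral_mono)
    fix x
    have "ennreal (norm (wform u \<phi> f F x)) \<le> (ennreal \<bar>k ?r ?R x\<bar> + ennreal \<bar>k ?i ?I x\<bar>) + (ennreal \<bar>k ?r ?I x\<bar> + ennreal \<bar>k ?i ?R x\<bar>)"
      unfolding wform_def k_def by (rule ennreal_norm_complex_integral_le) measurable
    then show "indicator unit_square x * ennreal (norm (wform u \<phi> f F x)) \<le> (indicator unit_square x * ennreal \<bar>k ?r ?R x\<bar> + indicator unit_square x * ennreal \<bar>k ?i ?I x\<bar>)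
        + (indicator unit_square x * ennreal \<bar>k ?r ?I x\<bar> + indicator unit_square x * ennreal \<bar>k ?i ?R x\<bar>)"
      unfolding distrib_left[symmetric] by (rule mult_left_mono) simp
  qed
  also have "\<dots> = ((\<integral>\<^sup>+x. indicator unit_square x * ennreal \<bar>k ?r ?R x\<bar> \<partial>lborel) + (\<integral>\<^sup>+x. indicator unit_square x * ennreal \<bar>k ?i ?I x\<bar> \<partial>lborel))
     + ((\<integral>\<^sup>+x. indicator unit_square x * ennreal \<bar>k ?r ?I x\<bar> \<partial>lborel) + (\<integral>\<^sup>+x. indicator unit_square x * ennreal \<bar>k ?i ?R x\<bar> \<partial>lborel))"
  proof -
    have m: "?r \<in> borel_measurable borel" "?i \<in> borel_measurable borel" "?R \<in> borel_measurable borel" "?I \<in> borel_measurable borel" by measurable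
    note kms = km[OF m(1,3)] km[OF m(2,4)] km[OF m(1,4)] km[OF m(2,3)]
    show ?thesis
      unfolding nn_integral_add[OF borel_measurable_add[OF kms(1,2)] borel_measurable_add[OF kms(3,4)]]
        nn_integral_add[OF kms(1,2)] nn_integral_add[OF kms(3,4)] ..
  qed
  also have "\<dots> \<le> (ennreal (4 * v) + ennreal (4 * v)) + (ennreal (4 * v) + ennreal (4 * v))"
    by (intro add_mono kb) auto
  also have "\<dots> = ennreal (16 * v)" using v by (simp add: ennreal_plus[symmetric] del: ennreal_plus)
  finally show ?thesis .
qed

lemma integrable_ind_avg_diff:
  fixes b c :: "plane \<Rightarrow> 'b::{banach, second_countable_topology}"
  assumes "integrable lborel (\<lambda>y. indicator (qbox r) y *\<^sub>R b (x + y))" "integrable lborel (\<lambda>y. indicator (qbox r) y *\<^sub>R c (x + y))"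
  shows "avg r (\<lambda>x. b x - c x) x = avg r b x - avg r c x" "avg r (\<lambda>x. b x + c x) x = avg r b x + avg r c x"
  unfolding avg_def scaleR_diff_right scaleR_add_right
  using assms by (simp_all add: Bochner_Integration.integral_diff Bochner_Integration.integral_add scaleR_diff_right scaleR_add_right)

text \<open>The exponents make each of the five error terms of \<open>quad_form_bound\<close> an \<open>O(Y powr -6)\<close> with \<open>\<delta> = Y powr -54\<close>, \<open>\<epsilon> = Y powr -1729\<close>,
  \<open>\<rho> = Y powr -1840\<close> and the intermediate scale \<open>s = Y powr -3944\<close>.\<close>

lemma quad_form_small:
  obtains K where "K \<ge> (1::real)"
    "\<And>u Y b \<phi>. 0 \<le> u \<Longrightarrow> u \<le> 1 \<Longrightarrow> K \<le> Y \<Longrightarrow> b \<in> borel_measurable borel \<Longrightarrow> (\<And>x. \<bar>b x\<bar> \<le> Y powr 12) \<Longrightarrow>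
      (\<And>t. 0 \<le> \<phi> t) \<Longrightarrow> (\<And>t. \<phi> t \<le> 1) \<Longrightarrow> (\<And>t. norm t > 3/2 \<Longrightarrow> \<phi> t = 0) \<Longrightarrow> (\<And>s t. \<bar>\<phi> s - \<phi> t\<bar> \<le> (2 * Y) * norm (s - t)) \<Longrightarrow>
      \<bar>LINT z|lborel. quad_weight \<phi> z * quad_prod u (\<lambda>x. avg (Y powr -4001) b x - avg (Y powr -3999) b x) z\<bar> \<le> (1 / Y) ^ 4"
proof -
  show thesis
  proof (rule quad_form_bound, goal_cases)
  case (1 K)
  note K = 1(1) and Q = 1(2)
  show ?case
  \<comment> \<open>1600 is 5 times 320: there are five error terms, each at most 320
    Y^(-6).\<close>
  proof (rule that[of "1600 * K"])
    fix u Y :: real and b \<phi> :: "plane \<Rightarrow> real"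
    assume u: "0 \<le> u" "u \<le> 1" and KY: "1600 * K \<le> Y" and bm[measurable]: "b \<in> borel_measurable borel" and bM: "\<And>x. \<bar>b x\<bar> \<le> Y powr 12"
      and \<phi>: "\<And>t. 0 \<le> \<phi> t" "\<And>t. \<phi> t \<le> 1" "\<And>t. norm t > 3/2 \<Longrightarrow> \<phi> t = 0" "\<And>s t. \<bar>\<phi> s - \<phi> t\<bar> \<le> (2 * Y) * norm (s - t)"
    define r q s \<delta> \<epsilon> \<rho> M where "r = Y powr -4001" and "q = Y powr -3999" and "s = Y powr -3944" and "\<delta> = Y powr -54"
      and "\<epsilon> = Y powr -1729" and "\<rho> = Y powr -1840" and "M = Y powr 12"
    note defs = r_def q_def s_def \<delta>_def \<epsilon>_def \<rho>_def M_def
    have Y1: "Y \<ge> 1600" "Y > 0" "Y \<ge> 1" and KY': "K \<le> Y" using KY K by auto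
    have pos: "r > 0" "q > 0" "s > 0" "\<delta> > 0" "\<epsilon> > 0" "\<rho> > 0" "M > 0" using Y1 by (auto simp: defs)
    have rq: "r \<le> q" using Y1 by (simp add: defs powr_mono)
    have bM': "\<bar>b x\<bar> \<le> M" for x using bM by (simp add: M_def)
    define F where "F x = avg r b x - avg q b x" for x
    have FM: "\<bar>F x\<bar> \<le> 2 * M" for x
      using avg_bounded[OF bm bM' pos(1), of x] avg_bounded[OF bm bM' pos(2), of x] by (simp add: F_def)
    have FL: "\<bar>F x - F y\<bar> \<le> (8 * M / r) * norm (x - y)" for x y
    proof -
      have "\<bar>F x - F y\<bar> \<le> 4 * M / r * norm (x - y) + 4 * M / q * norm (x - y)"
        using avg_lipschitz[OF bm bM' pos(1), of x y] avg_lipschitz[OF bm bM' pos(2), of x y] by (simp add: F_def)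
      also have "4 * M / q * norm (x - y) \<le> 4 * M / r * norm (x - y)"
        using pos rq by (intro mult_right_mono divide_left_mono) auto
      finally show ?thesis by (simp add: field_simps)
    qed
    have Fav: "\<bar>avg s F x\<bar> \<le> 16 * M * q / s" for x
    proof -
      have i: "integrable lborel (\<lambda>y. indicator (qbox s) y *\<^sub>R avg p b (x + y))" if "p > 0" for p
        using avg_bounded[OF bm bM' that] by (intro avg_integrable_bounded[where M=M]) auto
      have "avg s F x = avg s (avg r b) x - avg s (avg q b) x"
        unfolding F_def[abs_def] by (rule integrable_ind_avg_diff(1)[OF i[OF pos(1)] i[OF pos(2)]])
      moreover have "\<bar>avg s (avg r b) x - avg s b x\<bar> \<le> 8 * M * r / s" "\<bar>avg s (avg q b) x - avg s b x\<bar> \<le> 8 * M * q / s"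
        using avg_avg_close[OF bm bM'] pos by auto
      moreover have "8 * M * r / s \<le> 8 * M * q / s" using rq pos by (intro divide_right_mono mult_left_mono) auto
      ultimately have "\<bar>avg s F x\<bar> \<le> 8 * M * q / s + 8 * M * q / s" by linarith
      then show ?thesis by (simp add: field_simps)
    qed
    have L1: "2 * Y \<ge> 1" using Y1 by simp
    note W = quad_weight_props[OF \<phi> L1]
    have c1: "K * s / \<epsilon> \<le> \<rho>"
    proof -
      have "K * s / \<epsilon> = K * (Y powr -3944 / Y powr -1729)" by (simp add: defs)
      also have "\<dots> = K * Y powr -2215" unfolding powr_diff[symmetric] by simp
      also have "\<dots> \<le> Y powr 1 * Y powr -2215" using KY' Y1 by (intro mult_right_mono) auto
      also have "\<dots> \<le> \<rho>" using Y1 unfolding powr_add[symmetric] \<rho>_def by (intro powr_mono) auto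
      finally show ?thesis .
    qed
    \<comment> \<open>54 times 32 is 1728; the extra power of Y in \<epsilon> absorbs the constant K
      \<le> Y.\<close>
    have c2: "K * \<epsilon> \<le> \<delta> ^ 32"
    proof -
      have "K * \<epsilon> \<le> Y powr 1 * Y powr -1729" unfolding \<epsilon>_def using KY' Y1 by (intro mult_right_mono) auto
      also have "\<dots> = Y powr -1728" unfolding powr_add[symmetric] by simp
      also have "\<dots> = \<delta> ^ 32" using Y1 by (simp add: \<delta>_def powr_power)
      finally show ?thesis .
    qed
    have \<rho>1: "\<rho> \<le> 1" using Y1 powr_mono[of "-1840" 0 Y] by (simp add: \<rho>_def)
    have "\<bar>LINT z|lborel. quad_weight \<phi> z * quad_prod u F z\<bar> \<le>
       K * ((2 * M) ^ 4 * \<delta> + (2 * M) ^ 3 * (16 * M * q / s) + (2 * M) ^ 4 * (s / \<epsilon>) / \<rho> + (10 * (2 * Y)) * \<rho> * (2 * M) ^ 4 + (2 * M) ^ 3 * (8 * M / r) * \<rho> * (s / \<epsilon>))"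
      by (rule Q[OF u W FM FL Fav pos(6) \<rho>1 pos(3,5,4) c1 c2])
    also have "\<dots> \<le> K * (320 * Y powr -6 + 320 * Y powr -6 + 320 * Y powr -6 + 320 * Y powr -6 + 320 * Y powr -6)"
    proof (intro mult_left_mono add_mono)
      have le: "c * Y powr a \<le> 320 * Y powr -6" if "c \<le> 320" "0 \<le> c" "a \<le> -6" for c a
        using that Y1 by (intro mult_mono powr_mono) auto
      have M34: "M ^ 4 = Y powr 48" "M ^ 3 = Y powr 36" using Y1 by (simp_all add: M_def powr_power)
      \<comment> \<open>The first and the last term are the tight ones, with exponents 48 - 54 = -6
        and 48 + 4001 - 1840 - 3944 + 1729 = -6.\<close>
      have "(2 * M) ^ 4 * \<delta> = 16 * Y powr -6"
        unfolding power_mult_distrib M34 \<delta>_def by (simp add: powr_add[symmetric])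
      from this show "(2 * M) ^ 4 * \<delta> \<le> 320 * Y powr -6" by (elim ord_eq_le_trans, intro le) simp_all
      have "(2 * M) ^ 3 * (16 * M * q / s) = 128 * (Y powr 36 * (Y powr 12 * Y powr -3999 / Y powr -3944))"
        unfolding power_mult_distrib M34 q_def s_def by (simp add: M_def)
      also have "\<dots> = 128 * Y powr -7" by (simp add: powr_add[symmetric] powr_diff[symmetric])
      finally show "(2 * M) ^ 3 * (16 * M * q / s) \<le> 320 * Y powr -6" by (elim ord_eq_le_trans, intro le) simp_all
      have "(2 * M) ^ 4 * (s / \<epsilon>) / \<rho> = 16 * (Y powr 48 * (Y powr -3944 / Y powr -1729) / Y powr -1840)"
        unfolding power_mult_distrib M34 \<epsilon>_def s_def \<rho>_def by simp
      also have "\<dots> = 16 * Y powr -327" by (simp add: powr_add[symmetric] powr_diff[symmetric])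
      finally show "(2 * M) ^ 4 * (s / \<epsilon>) / \<rho> \<le> 320 * Y powr -6" by (elim ord_eq_le_trans, intro le) simp_all
      have "(10 * (2 * Y)) * \<rho> * (2 * M) ^ 4 = 320 * (Y powr 1 * Y powr -1840 * Y powr 48)"
        unfolding power_mult_distrib M34 \<rho>_def using Y1 by simp
      also have "\<dots> = 320 * Y powr -1791" unfolding powr_add[symmetric] by simp
      finally show "(10 * (2 * Y)) * \<rho> * (2 * M) ^ 4 \<le> 320 * Y powr -6" by (elim ord_eq_le_trans, intro le) simp_all
      have "(2 * M) ^ 3 * (8 * M / r) * \<rho> * (s / \<epsilon>) = 64 * (Y powr 36 * (Y powr 12 / Y powr -4001) * Y powr -1840 * (Y powr -3944 / Y powr -1729))"
        unfolding power_mult_distrib M34 \<epsilon>_def s_def \<rho>_def r_def by (simp add: M_def)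
      also have "\<dots> = 64 * Y powr -6" by (simp add: powr_add[symmetric] powr_diff[symmetric])
      finally show "(2 * M) ^ 3 * (8 * M / r) * \<rho> * (s / \<epsilon>) \<le> 320 * Y powr -6" by (elim ord_eq_le_trans, intro le) simp_all
    qed (use K in simp)
    also have "\<dots> = (1600 * K) * Y powr -6" by simp
    also have "\<dots> \<le> Y powr 2 * Y powr -6"
    proof (intro mult_right_mono)
      have "1600 * K \<le> Y powr 1" using KY Y1 by simp
      also have "\<dots> \<le> Y powr 2" using Y1 by (intro powr_mono) auto
      finally show "1600 * K \<le> Y powr 2" .
    qed simp
    also have "\<dots> = (1 / Y) ^ 4"
    proof -
      have "Y powr 2 * Y powr -6 = Y powr (- 4)" by (simp add: powr_add[symmetric])
      also have "\<dots> = 1 / Y powr 4" by (rule powr_minus_divide)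
      also have "Y powr 4 = Y ^ 4" using Y1 powr_realpow[of Y 4] by simp
      finally show ?thesis by (simp add: power_one_over)
    qed
    finally show "\<bar>LINT z|lborel. quad_weight \<phi> z * quad_prod u (\<lambda>x. avg (Y powr -4001) b x - avg (Y powr -3999) b x) z\<bar> \<le> (1 / Y) ^ 4"
      unfolding F_def[abs_def] r_def q_def .
  qed (use K in simp)
  qed
qed

section \<open>Splitting the second function\<close>

lemma weighted_nn_le_nnform:
  fixes f F :: "plane \<Rightarrow> complex" and w :: "plane \<Rightarrow> real"
  assumes [measurable]: "f \<in> borel_measurable borel" "F \<in> borel_measurable borel" "S \<in> sets borel" and w: "\<And>t. \<bar>w t\<bar> \<le> indicator S t"
  shows "(\<integral>\<^sup>+x. indicator unit_square x * (\<integral>\<^sup>+t. ennreal (norm (w t *\<^sub>R (f (x + Bu u t) * F (x + power_sum_map t)))) \<partial>lborel) \<partial>lborel)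
     \<le> nnform u S (\<lambda>x. ennreal (norm (f x))) (\<lambda>x. ennreal (norm (F x)))"
proof -
  have "(\<integral>\<^sup>+x. indicator unit_square x * (\<integral>\<^sup>+t. ennreal (norm (w t *\<^sub>R (f (x + Bu u t) * F (x + power_sum_map t)))) \<partial>lborel) \<partial>lborel)
    \<le> (\<integral>\<^sup>+x. \<integral>\<^sup>+t. indicator S t * indicator unit_square x * ennreal (norm (f (x + Bu u t))) * ennreal (norm (F (x + power_sum_map t))) \<partial>lborel \<partial>lborel)"
  proof (rule nn_integral_mono)
    fix x
    have "(\<integral>\<^sup>+t. ennreal (norm (w t *\<^sub>R (f (x + Bu u t) * F (x + power_sum_map t)))) \<partial>lborel)
      \<le> (\<integral>\<^sup>+t. indicator S t * ennreal (norm (f (x + Bu u t))) * ennreal (norm (F (x + power_sum_map t))) \<partial>lborel)"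
    proof (rule nn_integral_mono)
      fix t
      have "norm (w t *\<^sub>R (f (x + Bu u t) * F (x + power_sum_map t))) \<le> indicator S t * (norm (f (x + Bu u t)) * norm (F (x + power_sum_map t)))"
        using w[of t] by (simp add: norm_mult mult_right_mono)
      then have "ennreal (norm (w t *\<^sub>R (f (x + Bu u t) * F (x + power_sum_map t)))) \<le> ennreal (indicator S t * (norm (f (x + Bu u t)) * norm (F (x + power_sum_map t))))"
        by (rule ennreal_leI)
      then show "ennreal (norm (w t *\<^sub>R (f (x + Bu u t) * F (x + power_sum_map t)))) \<le> indicator S t * ennreal (norm (f (x + Bu u t))) * ennreal (norm (F (x + power_sum_map t)))"
        by (cases "t \<in> S") (simp_all add: ennreal_mult)
    qed
    then show "indicator unit_square x * (\<integral>\<^sup>+t. ennreal (norm (w t *\<^sub>R (f (x + Bu u t) * F (x + power_sum_map t)))) \<partial>lborel)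
      \<le> (\<integral>\<^sup>+t. indicator S t * indicator unit_square x * ennreal (norm (f (x + Bu u t))) * ennreal (norm (F (x + power_sum_map t))) \<partial>lborel)"
      by (cases "x \<in> unit_square") simp_all
  qed
  also have "\<dots> = nnform u S (\<lambda>x. ennreal (norm (f x))) (\<lambda>x. ennreal (norm (F x)))"
    unfolding nnform_def by (rule lborel_pair.Fubini'[symmetric]) measurable
  finally show ?thesis .
qed

lemma wform_le_nnform:
  fixes f F :: "plane \<Rightarrow> complex" and w :: "plane \<Rightarrow> real"
  assumes "f \<in> borel_measurable borel" "F \<in> borel_measurable borel" "S \<in> sets borel" and w: "\<And>t. \<bar>w t\<bar> \<le> indicator S t"
  shows "nnL1_square (wform u w f F)
     \<le> nnform u S (\<lambda>x. ennreal (norm (f x))) (\<lambda>x. ennreal (norm (F x)))"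
  by (rule order_trans[OF nn_integral_mono weighted_nn_le_nnform[OF assms]])
     (unfold wform_def, intro mult_left_mono ennreal_norm_integral_le, simp)

text \<open>Where the modulus of f exceeds M it is at most its square divided by M.\<close>

lemma truncation_tail_L1:
  fixes f :: "plane \<Rightarrow> complex"
  assumes [measurable]: "f \<in> borel_measurable borel" and f2: "nnL2 f \<le> 1" and M: "M > 0"
  shows "(\<integral>\<^sup>+x. ennreal (if norm (f x) \<le> M then 0 else norm (f x)) \<partial>lborel) \<le> ennreal (1 / M)"
proof -
  have "(\<integral>\<^sup>+x. ennreal (if norm (f x) \<le> M then 0 else norm (f x)) \<partial>lborel) \<le> (\<integral>\<^sup>+x. ennreal (1 / M) * ennreal ((norm (f x))\<^sup>2) \<partial>lborel)"
  proof (rule nn_integral_mono)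
    fix x
    have "(if norm (f x) \<le> M then 0 else norm (f x)) \<le> 1 / M * (norm (f x))\<^sup>2"
      using M mult_right_mono[of M "norm (f x)" "norm (f x)"] by (auto simp: field_simps power2_eq_square)
    then have "ennreal (if norm (f x) \<le> M then 0 else norm (f x)) \<le> ennreal (1 / M * (norm (f x))\<^sup>2)" by (rule ennreal_leI)
    also have "\<dots> = ennreal (1 / M) * ennreal ((norm (f x))\<^sup>2)" using M by (intro ennreal_mult) auto
    finally show "ennreal (if norm (f x) \<le> M then 0 else norm (f x)) \<le> ennreal (1 / M) * ennreal ((norm (f x))\<^sup>2)" .
  qed
  also have "\<dots> = ennreal (1 / M) * nnL2 f" by (rule nn_integral_cmult) measurable
  also have "\<dots> \<le> ennreal (1 / M) * 1" by (intro mult_left_mono f2) simp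
  finally show ?thesis by simp
qed

lemma avg_diff_L2:
  fixes b :: "plane \<Rightarrow> complex"
  assumes [measurable]: "b \<in> borel_measurable borel" and b: "nnL2 b \<le> 1" and r: "r > 0" "q > 0"
  shows "(\<integral>\<^sup>+x. ennreal ((norm (avg r b x - avg q b x))\<^sup>2) \<partial>lborel) \<le> 4"
proof -
  have "(\<integral>\<^sup>+x. ennreal ((norm (avg r b x - avg q b x))\<^sup>2) \<partial>lborel)
     \<le> (\<integral>\<^sup>+x. 2 * ennreal ((norm (avg r b x))\<^sup>2) + 2 * ennreal ((norm (avg q b x))\<^sup>2) \<partial>lborel)"
  proof (rule nn_integral_mono)
    fix x
    have "ennreal ((norm (avg r b x - avg q b x))\<^sup>2) \<le> ennreal (2 * (norm (avg r b x))\<^sup>2 + 2 * (norm (avg q b x))\<^sup>2)"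
      using norm_sq_add_le[of "avg r b x" "- avg q b x"] by (intro ennreal_leI) simp
    then show "ennreal ((norm (avg r b x - avg q b x))\<^sup>2) \<le> 2 * ennreal ((norm (avg r b x))\<^sup>2) + 2 * ennreal ((norm (avg q b x))\<^sup>2)"
      by (simp add: ennreal_plus ennreal_mult)
  qed
  also have "\<dots> = 2 * nnL2 (avg r b) + 2 * nnL2 (avg q b)"
    by (simp add: nn_integral_add nn_integral_cmult)
  also have "\<dots> \<le> 2 * 1 + 2 * 1"
    using order_trans[OF avg_L2 b] r by (intro add_mono mult_left_mono) simp_all
  finally show ?thesis by simp
qed

text \<open>Here b, the large part of f2, is small in L^1 but not in L^2. The part of f below Y^11
  is paired with it in sup norm, at the cost Y^11 Y^(-12). The part above has itself L^1 norm at
  most Y^(-11): off the degenerate set the improving bound loses only \<epsilon>^(-4) = Y^20 against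
  the gain Y^(-23), and the degenerate set has measure O(1/Y), so that L^2 norms suffice on
  it.\<close>

lemma tail_form_bound:
  obtains K where "K \<ge> (1::real)"
    "\<And>u Y r q f b. 0 \<le> u \<Longrightarrow> u \<le> 1 \<Longrightarrow> K \<le> Y \<Longrightarrow> 0 < r \<Longrightarrow> 0 < q \<Longrightarrow> f \<in> borel_measurable borel \<Longrightarrow> b \<in> borel_measurable borel \<Longrightarrow>
      nnL2 f \<le> 1 \<Longrightarrow> nnL2 b \<le> 1 \<Longrightarrow>
      nnL1 b \<le> ennreal (1 / Y ^ 12) \<Longrightarrow>
      nnform u unit_square (\<lambda>x. ennreal (norm (f x :: complex))) (\<lambda>x. ennreal (norm (avg r b x - avg q b x :: complex))) \<le> ennreal (K / Y)"
proof -
  show thesis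
  proof (rule nnform_improving, goal_cases)
  case (1 K1)
  note K1 = 1(1) and imp = 1(2)
  obtain K2 where K2: "K2 \<ge> (1::real)" and deg:
    "\<And>u \<epsilon> \<delta>. 0 \<le> u \<Longrightarrow> u \<le> 1 \<Longrightarrow> 0 < \<delta> \<Longrightarrow> K2 * \<epsilon> \<le> \<delta> ^ 4 \<Longrightarrow>
      emeasure lborel {t \<in> unit_square. \<bar>phase_jac u t\<bar> \<le> \<epsilon>} \<le> ennreal (512 * \<delta>)"
    by (rule phase_degenerate_measure) blast
  show ?case
  proof (rule that[of "1026 + 2 * K1 + K2"])
    fix u Y r q :: real and f b :: "plane \<Rightarrow> complex"
    assume u: "0 \<le> u" "u \<le> 1" and Y: "1026 + 2 * K1 + K2 \<le> Y" and rq: "0 < r" "0 < q"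
      and fm[measurable]: "f \<in> borel_measurable borel" and bm[measurable]: "b \<in> borel_measurable borel"
      and f2: "nnL2 f \<le> 1" and b2: "nnL2 b \<le> 1"
      and b1: "nnL1 b \<le> ennreal (1 / Y ^ 12)"
    have Y1: "Y \<ge> 1" "Y > 0" and YK: "K2 \<le> Y" using Y K1 K2 by auto
    define a0 a1 where "a0 x = ennreal (if norm (f x) \<le> Y ^ 11 then norm (f x) else 0)"
      and "a1 x = ennreal (if norm (f x) \<le> Y ^ 11 then 0 else norm (f x))" for x
    have [measurable]: "a0 \<in> borel_measurable borel" "a1 \<in> borel_measurable borel" unfolding a0_def a1_def by measurable
    define B where "B x = ennreal (norm (avg r b x - avg q b x))" for x
    define N where "N \<rho> x = ennreal (1 / \<rho>\<^sup>2) * (\<integral>\<^sup>+y. indicator (qbox \<rho>) y * ennreal (norm (b (x + y))) \<partial>lborel)" for \<rho> x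
    have [measurable]: "B \<in> borel_measurable borel" unfolding B_def by measurable
    have Nm[measurable]: "N \<rho> \<in> borel_measurable borel" for \<rho>
    proof -
      have "N \<rho> \<in> borel_measurable lborel" unfolding N_def by measurable
      then show ?thesis by simp
    qed
    have BN: "B x \<le> N r x + N q x" for x
    proof -
      have "B x \<le> ennreal (norm (avg r b x) + norm (avg q b x))" unfolding B_def by (intro ennreal_leI norm_triangle_ineq4)
      also have "\<dots> = ennreal (norm (avg r b x)) + ennreal (norm (avg q b x))" by simp
      also have "\<dots> \<le> N r x + N q x" unfolding N_def by (intro add_mono avg_norm_le bm)
      finally show ?thesis .
    qed
    have NI: "(\<integral>\<^sup>+x. N \<rho> x \<partial>lborel) \<le> ennreal (1 / Y ^ 12)" if "\<rho> > 0" for \<rho>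
      unfolding N_def using nn_integral_avg_le[of "\<lambda>x. ennreal (norm (b x))" \<rho>] that b1 by simp
    have "nnform u unit_square (\<lambda>x. ennreal (norm (f x))) B = nnform u unit_square (\<lambda>x. a0 x + a1 x) B"
      by (rule arg_cong[where f="\<lambda>a. nnform u unit_square a B"]) (auto simp: a0_def a1_def)
    also have "\<dots> = nnform u unit_square a0 B + nnform u unit_square a1 B" by (rule nnform_add_left) measurable
    also have "\<dots> \<le> ennreal (2 / Y) + (ennreal (2 * K1 / Y) + ennreal (1024 / Y))"
    proof (rule add_mono)
      have "nnform u unit_square a0 B \<le> nnform u unit_square (\<lambda>_. ennreal (Y ^ 11)) (\<lambda>x. N r x + N q x)"
        by (rule nnform_mono[OF order_refl _ BN]) (use Y1 in \<open>simp add: a0_def ennreal_leI\<close>)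
      also have "\<dots> \<le> ennreal (Y ^ 11) * (\<integral>\<^sup>+x. N r x + N q x \<partial>lborel)" by (rule nnform_const_left) measurable
      also have "(\<integral>\<^sup>+x. N r x + N q x \<partial>lborel) = (\<integral>\<^sup>+x. N r x \<partial>lborel) + (\<integral>\<^sup>+x. N q x \<partial>lborel)" by (rule nn_integral_add) simp_all
      also have "ennreal (Y ^ 11) * \<dots> \<le> ennreal (Y ^ 11) * (ennreal (1 / Y ^ 12) + ennreal (1 / Y ^ 12))"
        by (intro mult_left_mono add_mono NI rq) simp
      also have "\<dots> = ennreal (Y ^ 11 * (1 / Y ^ 12 + 1 / Y ^ 12))" using Y1 by (simp add: ennreal_plus[symmetric] ennreal_mult[symmetric] del: ennreal_plus)
      also have "Y ^ 11 * (1 / Y ^ 12 + 1 / Y ^ 12) = 2 / Y"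
      proof -
        have "Y ^ 12 = Y * Y ^ 11" by (simp flip: power_Suc)
        then show ?thesis using Y1 by simp
      qed
      finally show "nnform u unit_square a0 B \<le> ennreal (2 / Y)" .
      \<comment> \<open>The sublevel estimate with \<delta> = 1/Y asks for
        \<open>K2 * \<epsilon> \<le> (1 / Y) ^ 4\<close>; the fifth power leaves one factor of Y to
        absorb \<open>K2\<close>.\<close>
      define \<epsilon> where "\<epsilon> = (1 / Y) ^ 5"
      have \<epsilon>: "0 < \<epsilon>" "\<epsilon> \<le> 1" using Y1 by (auto simp: \<epsilon>_def intro: power_le_one)
      define G D where "G = {t \<in> unit_square. \<epsilon> < \<bar>phase_jac u t\<bar>}" and "D = {t \<in> unit_square. \<bar>phase_jac u t\<bar> \<le> \<epsilon>}"
      have [measurable]: "G \<in> sets borel" "D \<in> sets borel"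
      proof -
        have "G = unit_square \<inter> {t \<in> space borel. \<epsilon> < \<bar>phase_jac u t\<bar>}" "D = unit_square \<inter> {t \<in> space borel. \<bar>phase_jac u t\<bar> \<le> \<epsilon>}"
          by (auto simp: G_def D_def)
        moreover have "{t \<in> space borel. \<epsilon> < \<bar>phase_jac u t\<bar>} \<in> sets borel" "{t \<in> space borel. \<bar>phase_jac u t\<bar> \<le> \<epsilon>} \<in> sets borel" by measurable
        ultimately show "G \<in> sets borel" "D \<in> sets borel" using unit_square_measurable by simp_all
      qed
      have a1I: "(\<integral>\<^sup>+x. a1 x \<partial>lborel) \<le> ennreal (1 / Y ^ 11)"
        unfolding a1_def by (rule truncation_tail_L1[OF fm f2]) (use Y1 in simp)
      have good: "nnform u G a1 (N \<rho>) \<le> ennreal (K1 / Y)" if \<rho>: "\<rho> > 0" for \<rho>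
      proof -
        have "nnform u G a1 (N \<rho>) \<le> ennreal (K1 / \<epsilon> ^ 4) * ((\<integral>\<^sup>+x. a1 x \<partial>lborel) * nnL1 b)"
          unfolding G_def N_def[abs_def] by (rule imp[OF u \<epsilon> \<rho>]) measurable
        also have "\<dots> \<le> ennreal (K1 / \<epsilon> ^ 4) * (ennreal (1 / Y ^ 11) * ennreal (1 / Y ^ 12))"
          by (intro mult_left_mono mult_mono a1I b1) simp_all
        also have "\<dots> = ennreal (K1 / \<epsilon> ^ 4 * (1 / Y ^ 11 * (1 / Y ^ 12)))"
        proof -
          have "0 \<le> K1 / \<epsilon> ^ 4" "0 \<le> 1 / Y ^ 11" "0 \<le> 1 / Y ^ 12" using Y1 K1 \<epsilon> by auto
          then show ?thesis by (simp only: ennreal_mult mult_nonneg_nonneg)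
        qed
        also have "K1 / \<epsilon> ^ 4 * (1 / Y ^ 11 * (1 / Y ^ 12)) = K1 / Y ^ 3"
        proof -
          have "\<epsilon> ^ 4 = 1 / Y ^ 20" by (simp add: \<epsilon>_def power_divide flip: power_mult)
          moreover have "1 / Y ^ 11 * (1 / Y ^ 12) = 1 / (Y ^ 20 * Y ^ 3)" by (simp flip: power_add)
          moreover have "K1 / (1 / A) * (1 / (A * B)) = K1 / B" if "A > 0" for A B :: real using that by simp
          from this[of "Y ^ 20" "Y ^ 3"] have e3: "K1 / (1 / Y ^ 20) * (1 / (Y ^ 20 * Y ^ 3)) = K1 / Y ^ 3" using Y1(2) zero_less_power by blast
          ultimately show ?thesis using e3 by (simp only:)
        qed
        also have "ennreal \<dots> \<le> ennreal (K1 / Y)"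
          using Y1 K1 by (intro ennreal_leI divide_left_mono) (auto simp: self_le_power)
        finally show ?thesis .
      qed
      have "nnform u unit_square a1 B \<le> nnform u (G \<union> D) a1 B" by (rule nnform_mono) (auto simp: G_def D_def)
      also have "\<dots> \<le> nnform u G a1 B + nnform u D a1 B" by (rule nnform_Un) measurable
      also have "\<dots> \<le> ennreal (2 * K1 / Y) + ennreal (1024 / Y)"
      proof (rule add_mono)
        have "nnform u G a1 B \<le> nnform u G a1 (\<lambda>x. N r x + N q x)" by (rule nnform_mono[OF order_refl order_refl BN])
        also have "\<dots> = nnform u G a1 (N r) + nnform u G a1 (N q)" by (rule nnform_add) measurable
        also have "\<dots> \<le> ennreal (K1 / Y) + ennreal (K1 / Y)" by (intro add_mono good rq)
        also have "\<dots> = ennreal (2 * K1 / Y)" using Y1 K1 by (simp add: ennreal_plus[symmetric] del: ennreal_plus)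
        finally show "nnform u G a1 B \<le> ennreal (2 * K1 / Y)" .
        have c: "K2 * \<epsilon> \<le> (1 / Y) ^ 4"
        proof -
          have "K2 * \<epsilon> \<le> Y * \<epsilon>" using mult_right_mono[OF YK, of \<epsilon>] \<epsilon> by simp
          also have "\<dots> = Y * (1 / Y) * (1 / Y) ^ 4" by (simp add: \<epsilon>_def power_numeral_reduce)
          also have "\<dots> = (1 / Y) ^ 4" using Y1 by simp
          finally show ?thesis .
        qed
        have "nnform u D a1 B \<le> ennreal (512 * (1 / Y) * 2)"
        proof (rule nnform_le_of_norms)
          show "emeasure lborel D \<le> ennreal (512 * (1 / Y))" unfolding D_def by (rule deg[OF u _ c]) (use Y1 in simp)
          have "(\<integral>\<^sup>+x. (a1 x)\<^sup>2 \<partial>lborel) \<le> nnL2 f"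
            by (intro nn_integral_mono) (auto simp: a1_def ennreal_power)
          then show "(\<integral>\<^sup>+x. (a1 x)\<^sup>2 \<partial>lborel) \<le> 1" using f2 by simp
          show "(\<integral>\<^sup>+x. (B x)\<^sup>2 \<partial>lborel) \<le> ennreal (2\<^sup>2)"
            using avg_diff_L2[OF bm b2 rq] by (simp add: B_def ennreal_power)
        qed (use Y1 in \<open>simp_all, measurable\<close>)
        then show "nnform u D a1 B \<le> ennreal (1024 / Y)" by simp
      qed
      finally show "nnform u unit_square a1 B \<le> ennreal (2 * K1 / Y) + ennreal (1024 / Y)" .
    qed
    also have "\<dots> = ennreal (2 / Y + (2 * K1 / Y + 1024 / Y))"
    proof -
      have "0 \<le> 2 / Y" "0 \<le> 2 * K1 / Y" "0 \<le> 1024 / Y" using Y1 K1 by auto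
      then show ?thesis by (simp only: ennreal_plus add_nonneg_nonneg)
    qed
    also have "\<dots> \<le> ennreal ((1026 + 2 * K1 + K2) / Y)" using Y1 K1 K2 by (intro ennreal_leI) (simp add: field_simps)
    finally show "nnform u unit_square (\<lambda>x. ennreal (norm (f x))) (\<lambda>x. ennreal (norm (avg r b x - avg q b x))) \<le> ennreal ((1026 + 2 * K1 + K2) / Y)"
      unfolding B_def[abs_def] .
  qed (use K1 K2 in simp)
  qed
qed

lemma avg_Re_Im:
  assumes [measurable]: "b \<in> borel_measurable borel" and M: "\<And>x. norm (b x) \<le> M"
  shows "Re (avg r b x) = avg r (\<lambda>x. Re (b x)) x" "Im (avg r b x) = avg r (\<lambda>x. Im (b x)) x"
proof -
  have i: "integrable lborel (\<lambda>y. indicator (qbox r) y *\<^sub>R b (x + y))" by (rule avg_integrable_bounded[OF assms])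
  show "Re (avg r b x) = avg r (\<lambda>x. Re (b x)) x" "Im (avg r b x) = avg r (\<lambda>x. Im (b x)) x"
    unfolding avg_def using integral_bounded_linear[OF bounded_linear_Re i] integral_bounded_linear[OF bounded_linear_Im i] by simp_all
qed

text \<open>The cutoff of width 1/Y has Lipschitz constant 2 Y whatever l is, so l does not enter
  the bound.\<close>

lemma smooth_part_bound:
  obtains K where "K \<ge> (1::real)"
    "\<And>u l Y f b. 0 \<le> u \<Longrightarrow> u \<le> 1 \<Longrightarrow> 0 < l \<Longrightarrow> l \<le> 1 \<Longrightarrow> K \<le> Y \<Longrightarrow> f \<in> borel_measurable borel \<Longrightarrow> b \<in> borel_measurable borel \<Longrightarrow>
      nnL2 f \<le> 1 \<Longrightarrow> (\<And>x. norm (b x) \<le> Y powr 12) \<Longrightarrow>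
      (nnL1_square (wform u (plateau (1 / Y) l) f (\<lambda>x. avg (Y powr -4001) b x - avg (Y powr -3999) b x))) \<le> ennreal (16 / Y)"
proof -
  show thesis
  proof (rule quad_form_small, goal_cases)
  case (1 K)
  note K = 1(1) and Q = 1(2)
  show ?case
  proof (rule that[OF K])
    fix u l Y :: real and f b :: "plane \<Rightarrow> complex"
    assume u: "0 \<le> u" "u \<le> 1" and l: "0 < l" "l \<le> 1" and KY: "K \<le> Y" and fm[measurable]: "f \<in> borel_measurable borel" and bm[measurable]: "b \<in> borel_measurable borel"
      and f2: "nnL2 f \<le> 1" and bM: "\<And>x. norm (b x) \<le> Y powr 12"
    define \<phi> where "\<phi> = plateau (1 / Y) l"
    have Y1: "Y \<ge> 1" "Y > 0" "1 / Y > 0" using K KY by auto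
    have \<phi>: "0 \<le> \<phi> t" "\<phi> t \<le> 1" "norm t > 3/2 \<Longrightarrow> \<phi> t = 0" "\<bar>\<phi> s - \<phi> t\<bar> \<le> (2 * Y) * norm (s - t)" for s t
      using plateau_props(1-4)[OF Y1(3) l, of t] plateau_props(4)[OF Y1(3) l, of s t] by (simp_all add: \<phi>_def)
    have \<phi>s: "\<phi> t \<le> indicator unit_square t" for t
    proof (cases "t \<in> unit_square")
      case False
      then have "t \<notin> qbox l" using l by (auto simp: qbox_def)
      then have "fst t \<notin> {0..l} \<or> snd t \<notin> {0..l}" by (cases t) (auto simp: qbox_def)
      then show ?thesis using trapezoid_props(3)[OF Y1(3), of "fst t" l] trapezoid_props(3)[OF Y1(3), of "snd t" l] by (auto simp: \<phi>_def plateau_def)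
    qed (use \<phi>(2) in simp)
    define r q where "r = Y powr -4001" and "q = Y powr -3999"
    have rq: "r > 0" "q > 0" using Y1 by (auto simp: r_def q_def)
    define F where "F x = avg r b x - avg q b x" for x
    have [measurable]: "F \<in> borel_measurable borel" unfolding F_def by measurable
    have FRe: "(\<lambda>x. Re (F x)) = (\<lambda>x. avg r (\<lambda>x. Re (b x)) x - avg q (\<lambda>x. Re (b x)) x)"
      and FIm: "(\<lambda>x. Im (F x)) = (\<lambda>x. avg r (\<lambda>x. Im (b x)) x - avg q (\<lambda>x. Im (b x)) x)"
      using avg_Re_Im[OF bm bM] by (simp_all add: F_def fun_eq_iff)
    have bR: "\<bar>Re (b x)\<bar> \<le> Y powr 12" "\<bar>Im (b x)\<bar> \<le> Y powr 12" for x
      using order_trans[OF abs_Re_le_cmod bM] order_trans[OF abs_Im_le_cmod bM] by auto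
    have m: "(\<lambda>x. Re (b x)) \<in> borel_measurable borel" "(\<lambda>x. Im (b x)) \<in> borel_measurable borel" by measurable
    have ct: "continuous_on UNIV (avg p c)" if "c \<in> borel_measurable borel" "\<And>x. \<bar>c x\<bar> \<le> Y powr 12" "p > 0" for p and c :: "plane \<Rightarrow> real"
      by (rule lipschitz_imp_continuous[OF avg_lipschitz[OF that]])
    have bd: "\<bar>avg r c x - avg q c x\<bar> \<le> 2 * Y powr 12" if "c \<in> borel_measurable borel" "\<And>x. \<bar>c x\<bar> \<le> Y powr 12" for c :: "plane \<Rightarrow> real" and x
      using avg_bounded[OF that rq(1), of x] avg_bounded[OF that rq(2), of x] by simp
    have "nnL1_square (wform u \<phi> f F) \<le> ennreal (16 * (1 / Y))"
    proof (rule smooth_form_bound[OF u fm f2 _ _ _ _ _ \<phi> _ \<phi>s])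
      show "continuous_on UNIV (\<lambda>x. Re (F x))" "continuous_on UNIV (\<lambda>x. Im (F x))"
        unfolding FRe FIm by (intro continuous_on_diff ct m bR rq)+
      show "\<bar>Re (F p)\<bar> \<le> 2 * Y powr 12" "\<bar>Im (F p)\<bar> \<le> 2 * Y powr 12" for p
        using bd[OF m(1) bR(1), of p] bd[OF m(2) bR(2), of p] fun_cong[OF FRe, of p] fun_cong[OF FIm, of p] by simp_all
      show "\<bar>LINT z|lborel. quad_weight \<phi> z * quad_prod u (\<lambda>x. Re (F x)) z\<bar> \<le> (1 / Y) ^ 4"
        "\<bar>LINT z|lborel. quad_weight \<phi> z * quad_prod u (\<lambda>x. Im (F x)) z\<bar> \<le> (1 / Y) ^ 4"
        unfolding FRe FIm r_def q_def by (intro Q u KY m bR \<phi>; simp)+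
    qed (use Y1 in simp_all)
    then show "nnL1_square (wform u (plateau (1 / Y) l) f (\<lambda>x. avg (Y powr -4001) b x - avg (Y powr -3999) b x)) \<le> ennreal (16 / Y)"
      unfolding F_def[abs_def] r_def q_def \<phi>_def by simp
  qed
  qed
qed

text \<open>The weight is exchanged for the Lipschitz cutoff on the last component only; the other
  two are estimated with the modulus inside the integral, where a sharp weight does no harm.\<close>

lemma wform_split:
  fixes f :: "plane \<Rightarrow> complex"
  assumes [measurable]: "f \<in> borel_measurable borel" "E \<in> borel_measurable borel" "Fr \<in> borel_measurable borel" "Fb \<in> borel_measurable borel"
      "w \<in> borel_measurable borel" "\<phi> \<in> borel_measurable borel"
    and F: "\<And>x. F x = E x + (Fr x + Fb x)"
  shows "ennreal (norm (wform u w f F x)) \<le>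
     (\<integral>\<^sup>+t. ennreal (norm (w t *\<^sub>R (f (x + Bu u t) * E (x + power_sum_map t)))) \<partial>lborel) +
    ((\<integral>\<^sup>+t. ennreal (norm (w t *\<^sub>R (f (x + Bu u t) * Fr (x + power_sum_map t)))) \<partial>lborel) +
    ((\<integral>\<^sup>+t. ennreal (norm ((w t - \<phi> t) *\<^sub>R (f (x + Bu u t) * Fb (x + power_sum_map t)))) \<partial>lborel) +
     ennreal (norm (wform u \<phi> f Fb x))))"
  unfolding wform_def
  by (rule order_trans[OF ennreal_norm_integral_add_le add_left_mono[OF order_trans[OF ennreal_norm_integral_add_le add_left_mono[OF ennreal_norm_integral_add_le]]]])
     (measurable, simp_all add: F algebra_simps)

lemma wform_measurable [measurable]:
  assumes [measurable]: "f \<in> borel_measurable borel" "F \<in> borel_measurable borel" "w \<in> borel_measurable borel"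
  shows "wform u w f F \<in> borel_measurable borel"
proof -
  have "wform u w f F \<in> borel_measurable lborel" unfolding wform_def by measurable
  then show ?thesis by simp
qed

text \<open>Four contributions of order 1/Y: E is small in L^2 by the two hypotheses on means;
  \<open>Fr\<close>, from the large values of f2, falls to \<open>tail_form_bound\<close>;
  \<open>Fb\<close>, from the others, is changed on the rim, of measure O(1/Y), and then falls to
  \<open>smooth_part_bound\<close>.\<close>

proposition frequency_decay:
  assumes C0: "C0 \<ge> (1::real)"
  obtains C where "C \<ge> (1::real)"
    "\<And>u lam l f1 f2. 0 \<le> u \<Longrightarrow> u \<le> 1 \<Longrightarrow> 1 \<le> lam \<Longrightarrow> 0 < l \<Longrightarrow> l \<le> 1 \<Longrightarrow> f1 \<in> borel_measurable borel \<Longrightarrow> f2 \<in> borel_measurable borel \<Longrightarrow>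
      nnL2 f1 \<le> 1 \<Longrightarrow> nnL2 f2 \<le> 1 \<Longrightarrow>
      (\<And>r. r > 0 \<Longrightarrow> (\<integral>\<^sup>+x. ennreal ((norm (f2 x - avg r f2 x))\<^sup>2) \<partial>lborel) \<le> ennreal (C0 * (r * lam)\<^sup>2)) \<Longrightarrow>
      (\<And>r. r > 0 \<Longrightarrow> nnL2 (avg r f2) \<le> ennreal (C0 * (1 / (r * lam))\<^sup>2)) \<Longrightarrow>
      (nnL1_square (wform u (indicator (qbox l)) f1 f2)) \<le> ennreal (C / lam powr (1 / 4000))"
proof -
  show thesis
  proof (rule tail_form_bound, goal_cases)
  case (1 K)
  note K = 1(1) and tail = 1(2)
  obtain K' where K': "K' \<ge> (1::real)" and smooth:
    "\<And>u l Y f b. 0 \<le> u \<Longrightarrow> u \<le> 1 \<Longrightarrow> 0 < l \<Longrightarrow> l \<le> 1 \<Longrightarrow> K' \<le> Y \<Longrightarrow> f \<in> borel_measurable borel \<Longrightarrow> b \<in> borel_measurable borel \<Longrightarrow>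
      nnL2 f \<le> 1 \<Longrightarrow> (\<And>x. norm (b x) \<le> Y powr 12) \<Longrightarrow>
      (nnL1_square (wform u (plateau (1 / Y) l) f (\<lambda>x. avg (Y powr -4001) b x - avg (Y powr -3999) b x))) \<le> ennreal (16 / Y)"
    by (rule smooth_part_bound) blast
  define C where "C = 2 * sqrt C0 + K + K' + 24"
  have sC: "sqrt C0 \<ge> 0" using C0 by simp
  show ?case
  proof (rule that[of C])
    show "C \<ge> 1" using sC K K' by (simp add: C_def)
    fix u lam l :: real and f1 f2 :: "plane \<Rightarrow> complex"
    assume u: "0 \<le> u" "u \<le> 1" and lam: "1 \<le> lam" and l: "0 < l" "l \<le> 1"
      and m[measurable]: "f1 \<in> borel_measurable borel" "f2 \<in> borel_measurable borel"
      and n1: "nnL2 f1 \<le> 1" and n2: "nnL2 f2 \<le> 1"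
      and lo: "\<And>r. r > 0 \<Longrightarrow> (\<integral>\<^sup>+x. ennreal ((norm (f2 x - avg r f2 x))\<^sup>2) \<partial>lborel) \<le> ennreal (C0 * (r * lam)\<^sup>2)"
      and hi: "\<And>r. r > 0 \<Longrightarrow> nnL2 (avg r f2) \<le> ennreal (C0 * (1 / (r * lam))\<^sup>2)"
    \<comment> \<open>With this choice Y^(-4001) and Y^(-3999) are 1 / \<open>lam\<close> divided
      and multiplied by Y, one scale on either side of the wavelength of f2.\<close>
    define Y where "Y = lam powr (1 / 4000)"
    have Y1: "Y \<ge> 1" unfolding Y_def using powr_mono[of 0 "1/4000" lam] lam by simp
    then have Y0: "Y > 0" by simp
    have lamY: "lam = Y powr 4000" unfolding Y_def using lam by (simp add: powr_powr)
    have qU: "qbox l \<subseteq> unit_square" using l by (auto simp: qbox_def)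
    have q1: "emeasure lborel (qbox l) \<le> ennreal 1"
      using emeasure_mono[OF qU, of lborel] unit_square_measurable by (simp add: emeasure_unit_square)
    have n1': "(\<integral>\<^sup>+x. (ennreal (norm (f1 x)))\<^sup>2 \<partial>lborel) \<le> 1" using n1 by (simp add: ennreal_power)
    have sqb: "(\<integral>\<^sup>+x. (ennreal (norm (g x)))\<^sup>2 \<partial>lborel) \<le> ennreal c" if "nnL2 g \<le> ennreal c" for c and g :: "plane \<Rightarrow> complex"
      using that by (simp add: ennreal_power)
    show "nnL1_square (wform u (indicator (qbox l)) f1 f2) \<le> ennreal (C / lam powr (1 / 4000))"
    proof (cases "K + K' \<le> Y")
      case False
      \<comment> \<open>For bounded Y the trivial bound 1 is already at most C / Y.\<close>
      have "(nnL1_square (wform u (indicator (qbox l)) f1 f2))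
        \<le> nnform u (qbox l) (\<lambda>x. ennreal (norm (f1 x))) (\<lambda>x. ennreal (norm (f2 x)))"
        by (rule wform_le_nnform) auto
      also have "\<dots> \<le> ennreal (1 * 1)"
        by (rule nnform_le_of_norms[OF _ _ _ q1 n1' sqb]) (use n2 in auto)
      also have "\<dots> \<le> ennreal (C / Y)"
      proof (rule ennreal_leI)
        have "Y \<le> C" using False sC unfolding C_def by linarith
        then show "1 * 1 \<le> C / Y" using Y0 by simp
      qed
      finally show ?thesis unfolding Y_def .
    next
      case True
      then have KY: "K \<le> Y" "K' \<le> Y" using K K' by auto
      define r q where "r = Y powr -4001" and "q = Y powr -3999"
      have rq: "r > 0" "q > 0" using Y0 by (auto simp: r_def q_def)
      have rlam: "r * lam = 1 / Y" 
      proof -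
        have "r * lam = Y powr (- 1)" unfolding r_def lamY powr_add[symmetric] by simp
        then show ?thesis using Y0 by (simp add: powr_minus_divide)
      qed
      have qlam: "1 / (q * lam) = 1 / Y"
      proof -
        have "q * lam = Y powr 1" unfolding q_def lamY powr_add[symmetric] by simp
        then show ?thesis using Y0 by simp
      qed
      have Y12: "Y powr 12 = Y ^ 12" using powr_realpow[OF Y0, of 12] by simp
      define b where "b x = (if norm (f2 x) \<le> Y ^ 12 then f2 x else 0)" for x
      define d where "d x = (if norm (f2 x) \<le> Y ^ 12 then 0 else f2 x)" for x
      have [measurable]: "b \<in> borel_measurable borel" "d \<in> borel_measurable borel" unfolding b_def d_def by measurable
      have bd: "f2 = (\<lambda>x. b x + d x)" by (auto simp: b_def d_def)
      have bM: "norm (b x) \<le> Y powr 12" for x using Y0 by (simp add: b_def Y12)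
      have dn: "norm (d x) = (if norm (f2 x) \<le> Y ^ 12 then 0 else norm (f2 x))" for x by (simp add: d_def)
      have d1: "nnL1 d \<le> ennreal (1 / Y ^ 12)"
        unfolding dn by (rule truncation_tail_L1[OF m(2) n2]) (use Y0 in simp)
      have b2: "nnL2 b \<le> 1" and d2: "nnL2 d \<le> 1"
        by (rule order_trans[OF nn_integral_mono n2]; simp add: b_def d_def)+
      have di: "integrable lborel d" using d1 by (intro integrableI_bounded) (auto intro: le_less_trans)
      have av: "avg p f2 x = avg p b x + avg p d x" for p x
      proof -
        have "integrable lborel (\<lambda>y. d (x + y))" using integrable_lborel_shift[OF di, of x] by (simp add: add.commute)
        then have i: "integrable lborel (\<lambda>y. indicator (qbox p) y *\<^sub>R d (x + y))"
          by (rule Bochner_Integration.integrable_bound) (auto split: split_indicator)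
        have "integrable lborel (\<lambda>y. indicator (qbox p) y *\<^sub>R b (x + y))" by (rule avg_integrable_bounded[OF _ bM]) measurable
        from integrable_ind_avg_diff(2)[OF this i] show ?thesis unfolding bd .
      qed
      define E where "E x = (f2 x - avg r f2 x) + avg q f2 x" for x
      define Fr where "Fr x = avg r d x - avg q d x" for x
      define Fb where "Fb x = avg r b x - avg q b x" for x
      have Em[measurable]: "E \<in> borel_measurable borel" "Fr \<in> borel_measurable borel" "Fb \<in> borel_measurable borel"
        unfolding E_def Fr_def Fb_def by measurable
      have F: "f2 x = E x + (Fr x + Fb x)" for x by (simp add: E_def Fr_def Fb_def av)
      have E2: "nnL2 E \<le> ennreal ((2 * sqrt C0 / Y)\<^sup>2)"
      proof -
        have "nnL2 E
          \<le> (\<integral>\<^sup>+x. 2 * ennreal ((norm (f2 x - avg r f2 x))\<^sup>2) + 2 * ennreal ((norm (avg q f2 x))\<^sup>2) \<partial>lborel)"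
        proof (rule nn_integral_mono)
          fix x
          have "ennreal ((norm (E x))\<^sup>2) \<le> ennreal (2 * (norm (f2 x - avg r f2 x))\<^sup>2 + 2 * (norm (avg q f2 x))\<^sup>2)"
            unfolding E_def by (intro ennreal_leI norm_sq_add_le)
          then show "ennreal ((norm (E x))\<^sup>2) \<le> 2 * ennreal ((norm (f2 x - avg r f2 x))\<^sup>2) + 2 * ennreal ((norm (avg q f2 x))\<^sup>2)"
            by (simp add: ennreal_plus ennreal_mult)
        qed
        also have "\<dots> = 2 * (\<integral>\<^sup>+x. ennreal ((norm (f2 x - avg r f2 x))\<^sup>2) \<partial>lborel) + 2 * nnL2 (avg q f2)"
          by (simp add: nn_integral_add nn_integral_cmult)
        also have "\<dots> \<le> 2 * ennreal (C0 * (1 / Y)\<^sup>2) + 2 * ennreal (C0 * (1 / Y)\<^sup>2)"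
          using lo[OF rq(1)] hi[OF rq(2)] unfolding rlam qlam by (intro add_mono mult_left_mono) simp_all
        also have "\<dots> = ennreal (2 * (C0 * (1 / Y)\<^sup>2) + 2 * (C0 * (1 / Y)\<^sup>2))"
        proof -
          have "0 \<le> C0 * (1 / Y)\<^sup>2" using C0 by simp
          moreover have "ennreal (2 * c) = 2 * ennreal c" if "0 \<le> c" for c using that by (simp add: ennreal_mult)
          ultimately show ?thesis by (simp only: ennreal_plus mult_nonneg_nonneg zero_le_numeral)
        qed
        also have "2 * (C0 * (1 / Y)\<^sup>2) + 2 * (C0 * (1 / Y)\<^sup>2) = (2 * sqrt C0 / Y)\<^sup>2"
          using C0 by (simp add: power_divide power_mult_distrib)
        finally show ?thesis .
      qed
      have F2: "nnL2 Fb \<le> ennreal (2\<^sup>2)"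
        using avg_diff_L2[OF _ b2 rq] by (simp add: Fb_def)
      have Yi: "1 / Y > 0" using Y0 by simp
      define \<phi> where "\<phi> = plateau (1 / Y) l"
      have \<phi>m[measurable]: "\<phi> \<in> borel_measurable borel"
        using lipschitz_imp_continuous[OF plateau_props(4)[OF Yi l]] unfolding \<phi>_def by (rule borel_measurable_continuous_onI)
      have rim[measurable]: "rim (1 / Y) l \<in> sets borel" by (rule plateau_props(6)[OF Yi l])
      define J where "J w g x = (\<integral>\<^sup>+t. ennreal (norm (w t *\<^sub>R (f1 (x + Bu u t) * g (x + power_sum_map t)))) \<partial>lborel)"
        for w :: "plane \<Rightarrow> real" and g :: "plane \<Rightarrow> complex" and x
      have Jm[measurable]: "J w g \<in> borel_measurable borel" if [measurable]: "w \<in> borel_measurable borel" "g \<in> borel_measurable borel" for w g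
      proof -
        have "J w g \<in> borel_measurable lborel" unfolding J_def by measurable
        then show ?thesis by simp
      qed
      have wm[measurable]: "(indicator (qbox l) :: _ \<Rightarrow> real) \<in> borel_measurable borel"
        by (rule borel_measurable_indicator) (rule qbox_measurable)
      let ?I = "\<lambda>x. indicator unit_square x :: ennreal"
      have "(\<integral>\<^sup>+x. ?I x * ennreal (norm (wform u (indicator (qbox l)) f1 f2 x)) \<partial>lborel)
        \<le> (\<integral>\<^sup>+x. ?I x * J (indicator (qbox l)) E x + (?I x * J (indicator (qbox l)) Fr x +
             (?I x * J (\<lambda>t. indicator (qbox l) t - \<phi> t) Fb x + ?I x * ennreal (norm (wform u \<phi> f1 Fb x)))) \<partial>lborel)"
        unfolding distrib_left[symmetric]
        unfolding J_def by (intro nn_integral_mono mult_left_mono wform_split[OF m(1) Em wm \<phi>m F]) simp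
      also have "\<dots> = (\<integral>\<^sup>+x. ?I x * J (indicator (qbox l)) E x \<partial>lborel) + ((\<integral>\<^sup>+x. ?I x * J (indicator (qbox l)) Fr x \<partial>lborel) +
             ((\<integral>\<^sup>+x. ?I x * J (\<lambda>t. indicator (qbox l) t - \<phi> t) Fb x \<partial>lborel) + (\<integral>\<^sup>+x. ?I x * ennreal (norm (wform u \<phi> f1 Fb x)) \<partial>lborel)))"
        by (simp add: nn_integral_add)
      also have "\<dots> \<le> ennreal (1 * (2 * sqrt C0 / Y)) + (ennreal (K / Y) + (ennreal (4 * (1 / Y) * 2) + ennreal (16 / Y)))"
      proof (intro add_mono)
        have "(\<integral>\<^sup>+x. ?I x * J (indicator (qbox l)) E x \<partial>lborel) \<le> nnform u (qbox l) (\<lambda>x. ennreal (norm (f1 x))) (\<lambda>x. ennreal (norm (E x)))"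
          unfolding J_def by (rule weighted_nn_le_nnform) auto
        also have "\<dots> \<le> ennreal (1 * (2 * sqrt C0 / Y))"
          by (rule nnform_le_of_norms[OF _ _ _ q1 n1' sqb[OF E2]]) (use C0 Y0 in auto)
        finally show "(\<integral>\<^sup>+x. ?I x * J (indicator (qbox l)) E x \<partial>lborel) \<le> ennreal (1 * (2 * sqrt C0 / Y))" .
        have "(\<integral>\<^sup>+x. ?I x * J (indicator (qbox l)) Fr x \<partial>lborel) \<le> nnform u (qbox l) (\<lambda>x. ennreal (norm (f1 x))) (\<lambda>x. ennreal (norm (Fr x)))"
          unfolding J_def by (rule weighted_nn_le_nnform) auto
        also have "\<dots> \<le> nnform u unit_square (\<lambda>x. ennreal (norm (f1 x))) (\<lambda>x. ennreal (norm (Fr x)))" by (rule nnform_mono[OF qU]) simp_all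
        also have "\<dots> \<le> ennreal (K / Y)" unfolding Fr_def by (rule tail[OF u KY(1) rq _ _ n1 d2 d1]) measurable
        finally show "(\<integral>\<^sup>+x. ?I x * J (indicator (qbox l)) Fr x \<partial>lborel) \<le> ennreal (K / Y)" .
        have "(\<integral>\<^sup>+x. ?I x * J (\<lambda>t. indicator (qbox l) t - \<phi> t) Fb x \<partial>lborel) \<le> nnform u (rim (1 / Y) l) (\<lambda>x. ennreal (norm (f1 x))) (\<lambda>x. ennreal (norm (Fb x)))"
          unfolding J_def \<phi>_def by (rule weighted_nn_le_nnform[OF _ _ rim plateau_props(5)[OF Yi l]]) auto
        also have "\<dots> \<le> ennreal (4 * (1 / Y) * 2)"
          by (rule nnform_le_of_norms[OF rim _ _ plateau_props(7)[OF Yi l] n1' sqb[OF F2]]) (use Y0 in auto)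
        finally show "(\<integral>\<^sup>+x. ?I x * J (\<lambda>t. indicator (qbox l) t - \<phi> t) Fb x \<partial>lborel) \<le> ennreal (4 * (1 / Y) * 2)" .
        show "(\<integral>\<^sup>+x. ?I x * ennreal (norm (wform u \<phi> f1 Fb x)) \<partial>lborel) \<le> ennreal (16 / Y)"
          unfolding \<phi>_def Fb_def[abs_def] r_def q_def by (rule smooth[OF u l KY(2) _ _ n1 bM]) measurable
      qed
      also have "\<dots> = ennreal (1 * (2 * sqrt C0 / Y) + (K / Y + (4 * (1 / Y) * 2 + 16 / Y)))"
      proof -
        have "0 \<le> 1 * (2 * sqrt C0 / Y)" "0 \<le> K / Y" "0 \<le> 4 * (1 / Y) * 2" "0 \<le> 16 / Y" using C0 K Y0 by auto
        then show ?thesis by (simp only: ennreal_plus add_nonneg_nonneg)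
      qed
      also have "\<dots> \<le> ennreal (C / Y)" using Y0 K' by (intro ennreal_leI) (simp add: C_def field_simps)
      finally show ?thesis unfolding Y_def .
    qed
  qed
  qed
qed

section \<open>The bound at the unit scale\<close>

text \<open>A bound below 1 is essential: the constant at \<open>l = 0\<close> may not exceed 1, also for \<open>lam\<close> close to 1.\<close>

lemma power_sum_overlap:
  "emeasure lborel {t \<in> unit_square. y - power_sum_map t \<in> unit_square} \<le> ennreal (24 / 25)"
proof -
  define A B :: "plane set" where "A = {0..1/5} \<times> {0..1/5}" and "B = {4/5..1} \<times> {4/5..1}"
  let ?H = "{t \<in> unit_square. y - power_sum_map t \<in> unit_square}"
  have m: "A \<in> sets lborel" "B \<in> sets lborel" "unit_square \<in> sets lborel"
    unfolding A_def B_def by (simp_all add: lborel_prod[symmetric])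
  have e: "emeasure lborel A = ennreal (1 / 25)" "emeasure lborel B = ennreal (1 / 25)"
  proof -
    have "emeasure (lborel \<Otimes>\<^sub>M lborel) A = ennreal (1 / 5) * ennreal (1 / 5)"
      unfolding A_def by (subst lborel.emeasure_pair_measure_Times) auto
    moreover have "emeasure (lborel \<Otimes>\<^sub>M lborel) B = ennreal (1 / 5) * ennreal (1 / 5)"
      unfolding B_def by (subst lborel.emeasure_pair_measure_Times) auto
    ultimately show "emeasure lborel A = ennreal (1 / 25)" "emeasure lborel B = ennreal (1 / 25)"
      by (simp_all add: lborel_prod ennreal_mult[symmetric])
  qed
  have d: "emeasure lborel (unit_square - X) = ennreal (24 / 25)" if "X \<in> sets lborel" "emeasure lborel X = ennreal (1 / 25)" "X \<subseteq> unit_square" for X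
  proof -
    have "emeasure lborel (unit_square - X) = emeasure lborel unit_square - emeasure lborel X"
      using that m by (intro emeasure_Diff) auto
    also have "\<dots> = ennreal 1 - ennreal (1 / 25)" by (simp add: emeasure_unit_square that)
    also have "\<dots> = ennreal (24 / 25)" by (subst ennreal_minus) auto
    finally show ?thesis .
  qed
  have sub: "A \<subseteq> unit_square" "B \<subseteq> unit_square" by (auto simp: A_def B_def)
  have "?H \<subseteq> unit_square - A \<or> ?H \<subseteq> unit_square - B"
  proof (rule ccontr)
    assume "\<not> ?thesis"
    then have nA: "\<not> ?H \<subseteq> unit_square - A" and nB: "\<not> ?H \<subseteq> unit_square - B" by (simp_all only: de_Morgan_disj simp_thms)
    have ex: "\<exists>s\<in>X. s \<in> H" if "H \<subseteq> U" "\<not> H \<subseteq> U - X" for H U X :: "plane set" using that by blast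
    have "\<exists>s\<in>A. s \<in> ?H" by (rule ex[OF Collect_restrict nA])
    moreover have "\<exists>s\<in>B. s \<in> ?H" by (rule ex[OF Collect_restrict nB])
    ultimately obtain s t where s: "s \<in> A" "y - power_sum_map s \<in> unit_square" and t: "t \<in> B" "y - power_sum_map t \<in> unit_square"
      unfolding mem_Collect_eq Bex_def by (elim exE conjE)
    \<comment> \<open>The first coordinate decides: the point s of A forces it to be at most 1 +
      2/25, the point t of B to be at least 32/25.\<close>
    have "fst y \<le> (fst s)\<^sup>2 + (snd s)\<^sup>2 + 1" "fst y \<ge> (fst t)\<^sup>2 + (snd t)\<^sup>2"
      using s(2) t(2) by (auto simp: power_sum_map_def mem_Times_iff)
    moreover have "(fst s)\<^sup>2 \<le> (1/5)\<^sup>2" "(snd s)\<^sup>2 \<le> (1/5)\<^sup>2" "(4/5)\<^sup>2 \<le> (fst t)\<^sup>2" "(4/5)\<^sup>2 \<le> (snd t)\<^sup>2"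
      using s(1) t(1) by (auto simp: A_def B_def mem_Times_iff intro!: power_mono)
    ultimately show False by (simp add: power2_eq_square)
  qed
  then show ?thesis
  proof
    assume "?H \<subseteq> unit_square - A"
    then have "emeasure lborel ?H \<le> emeasure lborel (unit_square - A)" by (rule emeasure_mono) (use m in auto)
    then show ?thesis using d[OF m(1) e(1) sub(1)] by simp
  next
    assume "?H \<subseteq> unit_square - B"
    then have "emeasure lborel ?H \<le> emeasure lborel (unit_square - B)" by (rule emeasure_mono) (use m in auto)
    then show ?thesis using d[OF m(2) e(2) sub(2)] by simp
  qed
qed

text \<open>Integrating over t first weights the square of b at y by the measure of the t with y -
  P(t) in the unit square, at most 24/25 by \<open>power_sum_overlap\<close>. Cauchy-Schwarz takes
  the square root.\<close>

lemma nnform_contraction: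
  assumes [measurable]: "a \<in> borel_measurable borel" "b \<in> borel_measurable borel"
    and a: "(\<integral>\<^sup>+x. (a x)\<^sup>2 \<partial>lborel) \<le> 1" and b: "(\<integral>\<^sup>+x. (b x)\<^sup>2 \<partial>lborel) \<le> 1"
  shows "nnform u unit_square a b \<le> ennreal (sqrt (24 / 25))"
proof (rule ennreal_le_of_square_le)
  let ?I = "\<lambda>t. indicator unit_square t :: ennreal"
  have pm[measurable]: "power_sum_map \<in> borel_measurable borel"
    unfolding power_sum_map_def by (intro borel_measurable_continuous_onI continuous_intros)
  have Im[measurable]: "?I \<in> borel_measurable borel" by measurable
  have "(\<integral>\<^sup>+t. \<integral>\<^sup>+x. ?I t * ?I x * (b (x + power_sum_map t))\<^sup>2 \<partial>lborel \<partial>lborel)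
    = (\<integral>\<^sup>+t. \<integral>\<^sup>+y. ?I t * ?I (y - power_sum_map t) * (b y)\<^sup>2 \<partial>lborel \<partial>lborel)"
  proof (rule nn_integral_cong)
    fix t
    have "(\<lambda>y. ?I t * ?I (y - power_sum_map t) * (b y)\<^sup>2) \<in> borel_measurable borel" by measurable
    from nn_integral_shift_Bu[OF this, of "power_sum_map t"]
    show "(\<integral>\<^sup>+x. ?I t * ?I x * (b (x + power_sum_map t))\<^sup>2 \<partial>lborel) = (\<integral>\<^sup>+y. ?I t * ?I (y - power_sum_map t) * (b y)\<^sup>2 \<partial>lborel)" by simp
  qed
  also have "\<dots> = (\<integral>\<^sup>+y. \<integral>\<^sup>+t. ?I t * ?I (y - power_sum_map t) * (b y)\<^sup>2 \<partial>lborel \<partial>lborel)"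
    by (rule lborel_pair.Fubini') measurable
  also have "\<dots> \<le> (\<integral>\<^sup>+y. ennreal (24 / 25) * (b y)\<^sup>2 \<partial>lborel)"
  proof (rule nn_integral_mono)
    fix y
    have H: "{t \<in> unit_square. y - power_sum_map t \<in> unit_square} \<in> sets lborel"
    proof -
      have "(\<lambda>t. y - power_sum_map t) -` unit_square \<inter> space lborel \<in> sets lborel"
        by (rule measurable_sets[of _ _ borel]) (use unit_square_measurable in auto)
      moreover have "{t \<in> unit_square. y - power_sum_map t \<in> unit_square} = unit_square \<inter> ((\<lambda>t. y - power_sum_map t) -` unit_square \<inter> space lborel)" by auto
      ultimately show ?thesis using unit_square_measurable by simp
    qed
    have "(\<integral>\<^sup>+t. ?I t * ?I (y - power_sum_map t) * (b y)\<^sup>2 \<partial>lborel) = (\<integral>\<^sup>+t. indicator {t \<in> unit_square. y - power_sum_map t \<in> unit_square} t * (b y)\<^sup>2 \<partial>lborel)"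
      by (intro nn_integral_cong) (simp split: split_indicator)
    also have "\<dots> = emeasure lborel {t \<in> unit_square. y - power_sum_map t \<in> unit_square} * (b y)\<^sup>2"
      by (subst nn_integral_multc) (use H in simp_all)
    also have "\<dots> \<le> ennreal (24 / 25) * (b y)\<^sup>2" by (intro mult_right_mono power_sum_overlap) simp
    finally show "(\<integral>\<^sup>+t. ?I t * ?I (y - power_sum_map t) * (b y)\<^sup>2 \<partial>lborel) \<le> ennreal (24 / 25) * (b y)\<^sup>2" .
  qed
  also have "\<dots> = ennreal (24 / 25) * (\<integral>\<^sup>+y. (b y)\<^sup>2 \<partial>lborel)" by (rule nn_integral_cmult) measurable
  also have "\<dots> \<le> ennreal (24 / 25) * 1" by (intro mult_left_mono b) simp
  finally have c: "(\<integral>\<^sup>+t. \<integral>\<^sup>+x. ?I t * ?I x * (b (x + power_sum_map t))\<^sup>2 \<partial>lborel \<partial>lborel) \<le> ennreal (24 / 25)" by simp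
  have "(nnform u unit_square a b)\<^sup>2 \<le> (emeasure lborel unit_square * (\<integral>\<^sup>+x. (a x)\<^sup>2 \<partial>lborel)) *
     (\<integral>\<^sup>+t. \<integral>\<^sup>+x. ?I t * ?I x * (b (x + power_sum_map t))\<^sup>2 \<partial>lborel \<partial>lborel)"
    by (rule nnform_Cauchy_Schwarz[OF unit_square_measurable assms(1,2)])
  also have "\<dots> \<le> (1 * 1) * ennreal (24 / 25)"
    by (intro mult_mono c a) (simp_all add: emeasure_unit_square)
  finally show "(nnform u unit_square a b)\<^sup>2 \<le> ennreal ((sqrt (24 / 25))\<^sup>2)" by simp
qed simp

section \<open>Normalisation and the final exponent\<close>

lemma wform_scale: "wform u w (\<lambda>x. c *\<^sub>R f x) (\<lambda>x. d *\<^sub>R F x) x = (c * d) *\<^sub>R wform u w f F x"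
proof -
  have "w t *\<^sub>R (c *\<^sub>R a * d *\<^sub>R b) = (c * d) *\<^sub>R (w t *\<^sub>R (a * b))" for t and a b :: complex
    by (simp add: algebra_simps)
  then show ?thesis by (simp add: wform_def del: scaleR_scaleR)
qed

lemma avg_scale: "avg r (\<lambda>x. c *\<^sub>R f x) x = c *\<^sub>R avg r f x"
  unfolding avg_def by (simp only: scaleR_left_commute[of _ c] integral_scaleR_right)

lemma nn_integral_scale_sq:
  fixes f :: "plane \<Rightarrow> complex"
  assumes [measurable]: "f \<in> borel_measurable borel"
  shows "(\<integral>\<^sup>+x. ennreal ((norm (c *\<^sub>R f x))\<^sup>2) \<partial>lborel) = ennreal (c\<^sup>2) * nnL2 f"
  by (subst nn_integral_cmult[symmetric]) (simp_all add: power_mult_distrib ennreal_mult)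

text \<open>Scaling to unit norm divides by \<open>A1\<close> and \<open>A2\<close>; when one of
  them is 0, the absolute form vanishes by Cauchy-Schwarz.\<close>

lemma wform_normalize:
  fixes f1 f2 :: "plane \<Rightarrow> complex"
  assumes m[measurable]: "f1 \<in> borel_measurable borel" "f2 \<in> borel_measurable borel"
    and n: "nnL2 f1 = ennreal (A1\<^sup>2)" "nnL2 f2 = ennreal (A2\<^sup>2)"
    and A: "A1 \<ge> 0" "A2 \<ge> 0" and B: "B \<ge> 0" and w: "\<And>t. \<bar>w t\<bar> \<le> indicator unit_square t"
    and wm[measurable]: "w \<in> borel_measurable borel"
    and bd: "A1 > 0 \<Longrightarrow> A2 > 0 \<Longrightarrow> (nnL1_square (wform u w (\<lambda>x. (1 / A1) *\<^sub>R f1 x) (\<lambda>x. (1 / A2) *\<^sub>R f2 x))) \<le> ennreal B"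
  shows "nnL1_square (wform u w f1 f2) \<le> ennreal (B * A1 * A2)"
proof (cases "A1 > 0 \<and> A2 > 0")
  case True
  have "nnL1_square (wform u w f1 f2)
    = (\<integral>\<^sup>+x. ennreal (A1 * A2) * (indicator unit_square x * ennreal (norm (wform u w (\<lambda>x. (1 / A1) *\<^sub>R f1 x) (\<lambda>x. (1 / A2) *\<^sub>R f2 x) x))) \<partial>lborel)"
  proof (intro nn_integral_cong)
    fix x
    have "norm (wform u w f1 f2 x) = (A1 * A2) * norm (wform u w (\<lambda>x. (1 / A1) *\<^sub>R f1 x) (\<lambda>x. (1 / A2) *\<^sub>R f2 x) x)"
      unfolding wform_scale using True by simp
    then have "ennreal (norm (wform u w f1 f2 x)) = ennreal (A1 * A2) * ennreal (norm (wform u w (\<lambda>x. (1 / A1) *\<^sub>R f1 x) (\<lambda>x. (1 / A2) *\<^sub>R f2 x) x))"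
      using True by (simp only: ennreal_mult mult_nonneg_nonneg A norm_ge_zero)
    then show "indicator unit_square x * ennreal (norm (wform u w f1 f2 x)) =
      ennreal (A1 * A2) * (indicator unit_square x * ennreal (norm (wform u w (\<lambda>x. (1 / A1) *\<^sub>R f1 x) (\<lambda>x. (1 / A2) *\<^sub>R f2 x) x)))"
      by (simp only: mult.left_commute)
  qed
  also have "\<dots> = ennreal (A1 * A2) * (nnL1_square (wform u w (\<lambda>x. (1 / A1) *\<^sub>R f1 x) (\<lambda>x. (1 / A2) *\<^sub>R f2 x)))"
  proof (rule nn_integral_cmult)
    have [measurable]: "(\<lambda>x. (1 / A1) *\<^sub>R f1 x) \<in> borel_measurable borel" "(\<lambda>x. (1 / A2) *\<^sub>R f2 x) \<in> borel_measurable borel" by measurable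
    show "(\<lambda>x. indicator unit_square x * ennreal (norm (wform u w (\<lambda>x. (1 / A1) *\<^sub>R f1 x) (\<lambda>x. (1 / A2) *\<^sub>R f2 x) x))) \<in> borel_measurable lborel"
      by measurable
  qed
  also have "\<dots> \<le> ennreal (A1 * A2) * ennreal B" using bd True by (intro mult_left_mono) auto
  also have "\<dots> = ennreal (B * A1 * A2)" using A B by (simp add: ennreal_mult[symmetric] mult_ac)
  finally show ?thesis .
next
  case False
  then have z: "A1 = 0 \<or> A2 = 0" using A by linarith
  let ?N = "nnform u unit_square (\<lambda>x. ennreal (norm (f1 x))) (\<lambda>x. ennreal (norm (f2 x)))"
  have "?N\<^sup>2 \<le> (emeasure lborel unit_square)\<^sup>2 * ((\<integral>\<^sup>+x. (ennreal (norm (f1 x)))\<^sup>2 \<partial>lborel) * (\<integral>\<^sup>+x. (ennreal (norm (f2 x)))\<^sup>2 \<partial>lborel))"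
    by (rule nnform_le_norms) measurable
  also have "\<dots> = ennreal (0\<^sup>2)" using z n by (auto simp: ennreal_power)
  finally have "?N \<le> ennreal 0" by (rule ennreal_le_of_square_le) simp
  moreover have "nnL1_square (wform u w f1 f2) \<le> ?N"
    by (rule wform_le_nnform[OF m unit_square_measurable w])
  ultimately show ?thesis by auto
qed

text \<open>For l \<ge> 1 the constant of \<open>frequency_decay\<close> can be hidden in an
  exponential in l. For l = 0 it cannot, so the contraction bound \<theta> is used for
  \<open>lam\<close> up to a threshold \<Lambda>, beyond which half of the decay exponent pays for
  the constant.\<close>

proposition averaging_decay:
  assumes C0: "C0 \<ge> (1::real)"
  obtains \<gamma> C where "\<gamma> > (0::real)" "C > (0::real)"
    "\<And>u lam l f1 f2 A1 A2. 0 \<le> u \<Longrightarrow> u \<le> 1 \<Longrightarrow> 1 \<le> lam \<Longrightarrow> f1 \<in> borel_measurable borel \<Longrightarrow> f2 \<in> borel_measurable borel \<Longrightarrow>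
      nnL2 f1 = ennreal (A1\<^sup>2) \<Longrightarrow> nnL2 f2 = ennreal (A2\<^sup>2) \<Longrightarrow> 0 \<le> A1 \<Longrightarrow> 0 \<le> A2 \<Longrightarrow>
      (\<And>r. r > 0 \<Longrightarrow> (\<integral>\<^sup>+x. ennreal ((norm (f2 x - avg r f2 x))\<^sup>2) \<partial>lborel) \<le> ennreal (C0 * (r * lam)\<^sup>2) * nnL2 f2) \<Longrightarrow>
      (\<And>r. r > 0 \<Longrightarrow> nnL2 (avg r f2) \<le> ennreal (C0 * (1 / (r * lam))\<^sup>2) * nnL2 f2) \<Longrightarrow>
      ennreal (2 ^ (2 * l)) * (nnL1_square (wform u (indicator (qbox (1 / 2 ^ l))) f1 f2))
        \<le> ennreal (2 powr (C * real l) * lam powr (- \<gamma>) * A1 * A2)"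
proof -
  show thesis
  proof (rule frequency_decay[OF C0], goal_cases)
  case (1 C)
  note C = 1(1) and decay = 1(2)
  define \<theta> where "\<theta> = sqrt (24 / 25 :: real)"
  have \<theta>: "0 < \<theta>" "\<theta> < 1" by (auto simp: \<theta>_def)
  \<comment> \<open>For \<open>lam\<close> above \<Lambda> the power \<open>lam\<close> powr
    (1/8000) exceeds C, and the other half of the exponent 1/4000 survives.\<close>
  define \<Lambda> where "\<Lambda> = (C + 1) powr 8000"
  have \<Lambda>: "\<Lambda> > 1" using C by (simp add: \<Lambda>_def)
  \<comment> \<open>The second entry of the minimum ensures \<theta> \<le> \<Lambda> powr (-
    \<gamma>), so that the contraction suffices for all \<open>lam\<close> up to \<Lambda>.\<close>
  define \<gamma> where "\<gamma> = min (1 / 8000) (- ln \<theta> / ln \<Lambda>)"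
  have \<gamma>: "\<gamma> > 0" "\<gamma> \<le> 1 / 8000" "\<gamma> * ln \<Lambda> \<le> - ln \<theta>"
  proof -
    have p: "- ln \<theta> > 0" "ln \<Lambda> > 0" using \<theta> \<Lambda> by auto
    then show "\<gamma> > 0" by (auto simp: \<gamma>_def divide_neg_pos)
    show "\<gamma> \<le> 1 / 8000" unfolding \<gamma>_def by (rule min.cobounded1)
    have "\<gamma> \<le> - ln \<theta> / ln \<Lambda>" unfolding \<gamma>_def by (rule min.cobounded2)
    then have "\<gamma> * ln \<Lambda> \<le> - ln \<theta> / ln \<Lambda> * ln \<Lambda>" using p by (intro mult_right_mono) auto
    then show "\<gamma> * ln \<Lambda> \<le> - ln \<theta>" using p by simp
  qed
  have crude: "C / lam powr (1 / 4000) \<le> C * lam powr (- \<gamma>)" if "lam \<ge> 1" for lam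
  proof -
    have "lam powr (- (1 / 4000)) \<le> lam powr (- \<gamma>)" using that \<gamma> by (intro powr_mono) auto
    then have "C * lam powr (- (1 / 4000)) \<le> C * lam powr (- \<gamma>)" using C by (intro mult_left_mono) auto
    moreover have "C / lam powr (1 / 4000) = C * lam powr (- (1 / 4000))" by (simp only: powr_minus divide_inverse)
    ultimately show ?thesis by (simp only:)
  qed
  have sharp: "min \<theta> (C / lam powr (1 / 4000)) \<le> lam powr (- \<gamma>)" if lam: "lam \<ge> 1" for lam
  proof (cases "lam \<le> \<Lambda>")
    case True
    have "\<gamma> * ln lam \<le> \<gamma> * ln \<Lambda>" using True lam \<gamma> by (intro mult_left_mono) auto
    then have "ln \<theta> \<le> - \<gamma> * ln lam" using \<gamma>(3) by simp
    then have "exp (ln \<theta>) \<le> exp (- \<gamma> * ln lam)" by (rule exp_le_cancel_iff[THEN iffD2])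
    then have "\<theta> \<le> lam powr (- \<gamma>)" using \<theta> lam by (simp add: powr_def)
    then show ?thesis by linarith
  next
    case False
    have "C \<le> C + 1" by simp
    also have "\<dots> = \<Lambda> powr (1 / 8000)" unfolding \<Lambda>_def powr_powr using C by simp
    also have "\<dots> \<le> lam powr (1 / 8000)" using False \<Lambda> by (intro powr_mono2) auto
    finally have "C / lam powr (1 / 4000) \<le> lam powr (1 / 8000) / lam powr (1 / 4000)" by (rule divide_right_mono) simp
    also have "\<dots> = lam powr (- (1 / 8000))" by (simp flip: powr_diff)
    also have "\<dots> \<le> lam powr (- \<gamma>)" using lam \<gamma> by (intro powr_mono) auto
    finally show ?thesis by linarith
  qed
  show ?case
  \<comment> \<open>In the exponent, 2 accounts for the normalisation 2^(2l) and the logarithm for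
    C, since C is at most C^l when l \<ge> 1.\<close>
  proof (rule that[of \<gamma> "2 + log 2 C"])
    show "\<gamma> > 0" by (rule \<gamma>(1))
    have lC: "log 2 C \<ge> 0" using C by simp
    then show "2 + log 2 C > 0" by simp
    fix u lam A1 A2 :: real and l :: nat and f1 f2 :: "plane \<Rightarrow> complex"
    assume u: "0 \<le> u" "u \<le> 1" and lam: "1 \<le> lam" and m[measurable]: "f1 \<in> borel_measurable borel" "f2 \<in> borel_measurable borel"
      and n1: "nnL2 f1 = ennreal (A1\<^sup>2)" and n2: "nnL2 f2 = ennreal (A2\<^sup>2)"
      and A: "0 \<le> A1" "0 \<le> A2"
      and lo: "\<And>r. r > 0 \<Longrightarrow> (\<integral>\<^sup>+x. ennreal ((norm (f2 x - avg r f2 x))\<^sup>2) \<partial>lborel) \<le> ennreal (C0 * (r * lam)\<^sup>2) * nnL2 f2"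
      and hi: "\<And>r. r > 0 \<Longrightarrow> nnL2 (avg r f2) \<le> ennreal (C0 * (1 / (r * lam))\<^sup>2) * nnL2 f2"
    define s where "s = (1 / 2 ^ l :: real)"
    have s: "0 < s" "s \<le> 1" by (auto simp: s_def)
    let ?w = "indicator (qbox s) :: plane \<Rightarrow> real"
    have qU: "qbox s \<subseteq> unit_square" using s by (auto simp: qbox_def)
    have w: "\<bar>?w t\<bar> \<le> indicator unit_square t" for t using qU by (auto split: split_indicator)
    have wm[measurable]: "?w \<in> borel_measurable borel" by (rule borel_measurable_indicator) (rule qbox_measurable)
    have one: "(\<integral>\<^sup>+x. ennreal ((norm ((1 / c) *\<^sub>R g x))\<^sup>2) \<partial>lborel) \<le> 1"
      if "g \<in> borel_measurable borel" "c > 0" "nnL2 g = ennreal (c\<^sup>2)" for c and g :: "plane \<Rightarrow> complex"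
      unfolding nn_integral_scale_sq[OF that(1)] that(3) using that(2) by (simp add: ennreal_mult[symmetric] power_divide)
    let ?W = "\<integral>\<^sup>+x. indicator unit_square x * ennreal (norm (wform u ?w f1 f2 x)) \<partial>lborel"
    have W1: "?W \<le> ennreal (\<theta> * A1 * A2)"
    proof (rule wform_normalize[OF m n1 n2 A _ w wm])
      assume p: "A1 > 0" "A2 > 0"
      have "(nnL1_square (wform u ?w (\<lambda>x. (1 / A1) *\<^sub>R f1 x) (\<lambda>x. (1 / A2) *\<^sub>R f2 x)))
        \<le> nnform u unit_square (\<lambda>x. ennreal (norm ((1 / A1) *\<^sub>R f1 x))) (\<lambda>x. ennreal (norm ((1 / A2) *\<^sub>R f2 x)))"
        by (rule wform_le_nnform[OF _ _ unit_square_measurable w]) measurable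
      also have "\<dots> \<le> ennreal \<theta>" unfolding \<theta>_def
        by (rule nnform_contraction) (use one[OF m(1) p(1) n1] one[OF m(2) p(2) n2] in \<open>simp_all only: ennreal_power norm_ge_zero, measurable\<close>)
      finally show "nnL1_square (wform u ?w (\<lambda>x. (1 / A1) *\<^sub>R f1 x) (\<lambda>x. (1 / A2) *\<^sub>R f2 x)) \<le> ennreal \<theta>" .
    qed (use \<theta> in simp)
    have W2: "?W \<le> ennreal (C / lam powr (1 / 4000) * A1 * A2)"
    proof (rule wform_normalize[OF m n1 n2 A _ w wm])
      assume p: "A1 > 0" "A2 > 0"
      have sc: "(\<integral>\<^sup>+x. ennreal ((norm ((1 / A2) *\<^sub>R g x))\<^sup>2) \<partial>lborel) \<le> ennreal D"
        if "g \<in> borel_measurable borel" "nnL2 g \<le> ennreal D * ennreal (A2\<^sup>2)" "D \<ge> 0" for g :: "plane \<Rightarrow> complex" and D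
      proof -
        have "(\<integral>\<^sup>+x. ennreal ((norm ((1 / A2) *\<^sub>R g x))\<^sup>2) \<partial>lborel) \<le> ennreal ((1 / A2)\<^sup>2) * (ennreal D * ennreal (A2\<^sup>2))"
          unfolding nn_integral_scale_sq[OF that(1)] by (intro mult_left_mono that(2)) simp
        also have "\<dots> = ennreal ((1 / A2)\<^sup>2 * (D * A2\<^sup>2))" using that(3) by (simp only: ennreal_mult mult_nonneg_nonneg zero_le_power2)
        also have "(1 / A2)\<^sup>2 * (D * A2\<^sup>2) = D" using p by (simp add: power_divide)
        finally show ?thesis .
      qed
      show "nnL1_square (wform u ?w (\<lambda>x. (1 / A1) *\<^sub>R f1 x) (\<lambda>x. (1 / A2) *\<^sub>R f2 x)) \<le> ennreal (C / lam powr (1 / 4000))"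
      proof (rule decay[OF u lam s _ _ one[OF m(1) p(1) n1] one[OF m(2) p(2) n2]])
        fix r :: real assume r: "r > 0"
        show "(\<integral>\<^sup>+x. ennreal ((norm ((1 / A2) *\<^sub>R f2 x - avg r (\<lambda>x. (1 / A2) *\<^sub>R f2 x) x))\<^sup>2) \<partial>lborel) \<le> ennreal (C0 * (r * lam)\<^sup>2)"
          unfolding avg_scale scaleR_diff_right[symmetric] by (rule sc) (use lo[OF r] n2 C0 in \<open>simp_all, measurable\<close>)
        show "(\<integral>\<^sup>+x. ennreal ((norm (avg r (\<lambda>x. (1 / A2) *\<^sub>R f2 x) x))\<^sup>2) \<partial>lborel) \<le> ennreal (C0 * (1 / (r * lam))\<^sup>2)"
          unfolding avg_scale by (rule sc) (use hi[OF r] n2 C0 in simp_all)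
      qed measurable
    qed (use C in simp)
    have W: "?W \<le> ennreal (min \<theta> (C / lam powr (1 / 4000)) * A1 * A2)"
      using W1 W2 by (simp add: min_def)
    show "ennreal (2 ^ (2 * l)) * (nnL1_square (wform u (indicator (qbox (1 / 2 ^ l))) f1 f2))
        \<le> ennreal (2 powr ((2 + log 2 C) * real l) * lam powr (- \<gamma>) * A1 * A2)"
    proof -
      have "ennreal (2 ^ (2 * l)) * ?W \<le> ennreal (2 ^ (2 * l)) * ennreal (min \<theta> (C / lam powr (1 / 4000)) * A1 * A2)"
        by (intro mult_left_mono W) simp
      also have "\<dots> = ennreal (2 ^ (2 * l) * (min \<theta> (C / lam powr (1 / 4000)) * A1 * A2))"
        using A C \<theta> by (intro ennreal_mult[symmetric]) auto
      also have "\<dots> \<le> ennreal (2 powr ((2 + log 2 C) * real l) * lam powr (- \<gamma>) * A1 * A2)"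
      proof (rule ennreal_leI)
        have "2 ^ (2 * l) * min \<theta> (C / lam powr (1 / 4000)) \<le> 2 powr ((2 + log 2 C) * real l) * lam powr (- \<gamma>)"
        proof (cases l)
          case 0
          then show ?thesis using sharp[OF lam] by simp
        next
          case (Suc k)
          have "2 ^ (2 * l) * min \<theta> (C / lam powr (1 / 4000)) \<le> 2 ^ (2 * l) * (C * lam powr (- \<gamma>))"
            using crude[OF lam] by (intro mult_left_mono) auto
          also have "\<dots> = (2 ^ (2 * l) * C) * lam powr (- \<gamma>)" by simp
          also have "\<dots> \<le> 2 powr ((2 + log 2 C) * real l) * lam powr (- \<gamma>)"
          proof (rule mult_right_mono)
            have "C = 2 powr (log 2 C)" using C by simp
            also have "\<dots> \<le> 2 powr (log 2 C * real l)" using lC Suc by (intro powr_mono) (simp_all add: mult_le_cancel_left1)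
            finally have "2 ^ (2 * l) * C \<le> 2 powr (2 * real l) * 2 powr (log 2 C * real l)"
              using powr_realpow[of 2 "2 * l"] C by (intro mult_mono) auto
            also have "\<dots> = 2 powr ((2 + log 2 C) * real l)" by (simp add: powr_add[symmetric] algebra_simps)
            finally show "2 ^ (2 * l) * C \<le> 2 powr ((2 + log 2 C) * real l)" .
          qed simp
          finally show ?thesis .
        qed
        from mult_right_mono[OF mult_right_mono[OF this A(1)] A(2)]
        show "2 ^ (2 * l) * (min \<theta> (C / lam powr (1 / 4000)) * A1 * A2) \<le> 2 powr ((2 + log 2 C) * real l) * lam powr (- \<gamma>) * A1 * A2"
          by (simp add: mult.assoc)
      qed
      finally show ?thesis unfolding s_def .
    qed
  qed
  qed
qed

section \<open>Almost everywhere representatives\<close>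

text \<open>By completeness of Lebesgue measure: preimages under f and g differ by a null
  set.\<close>

lemma lebesgue_measurable_AE_eq:
  fixes f g :: "plane \<Rightarrow> complex"
  assumes g: "g \<in> borel_measurable lebesgue" and fg: "AE x in lborel. f x = g x"
  shows "f \<in> borel_measurable lebesgue"
proof (rule measurableI)
  fix A :: "complex set" assume A: "A \<in> sets borel"
  have "AE x in lebesgue. f x = g x" using fg by (rule AE_completion)
  then have "AE x in lebesgue. x \<in> g -` A \<inter> space lebesgue \<longleftrightarrow> x \<in> f -` A \<inter> space lebesgue"
    by (rule eventually_mono) auto
  moreover have "g -` A \<inter> space lebesgue \<in> sets lebesgue" using g A by (rule measurable_sets)
  ultimately show "f -` A \<inter> space lebesgue \<in> sets lebesgue"
    by (rule completion.in_sets_AE) auto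
qed simp

text \<open>For a single x the map t \<mapsto> x + g t may carry a set of positive measure into the
  exceptional null set. Tonelli's theorem with translation invariance in x excludes this for almost
  every x.\<close>

lemma AE_shifted:
  fixes P :: "plane \<Rightarrow> bool" and g :: "plane \<Rightarrow> plane"
  assumes P: "AE x in lborel. P x" and [measurable]: "g \<in> borel_measurable borel"
  shows "AE x in lborel. AE t in lborel. P (x + g t)"
proof -
  obtain N where N: "{x \<in> space lborel. \<not> P x} \<subseteq> N" "emeasure lborel N = 0" and Nm: "N \<in> sets lborel"
    by (rule AE_E[OF P])
  have [measurable]: "N \<in> sets borel" using Nm by simp
  have "(\<integral>\<^sup>+x. \<integral>\<^sup>+t. indicator N (x + g t) \<partial>lborel \<partial>lborel) = (\<integral>\<^sup>+t. \<integral>\<^sup>+x. indicator N (x + g t) \<partial>lborel \<partial>lborel)"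
    by (rule lborel_pair.Fubini') measurable
  also have "\<dots> = (\<integral>\<^sup>+(t :: plane). 0 \<partial>lborel)"
  proof (rule nn_integral_cong)
    fix t
    have "(\<integral>\<^sup>+x. indicator N (x + g t) \<partial>lborel) = (\<integral>\<^sup>+x. indicator N x \<partial>lborel)"
      by (rule nn_integral_shift_Bu) measurable
    then show "(\<integral>\<^sup>+x. indicator N (x + g t) \<partial>lborel) = 0" using N Nm by simp
  qed
  finally have "(\<integral>\<^sup>+x. \<integral>\<^sup>+t. indicator N (x + g t) \<partial>lborel \<partial>lborel) = 0" by simp
  moreover have "(\<lambda>x. \<integral>\<^sup>+t. indicator N (x + g t) \<partial>lborel) \<in> borel_measurable lborel" by measurable
  ultimately have "AE x in lborel. (\<integral>\<^sup>+t. indicator N (x + g t) \<partial>lborel) = 0" by (simp only: nn_integral_0_iff_AE)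
  then show ?thesis
  proof (rule eventually_mono)
    fix x assume z: "(\<integral>\<^sup>+t. indicator N (x + g t) \<partial>lborel) = 0"
    have "(\<lambda>t. indicator N (x + g t) :: ennreal) \<in> borel_measurable lborel" by measurable
    then have "AE t in lborel. (indicator N (x + g t) :: ennreal) = 0" using z by (simp only: nn_integral_0_iff_AE)
    then show "AE t in lborel. P (x + g t)"
    proof (rule eventually_mono)
      fix t assume "(indicator N (x + g t) :: ennreal) = 0"
      then have "x + g t \<notin> N" by (auto simp: indicator_def split: if_splits)
      then show "P (x + g t)" using N(1) by auto
    qed
  qed
qed

text \<open>The passage from R to u = 1/R and from the given functions to Borel representatives,
  which affects the average only for x in a null set.\<close>

lemma bilinear_avg_eq_wform:
  assumes m[measurable]: "f1' \<in> borel_measurable borel" "f2' \<in> borel_measurable borel"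
    and f1: "AE x in lborel. f1 x = f1' x" and f2: "AE x in lborel. f2 x = f2' x"
  shows "AE x in lborel. bilinear_avg R l f1 f2 x = 2 ^ (2 * l) *\<^sub>R wform (1 / R) (indicator (qbox (1 / 2 ^ l))) f1' f2' x"
proof -
  have Bu: "aniso_dilation R = Bu (1 / R)" by (auto simp: aniso_dilation_def Bu_def power_divide)
  have [measurable]: "Bu (1 / R) \<in> borel_measurable borel" "power_sum_map \<in> borel_measurable borel"
    unfolding Bu_def power_sum_map_def by (intro borel_measurable_continuous_onI continuous_intros)+
  have wm[measurable]: "(indicator (qbox (1 / 2 ^ l)) :: _ \<Rightarrow> real) \<in> borel_measurable borel"
    by (rule borel_measurable_indicator) (rule qbox_measurable)
  have "AE x in lborel. AE t in lborel. f1 (x + Bu (1 / R) t) = f1' (x + Bu (1 / R) t)" by (rule AE_shifted[OF f1]) measurable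
  moreover have "AE x in lborel. AE t in lborel. f2 (x + power_sum_map t) = f2' (x + power_sum_map t)" by (rule AE_shifted[OF f2]) measurable
  ultimately show ?thesis
  proof eventually_elim
    fix x
    assume a: "AE t in lborel. f1 (x + Bu (1 / R) t) = f1' (x + Bu (1 / R) t)" "AE t in lborel. f2 (x + power_sum_map t) = f2' (x + power_sum_map t)"
    define h where "h t = f1 (x + Bu (1 / R) t) * f2 (x + power_sum_map t) * complex_of_real (square_bump l t)" for t
    define h' where "h' t = 2 ^ (2 * l) *\<^sub>R (indicator (qbox (1 / 2 ^ l)) t *\<^sub>R (f1' (x + Bu (1 / R) t) * f2' (x + power_sum_map t)))" for t
    have h'm: "h' \<in> borel_measurable lborel" unfolding h'_def by measurable
    have e: "AE t in lborel. h t = h' t"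
      using a by eventually_elim (simp add: h_def h'_def square_bump_def qbox_def scaleR_conv_of_real)
    have "bilinear_avg R l f1 f2 x = (LINT t|lebesgue. h t)" by (simp add: bilinear_avg_def h_def Bu)
    also have "\<dots> = (LINT t|lebesgue. h' t)"
    proof (rule integral_cong_AE)
      show "h' \<in> borel_measurable lebesgue" using h'm by (rule measurable_completion)
      then show "h \<in> borel_measurable lebesgue" using e by (rule lebesgue_measurable_AE_eq)
      show "AE t in lebesgue. h t = h' t" using e by (rule AE_completion)
    qed
    also have "\<dots> = (LINT t|lborel. h' t)" by (rule integral_completion[OF h'm])
    also have "\<dots> = 2 ^ (2 * l) *\<^sub>R wform (1 / R) (indicator (qbox (1 / 2 ^ l))) f1' f2' x"
      unfolding h'_def wform_def by (rule integral_scaleR_right)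
    finally show "bilinear_avg R l f1 f2 x = 2 ^ (2 * l) *\<^sub>R wform (1 / R) (indicator (qbox (1 / 2 ^ l))) f1' f2' x" .
  qed
qed

text \<open>Integrability is part of the conclusion because a non-integrable function has integral 0
  by default, which would make the inequality empty. The bound on \<open>K l\<close> is attained:
  the witness is 2 to the power C l.\<close>

theorem theorem4:
  "\<exists>\<gamma>>0. \<exists>C>0. \<exists>K :: nat \<Rightarrow> real. (\<forall>l. K l \<le> 2 powr (C * real l)) \<and>
     (\<forall>R\<ge>1. \<forall>lam\<ge>1. \<forall>l. \<forall>f1\<in>L2. \<forall>f2\<in>L2. \<forall>g.
        has_fourier_transform f2 g \<and> ess_support g \<subseteq> ball 0 (2 * lam) - ball 0 lam \<longrightarrow>
        set_integrable lebesgue unit_square (bilinear_avg R l f1 f2) \<and>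
        (LINT x:unit_square|lebesgue. norm (bilinear_avg R l f1 f2 x))
          \<le> K l * lam powr (- \<gamma>) * L2_norm f1 * L2_norm f2)"
proof -
  \<comment> \<open>The constant of the first bound in \<open>annulus_frequency_bounds\<close>; it
    also exceeds the constant 4 of the second.\<close>
  define C0 where "C0 = 4 * (8 * pi)\<^sup>2"
  have "1 \<le> 4 * (8 * pi)\<^sup>2"
  proof -
    have "1 \<le> 8 * pi" using pi_gt3 by simp
    then have "1 \<le> (8 * pi)\<^sup>2" by (rule one_le_power)
    then show ?thesis by linarith
  qed
  then have C0: "C0 \<ge> 1" "C0 \<ge> 4"
    unfolding C0_def using one_le_power[of "8 * pi" 2] pi_gt3 by linarith+
  show ?thesis
  proof (rule averaging_decay[OF C0(1)], goal_cases)
  case (1 \<gamma> C)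
  note \<gamma> = 1(1) and C = 1(2) and main = 1(3)
  have goal: "set_integrable lebesgue unit_square (bilinear_avg R l f1 f2) \<and>
        (LINT x:unit_square|lebesgue. norm (bilinear_avg R l f1 f2 x)) \<le> 2 powr (C * real l) * lam powr (- \<gamma>) * L2_norm f1 * L2_norm f2"
    if R: "R \<ge> 1" and lam: "lam \<ge> 1" and f1: "f1 \<in> L2" and f2: "f2 \<in> L2" and ft: "has_fourier_transform f2 g" and supp: "ess_support g \<subseteq> ball 0 (2 * lam) - ball 0 lam"
    for R lam l f1 f2 g
  proof -
    obtain f1' where m1[measurable]: "f1' \<in> borel_measurable borel" and e1: "AE x in lborel. f1 x = f1' x"
      and n1: "nnL2 f1' = ennreal ((L2_norm f1)\<^sup>2)"
      using L2_borel_representative[OF f1] by blast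
    obtain f2' where m2[measurable]: "f2' \<in> borel_measurable borel" and e2: "AE x in lborel. f2 x = f2' x"
      and n2: "nnL2 f2' = ennreal ((L2_norm f2)\<^sup>2)"
      using L2_borel_representative[OF f2] by blast
    have A: "0 \<le> L2_norm f1" "0 \<le> L2_norm f2" by (auto simp: L2_norm_def intro: Bochner_Integration.integral_nonneg)
    have lam0: "lam > 0" using lam by simp
    define W where "W x = 2 ^ (2 * l) *\<^sub>R wform (1 / R) (indicator (qbox (1 / 2 ^ l))) f1' f2' x" for x
    have [measurable]: "(indicator (qbox (1 / 2 ^ l)) :: _ \<Rightarrow> real) \<in> borel_measurable borel"
      by (rule borel_measurable_indicator) (rule qbox_measurable)
    have Wm[measurable]: "W \<in> borel_measurable borel" unfolding W_def by measurable
    have BW: "AE x in lborel. bilinear_avg R l f1 f2 x = W x" unfolding W_def by (rule bilinear_avg_eq_wform[OF m1 m2 e1 e2])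
    let ?B = "2 powr (C * real l) * lam powr (- \<gamma>) * L2_norm f1 * L2_norm f2"
    have B0: "0 \<le> ?B" using A by simp
    have "(\<integral>\<^sup>+x. ennreal (norm (indicator unit_square x *\<^sub>R W x)) \<partial>lborel)
      = ennreal (2 ^ (2 * l)) * (nnL1_square (wform (1 / R) (indicator (qbox (1 / 2 ^ l))) f1' f2'))"
    proof (subst nn_integral_cmult[symmetric])
      show "(\<lambda>x. indicator unit_square x * ennreal (norm (wform (1 / R) (indicator (qbox (1 / 2 ^ l))) f1' f2' x))) \<in> borel_measurable lborel"
        by measurable
      show "(\<integral>\<^sup>+x. ennreal (norm (indicator unit_square x *\<^sub>R W x)) \<partial>lborel)
        = (\<integral>\<^sup>+x. ennreal (2 ^ (2 * l)) * (indicator unit_square x * ennreal (norm (wform (1 / R) (indicator (qbox (1 / 2 ^ l))) f1' f2' x))) \<partial>lborel)"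
        by (intro nn_integral_cong) (simp add: W_def ennreal_mult split: split_indicator)
    qed
    also have "\<dots> \<le> ennreal ?B"
    proof (rule main[OF _ _ lam m1 m2 n1 n2 A])
      show "0 \<le> 1 / R" "1 / R \<le> 1" using R by auto
      fix r :: real assume r: "r > 0"
      show "(\<integral>\<^sup>+x. ennreal ((norm (f2' x - avg r f2' x))\<^sup>2) \<partial>lborel) \<le> ennreal (C0 * (r * lam)\<^sup>2) * nnL2 f2'"
        using annulus_frequency_bounds(1)[OF ft supp lam0 m2 e2 r] by (simp only: C0_def power_mult_distrib mult.assoc)
      have "ennreal (4 * (1 / (r * lam))\<^sup>2) \<le> ennreal (C0 * (1 / (r * lam))\<^sup>2)"
        using C0(2) by (intro ennreal_leI mult_right_mono) auto
      from order_trans[OF annulus_frequency_bounds(2)[OF ft supp lam0 m2 e2 r] mult_right_mono[OF this]]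
      show "nnL2 (avg r f2') \<le> ennreal (C0 * (1 / (r * lam))\<^sup>2) * nnL2 f2'" by simp
    qed
    finally have nn: "(\<integral>\<^sup>+x. ennreal (norm (indicator unit_square x *\<^sub>R W x)) \<partial>lborel) \<le> ennreal ?B" .
    have ind: "(indicator unit_square :: _ \<Rightarrow> real) \<in> borel_measurable borel"
      by (rule borel_measurable_indicator) (rule unit_square_measurable)
    have UWm: "(\<lambda>x. indicator unit_square x *\<^sub>R W x) \<in> borel_measurable lborel" using ind by measurable
    have UWi: "integrable lborel (\<lambda>x. indicator unit_square x *\<^sub>R W x)"
      using nn by (intro integrableI_bounded UWm) (auto intro: le_less_trans)
    have UWl: "integrable lebesgue (\<lambda>x. indicator unit_square x *\<^sub>R W x)" using UWi UWm by (simp only: integrable_completion)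
    have BWe: "AE x in lborel. indicator unit_square x *\<^sub>R bilinear_avg R l f1 f2 x = indicator unit_square x *\<^sub>R W x"
      using BW by (rule eventually_mono) simp
    have Bm: "(\<lambda>x. indicator unit_square x *\<^sub>R bilinear_avg R l f1 f2 x) \<in> borel_measurable lebesgue"
      by (rule lebesgue_measurable_AE_eq[OF measurable_completion[OF UWm] BWe])
    have si: "integrable lebesgue (\<lambda>x. indicator unit_square x *\<^sub>R bilinear_avg R l f1 f2 x)"
    proof (rule integrable_cong_AE_imp[OF UWl Bm])
      show "AE x in lebesgue. indicator unit_square x *\<^sub>R W x = indicator unit_square x *\<^sub>R bilinear_avg R l f1 f2 x"
        using AE_completion[OF BWe] by (rule eventually_mono) (rule sym)
    qed
    have "ennreal (LINT x:unit_square|lebesgue. norm (bilinear_avg R l f1 f2 x)) = ennreal (LINT x|lebesgue. norm (indicator unit_square x *\<^sub>R bilinear_avg R l f1 f2 x))"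
      by (simp add: set_lebesgue_integral_def)
    also have "\<dots> = (\<integral>\<^sup>+x. ennreal (norm (indicator unit_square x *\<^sub>R bilinear_avg R l f1 f2 x)) \<partial>lebesgue)"
      by (rule nn_integral_eq_integral[symmetric]) (use integrable_norm[OF si] in auto)
    also have "\<dots> = (\<integral>\<^sup>+x. ennreal (norm (indicator unit_square x *\<^sub>R bilinear_avg R l f1 f2 x)) \<partial>lborel)" by (rule nn_integral_completion)
    also have "\<dots> = (\<integral>\<^sup>+x. ennreal (norm (indicator unit_square x *\<^sub>R W x)) \<partial>lborel)"
      using BWe by (intro nn_integral_cong_AE) (auto elim: eventually_mono)
    also note nn
    finally have "(LINT x:unit_square|lebesgue. norm (bilinear_avg R l f1 f2 x)) \<le> ?B" using B0 by (simp only: ennreal_le_iff)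
    then show ?thesis using si by (simp add: set_integrable_def)
  qed
  show ?case
    by (rule exI[of _ \<gamma>], rule conjI[OF \<gamma>], rule exI[of _ C], rule conjI[OF C], rule exI[of _ "\<lambda>l. 2 powr (C * real l)"])
       (use goal in blast)
  qed
qed

end
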